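(* Let $\mathcal N$ be a primitive poset of type $(m_1,\ldots,m_n)$. Assume that $X$ is an indecomposable rigid strict representation of $Q(\mathcal N)$. Then $X$ is unitarizable with some weight $\chi$, and the corresponding collection of Hermitian matrices $A_1,\ldots,A_n$ (the corresponding representation of the $*$-algebra $\mathcal B_{\Gamma(\mathcal N),\omega}$) is rigid, i.e. $\mathrm{rig}(A_1,\ldots,A_n)=2$.
   Context: The base field is $\mathbb C$. A primitive poset of type $(m_1,\dots,m_n)$ is the disjoint (cardinal) sum of $n$ chains; denote the elements of the $j$-th chain by $1^{(j)}\prec 2^{(j)}\prec\dots\prec m_j^{(j)}$. $Q(\mathcal N)$ is the star-shaped quiver obtained by adding a greatest element $q_0$ and orienting the Hasse diagram towards $q_0$; thus the branches are $1^{(j)}\to 2^{(j)}\to\dots\to m_j^{(j)}\to q_0$. A representation $X$ is strict if all its maps are injective, and rigid if $\mathrm{Ext}(X,X)=0$. A strict $X$ is identified with the subspaces $V_i^{(j)}\subseteq V_0=X_{q_0}$ (images of $X_{i^{(j)}}$). $X$ is unitarizable with the weight $\chi=(\chi_0;(\chi_i^{(j)}))\in\mathbb R_+^{|\mathcal N|+1}$ (with $\chi_i^{(j)}>0$ and $\chi_0\ge0$) if $V_0$ has a Hermitian inner product such that the orthogonal projections $P_i^{(j)}$ onto $V_i^{(j)}$ satisfy $\sum_{j=1}^n\sum_{i=1}^{m_j}\chi_i^{(j)}P_i^{(j)}=\chi_0\mathbb I$. The corresponding Hermitian matrices are $A_j=\sum_{i=1}^{m_j}\chi_i^{(j)}P_i^{(j)}$,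 $j=1,\dots,n$; they satisfy $A_1+\dots+A_n=\chi_0\mathbb I$. Equivalently $A_j=\sum_i\omega_i^{(j)}\widetilde P_i^{(j)}$ with $\widetilde P_1^{(j)}=P_1^{(j)}$, $\widetilde P_i^{(j)}=P_i^{(j)}-P_{i-1}^{(j)}$, $\omega_{m_j}^{(j)}=\chi_{m_j}^{(j)}$, $\omega_i^{(j)}=\chi_i^{(j)}+\omega_{i+1}^{(j)}$, so the spectrum of $A_j$ lies in $\{0,\omega_1^{(j)},\dots,\omega_{m_j}^{(j)}\}$; this is the $*$-representation of $\mathcal B_{\Gamma(\mathcal N),\omega}$ (with $\omega_0=\chi_0$) associated to the unitarized $X$. For matrices $A_1,\dots,A_n\in M_m(\mathbb C)$, the rigidity index is $\mathrm{rig}(A_1,\dots,A_n)=m^2(2-n)+\sum_{i=1}^n\dim Z(A_i)$, where $Z(A)=\{B\in M_m(\mathbb C): AB=BA\}$. The collection is rigid if its rigidity index equals $2$. *)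

theory Defs
  imports
    "Graph_Theory.Digraph"
    "Jordan_Normal_Form.Matrix_Kernel"
    "Jordan_Normal_Form.Schur_Decomposition"
    "Jordan_Normal_Form.Spectral_Radius"
begin

section \<open>Representations of quivers\<close>

text \<open>
  A quiver is a directed multigraph. A finite-dimensional complex representation is given in
  coordinates: the space at the vertex \<open>v\<close> is \<open>carrier_vec (rdim X v)\<close>, and the map along the
  arrow \<open>a\<close> is the matrix \<open>rmap X a\<close>. Values outside the vertices and arrows are irrelevant.
\<close>

record ('v, 'a) quiver_rep =
  rdim :: "'v \<Rightarrow> nat"
  rmap :: "'a \<Rightarrow> complex mat"

definition is_rep :: "('v, 'a) pre_digraph \<Rightarrow> ('v, 'a) quiver_rep \<Rightarrow> bool" where
  "is_rep Q X \<longleftrightarrow>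
     (\<forall>a\<in>arcs Q. rmap X a \<in> carrier_mat (rdim X (head Q a)) (rdim X (tail Q a)))"

definition strict_rep :: "('v, 'a) pre_digraph \<Rightarrow> ('v, 'a) quiver_rep \<Rightarrow> bool" where
  "strict_rep Q X \<longleftrightarrow>
     (\<forall>a\<in>arcs Q. inj_on (\<lambda>x. rmap X a *\<^sub>v x) (carrier_vec (rdim X (tail Q a))))"

definition rep_hom ::
  "('v, 'a) pre_digraph \<Rightarrow> ('v, 'a) quiver_rep \<Rightarrow> ('v, 'a) quiver_rep \<Rightarrow>
   ('v \<Rightarrow> complex mat) \<Rightarrow> bool" where
  "rep_hom Q X Y \<phi> \<longleftrightarrow>
     (\<forall>v\<in>verts Q. \<phi> v \<in> carrier_mat (rdim Y v) (rdim X v)) \<and>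
     (\<forall>a\<in>arcs Q. \<phi> (head Q a) * rmap X a = rmap Y a * \<phi> (tail Q a))"

definition rep_iso ::
  "('v, 'a) pre_digraph \<Rightarrow> ('v, 'a) quiver_rep \<Rightarrow> ('v, 'a) quiver_rep \<Rightarrow>
   ('v \<Rightarrow> complex mat) \<Rightarrow> bool" where
  "rep_iso Q X Y \<phi> \<longleftrightarrow> rep_hom Q X Y \<phi> \<and> (\<forall>v\<in>verts Q. invertible_mat (\<phi> v))"

definition zero_rep :: "('v, 'a) pre_digraph \<Rightarrow> ('v, 'a) quiver_rep \<Rightarrow> bool" where
  "zero_rep Q X \<longleftrightarrow> (\<forall>v\<in>verts Q. rdim X v = 0)"

definition direct_sum_rep ::
  "('v, 'a) quiver_rep \<Rightarrow> ('v, 'a) quiver_rep \<Rightarrow> ('v, 'a) quiver_rep" where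
  "direct_sum_rep Y Z =
     \<lparr>rdim = (\<lambda>v. rdim Y v + rdim Z v),
      rmap = (\<lambda>a. four_block_mat
        (rmap Y a) (0\<^sub>m (dim_row (rmap Y a)) (dim_col (rmap Z a)))
        (0\<^sub>m (dim_row (rmap Z a)) (dim_col (rmap Y a))) (rmap Z a))\<rparr>"

definition indecomposable_rep :: "('v, 'a) pre_digraph \<Rightarrow> ('v, 'a) quiver_rep \<Rightarrow> bool" where
  "indecomposable_rep Q X \<longleftrightarrow>
     \<not> zero_rep Q X \<and>
     (\<forall>Y Z. is_rep Q Y \<and> is_rep Q Z \<and> (\<exists>\<phi>. rep_iso Q X (direct_sum_rep Y Z) \<phi>) \<longrightarrow>
        zero_rep Q Y \<or> zero_rep Q Z)"

subsection \<open>Extensions\<close>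

text \<open>
  The group \<open>Ext\<close> (in degree one) is the set of Yoneda classes of short exact sequences
  \<open>0 \<rightarrow> X \<rightarrow> E \<rightarrow> Y \<rightarrow> 0\<close>; its zero element is the class of the sequence with middle term
  \<open>X \<oplus> Y\<close>. Exactness of a sequence of representations is exactness at every vertex.
\<close>

type_synonym ('v, 'a) rep_ext =
  "('v, 'a) quiver_rep \<times> ('v \<Rightarrow> complex mat) \<times> ('v \<Rightarrow> complex mat)"

definition extensions ::
  "('v, 'a) pre_digraph \<Rightarrow> ('v, 'a) quiver_rep \<Rightarrow> ('v, 'a) quiver_rep \<Rightarrow>
   ('v, 'a) rep_ext set" where
  "extensions Q Y X = {(E, \<iota>, \<pi>).
     is_rep Q E \<and> rep_hom Q X E \<iota> \<and> rep_hom Q E Y \<pi> \<and>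
     (\<forall>v\<in>verts Q.
        inj_on (\<lambda>x. \<iota> v *\<^sub>v x) (carrier_vec (rdim X v)) \<and>
        (\<lambda>x. \<iota> v *\<^sub>v x) ` carrier_vec (rdim X v) = mat_kernel (\<pi> v) \<and>
        (\<lambda>x. \<pi> v *\<^sub>v x) ` carrier_vec (rdim E v) = carrier_vec (rdim Y v))}"

definition ext_equiv ::
  "('v, 'a) pre_digraph \<Rightarrow> ('v, 'a) quiver_rep \<Rightarrow> ('v, 'a) quiver_rep \<Rightarrow>
   (('v, 'a) rep_ext \<times> ('v, 'a) rep_ext) set" where
  "ext_equiv Q Y X = {((E, \<iota>, \<pi>), (E', \<iota>', \<pi>')).
     (E, \<iota>, \<pi>) \<in> extensions Q Y X \<and> (E', \<iota>', \<pi>') \<in> extensions Q Y X \<and>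
     (\<exists>\<theta>. rep_iso Q E E' \<theta> \<and> (\<forall>v\<in>verts Q. \<theta> v * \<iota> v = \<iota>' v \<and> \<pi>' v * \<theta> v = \<pi> v))}"

definition Ext ::
  "('v, 'a) pre_digraph \<Rightarrow> ('v, 'a) quiver_rep \<Rightarrow> ('v, 'a) quiver_rep \<Rightarrow>
   ('v, 'a) rep_ext set set" where
  "Ext Q Y X = extensions Q Y X // ext_equiv Q Y X"

text \<open>In block form the maps of the split sequence are the column \<open>(1, 0)\<close> and the row \<open>(0, 1)\<close>.\<close>

definition split_ext ::
  "('v, 'a) quiver_rep \<Rightarrow> ('v, 'a) quiver_rep \<Rightarrow> ('v, 'a) rep_ext" where
  "split_ext Y X = (direct_sum_rep X Y,
     (\<lambda>v. 1\<^sub>m (rdim X v) @\<^sub>r 0\<^sub>m (rdim Y v) (rdim X v)),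
     (\<lambda>v. transpose_mat (0\<^sub>m (rdim X v) (rdim Y v) @\<^sub>r 1\<^sub>m (rdim Y v))))"

lemma split_ext_in_extensions:
  assumes Q: "wf_digraph Q" and X: "is_rep Q X" and Y: "is_rep Q Y"
  shows "split_ext Y X \<in> extensions Q Y X"
proof -
  interpret wf_digraph Q by (fact Q)
  define E where "E = direct_sum_rep X Y"
  define i where "i = (\<lambda>v. 1\<^sub>m (rdim X v) @\<^sub>r (0\<^sub>m (rdim Y v) (rdim X v) :: complex mat))"
  define p where
    "p = (\<lambda>v. transpose_mat ((0\<^sub>m (rdim X v) (rdim Y v) :: complex mat) @\<^sub>r 1\<^sub>m (rdim Y v)))"
  have dE: "rdim E v = rdim X v + rdim Y v" for v
    by (simp add: E_def direct_sum_rep_def)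
  have ci: "i v \<in> carrier_mat (rdim X v + rdim Y v) (rdim X v)"
    and cp: "p v \<in> carrier_mat (rdim Y v) (rdim X v + rdim Y v)" for v
    by (auto simp: i_def p_def)
  have iv: "i v *\<^sub>v x = x @\<^sub>v 0\<^sub>v (rdim Y v)" if "x \<in> carrier_vec (rdim X v)" for v x
    using that by (auto simp: i_def mat_mult_append[OF one_carrier_mat zero_carrier_mat])
  have p_block: "p v = four_block_mat (0\<^sub>m (rdim Y v) (rdim X v)) (1\<^sub>m (rdim Y v))
      (0\<^sub>m 0 (rdim X v)) (0\<^sub>m 0 (rdim Y v))" for v
    unfolding p_def append_rows_def
    by (subst transpose_four_block_mat) auto
  have pv: "p v *\<^sub>v (x @\<^sub>v y) = y"
    if x: "x \<in> carrier_vec (rdim X v)" and y: "y \<in> carrier_vec (rdim Y v)" for v x y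
  proof -
    have "p v *\<^sub>v (x @\<^sub>v y) = (0\<^sub>m (rdim Y v) (rdim X v) *\<^sub>v x + 1\<^sub>m (rdim Y v) *\<^sub>v y) @\<^sub>v
        (0\<^sub>m 0 (rdim X v) *\<^sub>v x + 0\<^sub>m 0 (rdim Y v) *\<^sub>v y)"
      unfolding p_block by (rule four_block_mat_mult_vec) (use x y in auto)
    also have "\<dots> = y" using x y by (intro eq_vecI) auto
    finally show ?thesis .
  qed
  have rE: "rmap E a = four_block_mat
        (rmap X a) (0\<^sub>m (rdim X (head Q a)) (rdim Y (tail Q a)))
        (0\<^sub>m (rdim Y (head Q a)) (rdim X (tail Q a))) (rmap Y a)" if "a \<in> arcs Q" for a
    using X Y that by (auto simp: E_def direct_sum_rep_def is_rep_def dest!: bspec)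
  have E: "is_rep Q E"
    using X Y by (auto simp: is_rep_def rE dE)
  have dE': "rdim E = (\<lambda>v. rdim X v + rdim Y v)"
    by (simp add: E_def direct_sum_rep_def)
  have i_block: "i v = four_block_mat (1\<^sub>m (rdim X v)) (0\<^sub>m (rdim X v) 0)
      (0\<^sub>m (rdim Y v) (rdim X v)) (0\<^sub>m (rdim Y v) 0)" for v
    by (simp add: i_def append_rows_def)
  have "rep_hom Q X E i \<and> rep_hom Q E Y p"
    unfolding rep_hom_def
  proof (intro conjI ballI)
    fix a assume a: "a \<in> arcs Q"
    have XA: "rmap X a \<in> carrier_mat (rdim X (head Q a)) (rdim X (tail Q a))"
     and YA: "rmap Y a \<in> carrier_mat (rdim Y (head Q a)) (rdim Y (tail Q a))"
      using X Y a by (auto simp: is_rep_def)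
    have "rmap E a * i (tail Q a) = four_block_mat (rmap X a) (0\<^sub>m (rdim X (head Q a)) 0)
        (0\<^sub>m (rdim Y (head Q a)) (rdim X (tail Q a))) (0\<^sub>m (rdim Y (head Q a)) 0)"
      unfolding rE[OF a] i_block
      by (subst mult_four_block_mat[OF XA zero_carrier_mat zero_carrier_mat YA one_carrier_mat
            zero_carrier_mat zero_carrier_mat zero_carrier_mat]) (use XA YA in simp)
    moreover have "i (head Q a) * rmap X a =
        i (head Q a) * four_block_mat (rmap X a) (0\<^sub>m (rdim X (head Q a)) 0)
        (0\<^sub>m 0 (rdim X (tail Q a))) (0\<^sub>m 0 0)"
      by (rule arg_cong[where f = "(*) (i (head Q a))"], rule eq_matI) (use XA in auto)
    moreover have "\<dots> = four_block_mat (rmap X a) (0\<^sub>m (rdim X (head Q a)) 0)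
        (0\<^sub>m (rdim Y (head Q a)) (rdim X (tail Q a))) (0\<^sub>m (rdim Y (head Q a)) 0)"
      unfolding i_block
      by (subst mult_four_block_mat[OF one_carrier_mat zero_carrier_mat zero_carrier_mat
            zero_carrier_mat XA zero_carrier_mat zero_carrier_mat zero_carrier_mat])
         (use XA YA in simp)
    ultimately show "i (head Q a) * rmap X a = rmap E a * i (tail Q a)" by simp
    have "p (head Q a) * rmap E a = four_block_mat (0\<^sub>m (rdim Y (head Q a)) (rdim X (tail Q a)))
        (rmap Y a) (0\<^sub>m 0 (rdim X (tail Q a))) (0\<^sub>m 0 (rdim Y (tail Q a)))"
      unfolding rE[OF a] p_block
      by (subst mult_four_block_mat[OF zero_carrier_mat one_carrier_mat zero_carrier_mat
            zero_carrier_mat XA zero_carrier_mat zero_carrier_mat YA]) (use XA YA in simp)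
    moreover have "rmap Y a * p (tail Q a) = four_block_mat (rmap Y a) (0\<^sub>m (rdim Y (head Q a)) 0)
        (0\<^sub>m 0 (rdim Y (tail Q a))) (0\<^sub>m 0 0) * p (tail Q a)"
      by (rule arg_cong[where f = "\<lambda>A. A * p (tail Q a)"], rule eq_matI) (use YA in auto)
    moreover have "\<dots> = four_block_mat (0\<^sub>m (rdim Y (head Q a)) (rdim X (tail Q a)))
        (rmap Y a) (0\<^sub>m 0 (rdim X (tail Q a))) (0\<^sub>m 0 (rdim Y (tail Q a)))"
      unfolding p_block
      by (subst mult_four_block_mat[OF YA zero_carrier_mat zero_carrier_mat zero_carrier_mat
            zero_carrier_mat one_carrier_mat zero_carrier_mat zero_carrier_mat])
         (use XA YA in simp)
    ultimately show "p (head Q a) * rmap E a = rmap Y a * p (tail Q a)" by simp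
  qed (use ci cp in \<open>auto simp: dE'\<close>)
  moreover have "inj_on (\<lambda>x. i v *\<^sub>v x) (carrier_vec (rdim X v)) \<and>
      (\<lambda>x. i v *\<^sub>v x) ` carrier_vec (rdim X v) = mat_kernel (p v) \<and>
      (\<lambda>x. p v *\<^sub>v x) ` carrier_vec (rdim E v) = carrier_vec (rdim Y v)" for v
  proof (intro conjI equalityI subsetI)
    show "inj_on (\<lambda>x. i v *\<^sub>v x) (carrier_vec (rdim X v))"
      by (rule inj_onI) (metis iv append_vec_eq)
  next
    fix z assume "z \<in> (\<lambda>x. i v *\<^sub>v x) ` carrier_vec (rdim X v)"
    then obtain x where x: "x \<in> carrier_vec (rdim X v)" "z = x @\<^sub>v 0\<^sub>v (rdim Y v)"
      using iv by auto
    then show "z \<in> mat_kernel (p v)"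
      using pv[OF x(1), of "0\<^sub>v (rdim Y v)"] by (intro mat_kernelI[OF cp]) auto
  next
    fix z assume "z \<in> mat_kernel (p v)"
    then have z: "z \<in> carrier_vec (rdim X v + rdim Y v)" "p v *\<^sub>v z = 0\<^sub>v (rdim Y v)"
      using mat_kernelD[OF cp] by auto
    define x y where "x = vec_first z (rdim X v)" and "y = vec_last z (rdim Y v)"
    have xy: "x \<in> carrier_vec (rdim X v)" "y \<in> carrier_vec (rdim Y v)" "z = x @\<^sub>v y"
      using z(1) by (auto simp: x_def y_def)
    with z pv[OF xy(1,2)] iv[OF xy(1)] have "z = i v *\<^sub>v x" by simp
    with xy(1) show "z \<in> (\<lambda>x. i v *\<^sub>v x) ` carrier_vec (rdim X v)" by blast
  next
    fix y assume "y \<in> (\<lambda>x. p v *\<^sub>v x) ` carrier_vec (rdim E v)"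
    then show "y \<in> carrier_vec (rdim Y v)" using mult_mat_vec_carrier[OF cp] by (auto simp: dE)
  next
    fix y :: "complex vec" assume y: "y \<in> carrier_vec (rdim Y v)"
    have "p v *\<^sub>v (0\<^sub>v (rdim X v) @\<^sub>v y) = y" by (rule pv) (use y in auto)
    then show "y \<in> (\<lambda>x. p v *\<^sub>v x) ` carrier_vec (rdim E v)"
      using y by (intro image_eqI[of _ _ "0\<^sub>v (rdim X v) @\<^sub>v y"]) (auto simp: dE)
  qed
  ultimately show ?thesis
    using E by (simp add: split_ext_def extensions_def E_def i_def p_def)
qed

definition zero_Ext ::
  "('v, 'a) pre_digraph \<Rightarrow> ('v, 'a) quiver_rep \<Rightarrow> ('v, 'a) quiver_rep \<Rightarrow>
   ('v, 'a) rep_ext set" where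
  "zero_Ext Q Y X = ext_equiv Q Y X `` {split_ext Y X}"

definition rigid_rep :: "('v, 'a) pre_digraph \<Rightarrow> ('v, 'a) quiver_rep \<Rightarrow> bool" where
  "rigid_rep Q X \<longleftrightarrow> Ext Q X X = {zero_Ext Q X X}"


section \<open>Primitive posets and their quivers\<close>

text \<open>
  The poset of type \<open>ms\<close> is the disjoint sum of chains of lengths \<open>ms ! 0, ms ! 1, \<dots>\<close>; the pair
  \<open>(j, i)\<close> is the \<open>i\<close>-th element of the chain \<open>j\<close>. Chains are numbered from 0, their elements from 1.
\<close>

definition primitive_type :: "nat list \<Rightarrow> bool" where
  "primitive_type ms \<longleftrightarrow> (\<forall>m\<in>set ms. 1 \<le> m)"

definition prim_elems :: "nat list \<Rightarrow> (nat \<times> nat) set" where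
  "prim_elems ms = {(j, i). j < length ms \<and> i \<in> {1..ms ! j}}"

definition prim_less :: "nat \<times> nat \<Rightarrow> nat \<times> nat \<Rightarrow> bool" where
  "prim_less x y \<longleftrightarrow> fst x = fst y \<and> snd x < snd y"

text \<open>Adjoining a greatest element, represented by \<open>None\<close>:\<close>

fun top_less :: "(nat \<times> nat) option \<Rightarrow> (nat \<times> nat) option \<Rightarrow> bool" where
  "top_less (Some x) (Some y) = prim_less x y"
| "top_less (Some x) None = True"
| "top_less None y = False"

type_synonym star_vertex = "(nat \<times> nat) option"
type_synonym star_rep = "(star_vertex, star_vertex \<times> star_vertex) quiver_rep"

text \<open>The arrows are the edges \<open>(u, v)\<close> of the Hasse diagram, with \<open>v\<close> covering \<open>u\<close>.\<close>

definition star_quiver :: "nat list \<Rightarrow> (star_vertex, star_vertex \<times> star_vertex) pre_digraph" where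
  "star_quiver ms =
     (let V = insert None (Some ` prim_elems ms) in
      \<lparr>verts = V,
       arcs = {(u, v). u \<in> V \<and> v \<in> V \<and> top_less u v \<and>
                       \<not> (\<exists>w\<in>V. top_less u w \<and> top_less w v)},
       tail = fst, head = snd\<rparr>)"

lemma arcs_star_quiver:
  "arcs (star_quiver ms) =
     {(Some (j, i), Some (j, Suc i)) | j i. j < length ms \<and> 1 \<le> i \<and> Suc i \<le> ms ! j} \<union>
     {(Some (j, ms ! j), None) | j. j < length ms \<and> 1 \<le> ms ! j}" (is "?A = ?B")
proof
  show "?B \<subseteq> ?A"
    by (auto simp: star_quiver_def prim_elems_def prim_less_def)
  show "?A \<subseteq> ?B"
  proof
    fix a assume a: "a \<in> ?A"
    obtain u v where uv: "a = (u, v)" by force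
    from a uv have V: "u \<in> insert None (Some ` prim_elems ms)" "v \<in> insert None (Some ` prim_elems ms)"
      and less: "top_less u v"
      and cov: "\<And>w. w \<in> insert None (Some ` prim_elems ms) \<Longrightarrow> top_less u w \<Longrightarrow> \<not> top_less w v"
      by (auto simp: star_quiver_def Let_def)
    from less obtain j i where u: "u = Some (j, i)" by (cases u) auto
    with V(1) have ji: "j < length ms" "1 \<le> i" "i \<le> ms ! j" by (auto simp: prim_elems_def)
    show "a \<in> ?B"
    proof (cases v)
      case None
      have "i = ms ! j"
      proof (rule ccontr)
        assume "i \<noteq> ms ! j"
        with ji have "(j, Suc i) \<in> prim_elems ms" by (auto simp: prim_elems_def)
        then show False using cov[of "Some (j, Suc i)"] u None by (auto simp: prim_less_def)
      qed
      then show ?thesis using uv u None ji by auto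
    next
      case (Some y)
      obtain l where y: "y = (j, l)" "i < l" using less u Some by (cases y) (auto simp: prim_less_def)
      with V(2) Some have l: "l \<le> ms ! j" by (auto simp: prim_elems_def)
      have "l = Suc i"
      proof (rule ccontr)
        assume "l \<noteq> Suc i"
        with y have "Suc i < l" by simp
        moreover from this l ji have "(j, Suc i) \<in> prim_elems ms" by (auto simp: prim_elems_def)
        ultimately show False using cov[of "Some (j, Suc i)"] u Some y by (auto simp: prim_less_def)
      qed
      then show ?thesis using uv u Some y l ji by auto
    qed
  qed
qed

lemma fin_digraph_star_quiver: "fin_digraph (star_quiver ms)"
proof
  have "prim_elems ms = (SIGMA j:{..<length ms}. {1..ms ! j})"
    by (auto simp: prim_elems_def)
  then have fin: "finite (prim_elems ms)" by simp
  then show "finite (verts (star_quiver ms))" by (simp add: star_quiver_def)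
  have "arcs (star_quiver ms) \<subseteq> verts (star_quiver ms) \<times> verts (star_quiver ms)"
    by (auto simp: star_quiver_def Let_def)
  with \<open>finite (verts (star_quiver ms))\<close> show "finite (arcs (star_quiver ms))"
    by (meson finite_SigmaI finite_subset)
qed (auto simp: star_quiver_def Let_def)

text \<open>
  \<open>to_top ms X j k\<close> is the composite of the maps of \<open>X\<close> from the element \<open>(j, ms ! j - k)\<close> to the
  greatest element.
\<close>

primrec to_top :: "nat list \<Rightarrow> star_rep \<Rightarrow> nat \<Rightarrow> nat \<Rightarrow> complex mat" where
  "to_top ms X j 0 = rmap X (Some (j, ms ! j), None)"
| "to_top ms X j (Suc k) =
     to_top ms X j k * rmap X (Some (j, ms ! j - Suc k), Some (j, ms ! j - k))"

definition subsp :: "nat list \<Rightarrow> star_rep \<Rightarrow> nat \<Rightarrow> nat \<Rightarrow> complex vec set" where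
  "subsp ms X j i = (\<lambda>x. to_top ms X j (ms ! j - i) *\<^sub>v x) ` carrier_vec (rdim X (Some (j, i)))"


section \<open>Unitarization\<close>

definition inner_product_on :: "nat \<Rightarrow> (complex vec \<Rightarrow> complex vec \<Rightarrow> complex) \<Rightarrow> bool" where
  "inner_product_on d h \<longleftrightarrow>
     (\<forall>u\<in>carrier_vec d. \<forall>v\<in>carrier_vec d. \<forall>w\<in>carrier_vec d. h (u + v) w = h u w + h v w) \<and>
     (\<forall>c. \<forall>u\<in>carrier_vec d. \<forall>v\<in>carrier_vec d. h (c \<cdot>\<^sub>v u) v = c * h u v) \<and>
     (\<forall>u\<in>carrier_vec d. \<forall>v\<in>carrier_vec d. h v u = cnj (h u v)) \<and>
     (\<forall>u\<in>carrier_vec d. u \<noteq> 0\<^sub>v d \<longrightarrow> Re (h u u) > 0)"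

definition orth_proj_onto ::
  "nat \<Rightarrow> (complex vec \<Rightarrow> complex vec \<Rightarrow> complex) \<Rightarrow> complex vec set \<Rightarrow> complex mat \<Rightarrow> bool" where
  "orth_proj_onto d h W P \<longleftrightarrow>
     P \<in> carrier_mat d d \<and>
     (\<forall>x\<in>carrier_vec d. P *\<^sub>v x \<in> W \<and> (\<forall>w\<in>W. h (x - P *\<^sub>v x) w = 0))"

abbreviation mat_sum :: "nat \<Rightarrow> ('i \<Rightarrow> complex mat) \<Rightarrow> 'i set \<Rightarrow> complex mat" where
  "mat_sum d f I \<equiv> finsum (module_mat TYPE(complex) d d) f I"

definition is_weight :: "nat list \<Rightarrow> real \<Rightarrow> (nat \<Rightarrow> nat \<Rightarrow> real) \<Rightarrow> bool" where
  "is_weight ms \<chi>0 \<chi> \<longleftrightarrow> \<chi>0 \<ge> 0 \<and> (\<forall>(j, i)\<in>prim_elems ms. \<chi> j i > 0)"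

definition weighted_op ::
  "nat list \<Rightarrow> nat \<Rightarrow> (nat \<Rightarrow> nat \<Rightarrow> real) \<Rightarrow> (nat \<Rightarrow> nat \<Rightarrow> complex mat) \<Rightarrow> nat \<Rightarrow> complex mat" where
  "weighted_op ms d \<chi> P j = mat_sum d (\<lambda>i. complex_of_real (\<chi> j i) \<cdot>\<^sub>m P j i) {1..ms ! j}"

definition unitarization ::
  "nat list \<Rightarrow> star_rep \<Rightarrow> real \<Rightarrow> (nat \<Rightarrow> nat \<Rightarrow> real) \<Rightarrow>
   (complex vec \<Rightarrow> complex vec \<Rightarrow> complex) \<Rightarrow> (nat \<Rightarrow> nat \<Rightarrow> complex mat) \<Rightarrow> bool" where
  "unitarization ms X \<chi>0 \<chi> h P \<longleftrightarrow>
     (let d = rdim X None in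
      inner_product_on d h \<and>
      (\<forall>(j, i)\<in>prim_elems ms. orth_proj_onto d h (subsp ms X j i) (P j i)) \<and>
      mat_sum d (weighted_op ms d \<chi> P) {0..<length ms} = complex_of_real \<chi>0 \<cdot>\<^sub>m 1\<^sub>m d)"

definition unitarizable ::
  "nat list \<Rightarrow> star_rep \<Rightarrow> real \<Rightarrow> (nat \<Rightarrow> nat \<Rightarrow> real) \<Rightarrow> bool" where
  "unitarizable ms X \<chi>0 \<chi> \<longleftrightarrow>
     is_weight ms \<chi>0 \<chi> \<and> (\<exists>h P. unitarization ms X \<chi>0 \<chi> h P)"

text \<open>
  The operators above act on the coordinate space with the inner product \<open>h\<close>, which need not be the
  standard one; Hermitian matrices are obtained by passing to a basis that is orthonormal for \<open>h\<close>.
  An orthonormal family of \<open>d\<close> vectors is automatically a basis.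
\<close>

definition orthonormal_basis ::
  "nat \<Rightarrow> (complex vec \<Rightarrow> complex vec \<Rightarrow> complex) \<Rightarrow> complex vec list \<Rightarrow> bool" where
  "orthonormal_basis d h bs \<longleftrightarrow>
     length bs = d \<and> set bs \<subseteq> carrier_vec d \<and>
     (\<forall>a<d. \<forall>b<d. h (bs ! a) (bs ! b) = (if a = b then 1 else 0))"

definition matrix_in_basis ::
  "(complex vec \<Rightarrow> complex vec \<Rightarrow> complex) \<Rightarrow> complex vec list \<Rightarrow> complex mat \<Rightarrow> complex mat" where
  "matrix_in_basis h bs T =
     mat (length bs) (length bs) (\<lambda>(a, b). h (T *\<^sub>v bs ! b) (bs ! a))"

definition hermitian_collection ::
  "nat list \<Rightarrow> star_rep \<Rightarrow> (nat \<Rightarrow> nat \<Rightarrow> real) \<Rightarrow>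
   (complex vec \<Rightarrow> complex vec \<Rightarrow> complex) \<Rightarrow> (nat \<Rightarrow> nat \<Rightarrow> complex mat) \<Rightarrow>
   complex vec list \<Rightarrow> complex mat list" where
  "hermitian_collection ms X \<chi> h P bs =
     map (\<lambda>j. matrix_in_basis h bs (weighted_op ms (rdim X None) \<chi> P j)) [0..<length ms]"

definition omega :: "nat list \<Rightarrow> (nat \<Rightarrow> nat \<Rightarrow> real) \<Rightarrow> nat \<Rightarrow> nat \<Rightarrow> real" where
  "omega ms \<chi> j i = (\<Sum>k=i..ms ! j. \<chi> j k)"

text \<open>
  A \<open>*\<close>-representation on the standard Hermitian space of dimension \<open>d\<close> of the algebra with
  self-adjoint generators \<open>a\<^sub>1, \<dots>, a\<^sub>n\<close>, whose spectra lie in the prescribed sets, and with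
  the relation \<open>a\<^sub>1 + \<dots> + a\<^sub>n = \<omega>0\<close>.
\<close>

definition star_algebra_rep ::
  "nat list \<Rightarrow> real \<Rightarrow> (nat \<Rightarrow> nat \<Rightarrow> real) \<Rightarrow> nat \<Rightarrow> complex mat list \<Rightarrow> bool" where
  "star_algebra_rep ms \<omega>0 \<omega> d As \<longleftrightarrow>
     length As = length ms \<and>
     (\<forall>j<length ms. As ! j \<in> carrier_mat d d \<and> mat_adjoint (As ! j) = As ! j \<and>
        spectrum (As ! j) \<subseteq> insert 0 ((\<lambda>i. complex_of_real (\<omega> j i)) ` {1..ms ! j})) \<and>
     mat_sum d (\<lambda>j. As ! j) {0..<length ms} = complex_of_real \<omega>0 \<cdot>\<^sub>m 1\<^sub>m d"


section \<open>The rigidity index\<close>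

definition centralizer_mat :: "nat \<Rightarrow> complex mat \<Rightarrow> complex mat set" where
  "centralizer_mat m A = {B \<in> carrier_mat m m. A * B = B * A}"

definition dim_centralizer :: "nat \<Rightarrow> complex mat \<Rightarrow> nat" where
  "dim_centralizer m A =
     vectorspace.dim class_ring ((module_mat TYPE(complex) m m)\<lparr>carrier := centralizer_mat m A\<rparr>)"

definition rigidity_index :: "nat \<Rightarrow> complex mat list \<Rightarrow> int" where
  "rigidity_index m As =
     (int m)\<^sup>2 * (2 - int (length As)) + (\<Sum>A\<leftarrow>As. int (dim_centralizer m A))"

definition rigid_collection :: "nat \<Rightarrow> complex mat list \<Rightarrow> bool" where
  "rigid_collection m As \<longleftrightarrow> rigidity_index m As = 2"

end

theory Submission
  imports Defs "HOL-Analysis.L2_Norm"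
begin

text \<open>
  An indecomposable rigid representation \<open>X\<close> is a brick. Rigidity and the brick property say that for
  the dimension vectors \<open>x\<close> of \<open>X\<close> and \<open>y\<close> of the subrepresentation cut out by a proper subspace,
  the Euler form satisfies \<open>\<langle>y, x\<rangle> > 0\<close> and \<open>\<langle>x, y\<rangle> \<le> 0\<close>. Hence \<open>X\<close> is stable for the weight
  \<open>\<langle>x, -\<rangle> - \<langle>-, x\<rangle>\<close>; by integrality it remains stable for a perturbation whose components are all
  positive. For a stable configuration of subspaces the Kempf-Ness functional, the weighted sum of the
  logarithms of the Gram determinants of the subspaces minus \<open>\<chi>0\<close> times that of the whole space,
  attains its minimum on Hermitian forms: stability pushes a minimizing form away from the boundary
  of the cone. Vanishing of the first variation in rank-one directions is the balance equation
  \<open>\<Sum> \<chi> P = \<chi>0 I\<close>.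

  Since the weight is positive, the eigenvalues of \<open>A\<^sub>j\<close> separate exactly the steps of the \<open>j\<close>-th
  flag. Thus the defect \<open>d\<^sup>2 - dim Z(A\<^sub>j)\<close> is twice the number of matrix entries killed by
  preserving the flag, and \<open>rig(A) = 2 \<langle>x, x\<rangle> = 2\<close>.
\<close>

section \<open>Linear algebra\<close>

text \<open>Three points need more than the overview gives. Why bricks: an endomorphism F that is
  singular at a vertex has trace zero there by Fitting's lemma. Rigidity supplies further
  endomorphisms built from F and a vertexwise generalized inverse G, and comparing traces forces the
  idempotent F G, hence F, to vanish at that vertex. Why the Euler form: Hom and Ext never appear as
  vector spaces. In bases adapted to the flags a homomorphism is a matrix with prescribed zero
  entries, so Hom = 0 and Ext = 0 become injectivity and surjectivity of finite linear systems, and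
  the inequalities come from counting equations and unknowns. Why a minimum exists: the cone of
  positive definite forms is not compact. The functional is scale invariant, so it is minimised over
  the compact set of forms between 1 and n. Stability yields a ratio R such that a spectral jump by
  the factor R admits a descent direction, and pigeonhole finds such a jump once the spread of the
  eigenvalues reaches R^d. With n = 2 R^d the minimiser is therefore interior up to scaling.\<close>

definition adj :: "complex mat \<Rightarrow> complex mat" where
  "adj A = mat (dim_col A) (dim_row A) (\<lambda>(i, j). cnj (A $$ (j, i)))"

lemma adj_carrier [simp, intro]: "A \<in> carrier_mat m n \<Longrightarrow> adj A \<in> carrier_mat n m"
  by (auto simp: adj_def)

lemma dim_adj [simp]: "dim_row (adj A) = dim_col A" "dim_col (adj A) = dim_row A"
  by (auto simp: adj_def)

lemma index_adj [simp]: "i < dim_col A \<Longrightarrow> j < dim_row A \<Longrightarrow> adj A $$ (i, j) = cnj (A $$ (j, i))"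
  by (simp add: adj_def)

lemma adj_adj [simp]: "adj (adj A) = A"
  by (rule eq_matI) auto

lemma mat_adjoint_eq_adj: "mat_adjoint A = adj A"
  by (rule eq_matI) (auto simp: mat_adjoint_def mat_of_rows_def)

lemma adj_mult:
  assumes "A \<in> carrier_mat m n" "B \<in> carrier_mat n k"
  shows "adj (A * B) = adj B * adj A"
  using assms by (intro eq_matI) (auto simp: scalar_prod_def mult.commute intro!: sum.cong)

lemma adj_one [simp]: "adj (1\<^sub>m n) = 1\<^sub>m n"
  by (rule eq_matI) auto

lemma adj_add:
  assumes "A \<in> carrier_mat m n" "B \<in> carrier_mat m n"
  shows "adj (A + B) = adj A + adj B"
  using assms by (intro eq_matI) auto

lemma adj_smult: "adj (c \<cdot>\<^sub>m A) = cnj c \<cdot>\<^sub>m adj A"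
  by (intro eq_matI) auto

lemma cscalar_prod_sum: "x \<in> carrier_vec n \<Longrightarrow> y \<in> carrier_vec n \<Longrightarrow> x \<bullet>c y = (\<Sum>i<n. x $ i * cnj (y $ i))"
  by (simp add: scalar_prod_def atLeast0LessThan)

lemma cscalar_prod_adj:
  assumes A: "A \<in> carrier_mat m n" and x: "x \<in> carrier_vec n" and y: "y \<in> carrier_vec m"
  shows "(A *\<^sub>v x) \<bullet>c y = x \<bullet>c (adj A *\<^sub>v y)"
proof -
  have "(A *\<^sub>v x) \<bullet>c y = (\<Sum>i<m. \<Sum>j<n. A $$ (i, j) * x $ j * cnj (y $ i))"
    using A x y by (simp add: scalar_prod_def atLeast0LessThan sum_distrib_right)
  also have "\<dots> = (\<Sum>j<n. \<Sum>i<m. A $$ (i, j) * x $ j * cnj (y $ i))" by (rule sum.swap)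
  also have "\<dots> = x \<bullet>c (adj A *\<^sub>v y)"
    using A x y by (simp add: scalar_prod_def atLeast0LessThan sum_distrib_left mult_ac)
  finally show ?thesis .
qed

lemma cscalar_prod_swap:
  assumes "x \<in> carrier_vec n" "y \<in> carrier_vec n"
  shows "y \<bullet>c x = cnj (x \<bullet>c y)"
  using assms by (simp add: cscalar_prod_sum mult.commute)

lemma cscalar_prod_add_left:
  assumes "x \<in> carrier_vec n" "y \<in> carrier_vec n" "z \<in> carrier_vec n"
  shows "(x + y) \<bullet>c z = x \<bullet>c z + y \<bullet>c z"
  using assms by (simp add: add_scalar_prod_distrib)

lemma cscalar_prod_add_right:
  assumes "x \<in> carrier_vec n" "y \<in> carrier_vec n" "z \<in> carrier_vec n"
  shows "z \<bullet>c (x + y) = z \<bullet>c x + z \<bullet>c y"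
  using assms by (simp add: conjugate_add_vec[of _ n] scalar_prod_add_distrib[of _ n])

lemma cscalar_prod_smult_left:
  assumes "x \<in> carrier_vec n" "z \<in> carrier_vec n"
  shows "(c \<cdot>\<^sub>v x) \<bullet>c z = c * (x \<bullet>c z)"
  using assms by simp

lemma cscalar_prod_smult_right:
  assumes "x \<in> carrier_vec n" "z \<in> carrier_vec n"
  shows "z \<bullet>c (c \<cdot>\<^sub>v x) = cnj c * (z \<bullet>c x)"
  using assms by (simp add: conjugate_smult_vec)

definition norm_sq :: "complex vec \<Rightarrow> real" where
  "norm_sq x = (\<Sum>i<dim_vec x. (cmod (x $ i))\<^sup>2)"

lemma cscalar_prod_self: "x \<bullet>c x = complex_of_real (norm_sq x)"
  by (simp add: norm_sq_def scalar_prod_def atLeast0LessThan complex_norm_square[symmetric])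

lemma norm_sq_nonneg [simp]: "norm_sq x \<ge> 0"
  by (simp add: norm_sq_def sum_nonneg)

lemma norm_sq_eq_0: "x \<in> carrier_vec n \<Longrightarrow> norm_sq x = 0 \<longleftrightarrow> x = 0\<^sub>v n"
  using conjugate_square_eq_0_vec[of x n] by (simp add: cscalar_prod_self)

lemma norm_sq_pos: "x \<in> carrier_vec n \<Longrightarrow> x \<noteq> 0\<^sub>v n \<Longrightarrow> norm_sq x > 0"
  using norm_sq_eq_0[of x n] norm_sq_nonneg[of x] by linarith

lemma norm_sq_smult: "norm_sq (c \<cdot>\<^sub>v x) = (cmod c)\<^sup>2 * norm_sq x"
  by (simp add: norm_sq_def norm_mult power_mult_distrib sum_distrib_left)

lemma norm_sq_isometry:
  assumes N: "N \<in> carrier_mat d k" and o: "adj N * N = 1\<^sub>m k" and c: "c \<in> carrier_vec k"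
  shows "norm_sq (N *\<^sub>v c) = norm_sq c"
proof -
  have "(N *\<^sub>v c) \<bullet>c (N *\<^sub>v c) = c \<bullet>c (adj N *\<^sub>v (N *\<^sub>v c))"
    by (rule cscalar_prod_adj[OF N c]) (use N c in auto)
  also have "adj N *\<^sub>v (N *\<^sub>v c) = c"
    using N c o by (simp flip: assoc_mult_mat_vec[of _ k d _ k])
  finally show ?thesis by (simp add: cscalar_prod_self)
qed

subsection \<open>Systems of linear equations\<close>

text \<open>Padding with zero rows gives a square matrix of determinant zero, hence a kernel vector.
  The comparisons of sizes of matrices and of linear systems below rest on this fact.\<close>

lemma wide_matrix_kernel:
  fixes A :: "complex mat"
  assumes A: "A \<in> carrier_mat m n" and "m < n"
  shows "\<exists>x\<in>carrier_vec n. x \<noteq> 0\<^sub>v n \<and> A *\<^sub>v x = 0\<^sub>v m"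
proof -
  define B where "B = mat n n (\<lambda>(i, j). if i < m then A $$ (i, j) else 0)"
  have B: "B \<in> carrier_mat n n" by (simp add: B_def)
  have "row B m = 0\<^sub>v n" using \<open>m < n\<close> by (intro eq_vecI) (auto simp: B_def)
  then have "transpose_mat B *\<^sub>v unit_vec n m = 0\<^sub>v n"
    using \<open>m < n\<close> B by (intro eq_vecI) (auto simp: B_def)
  then have "det (transpose_mat B) = 0"
    using \<open>m < n\<close> B by (subst det_0_iff_vec_prod_zero[of _ n]) (auto intro!: exI[of _ "unit_vec n m"])
  then have "det B = 0" by (simp add: det_transpose[OF B])
  then obtain x where x: "x \<in> carrier_vec n" "x \<noteq> 0\<^sub>v n" "B *\<^sub>v x = 0\<^sub>v n"
    using det_0_iff_vec_prod_zero[OF B] by auto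
  have "A *\<^sub>v x = 0\<^sub>v m"
  proof (rule eq_vecI)
    fix i assume "i < dim_vec (0\<^sub>v m)"
    then have i: "i < m" "i < n" using \<open>m < n\<close> by auto
    have "(B *\<^sub>v x) $ i = 0" using x i by simp
    moreover have "row B i = row A i" using i A by (intro eq_vecI) (auto simp: B_def)
    ultimately show "(A *\<^sub>v x) $ i = 0\<^sub>v m $ i" using i A B by simp
  qed (use A in simp)
  with x show ?thesis by blast
qed

text \<open>Transports the kernel vector along enumerations of the unknowns \<open>I\<close> and the
  equations \<open>J\<close>, so that linear systems can be indexed by arbitrary finite sets such as
  sets of matrix positions.\<close>

lemma homogeneous_system_solution:
  fixes K :: "'j \<Rightarrow> 'i \<Rightarrow> complex"
  assumes fI: "finite I" and fJ: "finite J" and less: "card J < card I"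
  shows "\<exists>x. (\<exists>i\<in>I. x i \<noteq> 0) \<and> (\<forall>j\<in>J. (\<Sum>i\<in>I. K j i * x i) = 0)"
proof -
  obtain f where f: "bij_betw f {..<card I} I"
    using fI ex_bij_betw_nat_finite atLeast0LessThan by metis
  obtain g where g: "bij_betw g {..<card J} J"
    using fJ ex_bij_betw_nat_finite atLeast0LessThan by metis
  define A where "A = mat (card J) (card I) (\<lambda>(a, b). K (g a) (f b))"
  have A: "A \<in> carrier_mat (card J) (card I)" by (simp add: A_def)
  obtain v where v: "v \<in> carrier_vec (card I)" "v \<noteq> 0\<^sub>v (card I)" "A *\<^sub>v v = 0\<^sub>v (card J)"
    using wide_matrix_kernel[OF A less] by auto
  define x where "x i = v $ (the_inv_into {..<card I} f i)" for i
  have inj: "inj_on f {..<card I}" using f by (simp add: bij_betw_def)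
  have xf: "x (f b) = v $ b" if "b < card I" for b
    using that by (simp add: x_def the_inv_into_f_f[OF inj])
  show ?thesis
  proof (intro exI conjI ballI)
    from v(1,2) obtain b where b: "b < card I" "v $ b \<noteq> 0" by fastforce
    then have "f b \<in> I" using f by (auto simp: bij_betw_def)
    then show "\<exists>i\<in>I. x i \<noteq> 0" using xf b by force
    fix j assume "j \<in> J"
    then obtain a where a: "a < card J" "j = g a" using g by (auto simp: bij_betw_def)
    have "(\<Sum>i\<in>I. K j i * x i) = (\<Sum>b<card I. K j (f b) * x (f b))"
      by (rule sum.reindex_bij_betw[OF f, symmetric])
    also have "\<dots> = (A *\<^sub>v v) $ a"
      using a v(1) by (simp add: A_def scalar_prod_def atLeast0LessThan xf)
    finally show "(\<Sum>i\<in>I. K j i * x i) = 0" using a v by simp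
  qed
qed

lemma injective_system_card_le:
  fixes K :: "'j \<Rightarrow> 'i \<Rightarrow> complex"
  assumes "finite I" "finite J"
    and "\<And>x. \<forall>j\<in>J. (\<Sum>i\<in>I. K j i * x i) = 0 \<Longrightarrow> \<forall>i\<in>I. x i = 0"
  shows "card I \<le> card J"
proof (rule ccontr)
  assume "\<not> ?thesis"
  then obtain x where "\<exists>i\<in>I. x i \<noteq> 0" "\<forall>j\<in>J. (\<Sum>i\<in>I. K j i * x i) = 0"
    using homogeneous_system_solution[OF assms(1,2), of K] by (auto simp: not_le)
  with assms(3)[of x] show False by blast
qed

text \<open>The solutions \<open>X l\<close> for the indicators of the single equations
  \<open>l\<close>, together with the kernel vector \<open>z\<close>, are \<open>card J + 1\<close>
  linearly independent vectors indexed by \<open>I\<close>. In the auxiliary system the index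
  \<open>None\<close> stands for \<open>z\<close>.\<close>

lemma surjective_system_card_less:
  fixes K :: "'j \<Rightarrow> 'i \<Rightarrow> complex"
  assumes fI: "finite I" and fJ: "finite J"
    and surj: "\<And>b. \<exists>x. \<forall>j\<in>J. (\<Sum>i\<in>I. K j i * x i) = b j"
    and z: "\<forall>j\<in>J. (\<Sum>i\<in>I. K j i * z i) = 0" "i0 \<in> I" "z i0 \<noteq> 0"
  shows "card J < card I"
proof -
  have "\<forall>l. \<exists>x. \<forall>j\<in>J. (\<Sum>i\<in>I. K j i * x i) = (if j = l then 1 else 0)"
    by (intro allI surj)
  from choice[OF this] obtain X where
    X: "\<And>l j. j \<in> J \<Longrightarrow> (\<Sum>i\<in>I. K j i * X l i) = (if j = l then 1 else 0)"
    by blast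
  have "card (insert None (Some ` J)) \<le> card I"
  proof (rule injective_system_card_le[where K = "\<lambda>i l. case l of None \<Rightarrow> z i | Some l \<Rightarrow> X l i"])
    fix t assume t: "\<forall>i\<in>I. (\<Sum>l\<in>insert None (Some ` J). (case l of None \<Rightarrow> z i | Some l \<Rightarrow> X l i) * t l) = 0"
    have t': "z i * t None + (\<Sum>l\<in>J. X l i * t (Some l)) = 0" if "i \<in> I" for i
      using t that fJ by (simp add: sum.insert_if image_iff sum.reindex)
    have J0: "t (Some j) = 0" if j: "j \<in> J" for j
    proof -
      have "0 = (\<Sum>i\<in>I. K j i * (z i * t None + (\<Sum>l\<in>J. X l i * t (Some l))))"
        using t' by simp
      also have "\<dots> = (\<Sum>i\<in>I. K j i * z i) * t None + (\<Sum>i\<in>I. \<Sum>l\<in>J. K j i * X l i * t (Some l))"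
        by (simp add: algebra_simps sum.distrib sum_distrib_left)
      also have "(\<Sum>i\<in>I. \<Sum>l\<in>J. K j i * X l i * t (Some l)) = (\<Sum>l\<in>J. (\<Sum>i\<in>I. K j i * X l i) * t (Some l))"
        by (subst sum.swap) (simp add: sum_distrib_right)
      also have "\<dots> = (\<Sum>l\<in>J. if j = l then t (Some l) else 0)"
        by (rule sum.cong) (use X[OF j] in auto)
      finally show ?thesis using z(1) j fJ by simp
    qed
    have "t None = 0" using t'[OF z(2)] J0 z(3) by simp
    with J0 show "\<forall>l\<in>insert None (Some ` J). t l = 0" by auto
  qed (use fI fJ in auto)
  then show ?thesis using fJ by (simp add: card_insert_if image_iff card_image)
qed

section \<open>Subspaces, bases orthonormal for a Hermitian form, and dimension\<close>

definition csub :: "nat \<Rightarrow> complex vec set \<Rightarrow> bool" where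
  "csub d S \<longleftrightarrow> S \<subseteq> carrier_vec d \<and> 0\<^sub>v d \<in> S \<and>
     (\<forall>x\<in>S. \<forall>y\<in>S. x + y \<in> S) \<and> (\<forall>c. \<forall>x\<in>S. c \<cdot>\<^sub>v x \<in> S)"

definition posdef :: "nat \<Rightarrow> complex mat \<Rightarrow> bool" where
  "posdef d H \<longleftrightarrow> H \<in> carrier_mat d d \<and> adj H = H \<and>
     (\<forall>x\<in>carrier_vec d. x \<noteq> 0\<^sub>v d \<longrightarrow> Re ((H *\<^sub>v x) \<bullet>c x) > 0)"

definition mimg :: "complex mat \<Rightarrow> complex vec set" where
  "mimg A = (\<lambda>x. A *\<^sub>v x) ` carrier_vec (dim_col A)"

text \<open>Carrying the form \<open>H\<close> as a parameter lets one notion serve both the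
  standard product, \<open>H = 1\<close>, and the inner products to be found. The matrix
  \<open>adj N * H\<close> is then a left inverse of \<open>N\<close>.\<close>

definition onb :: "complex mat \<Rightarrow> nat \<Rightarrow> nat \<Rightarrow> complex mat \<Rightarrow> complex vec set \<Rightarrow> bool" where
  "onb H d k N S \<longleftrightarrow> N \<in> carrier_mat d k \<and> adj N * (H * N) = 1\<^sub>m k \<and> mimg N = S"

text \<open>Span of the first \<open>k\<close> unit vectors, kept inside dimension \<open>d\<close>:
  in a basis adapted to a flag, each step of the flag is the image of such a subspace.\<close>

definition coords :: "nat \<Rightarrow> nat \<Rightarrow> complex vec set" where
  "coords d k = {c \<in> carrier_vec d. \<forall>a<d. k \<le> a \<longrightarrow> c $ a = 0}"

lemma csubD:
  assumes "csub d S"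
  shows "S \<subseteq> carrier_vec d" "0\<^sub>v d \<in> S" "x \<in> S \<Longrightarrow> y \<in> S \<Longrightarrow> x + y \<in> S" "x \<in> S \<Longrightarrow> c \<cdot>\<^sub>v x \<in> S"
    "x \<in> S \<Longrightarrow> x \<in> carrier_vec d"
  using assms by (auto simp: csub_def)

lemma csub_minus:
  assumes S: "csub d S" and x: "x \<in> S" and y: "y \<in> S"
  shows "x - y \<in> S"
proof -
  have "x - y = x + (-1) \<cdot>\<^sub>v y"
    using csubD(5)[OF S] x y by (intro eq_vecI) auto
  then show ?thesis using csubD(3,4)[OF S] x y by metis
qed

lemma csub_carrier [simp]: "csub d (carrier_vec d)"
  by (auto simp: csub_def)

lemma csub_Int: "csub d S \<Longrightarrow> csub d T \<Longrightarrow> csub d (S \<inter> T)"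
  by (auto simp: csub_def)

lemma csub_zero [simp]: "csub d {0\<^sub>v d}"
  by (auto simp: csub_def)

lemma mult_mat_vec_zero: "A \<in> carrier_mat m n \<Longrightarrow> A *\<^sub>v 0\<^sub>v n = 0\<^sub>v m"
  by (intro eq_vecI) auto

lemma mult_unit_vec_col: "(A :: complex mat) \<in> carrier_mat m n \<Longrightarrow> j < n \<Longrightarrow> A *\<^sub>v unit_vec n j = col A j"
  by (intro eq_vecI) auto

lemma mimg_iff: "A \<in> carrier_mat m n \<Longrightarrow> y \<in> mimg A \<longleftrightarrow> (\<exists>x\<in>carrier_vec n. y = A *\<^sub>v x)"
  by (auto simp: mimg_def)

lemma mimgI: "A \<in> carrier_mat m n \<Longrightarrow> x \<in> carrier_vec n \<Longrightarrow> A *\<^sub>v x \<in> mimg A"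
  by (auto simp: mimg_def)

lemma csub_mimg:
  assumes A: "A \<in> carrier_mat m n"
  shows "csub m (mimg A)"
  unfolding csub_def
proof (intro conjI ballI allI)
  show "mimg A \<subseteq> carrier_vec m" using A by (auto simp: mimg_def)
  have "0\<^sub>v m = A *\<^sub>v 0\<^sub>v n" using A by auto
  then show "0\<^sub>v m \<in> mimg A" using mimgI[OF A] by auto
next
  fix x y assume "x \<in> mimg A" "y \<in> mimg A"
  then obtain a b where "a \<in> carrier_vec n" "b \<in> carrier_vec n" "x = A *\<^sub>v a" "y = A *\<^sub>v b"
    using mimg_iff[OF A] by auto
  then show "x + y \<in> mimg A" using A mimgI[OF A, of "a + b"] by (simp add: mult_add_distrib_mat_vec)
next
  fix c x assume "x \<in> mimg A"
  then obtain a where "a \<in> carrier_vec n" "x = A *\<^sub>v a" using mimg_iff[OF A] by auto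
  then show "c \<cdot>\<^sub>v x \<in> mimg A" using A mimgI[OF A, of "c \<cdot>\<^sub>v a"] by (simp add: mult_mat_vec)
qed

lemma posdefD:
  assumes "posdef d H"
  shows "H \<in> carrier_mat d d" "adj H = H"
    "x \<in> carrier_vec d \<Longrightarrow> x \<noteq> 0\<^sub>v d \<Longrightarrow> Re ((H *\<^sub>v x) \<bullet>c x) > 0"
  using assms by (auto simp: posdef_def)

lemma posdef_one [simp]: "posdef d (1\<^sub>m d)"
  by (auto simp: posdef_def cscalar_prod_self norm_sq_pos)

lemma hermitian_form_swap:
  assumes H: "H \<in> carrier_mat d d" "adj H = H" and x: "x \<in> carrier_vec d" and y: "y \<in> carrier_vec d"
  shows "(H *\<^sub>v y) \<bullet>c x = cnj ((H *\<^sub>v x) \<bullet>c y)"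
  using cscalar_prod_adj[OF H(1) y x] cscalar_prod_swap[of "H *\<^sub>v x" d y] H x y by simp

lemma hermitian_form_real:
  assumes "H \<in> carrier_mat d d" "adj H = H" "x \<in> carrier_vec d"
  shows "(H *\<^sub>v x) \<bullet>c x = complex_of_real (Re ((H *\<^sub>v x) \<bullet>c x))"
  using hermitian_form_swap[OF assms assms(3)] by (simp add: complex_eq_iff)

lemma index_adj_mult_vec:
  assumes "A \<in> carrier_mat d k" "x \<in> carrier_vec d" "i < k"
  shows "(adj A *\<^sub>v x) $ i = x \<bullet>c col A i"
  using assms by (simp add: scalar_prod_def mult.commute)

lemma index_adj_form:
  assumes "A \<in> carrier_mat d k" "H \<in> carrier_mat d d" "B \<in> carrier_mat d l" "i < k" "j < l"
  shows "(adj A * (H * B)) $$ (i, j) = (H *\<^sub>v col B j) \<bullet>c col A i"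
proof -
  have "(adj A * (H * B)) $$ (i, j) = row (adj A) i \<bullet> (H *\<^sub>v col B j)"
    using assms col_mult2[OF assms(2,3,5)] by (subst index_mult_mat(1)) auto
  also have "\<dots> = (H *\<^sub>v col B j) \<bullet>c col A i"
    using assms by (simp add: scalar_prod_def mult.commute)
  finally show ?thesis .
qed

lemma mult_mat_vec_sum:
  assumes "A \<in> carrier_mat m n" "x \<in> carrier_vec n" "i < m"
  shows "(A *\<^sub>v x) $ i = (\<Sum>j<n. A $$ (i, j) * x $ j)"
  using assms by (simp add: scalar_prod_def atLeast0LessThan)

lemma factor_through:
  assumes A: "A \<in> carrier_mat m n" and B: "B \<in> carrier_mat m k"
    and sub: "\<And>j. j < n \<Longrightarrow> col A j \<in> mimg B"
  shows "\<exists>C\<in>carrier_mat k n. A = B * C"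
proof -
  have "\<exists>c. j < n \<longrightarrow> c \<in> carrier_vec k \<and> col A j = B *\<^sub>v c" for j
    using sub[of j] mimg_iff[OF B] by blast
  then obtain c where c: "\<And>j. j < n \<Longrightarrow> c j \<in> carrier_vec k \<and> col A j = B *\<^sub>v c j"
    by metis
  define C where "C = mat k n (\<lambda>(i, j). c j $ i)"
  have C: "C \<in> carrier_mat k n" by (simp add: C_def)
  have cC: "col C j = c j" if "j < n" for j
    using c[OF that] that by (intro eq_vecI) (auto simp: C_def)
  have "A = B * C"
  proof (rule eq_matI)
    fix i j assume "i < dim_row (B * C)" "j < dim_col (B * C)"
    then have ij: "i < m" "j < n" using B C by auto
    have "A $$ (i, j) = col A j $ i" using A ij by simp
    also have "\<dots> = (B * C) $$ (i, j)" using c[OF ij(2)] cC[OF ij(2)] B C ij by simp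
    finally show "A $$ (i, j) = (B * C) $$ (i, j)" .
  qed (use A B C in auto)
  with C show ?thesis by blast
qed

lemma col_in_mimg: "A \<in> carrier_mat m n \<Longrightarrow> j < n \<Longrightarrow> col A j \<in> mimg A"
  using mimgI[of A m n "unit_vec n j"] by (simp add: mult_unit_vec_col)

lemma factor_through_mimg:
  assumes A: "A \<in> carrier_mat m n" and B: "B \<in> carrier_mat m k" and sub: "mimg A \<subseteq> mimg B"
  shows "\<exists>C\<in>carrier_mat k n. A = B * C"
  using col_in_mimg[OF A] sub by (intro factor_through[OF A B]) auto

lemma left_invertible_dim_le:
  fixes A :: "complex mat"
  assumes A: "A \<in> carrier_mat m n" and L: "L \<in> carrier_mat n m" and LA: "L * A = 1\<^sub>m n"
  shows "n \<le> m"
proof (rule ccontr)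
  assume "\<not> n \<le> m"
  then obtain x where x: "x \<in> carrier_vec n" "x \<noteq> 0\<^sub>v n" "A *\<^sub>v x = 0\<^sub>v m"
    using wide_matrix_kernel[OF A] by auto
  have "x = L * A *\<^sub>v x" using x LA by simp
  also have "\<dots> = 0\<^sub>v n" using assoc_mult_mat_vec[OF L A x(1)] x(3) mult_mat_vec_zero[OF L] by simp
  finally show False using x by simp
qed

text \<open>If \<open>A = B * C\<close>, then \<open>L * B\<close> is a left inverse of
  \<open>C\<close>, so the size bound applies to \<open>C\<close>. This serves as the monotonicity
  of dimension.\<close>

lemma left_invertible_dim_mono:
  fixes A :: "complex mat"
  assumes A: "A \<in> carrier_mat m n" and L: "L \<in> carrier_mat n m" and LA: "L * A = 1\<^sub>m n"
    and B: "B \<in> carrier_mat m k" and sub: "mimg A \<subseteq> mimg B"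
  shows "n \<le> k"
proof -
  obtain C where C: "C \<in> carrier_mat k n" "A = B * C"
    using factor_through_mimg[OF A B sub] by blast
  have "L * B * C = 1\<^sub>m n" using C LA L B by simp
  then show ?thesis by (intro left_invertible_dim_le[OF C(1), of "L * B"]) (use L B in auto)
qed

lemma onb_left_inverse:
  assumes "onb H d k N S" "H \<in> carrier_mat d d"
  shows "adj N * H \<in> carrier_mat k d" "adj N * H * N = 1\<^sub>m k"
  using assms assoc_mult_mat[of "adj N" k d H d N k] by (auto simp: onb_def)

lemma onb_dim_mono:
  assumes "onb H d k N S" "H \<in> carrier_mat d d" "onb H' d k' N' S'" "S \<subseteq> S'"
  shows "k \<le> k'"
  using left_invertible_dim_mono[OF _ onb_left_inverse[OF assms(1,2)]] assms by (auto simp: onb_def)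

lemma onb_dim_le: "onb H d k N S \<Longrightarrow> H \<in> carrier_mat d d \<Longrightarrow> k \<le> d"
  using left_invertible_dim_le[OF _ onb_left_inverse] by (auto simp: onb_def)

text \<open>Orthonormal families have at most \<open>d\<close> members, so a longest one inside
  \<open>S\<close> extending \<open>N\<close> exists; if it did not span \<open>S\<close>, one
  Gram-Schmidt step would lengthen it. The columns of \<open>N\<close> are kept verbatim, which is
  what makes bases adapted to flags possible.\<close>

lemma extend_onb:
  assumes H: "posdef d H" and S: "csub d S" and N: "onb H d k N T" and sub: "T \<subseteq> S"
  shows "\<exists>k' N'. k \<le> k' \<and> onb H d k' N' S \<and> (\<forall>i<d. \<forall>j<k. N' $$ (i, j) = N $$ (i, j))"
proof -
  note Hc = posdefD(1)[OF H] and Hh = posdefD(2)[OF H]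
  define P where "P k' N' \<longleftrightarrow> k \<le> k' \<and> onb H d k' N' (mimg N') \<and> mimg N' \<subseteq> S \<and>
    (\<forall>i<d. \<forall>j<k. N' $$ (i, j) = N $$ (i, j))" for k' N'
  have "P k N" using N sub by (auto simp: P_def onb_def)
  then have ex: "\<exists>k'. \<exists>N'. P k' N'" by blast
  have bd: "k' \<le> d" if "\<exists>N'. P k' N'" for k'
    using that onb_dim_le[OF _ Hc] by (auto simp: P_def)
  define q where "q = (GREATEST k'. \<exists>N'. P k' N')"
  have "\<exists>N'. P q N'" unfolding q_def by (rule GreatestI_ex_nat[OF ex]) (use bd in blast)
  then obtain M where M: "P q M" by blast
  have max: "k' \<le> q" if "P k' N'" for k' N'
    unfolding q_def by (rule Greatest_le_nat[where b = d]) (use bd that in blast)+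
  have Mc: "M \<in> carrier_mat d q" and Mo: "adj M * (H * M) = 1\<^sub>m q" and MS: "mimg M \<subseteq> S"
    using M by (auto simp: P_def onb_def)
  have "S \<subseteq> mimg M"
  proof (rule ccontr)
    assume "\<not> S \<subseteq> mimg M"
    then obtain v where v: "v \<in> S" "v \<notin> mimg M" by blast
    have vc: "v \<in> carrier_vec d" using csubD(5)[OF S v(1)] .
    define a where "a = adj M *\<^sub>v (H *\<^sub>v v)"
    have ac: "a \<in> carrier_vec q" using Mc Hc vc by (auto simp: a_def intro!: mult_mat_vec_carrier)
    \<comment> \<open>The component of \<open>v\<close> orthogonal to the columns of
      \<open>M\<close>; it is nonzero because \<open>v\<close> lies outside their span.\<close>
    define w where "w = v - M *\<^sub>v a"
    have Ma: "M *\<^sub>v a \<in> mimg M" using mimgI[OF Mc ac] .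
    have wS: "w \<in> S" unfolding w_def using csub_minus[OF S v(1)] Ma MS by auto
    have wc: "w \<in> carrier_vec d" using csubD(5)[OF S wS] .
    have w0: "w \<noteq> 0\<^sub>v d"
    proof
      assume "w = 0\<^sub>v d"
      then have "v - M *\<^sub>v a = 0\<^sub>v d" by (simp add: w_def)
      then have "v = M *\<^sub>v a" using vc Mc ac
        by (metis carrier_vecD dim_mult_mat_vec index_minus_vec(1) index_zero_vec(1)
            carrier_matD(1) eq_vecI right_minus_eq)
      then show False using v(2) Ma by simp
    qed
    have Mw: "adj M *\<^sub>v (H *\<^sub>v w) = 0\<^sub>v q"
    proof -
      have "adj M *\<^sub>v (H *\<^sub>v w) = a - adj M *\<^sub>v (H *\<^sub>v (M *\<^sub>v a))"
        unfolding w_def using Hc vc Mc ac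
        by (simp add: mult_minus_distrib_mat_vec[of _ d d] mult_minus_distrib_mat_vec[of _ q d] a_def)
      also have "adj M *\<^sub>v (H *\<^sub>v (M *\<^sub>v a)) = (adj M * (H * M)) *\<^sub>v a"
        using Hc Mc ac by (simp add: assoc_mult_mat_vec[of _ q d _ q] assoc_mult_mat_vec[of _ d d _ q])
      finally show ?thesis using Mo ac by simp
    qed
    define s where "s = Re ((H *\<^sub>v w) \<bullet>c w)"
    have s: "s > 0" using posdefD(3)[OF H wc w0] by (simp add: s_def)
    have sw: "(H *\<^sub>v w) \<bullet>c w = complex_of_real s"
      unfolding s_def by (rule hermitian_form_real[OF Hc Hh wc])
    define u where "u = complex_of_real (1 / sqrt s) \<cdot>\<^sub>v w"
    have uc: "u \<in> carrier_vec d" and uS: "u \<in> S" using wc csubD(4)[OF S wS] by (auto simp: u_def)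
    have uu: "(H *\<^sub>v u) \<bullet>c u = 1"
    proof -
      have "(H *\<^sub>v u) \<bullet>c u = complex_of_real (1 / sqrt s) * (complex_of_real (1 / sqrt s) * complex_of_real s)"
        unfolding u_def using wc Hc
        by (simp add: mult_mat_vec[of _ d d] cscalar_prod_smult_right[of _ d] conjugate_smult_vec sw)
      also have "\<dots> = complex_of_real (1 / sqrt s * (1 / sqrt s * s))" by (simp only: of_real_mult)
      also have "1 / sqrt s * (1 / sqrt s * s) = 1" using s by (simp add: field_simps)
      finally show ?thesis by simp
    qed
    have uM: "(H *\<^sub>v u) \<bullet>c col M i = 0" if "i < q" for i
    proof -
      have "(H *\<^sub>v u) \<bullet>c col M i = (adj M *\<^sub>v (H *\<^sub>v u)) $ i"
        using index_adj_mult_vec[OF Mc, of "H *\<^sub>v u" i] Hc uc that by simp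
      also have "adj M *\<^sub>v (H *\<^sub>v u) = complex_of_real (1 / sqrt s) \<cdot>\<^sub>v (adj M *\<^sub>v (H *\<^sub>v w))"
        unfolding u_def using wc Hc Mc by (simp add: mult_mat_vec[of _ d d] mult_mat_vec[of _ q d])
      finally show ?thesis using Mw that by simp
    qed
    define M' where "M' = mat d (Suc q) (\<lambda>(i, j). if j < q then M $$ (i, j) else u $ i)"
    have M'c: "M' \<in> carrier_mat d (Suc q)" by (simp add: M'_def)
    have colM: "col M' j = (if j < q then col M j else u)" if "j < Suc q" for j
      using that Mc uc by (intro eq_vecI) (auto simp: M'_def)
    have "adj M' * (H * M') = 1\<^sub>m (Suc q)"
    proof (rule eq_matI)
      fix i j assume "i < dim_row (1\<^sub>m (Suc q))" "j < dim_col (1\<^sub>m (Suc q))"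
      then have ij: "i < Suc q" "j < Suc q" by auto
      have MM: "(H *\<^sub>v col M j) \<bullet>c col M i = (if i = j then 1 else 0)" if "i < q" "j < q" for i j
        using index_adj_form[OF Mc Hc Mc that] that Mo by simp
      have Mu: "(H *\<^sub>v col M j) \<bullet>c u = 0" if "j < q" for j
        using hermitian_form_swap[OF Hc Hh uc, of "col M j"] uM[OF that] that Mc by simp
      show "(adj M' * (H * M')) $$ (i, j) = 1\<^sub>m (Suc q) $$ (i, j)"
        using ij index_adj_form[OF M'c Hc M'c ij] colM[OF ij(1)] colM[OF ij(2)] MM Mu uM uu
        by (auto simp: less_Suc_eq)
    qed (use M'c in auto)
    moreover have "mimg M' \<subseteq> S"
    proof
      fix y assume "y \<in> mimg M'"
      then obtain c where c: "c \<in> carrier_vec (Suc q)" "y = M' *\<^sub>v c" using mimg_iff[OF M'c] by auto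
      have "y = M *\<^sub>v vec q (\<lambda>j. c $ j) + (c $ q) \<cdot>\<^sub>v u"
      proof (rule eq_vecI)
        fix i assume "i < dim_vec (M *\<^sub>v vec q (\<lambda>j. c $ j) + (c $ q) \<cdot>\<^sub>v u)"
        then have i: "i < d" using uc by simp
        have "y $ i = (\<Sum>j<Suc q. M' $$ (i, j) * c $ j)"
          unfolding c(2) by (rule mult_mat_vec_sum[OF M'c c(1) i])
        also have "\<dots> = (\<Sum>j<q. M $$ (i, j) * c $ j) + u $ i * c $ q" using i by (simp add: M'_def)
        also have "\<dots> = (M *\<^sub>v vec q (\<lambda>j. c $ j) + (c $ q) \<cdot>\<^sub>v u) $ i"
          using i uc Mc mult_mat_vec_sum[OF Mc, of "vec q (\<lambda>j. c $ j)" i] by simp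
        finally show "y $ i = \<dots>" .
      qed (use c(2) M'c uc in simp)
      moreover have "M *\<^sub>v vec q (\<lambda>j. c $ j) \<in> S" using mimgI[OF Mc] MS by auto
      ultimately show "y \<in> S" using csubD(3,4)[OF S] uS by simp
    qed
    ultimately have "P (Suc q) M'"
      using M M'c by (auto simp: P_def onb_def M'_def)
    then show False using max by fastforce
  qed
  then have "onb H d q M S" using M MS by (auto simp: P_def)
  then show ?thesis using M unfolding P_def by blast
qed

lemma onb_empty: "onb H d 0 (0\<^sub>m d 0) {0\<^sub>v d}" if "H \<in> carrier_mat d d"
proof -
  have "x = 0\<^sub>v 0" if "x \<in> carrier_vec 0" for x :: "complex vec"
    by (rule eq_vecI) (use carrier_vecD[OF that] in simp_all)
  then have "carrier_vec 0 = {0\<^sub>v 0 :: complex vec}" using zero_carrier_vec by blast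
  moreover have "0\<^sub>m d 0 *\<^sub>v 0\<^sub>v 0 = (0\<^sub>v d :: complex vec)" by (intro eq_vecI) auto
  ultimately have "mimg (0\<^sub>m d 0) = {0\<^sub>v d}" by (simp add: mimg_def)
  moreover have "adj (0\<^sub>m d 0) * (H * 0\<^sub>m d 0) = 1\<^sub>m 0" by (rule eq_matI) auto
  ultimately show ?thesis by (simp add: onb_def)
qed

lemma onb_exists:
  assumes "posdef d H" "csub d S"
  shows "\<exists>k N. onb H d k N S"
  using extend_onb[OF assms onb_empty] assms csubD(2)[OF assms(2)] by (auto simp: posdef_def)

lemma onb_carrier_dim:
  assumes H: "H \<in> carrier_mat d d" and N: "onb H d k N (carrier_vec d)"
  shows "k = d"
proof -
  have "onb (1\<^sub>m d) d d (1\<^sub>m d) (carrier_vec d)" by (force simp: onb_def mimg_def)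
  then have "d \<le> k" using onb_dim_mono[OF _ _ N] by auto
  with onb_dim_le[OF N H] show ?thesis by simp
qed

text \<open>Fixed through the standard form; by \<open>cdim_eq\<close> the length of an orthonormal
  basis for any other form \<open>H\<close> is the same number.\<close>

definition cdim :: "nat \<Rightarrow> complex vec set \<Rightarrow> nat" where
  "cdim d S = (THE k. \<exists>N. onb (1\<^sub>m d) d k N S)"

lemma cdim_eq:
  assumes H: "H \<in> carrier_mat d d" and N: "onb H d k N S"
  shows "cdim d S = k"
proof -
  have S: "csub d S" using N csub_mimg by (auto simp: onb_def)
  show ?thesis unfolding cdim_def
  proof (rule the_equality)
    obtain k' N' where N': "onb (1\<^sub>m d) d k' N' S" using onb_exists[OF posdef_one S] by blast
    have "k' = k" using onb_dim_mono[OF N H N'] onb_dim_mono[OF N' _ N] by simp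
    with N' show "\<exists>N. onb (1\<^sub>m d) d k N S" by blast
    fix l assume "\<exists>N. onb (1\<^sub>m d) d l N S"
    then show "l = k" using onb_dim_mono[OF N H] onb_dim_mono[OF _ _ N] by (metis antisym order_refl one_carrier_mat)
  qed
qed

text \<open>The basis is extended step by step along the flag. Because earlier columns survive, a
  subspace spanned by the first \<open>z\<close> columns of the short basis is spanned by the first
  \<open>z\<close> columns of the long one.\<close>

lemma adapted_onb_aux:
  assumes H: "posdef d H" and S: "\<And>i. i \<le> m \<Longrightarrow> csub d (S i)" and mono: "\<And>i. i < m \<Longrightarrow> S i \<subseteq> S (Suc i)"
  shows "\<exists>k N x. onb H d k N (S m) \<and> x m = k \<and> (\<forall>i<m. x i \<le> x (Suc i)) \<and>
    (\<forall>i\<le>m. x i \<le> k \<and> S i = (\<lambda>c. N *\<^sub>v c) ` coords k (x i))"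
  using S mono
proof (induction m)
  case 0
  then obtain k N where N: "onb H d k N (S 0)" using onb_exists[OF H] by blast
  have "coords k k = carrier_vec k" by (auto simp: coords_def)
  then have "S 0 = (\<lambda>c. N *\<^sub>v c) ` coords k k" using N by (auto simp: onb_def mimg_def)
  then show ?case using N by (intro exI[of _ k] exI[of _ N] exI[of _ "\<lambda>_. k"]) auto
next
  case (Suc m)
  then obtain k N x where N: "onb H d k N (S m)" and x: "x m = k" "\<forall>i<m. x i \<le> x (Suc i)"
    and Sx: "\<forall>i\<le>m. x i \<le> k \<and> S i = (\<lambda>c. N *\<^sub>v c) ` coords k (x i)" by force
  obtain k' N' where k': "k \<le> k'" and N': "onb H d k' N' (S (Suc m))"
    and ext: "\<forall>i<d. \<forall>j<k. N' $$ (i, j) = N $$ (i, j)"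
    using extend_onb[OF H Suc.prems(1)[of "Suc m"] N Suc.prems(2)[of m]] by auto
  have Nc: "N \<in> carrier_mat d k" "N' \<in> carrier_mat d k'" using N N' by (auto simp: onb_def)
  have eq: "(\<lambda>c. N *\<^sub>v c) ` coords k z = (\<lambda>c. N' *\<^sub>v c) ` coords k' z" if z: "z \<le> k" for z
  proof -
    have NN: "N' *\<^sub>v c = N *\<^sub>v vec k (\<lambda>a. c $ a)" if c: "c \<in> coords k' z" for c
    proof (rule eq_vecI)
      fix i assume "i < dim_vec (N *\<^sub>v vec k (\<lambda>a. c $ a))"
      then have i: "i < d" using Nc by simp
      have "(N' *\<^sub>v c) $ i = (\<Sum>j<k'. N' $$ (i, j) * c $ j)"
        using c by (intro mult_mat_vec_sum[OF Nc(2) _ i]) (auto simp: coords_def)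
      also have "\<dots> = (\<Sum>j<k. N' $$ (i, j) * c $ j)"
        using k' z c by (intro sum.mono_neutral_right) (auto simp: coords_def)
      also have "\<dots> = (N *\<^sub>v vec k (\<lambda>a. c $ a)) $ i"
        using mult_mat_vec_sum[OF Nc(1) _ i, of "vec k (\<lambda>a. c $ a)"] ext i by simp
      finally show "(N' *\<^sub>v c) $ i = (N *\<^sub>v vec k (\<lambda>a. c $ a)) $ i" .
    qed (use Nc in simp)
    show ?thesis
    proof (intro equalityI subsetI)
      fix y assume "y \<in> (\<lambda>c. N *\<^sub>v c) ` coords k z"
      then obtain c where c: "c \<in> coords k z" "y = N *\<^sub>v c" by blast
      define c' where "c' = vec k' (\<lambda>a. if a < k then c $ a else 0)"
      have "c' \<in> coords k' z" using c(1) by (auto simp: c'_def coords_def)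
      moreover have "vec k (\<lambda>a. c' $ a) = c" using c(1) k' by (intro eq_vecI) (auto simp: c'_def coords_def)
      ultimately show "y \<in> (\<lambda>c. N' *\<^sub>v c) ` coords k' z" using NN[of c'] c(2) by (metis imageI)
    next
      fix y assume "y \<in> (\<lambda>c. N' *\<^sub>v c) ` coords k' z"
      then obtain c where c: "c \<in> coords k' z" "y = N' *\<^sub>v c" by blast
      have "vec k (\<lambda>a. c $ a) \<in> coords k z" using c(1) k' by (auto simp: coords_def)
      then show "y \<in> (\<lambda>c. N *\<^sub>v c) ` coords k z" using NN[OF c(1)] c(2) by auto
    qed
  qed
  define x' where "x' = x(Suc m := k')"
  have "coords k' k' = carrier_vec k'" by (auto simp: coords_def)
  then have top: "S (Suc m) = (\<lambda>c. N' *\<^sub>v c) ` coords k' k'" using N' by (auto simp: onb_def mimg_def)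
  show ?case
  proof (intro exI conjI allI impI)
    show "onb H d k' N' (S (Suc m))" by fact
    show "x' (Suc m) = k'" by (simp add: x'_def)
    fix i
    show "x' i \<le> x' (Suc i)" if "i < Suc m" using that x k' Sx by (auto simp: x'_def less_Suc_eq)
    show "x' i \<le> k'" if "i \<le> Suc m" using that k' Sx by (auto simp: x'_def le_Suc_eq)
    show "S i = (\<lambda>c. N' *\<^sub>v c) ` coords k' (x' i)" if "i \<le> Suc m"
      using that top Sx eq by (cases "i = Suc m") (auto simp: x'_def)
  qed
qed

lemma index_mult_mat_sum:
  assumes "A \<in> carrier_mat m n" "B \<in> carrier_mat n k" "i < m" "j < k"
  shows "(A * B) $$ (i, j) = (\<Sum>l<n. A $$ (i, l) * B $$ (l, j))"
  using assms by (simp add: scalar_prod_def atLeast0LessThan)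

subsection \<open>Trace, generalized inverses and Fitting idempotents\<close>

definition mtrace :: "complex mat \<Rightarrow> complex" where
  "mtrace A = (\<Sum>i<dim_row A. A $$ (i, i))"

lemma mtrace_comm:
  assumes A: "A \<in> carrier_mat m n" and B: "B \<in> carrier_mat n m"
  shows "mtrace (A * B) = mtrace (B * A)"
proof -
  have "mtrace (A * B) = (\<Sum>i<m. \<Sum>j<n. A $$ (i, j) * B $$ (j, i))"
    using A B by (simp add: mtrace_def scalar_prod_def atLeast0LessThan)
  also have "\<dots> = (\<Sum>j<n. \<Sum>i<m. B $$ (j, i) * A $$ (i, j))"
    by (subst sum.swap) (simp add: mult.commute)
  also have "\<dots> = mtrace (B * A)"
    using A B by (simp add: mtrace_def scalar_prod_def atLeast0LessThan)
  finally show ?thesis .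
qed

lemma mtrace_minus:
  assumes "A \<in> carrier_mat n n" "B \<in> carrier_mat n n"
  shows "mtrace (A - B) = mtrace A - mtrace B"
  using assms by (simp add: mtrace_def sum_subtractf)

lemma onb_one_projection:
  assumes N: "onb (1\<^sub>m d) d k N S"
  shows "N \<in> carrier_mat d k" "adj N * N = 1\<^sub>m k"
    "x \<in> S \<Longrightarrow> N *\<^sub>v (adj N *\<^sub>v x) = x"
proof -
  show Nc: "N \<in> carrier_mat d k" and NN: "adj N * N = 1\<^sub>m k" using N by (auto simp: onb_def)
  assume "x \<in> S"
  then obtain c where c: "c \<in> carrier_vec k" "x = N *\<^sub>v c"
    using N mimg_iff[OF Nc] by (auto simp: onb_def)
  have "adj N *\<^sub>v (N *\<^sub>v c) = (adj N * N) *\<^sub>v c"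
    by (rule assoc_mult_mat_vec[symmetric, of _ k d _ k]) (use Nc c in auto)
  then show "N *\<^sub>v (adj N *\<^sub>v x) = x" using c NN by simp
qed

text \<open>\<open>N * adj N\<close> is the orthogonal projection onto \<open>S\<close>, so it fixes
  every column lying in \<open>S\<close>.\<close>

lemma onb_one_projection_mat:
  assumes N: "onb (1\<^sub>m d) d k N S" and A: "A \<in> carrier_mat d m" and sub: "mimg A \<subseteq> S"
  shows "N * (adj N * A) = A"
proof (rule eq_matI)
  have Nc: "N \<in> carrier_mat d k" using N by (auto simp: onb_def)
  then show "dim_row (N * (adj N * A)) = dim_row A" "dim_col (N * (adj N * A)) = dim_col A"
    using A by auto
  fix i j assume "i < dim_row A" "j < dim_col A"
  then have ij: "i < d" "j < m" using A by auto
  have "col A j \<in> S" using col_in_mimg[OF A ij(2)] sub by auto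
  then have "N *\<^sub>v (adj N *\<^sub>v col A j) = col A j" by (rule onb_one_projection(3)[OF N])
  moreover have "col (N * (adj N * A)) j = N *\<^sub>v (adj N *\<^sub>v col A j)"
    using col_mult2[OF Nc, of "adj N * A" m j] col_mult2[of "adj N" k d A m j] Nc A ij by auto
  ultimately have "col (N * (adj N * A)) j $ i = col A j $ i" by simp
  then show "(N * (adj N * A)) $$ (i, j) = A $$ (i, j)" using Nc A ij by (simp add: index_col del: col_mult2)
qed

text \<open>The orthogonal projection onto the image of \<open>F\<close> factors as
  \<open>F * G\<close>, and it fixes \<open>F\<close>.\<close>

lemma generalized_inverse:
  fixes F :: "complex mat"
  assumes F: "F \<in> carrier_mat n m"
  shows "\<exists>G\<in>carrier_mat m n. F * (G * F) = F"
proof -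
  obtain k N where N: "onb (1\<^sub>m n) n k N (mimg F)" using onb_exists[OF posdef_one csub_mimg[OF F]] by blast
  note Nc = onb_one_projection(1)[OF N]
  have "mimg (N * adj N) \<subseteq> mimg F"
  proof
    fix y assume "y \<in> mimg (N * adj N)"
    then obtain c where c: "c \<in> carrier_vec n" "y = N * adj N *\<^sub>v c"
      using mimg_iff[of "N * adj N" n n] Nc by auto
    then have "y = N *\<^sub>v (adj N *\<^sub>v c)" using Nc by (simp add: assoc_mult_mat_vec[of _ n k _ n])
    then have "y \<in> mimg N" using mimgI[OF Nc, of "adj N *\<^sub>v c"] Nc c by (auto intro: mult_mat_vec_carrier)
    then show "y \<in> mimg F" using N by (simp add: onb_def)
  qed
  then obtain G where G: "G \<in> carrier_mat m n" "N * adj N = F * G"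
    using factor_through_mimg[of "N * adj N" n n F m] Nc F by auto
  have "F * (G * F) = F * G * F" using F G by (simp add: assoc_mult_mat[of _ n m _ n _ m])
  also have "\<dots> = N * (adj N * F)" unfolding G(2)[symmetric] by (rule assoc_mult_mat[of _ n k _ n _ m]) (use Nc F in auto)
  also have "\<dots> = F" by (rule onb_one_projection_mat[OF N F]) simp
  finally show ?thesis using G by blast
qed

lemma pow_mat_Suc_left: "A \<in> carrier_mat n n \<Longrightarrow> A ^\<^sub>m Suc k = A * A ^\<^sub>m k"
proof (induction k)
  case (Suc k)
  have "A ^\<^sub>m Suc (Suc k) = A * A ^\<^sub>m k * A" using Suc by simp
  also have "\<dots> = A * A ^\<^sub>m Suc k" using Suc.prems by (simp add: assoc_mult_mat[of _ n n _ n _ n])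
  finally show ?case .
qed auto

lemma pow_mat_add: "A \<in> carrier_mat n n \<Longrightarrow> A ^\<^sub>m (k + l) = A ^\<^sub>m k * A ^\<^sub>m l"
  by (induction l) (auto simp: assoc_mult_mat[of _ n n _ n _ n])

lemma pow_mat_intertwine:
  assumes F: "F \<in> carrier_mat m m" and G: "G \<in> carrier_mat n n" and A: "A \<in> carrier_mat m n"
    and "F * A = A * G"
  shows "F ^\<^sub>m k * A = A * G ^\<^sub>m k"
proof (induction k)
  case (Suc k)
  have "F ^\<^sub>m Suc k * A = F ^\<^sub>m k * (F * A)" using F A by (simp add: assoc_mult_mat[of _ m m _ m _ n])
  also have "\<dots> = F ^\<^sub>m k * A * G" using F A G assms(4) by (simp add: assoc_mult_mat[of _ m m _ n _ n])
  also have "\<dots> = A * G ^\<^sub>m Suc k" using Suc A G by (simp add: assoc_mult_mat[of _ m n _ n _ n])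
  finally show ?case .
qed (use F G A in auto)

text \<open>The first \<open>n * n + 1\<close> powers of \<open>F\<close> are linearly dependent,
  since matrices have only \<open>n * n\<close> entries. Solving a relation for its lowest power, of
  exponent \<open>p\<close>, expresses that power through higher ones; \<open>Q\<close> is the
  resulting polynomial in \<open>F\<close> and therefore commutes with \<open>F\<close>.\<close>

lemma pow_mat_relation:
  fixes F :: "complex mat"
  assumes F: "F \<in> carrier_mat n n"
  shows "\<exists>p Q. Q \<in> carrier_mat n n \<and> F * Q = Q * F \<and> F ^\<^sub>m p = F ^\<^sub>m Suc p * Q"
proof -
  have "\<exists>c. (\<exists>l\<in>{..n*n}. c l \<noteq> 0) \<and>
      (\<forall>ij\<in>{..<n}\<times>{..<n}. (\<Sum>l\<in>{..n*n}. (F ^\<^sub>m l) $$ ij * c l) = 0)"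
    by (rule homogeneous_system_solution[where K = "\<lambda>ij l. (F ^\<^sub>m l) $$ ij"]) auto
  then obtain c l0 where l0: "l0 \<le> n*n" "c l0 \<noteq> 0"
    and c: "\<And>i j. i < n \<Longrightarrow> j < n \<Longrightarrow> (\<Sum>l\<le>n*n. (F ^\<^sub>m l) $$ (i, j) * c l) = 0"
    by force
  define p where "p = (LEAST l. c l \<noteq> 0)"
  have cp: "c p \<noteq> 0" unfolding p_def by (rule LeastI[of _ l0]) (use l0 in auto)
  have small: "c l = 0" if "l < p" for l using not_less_Least[of l "\<lambda>l. c l \<noteq> 0"] that by (auto simp: p_def)
  have pn: "p \<le> n*n" using Least_le[of "\<lambda>l. c l \<noteq> 0" l0] l0 by (auto simp: p_def)
  define a where "a l = - c (Suc p + l) / c p" for l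
  define m where "m = n*n - p"
  define Q where "Q = mat n n (\<lambda>ij. \<Sum>l<m. a l * (F ^\<^sub>m l) $$ ij)"
  have Qc: "Q \<in> carrier_mat n n" by (simp add: Q_def)
  have Fl: "F ^\<^sub>m l \<in> carrier_mat n n" for l using F by simp
  have left: "(A * Q) $$ (i, j) = (\<Sum>l<m. a l * (A * F ^\<^sub>m l) $$ (i, j))"
    if A: "A \<in> carrier_mat n n" and "i < n" "j < n" for A i j
  proof -
    have "(A * Q) $$ (i, j) = (\<Sum>k<n. \<Sum>l<m. A $$ (i, k) * (a l * (F ^\<^sub>m l) $$ (k, j)))"
      unfolding index_mult_mat_sum[OF that(1) Qc that(2,3)] using that by (simp add: Q_def sum_distrib_left)
    also have "\<dots> = (\<Sum>l<m. \<Sum>k<n. A $$ (i, k) * (a l * (F ^\<^sub>m l) $$ (k, j)))" by (rule sum.swap)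
    also have "\<dots> = (\<Sum>l<m. a l * (A * F ^\<^sub>m l) $$ (i, j))"
      unfolding index_mult_mat_sum[OF A Fl that(2,3)] by (simp add: sum_distrib_left mult_ac)
    finally show ?thesis .
  qed
  have right: "(Q * A) $$ (i, j) = (\<Sum>l<m. a l * (F ^\<^sub>m l * A) $$ (i, j))"
    if A: "A \<in> carrier_mat n n" and "i < n" "j < n" for A i j
  proof -
    have "(Q * A) $$ (i, j) = (\<Sum>k<n. \<Sum>l<m. (a l * (F ^\<^sub>m l) $$ (i, k)) * A $$ (k, j))"
      unfolding index_mult_mat_sum[OF Qc that] using that by (simp add: Q_def sum_distrib_right)
    also have "\<dots> = (\<Sum>l<m. \<Sum>k<n. (a l * (F ^\<^sub>m l) $$ (i, k)) * A $$ (k, j))" by (rule sum.swap)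
    also have "\<dots> = (\<Sum>l<m. a l * (F ^\<^sub>m l * A) $$ (i, j))"
      unfolding index_mult_mat_sum[OF Fl that] by (simp add: sum_distrib_left mult_ac)
    finally show ?thesis .
  qed
  have "F * Q = Q * F"
  proof (rule eq_matI)
    fix i j assume "i < dim_row (Q * F)" "j < dim_col (Q * F)"
    then have ij: "i < n" "j < n" using F Qc by auto
    show "(F * Q) $$ (i, j) = (Q * F) $$ (i, j)"
      unfolding left[OF F ij] right[OF F ij] using pow_mat_Suc_left[OF F] by simp
  qed (use F Qc in auto)
  moreover have "F ^\<^sub>m p = F ^\<^sub>m Suc p * Q"
  proof (rule eq_matI)
    fix i j assume "i < dim_row (F ^\<^sub>m Suc p * Q)" "j < dim_col (F ^\<^sub>m Suc p * Q)"
    then have ij: "i < n" "j < n" using F Qc by auto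
    have "0 = (\<Sum>l\<le>n*n. (F ^\<^sub>m l) $$ (i, j) * c l)" using c[OF ij] by simp
    also have "\<dots> = (\<Sum>l\<in>{p..p + m}. (F ^\<^sub>m l) $$ (i, j) * c l)"
      using small pn by (intro sum.mono_neutral_right) (auto simp: m_def not_le)
    also have "\<dots> = (F ^\<^sub>m p) $$ (i, j) * c p + (\<Sum>l\<in>{Suc p..p + m}. (F ^\<^sub>m l) $$ (i, j) * c l)"
      by (rule sum.atLeast_Suc_atMost) simp
    also have "(\<Sum>l\<in>{Suc p..p + m}. (F ^\<^sub>m l) $$ (i, j) * c l) = (\<Sum>l<m. (F ^\<^sub>m (Suc p + l)) $$ (i, j) * c (Suc p + l))"
      by (rule sum.reindex_bij_witness[where i = "\<lambda>l. Suc p + l" and j = "\<lambda>l. l - Suc p"]) auto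
    finally have "(F ^\<^sub>m p) $$ (i, j) = (\<Sum>l<m. (F ^\<^sub>m (Suc p + l)) $$ (i, j) * c (Suc p + l)) * (- 1 / c p)"
      using cp by (simp add: field_simps add_eq_0_iff)
    also have "\<dots> = (\<Sum>l<m. a l * (F ^\<^sub>m (Suc p + l)) $$ (i, j))"
      by (simp add: sum_distrib_right a_def mult_ac sum_negf sum_divide_distrib del: pow_mat.simps)
    also have "\<dots> = (F ^\<^sub>m Suc p * Q) $$ (i, j)"
      unfolding left[OF Fl ij] pow_mat_add[OF F] by simp
    finally show "(F ^\<^sub>m p) $$ (i, j) = (F ^\<^sub>m Suc p * Q) $$ (i, j)" .
  qed (use F Qc in auto)
  ultimately show ?thesis using Qc by blast
qed

text \<open>Iterating the relation between the exponents \<open>p\<close> and \<open>p + 1\<close>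
  shows that the power \<open>q\<close> of \<open>F\<close> is its power \<open>2 q\<close> times
  the power \<open>q\<close> of \<open>Q\<close>. So the latter serves as \<open>L\<close>, and the
  product with it is the Fitting idempotent. All large \<open>q\<close> are allowed because one
  exponent must later serve every vertex.\<close>

lemma group_inverse_of_power:
  fixes F :: "complex mat"
  assumes F: "F \<in> carrier_mat n n"
  shows "\<exists>p. \<forall>q\<ge>p. \<exists>L\<in>carrier_mat n n. F ^\<^sub>m q * L = L * F ^\<^sub>m q \<and> F ^\<^sub>m q = F ^\<^sub>m q * (F ^\<^sub>m q * L)"
proof -
  obtain p Q where Q: "Q \<in> carrier_mat n n" and comm: "F * Q = Q * F" and rel: "F ^\<^sub>m p = F ^\<^sub>m Suc p * Q"
    using pow_mat_relation[OF F] by blast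
  have Fl: "F ^\<^sub>m l \<in> carrier_mat n n" "Q ^\<^sub>m l \<in> carrier_mat n n" for l using F Q by auto
  have "\<exists>L\<in>carrier_mat n n. F ^\<^sub>m q * L = L * F ^\<^sub>m q \<and> F ^\<^sub>m q = F ^\<^sub>m q * (F ^\<^sub>m q * L)" if "p \<le> q" for q
  proof -
    have one: "F ^\<^sub>m l = F ^\<^sub>m Suc l * Q" if "p \<le> l" for l
    proof -
      have "F ^\<^sub>m l = F ^\<^sub>m (l - p) * F ^\<^sub>m p" using that pow_mat_add[OF F, of "l - p" p] by simp
      also have "\<dots> = F ^\<^sub>m (l - p) * F ^\<^sub>m Suc p * Q"
        using rel Fl Q F by (simp add: assoc_mult_mat[of _ n n _ n _ n] del: pow_mat.simps)
      also have "F ^\<^sub>m (l - p) * F ^\<^sub>m Suc p = F ^\<^sub>m Suc l"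
        using that pow_mat_add[OF F, of "l - p" "Suc p"] by (simp del: pow_mat.simps)
      finally show ?thesis .
    qed
    have "F ^\<^sub>m q = F ^\<^sub>m (q + k) * Q ^\<^sub>m k" for k
    proof (induction k)
      case 0 then show ?case using right_mult_one_mat[OF Fl(1)[of q]] Q by simp
    next
      case (Suc k)
      note Suc
      also have "F ^\<^sub>m (q + k) * Q ^\<^sub>m k = F ^\<^sub>m Suc (q + k) * Q * Q ^\<^sub>m k"
        by (rule arg_cong[where f = "\<lambda>A. A * Q ^\<^sub>m k"], rule one) (use that in simp)
      also have "\<dots> = F ^\<^sub>m Suc (q + k) * Q ^\<^sub>m Suc k"
        unfolding pow_mat_Suc_left[OF Q] using Fl Q F by (simp add: assoc_mult_mat[of _ n n _ n _ n] del: pow_mat.simps)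
      finally show ?case by (simp del: pow_mat.simps)
    qed
    from this[of q] have "F ^\<^sub>m q = F ^\<^sub>m q * (F ^\<^sub>m q * Q ^\<^sub>m q)"
      using pow_mat_add[OF F, of q q] assoc_mult_mat[OF Fl(1) Fl(1) Fl(2), of q q q] by simp
    moreover have "F ^\<^sub>m q * Q ^\<^sub>m q = Q ^\<^sub>m q * F ^\<^sub>m q"
      using pow_mat_intertwine[OF F F Fl(2)] pow_mat_intertwine[OF Q Q F comm[symmetric]] by simp
    ultimately show ?thesis using Fl by blast
  qed
  then show ?thesis by blast
qed

text \<open>Factor \<open>F = N * R\<close> with \<open>N\<close> an orthonormal basis of the image,
  of size \<open>r\<close>. Then \<open>R * N\<close> is nilpotent of size \<open>r\<close> and has
  the same trace, and \<open>r < n\<close> because a surjective nilpotent matrix would have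
  invertible powers. Induction on the size finishes.\<close>

lemma mtrace_nilpotent:
  fixes F :: "complex mat"
  shows "F \<in> carrier_mat n n \<Longrightarrow> F ^\<^sub>m q = 0\<^sub>m n n \<Longrightarrow> mtrace F = 0"
proof (induction n arbitrary: F q rule: less_induct)
  case (less n)
  note F = less.prems(1)
  show ?case
  proof (cases "n = 0")
    case True then show ?thesis using F by (simp add: mtrace_def)
  next
    case False
    obtain r N where N: "onb (1\<^sub>m n) n r N (mimg F)" using onb_exists[OF posdef_one csub_mimg[OF F]] by blast
    note Nc = onb_one_projection(1)[OF N]
    define R where "R = adj N * F"
    have R: "R \<in> carrier_mat r n" using Nc F by (auto simp: R_def)
    have FN: "F = N * R" unfolding R_def using onb_one_projection_mat[OF N F] by simp
    have RN: "R * N \<in> carrier_mat r r" using R Nc by auto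
    have NF: "(R * N) ^\<^sub>m k * R = R * F ^\<^sub>m k" for k
      by (rule pow_mat_intertwine[OF RN F R]) (use FN R Nc in \<open>simp add: assoc_mult_mat[of _ r n _ r _ n]\<close>)
    have "(R * N) ^\<^sub>m Suc q = R * F ^\<^sub>m q * N"
      using NF[of q] RN R Nc assoc_mult_mat[of "(R * N) ^\<^sub>m q" r r R n N r] by simp
    then have nil: "(R * N) ^\<^sub>m Suc q = 0\<^sub>m r r" using less.prems(2) R Nc F by simp
    have "r \<noteq> n"
    proof
      assume rn: "r = n"
      have "adj N * N = 1\<^sub>m n" using onb_one_projection(2)[OF N] rn by simp
      then have NN: "N * adj N = 1\<^sub>m n" using mat_mult_left_right_inverse[of "adj N" n N] Nc rn by auto
      have surj: "mimg F = carrier_vec n"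
      proof -
        have "x \<in> mimg N" if "x \<in> carrier_vec n" for x
        proof -
          have "x = N *\<^sub>v (adj N *\<^sub>v x)" using that Nc rn NN by (simp flip: assoc_mult_mat_vec[of _ n n _ n])
          moreover have "adj N *\<^sub>v x \<in> carrier_vec n" using that Nc rn by (auto intro!: mult_mat_vec_carrier)
          ultimately show ?thesis using mimgI[of N n n] Nc rn by metis
        qed
        then show ?thesis using N csubD(1)[OF csub_mimg[OF F]] by (auto simp: onb_def)
      qed
      then obtain G where G: "G \<in> carrier_mat n n" "1\<^sub>m n = F * G"
        using factor_through_mimg[of "1\<^sub>m n" n n F n] F csubD(1)[OF csub_mimg[of "1\<^sub>m n" n n]] by auto
      have "F ^\<^sub>m k * G ^\<^sub>m k = 1\<^sub>m n" for k
      proof (induction k)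
        case (Suc k)
        have "F ^\<^sub>m Suc k * G ^\<^sub>m Suc k = F ^\<^sub>m k * (F * G) * G ^\<^sub>m k"
          unfolding pow_mat_Suc_left[OF G(1)] using F G(1) by (simp add: assoc_mult_mat[of _ n n _ n _ n])
        then show ?case using Suc F right_mult_one_mat[of "F ^\<^sub>m k" n n] unfolding G(2)[symmetric] by simp
      qed (use F G(1) in simp)
      from this[of q] have "0\<^sub>m n n = (1\<^sub>m n :: complex mat)"
        unfolding less.prems(2) using left_mult_zero_mat[of "G ^\<^sub>m q" n n n] G(1) by simp
      then have "(0\<^sub>m n n :: complex mat) $$ (0, 0) = 1\<^sub>m n $$ (0, 0)" by simp
      then show False using False by simp
    qed
    moreover have "r \<le> n" using onb_dim_le[OF N] by simp
    moreover have "mtrace F = mtrace (R * N)" unfolding FN by (rule mtrace_comm[OF Nc R])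
    ultimately show ?thesis using less.IH[of r "R * N" "Suc q"] RN nil by simp
  qed
qed

text \<open>The trace of an idempotent is its rank: factoring \<open>e = N * R\<close> through an
  orthonormal basis \<open>N\<close> of the image gives \<open>R * N = 1\<close>.\<close>

lemma mtrace_idempotent_eq_0:
  assumes e: "e \<in> carrier_mat n n" "e * e = e" and "mtrace e = 0"
  shows "e = 0\<^sub>m n n"
proof -
  obtain r N where N: "onb (1\<^sub>m n) n r N (mimg e)" using onb_exists[OF posdef_one csub_mimg[OF e(1)]] by blast
  note Nc = onb_one_projection(1)[OF N]
  define R where "R = adj N * e"
  have R: "R \<in> carrier_mat r n" using Nc e by (auto simp: R_def)
  have eN: "e = N * R" unfolding R_def using onb_one_projection_mat[OF N e(1)] by simp
  obtain C where C: "C \<in> carrier_mat n r" "N = e * C"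
    using factor_through_mimg[OF Nc e(1)] N by (auto simp: onb_def)
  have "e * N = N" using C e assoc_mult_mat[OF e(1) e(1) C(1)] by simp
  then have "R * N = 1\<^sub>m r"
    unfolding R_def using Nc e(1) onb_one_projection(2)[OF N] by (simp add: assoc_mult_mat[of _ r n _ n _ r])
  then have "mtrace e = of_nat r" unfolding eN mtrace_comm[OF Nc R] by (simp add: mtrace_def)
  with assms have "r = 0" by simp
  then show ?thesis unfolding eN using Nc R by (intro eq_matI) (auto simp: scalar_prod_def)
qed

section \<open>Rigid indecomposable representations are bricks\<close>

text \<open>Side conditions are equations between dimensions instead of carrier memberships, so that
  rewriting can reassociate long products once the dimensions of the factors are known.\<close>

lemma mult_assoc_dim:
  fixes A :: "complex mat"
  shows "dim_col A = dim_row B \<Longrightarrow> dim_col B = dim_row C \<Longrightarrow> A * B * C = A * (B * C)"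
  by (rule assoc_mult_mat[of _ "dim_row A" "dim_row B" _ "dim_row C" _ "dim_col C"]) auto

lemma mult_minus_distrib_dim:
  fixes A :: "complex mat"
  shows "dim_col A = dim_row B \<Longrightarrow> dim_row C = dim_row B \<Longrightarrow> dim_col C = dim_col B \<Longrightarrow>
    A * (B - C) = A * B - A * C"
  by (rule mult_minus_distrib_mat[of _ "dim_row A" "dim_row B" _ "dim_col B"]) auto

lemma minus_mult_distrib_dim:
  fixes A :: "complex mat"
  shows "dim_col A = dim_row C \<Longrightarrow> dim_row B = dim_row A \<Longrightarrow> dim_col B = dim_col A \<Longrightarrow>
    (A - B) * C = A * C - B * C"
  by (rule minus_mult_distrib_mat[of _ "dim_row A" "dim_col A" _ _ "dim_col C"]) auto

lemma sum_delta_mult: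
  fixes f :: "nat \<Rightarrow> complex"
  shows "(\<Sum>l<n. (if l = a then 1 else 0) * f l) = (if a < n then f a else 0)"
    "(\<Sum>l<n. (if a = l then 1 else 0) * f l) = (if a < n then f a else 0)"
  by (simp_all add: if_distrib[of "\<lambda>x. x * _"] cong: if_cong)

section \<open>Rigidity as solvability of commutator equations on the arrows\<close>

definition fst_incl :: "nat \<Rightarrow> complex mat" where
  "fst_incl n = mat (n + n) n (\<lambda>(r, c). if r = c then 1 else 0)"

definition snd_proj :: "nat \<Rightarrow> complex mat" where
  "snd_proj n = mat n (n + n) (\<lambda>(r, c). if c = n + r then 1 else 0)"

lemma fst_incl_eq: "fst_incl n = 1\<^sub>m n @\<^sub>r 0\<^sub>m n n"
  by (rule eq_matI) (auto simp: fst_incl_def append_rows_def)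

lemma snd_proj_eq: "snd_proj n = transpose_mat (0\<^sub>m n n @\<^sub>r 1\<^sub>m n)"
  by (rule eq_matI) (auto simp: snd_proj_def append_rows_def)

lemma mult_fst_incl: "M \<in> carrier_mat m (n + n) \<Longrightarrow> r < m \<Longrightarrow> c < n \<Longrightarrow> (M * fst_incl n) $$ (r, c) = M $$ (r, c)"
  by (subst index_mult_mat_sum[of _ m "n + n" _ n]) (auto simp: fst_incl_def if_distrib sum.delta cong: if_cong)

lemma fst_incl_mult: "M \<in> carrier_mat n k \<Longrightarrow> r < n + n \<Longrightarrow> c < k \<Longrightarrow>
    (fst_incl n * M) $$ (r, c) = (if r < n then M $$ (r, c) else 0)"
  by (subst index_mult_mat_sum[of _ "n + n" n _ k]) (auto simp: fst_incl_def sum_delta_mult)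

lemma snd_proj_mult: "M \<in> carrier_mat (n + n) k \<Longrightarrow> r < n \<Longrightarrow> c < k \<Longrightarrow>
    (snd_proj n * M) $$ (r, c) = M $$ (n + r, c)"
  by (subst index_mult_mat_sum[of _ n "n + n" _ k]) (auto simp: snd_proj_def sum_delta_mult)

lemma mult_snd_proj:
  assumes "M \<in> carrier_mat k n" "r < k" "c < n + n"
  shows "(M * snd_proj n) $$ (r, c) = (if c < n then 0 else M $$ (r, c - n))"
proof -
  have "(M * snd_proj n) $$ (r, c) = (\<Sum>l<n. if c = n + l then M $$ (r, l) else 0)"
    using assms by (subst index_mult_mat_sum[of _ k n _ "n + n"]) (auto simp: snd_proj_def intro!: sum.cong)
  also have "\<dots> = (\<Sum>l<n. if c - n = l then (if c < n then 0 else M $$ (r, l)) else 0)"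
    by (rule sum.cong) auto
  also have "\<dots> = (if c < n then 0 else M $$ (r, c - n))"
    using assms by (cases "c < n") auto
  finally show ?thesis .
qed

text \<open>A family \<open>C\<close> on the arrows is the off-diagonal block of a self-extension of
  \<open>X\<close>. Rigidity makes this extension equivalent to the split one; the equivalence is
  unitriangular, and its off-diagonal block solves the equation. In effect, Ext(X, X) is the
  cokernel of the commutator map.\<close>

lemma rigid_rep_surjective:
  assumes Q: "wf_digraph Q" and X: "is_rep Q X" and rigid: "rigid_rep Q X"
    and C: "\<And>a. a \<in> arcs Q \<Longrightarrow> C a \<in> carrier_mat (rdim X (head Q a)) (rdim X (tail Q a))"
  shows "\<exists>\<phi>. (\<forall>v\<in>verts Q. \<phi> v \<in> carrier_mat (rdim X v) (rdim X v)) \<and>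
    (\<forall>a\<in>arcs Q. \<phi> (head Q a) * rmap X a - rmap X a * \<phi> (tail Q a) = C a)"
proof -
  interpret wf_digraph Q by (fact Q)
  have XA: "rmap X a \<in> carrier_mat (rdim X (head Q a)) (rdim X (tail Q a))" if "a \<in> arcs Q" for a
    using X that by (auto simp: is_rep_def)
  define i where "i v = fst_incl (rdim X v)" for v
  define p where "p v = snd_proj (rdim X v)" for v
  have ic: "i v \<in> carrier_mat (rdim X v + rdim X v) (rdim X v)"
    and pc: "p v \<in> carrier_mat (rdim X v) (rdim X v + rdim X v)" for v
    by (auto simp: i_def p_def fst_incl_def snd_proj_def)
  define E where "E = \<lparr>rdim = (\<lambda>v. rdim X v + rdim X v),
    rmap = (\<lambda>a. four_block_mat (rmap X a) (C a) (0\<^sub>m (dim_row (rmap X a)) (dim_col (rmap X a))) (rmap X a))\<rparr>"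
  have split: "split_ext X X = (direct_sum_rep X X, i, p)"
    by (auto simp: split_ext_def fun_eq_iff i_def p_def fst_incl_eq snd_proj_eq)
  have mem: "(direct_sum_rep X X, i, p) \<in> extensions Q X X"
    using split_ext_in_extensions[OF Q X X] unfolding split .
  have rE: "rmap E a = four_block_mat (rmap X a) (C a)
      (0\<^sub>m (rdim X (head Q a)) (rdim X (tail Q a))) (rmap X a)" if "a \<in> arcs Q" for a
    using XA[OF that] by (simp add: E_def)
  have rEc: "rmap E a \<in> carrier_mat (rdim X (head Q a) + rdim X (head Q a)) (rdim X (tail Q a) + rdim X (tail Q a))"
    if "a \<in> arcs Q" for a unfolding rE[OF that] using XA[OF that] by auto
  have dE: "rdim E v = rdim X v + rdim X v" for v by (simp add: E_def)
  have repE: "is_rep Q E" using rEc by (auto simp: is_rep_def dE)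
  have homi: "rep_hom Q X E i" unfolding rep_hom_def
  proof (intro conjI ballI)
    fix a assume a: "a \<in> arcs Q"
    show "i (head Q a) * rmap X a = rmap E a * i (tail Q a)"
    proof (rule eq_matI)
      fix r c assume "r < dim_row (rmap E a * i (tail Q a))" "c < dim_col (rmap E a * i (tail Q a))"
      then have rc: "r < rdim X (head Q a) + rdim X (head Q a)" "c < rdim X (tail Q a)"
        using rEc[OF a] ic[of "tail Q a"] by auto
      show "(i (head Q a) * rmap X a) $$ (r, c) = (rmap E a * i (tail Q a)) $$ (r, c)"
        unfolding i_def fst_incl_mult[OF XA[OF a] rc] mult_fst_incl[OF rEc[OF a] rc]
        using rc XA[OF a] by (simp add: rE[OF a])
    qed (use rEc[OF a] XA[OF a] ic[of "tail Q a"] ic[of "head Q a"] in auto)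
  qed (use ic in \<open>auto simp: dE\<close>)
  have homp: "rep_hom Q E X p" unfolding rep_hom_def
  proof (intro conjI ballI)
    fix a assume a: "a \<in> arcs Q"
    show "p (head Q a) * rmap E a = rmap X a * p (tail Q a)"
    proof (rule eq_matI)
      fix r c assume "r < dim_row (rmap X a * p (tail Q a))" "c < dim_col (rmap X a * p (tail Q a))"
      then have rc: "r < rdim X (head Q a)" "c < rdim X (tail Q a) + rdim X (tail Q a)"
        using XA[OF a] pc[of "tail Q a"] by auto
      show "(p (head Q a) * rmap E a) $$ (r, c) = (rmap X a * p (tail Q a)) $$ (r, c)"
        unfolding p_def snd_proj_mult[OF rEc[OF a] rc] mult_snd_proj[OF XA[OF a] rc]
        using rc XA[OF a] by (simp add: rE[OF a])
    qed (use rEc[OF a] XA[OF a] pc[of "tail Q a"] pc[of "head Q a"] in auto)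
  qed (use pc in \<open>auto simp: dE\<close>)
  have memE: "(E, i, p) \<in> extensions Q X X"
    using mem homi homp repE dE by (auto simp: extensions_def direct_sum_rep_def)
  have refl: "((E, i, p), (E, i, p)) \<in> ext_equiv Q X X"
  proof -
    have "rep_iso Q E E (\<lambda>v. 1\<^sub>m (rdim E v))"
      unfolding rep_iso_def rep_hom_def
    proof (intro conjI ballI)
      fix a assume a: "a \<in> arcs Q"
      show "1\<^sub>m (rdim E (head Q a)) * rmap E a = rmap E a * 1\<^sub>m (rdim E (tail Q a))"
        using rEc[OF a] dE by simp
    next
      fix v
      show "invertible_mat (1\<^sub>m (rdim E v) :: complex mat)"
        unfolding invertible_mat_def inverts_mat_def by (auto intro!: exI[of _ "1\<^sub>m (rdim E v)"])
    qed auto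
    moreover have "1\<^sub>m (rdim E v) * i v = i v \<and> p v * 1\<^sub>m (rdim E v) = p v" for v
      using ic[of v] pc[of v] dE by simp
    ultimately show ?thesis using memE by (auto simp: ext_equiv_def)
  qed
  have "ext_equiv Q X X `` {(E, i, p)} \<in> Ext Q X X"
    unfolding Ext_def by (rule quotientI[OF memE])
  then have "ext_equiv Q X X `` {(E, i, p)} = zero_Ext Q X X" using rigid by (auto simp: rigid_rep_def)
  \<comment> \<open>The class of the new extension contains that extension, so equality with the
    class of the split one yields the equivalence \<theta>.\<close>
  then have "(split_ext X X, (E, i, p)) \<in> ext_equiv Q X X" using refl by (auto simp: zero_Ext_def)
  then obtain \<theta> where iso: "rep_iso Q (direct_sum_rep X X) E \<theta>"
    and \<theta>i: "\<And>v. v \<in> verts Q \<Longrightarrow> \<theta> v * i v = i v" and p\<theta>: "\<And>v. v \<in> verts Q \<Longrightarrow> p v * \<theta> v = p v"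
    unfolding split ext_equiv_def by auto
  \<comment> \<open>The upper right block of \<theta>; compatibility with \<open>i\<close> and
    \<open>p\<close> fixes the other three blocks.\<close>
  define s where "s v = mat (rdim X v) (rdim X v) (\<lambda>(r, c). \<theta> v $$ (r, rdim X v + c))" for v
  have sc: "s v \<in> carrier_mat (rdim X v) (rdim X v)" for v by (simp add: s_def)
  have \<theta>c: "\<theta> v \<in> carrier_mat (rdim X v + rdim X v) (rdim X v + rdim X v)" if "v \<in> verts Q" for v
    using iso that dE by (auto simp: rep_iso_def rep_hom_def direct_sum_rep_def)
  have \<theta>_block: "\<theta> v = four_block_mat (1\<^sub>m (rdim X v)) (s v) (0\<^sub>m (rdim X v) (rdim X v)) (1\<^sub>m (rdim X v))"
    if v: "v \<in> verts Q" for v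
  proof (rule eq_matI)
    let ?n = "rdim X v"
    fix r c assume "r < dim_row (four_block_mat (1\<^sub>m ?n) (s v) (0\<^sub>m ?n ?n) (1\<^sub>m ?n))"
      "c < dim_col (four_block_mat (1\<^sub>m ?n) (s v) (0\<^sub>m ?n ?n) (1\<^sub>m ?n))"
    then have rc: "r < ?n + ?n" "c < ?n + ?n" by auto
    show "\<theta> v $$ (r, c) = four_block_mat (1\<^sub>m ?n) (s v) (0\<^sub>m ?n ?n) (1\<^sub>m ?n) $$ (r, c)"
    proof (cases "c < ?n")
      case True
      have "\<theta> v $$ (r, c) = (\<theta> v * fst_incl ?n) $$ (r, c)" by (rule mult_fst_incl[OF \<theta>c[OF v] rc(1) True, symmetric])
      also have "\<dots> = fst_incl ?n $$ (r, c)" using \<theta>i[OF v] by (simp add: i_def)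
      finally show ?thesis using rc True by (auto simp: fst_incl_def)
    next
      case c: False
      show ?thesis
      proof (cases "r < ?n")
        case True then show ?thesis using rc c by (auto simp: s_def)
      next
        case False
        have "\<theta> v $$ (?n + (r - ?n), c) = (snd_proj ?n * \<theta> v) $$ (r - ?n, c)"
          by (rule snd_proj_mult[OF \<theta>c[OF v] _ rc(2), symmetric]) (use rc False in auto)
        also have "\<dots> = snd_proj ?n $$ (r - ?n, c)" using p\<theta>[OF v] by (simp add: p_def)
        finally show ?thesis using rc False c by (auto simp: snd_proj_def)
      qed
    qed
  qed (use \<theta>c[OF v] in auto)
  have "s (head Q a) * rmap X a - rmap X a * s (tail Q a) = C a" if a: "a \<in> arcs Q" for a
  proof (rule eq_matI)
    let ?h = "head Q a" and ?t = "tail Q a"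
    let ?m = "rdim X (head Q a)" and ?n = "rdim X (tail Q a)"
    have vs: "?h \<in> verts Q" "?t \<in> verts Q" using a by auto
    note Xa = XA[OF a] and Ca = C[OF a]
    have "\<theta> ?h * rmap (direct_sum_rep X X) a = rmap E a * \<theta> ?t"
      using iso a by (auto simp: rep_iso_def rep_hom_def)
    moreover have "rmap (direct_sum_rep X X) a = four_block_mat (rmap X a) (0\<^sub>m ?m ?n) (0\<^sub>m ?m ?n) (rmap X a)"
      using Xa by (simp add: direct_sum_rep_def)
    moreover have "\<theta> ?h * four_block_mat (rmap X a) (0\<^sub>m ?m ?n) (0\<^sub>m ?m ?n) (rmap X a) =
      four_block_mat (rmap X a) (s ?h * rmap X a) (0\<^sub>m ?m ?n) (rmap X a)"
      unfolding \<theta>_block[OF vs(1)]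
      by (subst mult_four_block_mat[OF one_carrier_mat sc zero_carrier_mat one_carrier_mat Xa zero_carrier_mat
            zero_carrier_mat Xa]) (use Xa sc[of ?h] in simp)
    moreover have "rmap E a * \<theta> ?t = four_block_mat (rmap X a) (rmap X a * s ?t + C a) (0\<^sub>m ?m ?n) (rmap X a)"
      unfolding \<theta>_block[OF vs(2)] rE[OF a]
      by (subst mult_four_block_mat[OF Xa Ca zero_carrier_mat Xa one_carrier_mat sc zero_carrier_mat one_carrier_mat])
         (use Xa Ca sc[of ?t] in simp)
    ultimately have eq: "four_block_mat (rmap X a) (s ?h * rmap X a) (0\<^sub>m ?m ?n) (rmap X a) =
      four_block_mat (rmap X a) (rmap X a * s ?t + C a) (0\<^sub>m ?m ?n) (rmap X a)" by simp
    fix r c assume "r < dim_row (C a)" "c < dim_col (C a)"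
    then have rc: "r < ?m" "c < ?n" using Ca by auto
    have "four_block_mat (rmap X a) (s ?h * rmap X a) (0\<^sub>m ?m ?n) (rmap X a) $$ (r, ?n + c) = (s ?h * rmap X a) $$ (r, c)"
      using rc Xa sc[of ?h] by (simp del: index_mult_mat)
    moreover have "four_block_mat (rmap X a) (rmap X a * s ?t + C a) (0\<^sub>m ?m ?n) (rmap X a) $$ (r, ?n + c)
       = (rmap X a * s ?t) $$ (r, c) + C a $$ (r, c)"
      using rc Xa sc[of ?t] Ca by (simp del: index_mult_mat(1))
    ultimately have "(s ?h * rmap X a) $$ (r, c) = (rmap X a * s ?t) $$ (r, c) + C a $$ (r, c)"
      using eq by simp
    then show "(s ?h * rmap X a - rmap X a * s ?t) $$ (r, c) = C a $$ (r, c)"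
      using rc Xa sc[of ?t] sc[of ?h] by (simp del: index_mult_mat(1))
  qed (use XA[OF a] C[OF a] sc in auto)
  then show ?thesis using sc by blast
qed

section \<open>Idempotent endomorphisms of indecomposable representations\<close>

lemma block_col_mult:
  fixes A :: "complex mat"
  assumes "A \<in> carrier_mat k n" "B \<in> carrier_mat l n" "M \<in> carrier_mat n m"
  shows "(A @\<^sub>r B) * M = (A * M) @\<^sub>r (B * M)"
proof -
  have "M = four_block_mat M (0\<^sub>m n 0) (0\<^sub>m 0 m) (0\<^sub>m 0 0)" using assms by (intro eq_matI) auto
  then have "(A @\<^sub>r B) * M = four_block_mat A (0\<^sub>m k 0) B (0\<^sub>m l 0) * four_block_mat M (0\<^sub>m n 0) (0\<^sub>m 0 m) (0\<^sub>m 0 0)"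
    using assms by (simp add: append_rows_def)
  also have "\<dots> = (A * M) @\<^sub>r (B * M)"
    by (subst mult_four_block_mat[OF assms(1) zero_carrier_mat assms(2) zero_carrier_mat assms(3)
          zero_carrier_mat zero_carrier_mat zero_carrier_mat]) (use assms in \<open>simp add: append_rows_def\<close>)
  finally show ?thesis .
qed

lemma block_row_mult_col:
  fixes A :: "complex mat"
  assumes "A \<in> carrier_mat k n" "B \<in> carrier_mat l n" "N \<in> carrier_mat m k" "K \<in> carrier_mat m l"
  shows "four_block_mat N K (0\<^sub>m 0 k) (0\<^sub>m 0 l) * (A @\<^sub>r B) = N * A + K * B"
proof -
  have "four_block_mat N K (0\<^sub>m 0 k) (0\<^sub>m 0 l) * (A @\<^sub>r B) =
    four_block_mat (N * A + K * B) (0\<^sub>m m 0) (0\<^sub>m 0 n) (0\<^sub>m 0 0)"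
    using assms unfolding append_rows_def
    by (simp, subst mult_four_block_mat[OF assms(3,4) zero_carrier_mat zero_carrier_mat assms(1)
          zero_carrier_mat assms(2) zero_carrier_mat]) simp
  also have "\<dots> = N * A + K * B" using assms by (intro eq_matI) auto
  finally show ?thesis .
qed

lemma block_col_mult_row:
  fixes A :: "complex mat"
  assumes "A \<in> carrier_mat k n" "B \<in> carrier_mat l n" "N \<in> carrier_mat n k'" "K \<in> carrier_mat n l'"
  shows "(A @\<^sub>r B) * four_block_mat N K (0\<^sub>m 0 k') (0\<^sub>m 0 l') = four_block_mat (A * N) (A * K) (B * N) (B * K)"
  using assms unfolding append_rows_def
  by (simp, subst mult_four_block_mat[OF assms(1) zero_carrier_mat assms(2) zero_carrier_mat assms(3,4)
        zero_carrier_mat zero_carrier_mat]) simp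

lemma block_diag_mult_col:
  fixes A :: "complex mat"
  assumes "Y \<in> carrier_mat k' k" "Z \<in> carrier_mat l' l" "A \<in> carrier_mat k n" "B \<in> carrier_mat l n"
  shows "four_block_mat Y (0\<^sub>m k' l) (0\<^sub>m l' k) Z * (A @\<^sub>r B) = (Y * A) @\<^sub>r (Z * B)"
  using assms unfolding append_rows_def
  by (simp, subst mult_four_block_mat[OF assms(1) zero_carrier_mat zero_carrier_mat assms(2,3)
        zero_carrier_mat assms(4) zero_carrier_mat]) simp

lemma idempotent_mult_onb:
  assumes e: "e \<in> carrier_mat n n" "e * e = e" and N: "onb (1\<^sub>m n) n k N (mimg e)"
  shows "e * N = N"
proof -
  obtain C where "C \<in> carrier_mat n k" "N = e * C"
    using factor_through_mimg[of N n k e n] N e by (auto simp: onb_def)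
  then show ?thesis using e by (metis assoc_mult_mat)
qed

text \<open>The images of \<open>e\<close> and \<open>f = 1 - e\<close> are complementary
  subrepresentations. Orthonormal bases \<open>N\<close> and \<open>K\<close> of them at each vertex
  give coordinates: \<phi> stacks the two coordinate maps, and \<psi>, the juxtaposed bases, is its
  inverse. Indecomposability makes one summand vanish.\<close>

lemma indecomposable_idempotent:
  assumes Q: "wf_digraph Q" and X: "is_rep Q X" and ind: "indecomposable_rep Q X"
    and e: "rep_hom Q X X e" and idem: "\<And>v. v \<in> verts Q \<Longrightarrow> e v * e v = e v"
  shows "(\<forall>v\<in>verts Q. e v = 0\<^sub>m (rdim X v) (rdim X v)) \<or> (\<forall>v\<in>verts Q. e v = 1\<^sub>m (rdim X v))"
proof -
  interpret wf_digraph Q by (fact Q)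
  have XA: "rmap X a \<in> carrier_mat (rdim X (head Q a)) (rdim X (tail Q a))" if "a \<in> arcs Q" for a
    using X that by (auto simp: is_rep_def)
  have ec: "e v \<in> carrier_mat (rdim X v) (rdim X v)" if "v \<in> verts Q" for v
    using e that by (auto simp: rep_hom_def)
  define f where "f v = 1\<^sub>m (rdim X v) - e v" for v
  have fc: "f v \<in> carrier_mat (rdim X v) (rdim X v)" if "v \<in> verts Q" for v
    using ec[OF that] by (auto simp: f_def intro: minus_carrier_mat)
  have ef: "e v * f v = 0\<^sub>m (rdim X v) (rdim X v)" "f v * e v = 0\<^sub>m (rdim X v) (rdim X v)"
    "f v * f v = f v" if v: "v \<in> verts Q" for v
    using ec[OF v] idem[OF v] by (auto simp: f_def mult_minus_distrib_dim minus_mult_distrib_dim)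
  have efX: "e (head Q a) * rmap X a = rmap X a * e (tail Q a)"
     "f (head Q a) * rmap X a = rmap X a * f (tail Q a)" if a: "a \<in> arcs Q" for a
  proof -
    show 1: "e (head Q a) * rmap X a = rmap X a * e (tail Q a)" using e a by (simp add: rep_hom_def)
    show "f (head Q a) * rmap X a = rmap X a * f (tail Q a)"
      using 1 ec[OF head_in_verts[OF a]] ec[OF tail_in_verts[OF a]] XA[OF a]
      by (simp add: f_def mult_minus_distrib_dim minus_mult_distrib_dim)
  qed
  have "\<exists>k N. v \<in> verts Q \<longrightarrow> onb (1\<^sub>m (rdim X v)) (rdim X v) k N (mimg (e v))" for v
    using onb_exists[OF posdef_one csub_mimg[OF ec]] by blast
  then obtain r N where N: "\<And>v. v \<in> verts Q \<Longrightarrow> onb (1\<^sub>m (rdim X v)) (rdim X v) (r v) (N v) (mimg (e v))"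
    by metis
  have "\<exists>k N. v \<in> verts Q \<longrightarrow> onb (1\<^sub>m (rdim X v)) (rdim X v) k N (mimg (f v))" for v
    using onb_exists[OF posdef_one csub_mimg[OF fc]] by blast
  then obtain s K where K: "\<And>v. v \<in> verts Q \<Longrightarrow> onb (1\<^sub>m (rdim X v)) (rdim X v) (s v) (K v) (mimg (f v))"
    by metis
  note Nc = onb_one_projection(1,2)[OF N] and Kc = onb_one_projection(1,2)[OF K]
  have eN: "e v * N v = N v" "f v * N v = 0\<^sub>m (rdim X v) (r v)"
    "f v * K v = K v" "e v * K v = 0\<^sub>m (rdim X v) (s v)" if v: "v \<in> verts Q" for v
  proof -
    show 1: "e v * N v = N v" by (rule idempotent_mult_onb[OF ec[OF v] idem[OF v] N[OF v]])
    show 2: "f v * K v = K v" by (rule idempotent_mult_onb[OF fc[OF v] ef(3)[OF v] K[OF v]])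
    have "f v * (e v * N v) = 0\<^sub>m (rdim X v) (r v)"
      using ef(2)[OF v] ec[OF v] fc[OF v] Nc[OF v] by (simp flip: mult_assoc_dim)
    then show "f v * N v = 0\<^sub>m (rdim X v) (r v)" using 1 by simp
    have "e v * (f v * K v) = 0\<^sub>m (rdim X v) (s v)"
      using ef(1)[OF v] ec[OF v] fc[OF v] Kc[OF v] by (simp flip: mult_assoc_dim)
    then show "e v * K v = 0\<^sub>m (rdim X v) (s v)" using 2 by simp
  qed
  have NNe: "N v * (adj (N v) * e v) = e v" "K v * (adj (K v) * f v) = f v" if v: "v \<in> verts Q" for v
    using onb_one_projection_mat[OF N[OF v] ec[OF v]] onb_one_projection_mat[OF K[OF v] fc[OF v]] by auto
  define Y where "Y = \<lparr>rdim = r, rmap = (\<lambda>a. adj (N (head Q a)) * (rmap X a * N (tail Q a)))\<rparr>"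
  define Z where "Z = \<lparr>rdim = s, rmap = (\<lambda>a. adj (K (head Q a)) * (rmap X a * K (tail Q a)))\<rparr>"
  define \<phi> where "\<phi> v = (adj (N v) * e v) @\<^sub>r (adj (K v) * f v)" for v
  define \<psi> where "\<psi> v = four_block_mat (N v) (K v) (0\<^sub>m 0 (r v)) (0\<^sub>m 0 (s v))" for v
  have repY: "is_rep Q Y" and repZ: "is_rep Q Z"
    unfolding is_rep_def
  proof (safe)
    fix a assume a: "a \<in> arcs Q"
    note v = head_in_verts[OF a] tail_in_verts[OF a]
    show "rmap Y a \<in> carrier_mat (rdim Y (head Q a)) (rdim Y (tail Q a))"
      "rmap Z a \<in> carrier_mat (rdim Z (head Q a)) (rdim Z (tail Q a))"
      using XA[OF a] Nc(1)[OF v(1)] Nc(1)[OF v(2)] Kc(1)[OF v(1)] Kc(1)[OF v(2)] by (auto simp: Y_def Z_def)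
  qed
  have blk: "adj (N v) * e v \<in> carrier_mat (r v) (rdim X v)" "adj (K v) * f v \<in> carrier_mat (s v) (rdim X v)"
    if v: "v \<in> verts Q" for v using Nc(1)[OF v] Kc(1)[OF v] ec[OF v] fc[OF v] by auto
  have \<phi>c: "\<phi> v \<in> carrier_mat (r v + s v) (rdim X v)" and \<psi>c: "\<psi> v \<in> carrier_mat (rdim X v) (r v + s v)"
    if v: "v \<in> verts Q" for v
    using Nc(1)[OF v] Kc(1)[OF v] blk[OF v] by (auto simp: \<psi>_def \<phi>_def)
  have \<phi>\<psi>: "\<phi> v * \<psi> v = 1\<^sub>m (r v + s v)" if v: "v \<in> verts Q" for v
  proof -
    have "\<phi> v * \<psi> v = four_block_mat (1\<^sub>m (r v)) (0\<^sub>m (r v) (s v)) (0\<^sub>m (s v) (r v)) (1\<^sub>m (s v))"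
      unfolding \<phi>_def \<psi>_def block_col_mult_row[OF blk[OF v] Nc(1)[OF v] Kc(1)[OF v]]
      using Nc[OF v] Kc[OF v] ec[OF v] fc[OF v] eN[OF v] by (simp add: mult_assoc_dim)
    also have "\<dots> = 1\<^sub>m (r v + s v)" by (rule eq_matI) auto
    finally show ?thesis .
  qed
  have \<psi>\<phi>: "\<psi> v * \<phi> v = 1\<^sub>m (rdim X v)" if v: "v \<in> verts Q" for v
    unfolding \<phi>_def \<psi>_def block_row_mult_col[OF blk[OF v] Nc(1)[OF v] Kc(1)[OF v]] NNe[OF v]
    using ec[OF v] unfolding f_def by (intro eq_matI) auto
  \<comment> \<open>\<open>invertible_mat\<close> asks for a square matrix, whereas \<phi> has a
    priori \<open>r v + s v\<close> rows and \<open>rdim X v\<close> columns.\<close>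
  have rs: "r v + s v = rdim X v" if v: "v \<in> verts Q" for v
    using left_invertible_dim_le[OF \<psi>c[OF v] \<phi>c[OF v] \<phi>\<psi>[OF v]]
      left_invertible_dim_le[OF \<phi>c[OF v] \<psi>c[OF v] \<psi>\<phi>[OF v]] by simp
  have "rep_iso Q X (direct_sum_rep Y Z) \<phi>"
    unfolding rep_iso_def rep_hom_def
  proof (intro conjI ballI)
    fix v assume v: "v \<in> verts Q"
    show "\<phi> v \<in> carrier_mat (rdim (direct_sum_rep Y Z) v) (rdim X v)"
      using \<phi>c[OF v] by (simp add: direct_sum_rep_def Y_def Z_def)
    show "invertible_mat (\<phi> v)"
      unfolding invertible_mat_def inverts_mat_def
      using \<phi>c[OF v] \<psi>c[OF v] \<phi>\<psi>[OF v] \<psi>\<phi>[OF v] rs[OF v] by (intro conjI exI[of _ "\<psi> v"]) auto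
  next
    fix a assume a: "a \<in> arcs Q"
    let ?h = "head Q a" and ?t = "tail Q a"
    have v: "?h \<in> verts Q" "?t \<in> verts Q" using a by auto
    note c = XA[OF a] Nc(1)[OF v(1)] Nc(1)[OF v(2)] Kc(1)[OF v(1)] Kc(1)[OF v(2)] ec[OF v(1)] ec[OF v(2)] fc[OF v(1)] fc[OF v(2)]
    have Yc: "rmap Y a \<in> carrier_mat (r ?h) (r ?t)" and Zc: "rmap Z a \<in> carrier_mat (s ?h) (s ?t)"
      using repY repZ a by (auto simp: is_rep_def Y_def Z_def)
    have 1: "rmap Y a * (adj (N ?t) * e ?t) = adj (N ?h) * e ?h * rmap X a"
      using c NNe(1)[OF v(2)] efX(1)[OF a] by (simp add: Y_def mult_assoc_dim)
    have 2: "rmap Z a * (adj (K ?t) * f ?t) = adj (K ?h) * f ?h * rmap X a"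
      using c NNe(2)[OF v(2)] efX(2)[OF a] by (simp add: Z_def mult_assoc_dim)
    have "rmap (direct_sum_rep Y Z) a = four_block_mat (rmap Y a) (0\<^sub>m (r ?h) (s ?t)) (0\<^sub>m (s ?h) (r ?t)) (rmap Z a)"
      using Yc Zc by (simp add: direct_sum_rep_def)
    then have "rmap (direct_sum_rep Y Z) a * \<phi> ?t = (rmap Y a * (adj (N ?t) * e ?t)) @\<^sub>r (rmap Z a * (adj (K ?t) * f ?t))"
      unfolding \<phi>_def by (simp only: block_diag_mult_col[OF Yc Zc blk[OF v(2)]])
    also have "\<dots> = \<phi> ?h * rmap X a" unfolding \<phi>_def block_col_mult[OF blk[OF v(1)] XA[OF a]] 1 2 ..
    finally show "\<phi> ?h * rmap X a = rmap (direct_sum_rep Y Z) a * \<phi> ?t" by simp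
  qed
  then have "zero_rep Q Y \<or> zero_rep Q Z" using ind repY repZ unfolding indecomposable_rep_def by blast
  then show ?thesis
  proof
    assume "zero_rep Q Y"
    then have r0: "r v = 0" if "v \<in> verts Q" for v using that by (simp add: zero_rep_def Y_def)
    have "e v = 0\<^sub>m (rdim X v) (rdim X v)" if v: "v \<in> verts Q" for v
    proof -
      have "e v $$ (i, j) = 0" if "i < rdim X v" "j < rdim X v" for i j
        using index_mult_mat_sum[of "N v" "rdim X v" 0 "adj (N v) * e v" "rdim X v" i j] that
          NNe(1)[OF v] Nc(1)[OF v] blk(1)[OF v] r0[OF v] by simp
      then show ?thesis using ec[OF v] by (intro eq_matI) auto
    qed
    then show ?thesis by blast
  next
    assume "zero_rep Q Z"
    then have s0: "s v = 0" if "v \<in> verts Q" for v using that by (simp add: zero_rep_def Z_def)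
    have "e v = 1\<^sub>m (rdim X v)" if v: "v \<in> verts Q" for v
    proof -
      have "f v $$ (i, j) = 0" if "i < rdim X v" "j < rdim X v" for i j
        using index_mult_mat_sum[of "K v" "rdim X v" 0 "adj (K v) * f v" "rdim X v" i j] that
          NNe(2)[OF v] Kc(1)[OF v] blk(2)[OF v] s0[OF v] by simp
      then show ?thesis using ec[OF v] by (intro eq_matI) (auto simp: f_def)
    qed
    then show ?thesis by blast
  qed
qed


text \<open>Fitting's lemma at all vertices with one exponent: the idempotents \<open>e v\<close>
  attached to a high power of \<open>F\<close> form an endomorphism of \<open>X\<close>, so they are
  all 0 or all 1. The value 1 would give \<open>F v0\<close> a right inverse; hence the power
  vanishes at \<open>v0\<close> and \<open>F v0\<close> is nilpotent.\<close>

lemma non_invertible_endomorphism_trace: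
  assumes Q: "fin_digraph Q" and X: "is_rep Q X" and ind: "indecomposable_rep Q X"
    and F: "rep_hom Q X X F" and v0: "v0 \<in> verts Q"
    and noninv: "\<And>L. L \<in> carrier_mat (rdim X v0) (rdim X v0) \<Longrightarrow> F v0 * L \<noteq> 1\<^sub>m (rdim X v0)"
  shows "mtrace (F v0) = 0"
proof -
  interpret fin_digraph Q by (fact Q)
  have XA: "rmap X a \<in> carrier_mat (rdim X (head Q a)) (rdim X (tail Q a))" if "a \<in> arcs Q" for a
    using X that by (auto simp: is_rep_def)
  have Fc: "F v \<in> carrier_mat (rdim X v) (rdim X v)" if "v \<in> verts Q" for v
    using F that by (auto simp: rep_hom_def)
  have "\<exists>p. v \<in> verts Q \<longrightarrow> (\<forall>q\<ge>p. \<exists>L\<in>carrier_mat (rdim X v) (rdim X v).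
      F v ^\<^sub>m q * L = L * F v ^\<^sub>m q \<and> F v ^\<^sub>m q = F v ^\<^sub>m q * (F v ^\<^sub>m q * L))" for v
    using group_inverse_of_power[OF Fc] by blast
  then obtain p where p: "\<And>v q. v \<in> verts Q \<Longrightarrow> p v \<le> q \<Longrightarrow> \<exists>L\<in>carrier_mat (rdim X v) (rdim X v).
      F v ^\<^sub>m q * L = L * F v ^\<^sub>m q \<and> F v ^\<^sub>m q = F v ^\<^sub>m q * (F v ^\<^sub>m q * L)"
    by metis
  \<comment> \<open>A common exponent beyond all the bounds \<open>p v\<close>; the successor makes
    it positive, so that a factor \<open>F v0\<close> can be split off below.\<close>
  define q where "q = Suc (\<Sum>v\<in>verts Q. p v)"
  have pq: "p v \<le> q" if "v \<in> verts Q" for v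
    using member_le_sum[of v "verts Q" p] that finite_verts by (simp add: q_def)
  define M where "M v = F v ^\<^sub>m q" for v
  have Mc: "M v \<in> carrier_mat (rdim X v) (rdim X v)" if "v \<in> verts Q" for v
    using Fc[OF that] by (simp add: M_def)
  have "\<exists>L. v \<in> verts Q \<longrightarrow> L \<in> carrier_mat (rdim X v) (rdim X v) \<and> M v * L = L * M v \<and> M v = M v * (M v * L)" for v
    using p[OF _ pq] unfolding M_def by blast
  then obtain L where L: "\<And>v. v \<in> verts Q \<Longrightarrow> L v \<in> carrier_mat (rdim X v) (rdim X v) \<and> M v * L v = L v * M v \<and> M v = M v * (M v * L v)"
    by metis
  define e where "e v = M v * L v" for v
  have ec: "e v \<in> carrier_mat (rdim X v) (rdim X v)" if "v \<in> verts Q" for v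
    using Mc[OF that] L[OF that] by (auto simp: e_def)
  have Me: "M v * e v = M v" if v: "v \<in> verts Q" for v using L[OF v] unfolding e_def by metis
  have eM: "e v * M v = M v" if v: "v \<in> verts Q" for v
  proof -
    have "e v * M v = M v * (L v * M v)"
      unfolding e_def using L[OF v] Mc[OF v] by (intro assoc_mult_mat) auto
    also have "\<dots> = M v" using L[OF v] by metis
    finally show ?thesis .
  qed
  have idem: "e v * e v = e v" if v: "v \<in> verts Q" for v
  proof -
    have "e v * e v = (e v * M v) * L v"
      unfolding e_def[of v] using Mc[OF v] L[OF v] by (intro assoc_mult_mat[symmetric]) auto
    then show ?thesis unfolding eM[OF v] by (simp add: e_def)
  qed
  have hom: "rep_hom Q X X e" unfolding rep_hom_def
  proof (intro conjI ballI)
    fix a assume a: "a \<in> arcs Q"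
    let ?h = "head Q a" and ?t = "tail Q a"
    have v: "?h \<in> verts Q" "?t \<in> verts Q" using a by auto
    have MX: "M ?h * rmap X a = rmap X a * M ?t"
      unfolding M_def by (rule pow_mat_intertwine[OF Fc[OF v(1)] Fc[OF v(2)] XA[OF a]])
        (use F a in \<open>simp add: rep_hom_def\<close>)
    have Lc: "L ?h \<in> carrier_mat (rdim X ?h) (rdim X ?h)" "L ?t \<in> carrier_mat (rdim X ?t) (rdim X ?t)"
      using L v by auto
    note c = XA[OF a] Mc[OF v(1)] Mc[OF v(2)] ec[OF v(1)] ec[OF v(2)] Lc
    have eL: "e ?h = L ?h * M ?h" using L[OF v(1)] by (simp add: e_def)
    \<comment> \<open>Both composites of \<open>e\<close> with the arrow turn out equal to the one
      having \<open>e\<close> on either side, because \<open>M\<close> commutes with the arrows and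
      \<open>e\<close> acts as the identity on \<open>M\<close> from left and right.\<close>
    have "e ?h * rmap X a = L ?h * (rmap X a * M ?t)" unfolding eL MX[symmetric] using c by (intro assoc_mult_mat) auto
    also have "\<dots> = L ?h * (rmap X a * (M ?t * e ?t))" unfolding Me[OF v(2)] ..
    also have "\<dots> = L ?h * (rmap X a * M ?t) * e ?t" using c by (simp add: mult_assoc_dim)
    also have "\<dots> = e ?h * (rmap X a * e ?t)" unfolding eL MX[symmetric] using c by (simp add: mult_assoc_dim)
    finally have 1: "e ?h * rmap X a = e ?h * (rmap X a * e ?t)" .
    have "rmap X a * e ?t = rmap X a * M ?t * L ?t" unfolding e_def using c by (simp add: mult_assoc_dim)
    also have "\<dots> = (e ?h * M ?h) * rmap X a * L ?t" unfolding eM[OF v(1)] MX ..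
    also have "\<dots> = e ?h * ((M ?h * rmap X a) * L ?t)" using c by (simp add: mult_assoc_dim)
    also have "\<dots> = e ?h * (rmap X a * e ?t)" unfolding MX e_def[of ?t] using c by (simp add: mult_assoc_dim)
    finally show "e ?h * rmap X a = rmap X a * e ?t" using 1 by simp
  qed (use ec in auto)
  have "e v0 \<noteq> 1\<^sub>m (rdim X v0)"
  proof
    assume "e v0 = 1\<^sub>m (rdim X v0)"
    moreover have "e v0 = F v0 * (F v0 ^\<^sub>m (q - 1) * L v0)"
    proof -
      have "M v0 = F v0 * F v0 ^\<^sub>m (q - 1)"
        unfolding M_def q_def diff_Suc_1 by (rule pow_mat_Suc_left[OF Fc[OF v0]])
      moreover have "L v0 \<in> carrier_mat (rdim X v0) (rdim X v0)" using L[OF v0] by blast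
      ultimately show ?thesis unfolding e_def using Fc[OF v0] by (metis assoc_mult_mat pow_carrier_mat)
    qed
    moreover have "F v0 ^\<^sub>m (q - 1) * L v0 \<in> carrier_mat (rdim X v0) (rdim X v0)"
      using Fc[OF v0] L[OF v0] by auto
    ultimately show False using noninv[of "F v0 ^\<^sub>m (q - 1) * L v0"] by simp
  qed
  then have "e v0 = 0\<^sub>m (rdim X v0) (rdim X v0)"
    using indecomposable_idempotent[OF wf_digraph_axioms X ind hom idem] v0 by blast
  then have "M v0 = 0\<^sub>m (rdim X v0) (rdim X v0)" using Me[OF v0] Mc[OF v0] by simp
  then show ?thesis unfolding M_def by (rule mtrace_nilpotent[OF Fc[OF v0]])
qed

text \<open>The suffixes h and t mark the head and the tail of the arrow X; F is an endomorphism, G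
  a vertexwise generalized inverse, and P solves the commutator equation with right-hand side C = G
  (F G X - X F G). This C is chosen because F G F = F gives C F = 0 and F C = F G X - X F G; hence P
  F and F (P - G) commute with the arrow.\<close>

lemma brick_arrow_identities:
  fixes X :: "complex mat"
  assumes X: "X \<in> carrier_mat m n"
    and h: "Fh \<in> carrier_mat m m" "Gh \<in> carrier_mat m m" "Ph \<in> carrier_mat m m"
    and t: "Ft \<in> carrier_mat n n" "Gt \<in> carrier_mat n n" "Pt \<in> carrier_mat n n"
    and FX: "Fh * X = X * Ft" and gh: "Fh * (Gh * Fh) = Fh" and gt: "Ft * (Gt * Ft) = Ft"
    and D: "Ph * X - X * Pt = Gh * (Fh * (Gh * X) - X * (Ft * Gt))"
  shows "Ph * Fh * X = X * (Pt * Ft)" "Fh * (Ph - Gh) * X = X * (Ft * (Pt - Gt))"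
proof -
  note dims = carrier_matD[OF X] carrier_matD[OF h(1)] carrier_matD[OF h(2)] carrier_matD[OF h(3)]
    carrier_matD[OF t(1)] carrier_matD[OF t(2)] carrier_matD[OF t(3)]
  have FX': "Fh * (X * Z) = X * (Ft * Z)" if "dim_row Z = n" for Z
    using arg_cong[OF FX, of "\<lambda>A. A * Z"] that dims by (simp add: mult_assoc_dim)
  have gh': "Fh * (Gh * (Fh * Z)) = Fh * Z" if "dim_row Z = m" for Z
    using arg_cong[OF gh, of "\<lambda>A. A * Z"] that dims by (simp add: mult_assoc_dim)
  have D1: "(Ph * X - X * Pt) * Ft = 0\<^sub>m m n"
  proof -
    have "(Ph * X - X * Pt) * Ft = Gh * (Fh * (Gh * (X * Ft)) - X * (Ft * (Gt * Ft)))"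
      unfolding D using dims by (simp add: mult_assoc_dim minus_mult_distrib_dim)
    also have "Fh * (Gh * (X * Ft)) = X * Ft"
      unfolding FX[symmetric] using gh'[of X] dims by simp
    also have "X * Ft - X * (Ft * (Gt * Ft)) = 0\<^sub>m m n"
      unfolding gt by (rule minus_r_inv_mat) (use X t in auto)
    finally show ?thesis using h(2) by simp
  qed
  have "Ph * Fh * X = Ph * (X * Ft)" using FX dims by (simp add: mult_assoc_dim)
  also have "\<dots> = X * (Pt * Ft)"
  proof (rule eq_matI)
    have "Ph * (X * Ft) - X * (Pt * Ft) = 0\<^sub>m m n"
      using D1 dims by (simp add: mult_assoc_dim minus_mult_distrib_dim)
    then have "(Ph * (X * Ft) - X * (Pt * Ft)) $$ (i, j) = 0" if "i < m" "j < n" for i j using that by simp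
    then show "(Ph * (X * Ft)) $$ (i, j) = (X * (Pt * Ft)) $$ (i, j)"
      if "i < dim_row (X * (Pt * Ft))" "j < dim_col (X * (Pt * Ft))" for i j
      using that dims by (simp del: index_mult_mat(1))
  qed (use dims in auto)
  finally show "Ph * Fh * X = X * (Pt * Ft)" .
  have "Fh * (Ph * X) - X * (Ft * Pt) = Fh * (Ph * X - X * Pt)"
    using dims FX'[of Pt] by (simp add: mult_minus_distrib_dim)
  also have "\<dots> = Fh * (Gh * X) - X * (Ft * Gt)"
    unfolding D using dims gh'[of "Gh * X"] gh'[of "X * Gt"] FX'[of Gt] by (simp add: mult_minus_distrib_dim)
  finally have D2: "Fh * (Ph * X) - X * (Ft * Pt) = Fh * (Gh * X) - X * (Ft * Gt)" .
  have "Fh * (Ph * X) - Fh * (Gh * X) = X * (Ft * Pt) - X * (Ft * Gt)"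
  proof (rule eq_matI)
    fix i j assume "i < dim_row (X * (Ft * Pt) - X * (Ft * Gt))" "j < dim_col (X * (Ft * Pt) - X * (Ft * Gt))"
    then have ij: "i < m" "j < n" using dims by auto
    have "(Fh * (Ph * X) - X * (Ft * Pt)) $$ (i, j) = (Fh * (Gh * X) - X * (Ft * Gt)) $$ (i, j)" using D2 by simp
    then show "(Fh * (Ph * X) - Fh * (Gh * X)) $$ (i, j) = (X * (Ft * Pt) - X * (Ft * Gt)) $$ (i, j)"
      using ij dims by (simp del: index_mult_mat(1) add: algebra_simps)
  qed (use dims in auto)
  then show "Fh * (Ph - Gh) * X = X * (Ft * (Pt - Gt))"
    using dims by (simp add: mult_assoc_dim mult_minus_distrib_dim minus_mult_distrib_dim)
qed

text \<open>With \<phi> as provided by rigidity, \<open>S\<close> = \<phi> F and \<open>T\<close> =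
  F (\<phi> - G) are endomorphisms that are not invertible at \<open>v0\<close>, so both have trace
  0 there. As \<phi> F and F \<phi> have equal traces, F G has trace 0 as well. But F G is
  idempotent, so it vanishes, and F = F G F = 0 at \<open>v0\<close>.\<close>

lemma rigid_indecomposable_endomorphism:
  assumes Q: "fin_digraph Q" and X: "is_rep Q X" and ind: "indecomposable_rep Q X" and rigid: "rigid_rep Q X"
    and F: "rep_hom Q X X F" and v0: "v0 \<in> verts Q"
    and noninv: "\<And>L. L \<in> carrier_mat (rdim X v0) (rdim X v0) \<Longrightarrow> F v0 * L \<noteq> 1\<^sub>m (rdim X v0)"
  shows "F v0 = 0\<^sub>m (rdim X v0) (rdim X v0)"
proof -
  interpret fin_digraph Q by (fact Q)
  let ?n = "rdim X"
  have XA: "rmap X a \<in> carrier_mat (?n (head Q a)) (?n (tail Q a))" if "a \<in> arcs Q" for a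
    using X that by (auto simp: is_rep_def)
  have Fc: "F v \<in> carrier_mat (?n v) (?n v)" if "v \<in> verts Q" for v
    using F that by (auto simp: rep_hom_def)
  have "\<exists>G. v \<in> verts Q \<longrightarrow> G \<in> carrier_mat (?n v) (?n v) \<and> F v * (G * F v) = F v" for v
    using generalized_inverse[OF Fc] by blast
  then obtain G where Gc: "\<And>v. v \<in> verts Q \<Longrightarrow> G v \<in> carrier_mat (?n v) (?n v)"
    and FGF: "\<And>v. v \<in> verts Q \<Longrightarrow> F v * (G v * F v) = F v"
    by metis
  define C where "C a = G (head Q a) * (F (head Q a) * (G (head Q a) * rmap X a) - rmap X a * (F (tail Q a) * G (tail Q a)))" for a
  have "C a \<in> carrier_mat (?n (head Q a)) (?n (tail Q a))" if a: "a \<in> arcs Q" for a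
    using XA[OF a] Gc[OF head_in_verts[OF a]] Gc[OF tail_in_verts[OF a]] Fc[OF head_in_verts[OF a]] Fc[OF tail_in_verts[OF a]]
    by (auto simp: C_def intro!: carrier_matI)
  from rigid_rep_surjective[OF wf_digraph_axioms X rigid this]
  obtain \<phi> where \<phi>c: "\<And>v. v \<in> verts Q \<Longrightarrow> \<phi> v \<in> carrier_mat (?n v) (?n v)"
    and \<phi>: "\<And>a. a \<in> arcs Q \<Longrightarrow> \<phi> (head Q a) * rmap X a - rmap X a * \<phi> (tail Q a) = C a" by blast
  define S where "S v = \<phi> v * F v" for v
  define T where "T v = F v * (\<phi> v - G v)" for v
  have "S (head Q a) * rmap X a = rmap X a * S (tail Q a) \<and> T (head Q a) * rmap X a = rmap X a * T (tail Q a)"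
    if a: "a \<in> arcs Q" for a
  proof -
    note v = head_in_verts[OF a] tail_in_verts[OF a]
    have "F (head Q a) * rmap X a = rmap X a * F (tail Q a)" using F a by (simp add: rep_hom_def)
    from brick_arrow_identities[OF XA[OF a] Fc[OF v(1)] Gc[OF v(1)] \<phi>c[OF v(1)] Fc[OF v(2)] Gc[OF v(2)] \<phi>c[OF v(2)]
        this FGF[OF v(1)] FGF[OF v(2)] \<phi>[OF a, unfolded C_def]]
    show ?thesis by (simp add: S_def T_def)
  qed
  moreover have c: "S v \<in> carrier_mat (?n v) (?n v)" "T v \<in> carrier_mat (?n v) (?n v)" if v: "v \<in> verts Q" for v
    using Fc[OF v] Gc[OF v] \<phi>c[OF v] by (auto simp: S_def T_def intro!: mult_carrier_mat[of _ "?n v" "?n v"] minus_carrier_mat)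
  ultimately have homS: "rep_hom Q X X S" and homT: "rep_hom Q X X T" by (auto simp: rep_hom_def)
  note Fv = Fc[OF v0] and Gv = Gc[OF v0] and \<phi>v = \<phi>c[OF v0]
  note dims = carrier_matD[OF Fv] carrier_matD[OF Gv] carrier_matD[OF \<phi>v]
  have "mtrace (T v0) = 0"
  proof (rule non_invertible_endomorphism_trace[OF Q X ind homT v0])
    fix L :: "complex mat" assume L: "L \<in> carrier_mat (?n v0) (?n v0)"
    have "T v0 * L = F v0 * ((\<phi> v0 - G v0) * L)" using dims L by (simp add: T_def mult_assoc_dim)
    moreover have "(\<phi> v0 - G v0) * L \<in> carrier_mat (?n v0) (?n v0)" using L Gv by (auto intro!: mult_carrier_mat[of _ "?n v0" "?n v0"] minus_carrier_mat)
    ultimately show "T v0 * L \<noteq> 1\<^sub>m (?n v0)" using noninv by simp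
  qed
  moreover have "mtrace (S v0) = 0"
  proof (rule non_invertible_endomorphism_trace[OF Q X ind homS v0])
    fix L :: "complex mat" assume L: "L \<in> carrier_mat (?n v0) (?n v0)"
    show "S v0 * L \<noteq> 1\<^sub>m (?n v0)"
    proof
      assume "S v0 * L = 1\<^sub>m (?n v0)"
      then have "\<phi> v0 * (F v0 * L) = 1\<^sub>m (?n v0)" using dims L by (simp add: S_def mult_assoc_dim)
      then have "F v0 * L * \<phi> v0 = 1\<^sub>m (?n v0)"
        using mat_mult_left_right_inverse[of "\<phi> v0" "?n v0" "F v0 * L"] Fv \<phi>v L by auto
      then have "F v0 * (L * \<phi> v0) = 1\<^sub>m (?n v0)" using dims L by (simp add: mult_assoc_dim)
      then show False using noninv[of "L * \<phi> v0"] L \<phi>v by auto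
    qed
  qed
  moreover have "mtrace (S v0) = mtrace (F v0 * \<phi> v0)" unfolding S_def by (rule mtrace_comm[OF \<phi>v Fv])
  moreover have "T v0 = F v0 * \<phi> v0 - F v0 * G v0" unfolding T_def using dims by (simp add: mult_minus_distrib_dim)
  moreover have "mtrace (F v0 * \<phi> v0 - F v0 * G v0) = mtrace (F v0 * \<phi> v0) - mtrace (F v0 * G v0)"
    by (rule mtrace_minus) (use Fv Gv \<phi>v in auto)
  ultimately have "mtrace (F v0 * G v0) = 0" by simp
  moreover have "F v0 * G v0 * (F v0 * G v0) = F v0 * G v0"
    using arg_cong[OF FGF[OF v0], of "\<lambda>A. A * G v0"] dims by (simp add: mult_assoc_dim)
  ultimately have "F v0 * G v0 = 0\<^sub>m (?n v0) (?n v0)" using mtrace_idempotent_eq_0[of "F v0 * G v0" "?n v0"] Fv Gv by auto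
  then have "F v0 * G v0 * F v0 = 0\<^sub>m (?n v0) (?n v0)" using Fv by simp
  then show ?thesis using FGF[OF v0] dims by (simp add: mult_assoc_dim)
qed

section \<open>Strict representations as configurations of subspaces\<close>

lemma inj_mult_cancel:
  fixes T :: "complex mat"
  assumes T: "T \<in> carrier_mat d m" and inj: "inj_on (\<lambda>x. T *\<^sub>v x) (carrier_vec m)"
    and B: "B \<in> carrier_mat m k" and C: "C \<in> carrier_mat m k" and eq: "T * B = T * C"
  shows "B = C"
proof (rule eq_matI)
  fix i j assume "i < dim_row C" "j < dim_col C"
  then have ij: "i < m" "j < k" using C by auto
  have "T *\<^sub>v col B j = T *\<^sub>v col C j"
    using col_mult2[OF T B ij(2)] col_mult2[OF T C ij(2)] eq by simp
  then have "col B j = col C j" using inj B C by (auto dest!: inj_onD)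
  then have "col B j $ i = col C j $ i" by simp
  then show "B $$ (i, j) = C $$ (i, j)" using B C ij by simp
qed (use B C in auto)

locale strict_star_rep =
  fixes ms :: "nat list" and X :: star_rep
  assumes rep: "is_rep (star_quiver ms) X" and strict: "strict_rep (star_quiver ms) X"
begin

abbreviation "Q \<equiv> star_quiver ms"
abbreviation "d \<equiv> rdim X None"

text \<open>\<open>to_top\<close> counts steps down from the end of the chain; \<open>T j i\<close>
  is indexed by the poset element instead.\<close>

definition T :: "nat \<Rightarrow> nat \<Rightarrow> complex mat" where
  "T j i = to_top ms X j (ms ! j - i)"

abbreviation V :: "nat \<Rightarrow> nat \<Rightarrow> complex vec set" where
  "V j i \<equiv> subsp ms X j i"

lemma tail_head [simp]: "tail Q = fst" "head Q = snd"
  by (simp_all add: star_quiver_def Let_def)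

lemma verts_Q: "verts Q = insert None (Some ` prim_elems ms)"
  by (simp add: star_quiver_def Let_def)

lemma in_verts [simp]: "None \<in> verts Q"
  "j < length ms \<Longrightarrow> 1 \<le> i \<Longrightarrow> i \<le> ms ! j \<Longrightarrow> Some (j, i) \<in> verts Q"
  by (auto simp: verts_Q prim_elems_def)

lemma chain_arc: "j < length ms \<Longrightarrow> 1 \<le> i \<Longrightarrow> Suc i \<le> ms ! j \<Longrightarrow> (Some (j, i), Some (j, Suc i)) \<in> arcs Q"
  by (auto simp: arcs_star_quiver)

lemma top_arc: "j < length ms \<Longrightarrow> 1 \<le> ms ! j \<Longrightarrow> (Some (j, ms ! j), None) \<in> arcs Q"
  by (auto simp: arcs_star_quiver)

lemma arc_cases:
  assumes "a \<in> arcs Q"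
  obtains j i where "j < length ms" "1 \<le> i" "Suc i \<le> ms ! j" "a = (Some (j, i), Some (j, Suc i))"
    | j where "j < length ms" "1 \<le> ms ! j" "a = (Some (j, ms ! j), None)"
  using assms unfolding arcs_star_quiver by blast

lemma arc_carrier: "a \<in> arcs Q \<Longrightarrow> rmap X a \<in> carrier_mat (rdim X (snd a)) (rdim X (fst a))"
  using rep by (auto simp: is_rep_def)

lemma arc_inj: "a \<in> arcs Q \<Longrightarrow> inj_on (\<lambda>x. rmap X a *\<^sub>v x) (carrier_vec (rdim X (fst a)))"
  using strict by (auto simp: strict_rep_def)

lemma T_top: "T j (ms ! j) = rmap X (Some (j, ms ! j), None)"
  by (simp add: T_def)

lemma T_step: "1 \<le> i \<Longrightarrow> Suc i \<le> ms ! j \<Longrightarrow> T j i = T j (Suc i) * rmap X (Some (j, i), Some (j, Suc i))"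
proof -
  assume i: "1 \<le> i" "Suc i \<le> ms ! j"
  then have "ms ! j - i = Suc (ms ! j - Suc i)" "ms ! j - Suc (ms ! j - Suc i) = i"
    "ms ! j - (ms ! j - Suc i) = Suc i" by auto
  then show ?thesis by (simp add: T_def)
qed

lemma T_carrier_inj:
  assumes j: "j < length ms" and i: "1 \<le> i" "i \<le> ms ! j"
  shows "T j i \<in> carrier_mat d (rdim X (Some (j, i))) \<and>
    inj_on (\<lambda>x. T j i *\<^sub>v x) (carrier_vec (rdim X (Some (j, i))))"
  using i(2,1)
proof (induction i rule: inc_induct)
  case base
  then show ?case using arc_carrier[OF top_arc[OF j]] arc_inj[OF top_arc[OF j]] by (simp add: T_top)
next
  case (step i)
  let ?R = "rmap X (Some (j, i), Some (j, Suc i))"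
  have i: "1 \<le> i" "Suc i \<le> ms ! j" using step by auto
  note a = chain_arc[OF j i]
  have R: "?R \<in> carrier_mat (rdim X (Some (j, Suc i))) (rdim X (Some (j, i)))"
    "inj_on (\<lambda>x. ?R *\<^sub>v x) (carrier_vec (rdim X (Some (j, i))))"
    using arc_carrier[OF a] arc_inj[OF a] by auto
  have S: "T j (Suc i) \<in> carrier_mat d (rdim X (Some (j, Suc i)))"
    "inj_on (\<lambda>x. T j (Suc i) *\<^sub>v x) (carrier_vec (rdim X (Some (j, Suc i))))"
    using step by auto
  have "inj_on (\<lambda>x. T j i *\<^sub>v x) (carrier_vec (rdim X (Some (j, i))))"
  proof (rule inj_onI)
    fix x y assume xy: "x \<in> carrier_vec (rdim X (Some (j, i)))" "y \<in> carrier_vec (rdim X (Some (j, i)))"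
      and eq: "T j i *\<^sub>v x = T j i *\<^sub>v y"
    then have "T j (Suc i) *\<^sub>v (?R *\<^sub>v x) = T j (Suc i) *\<^sub>v (?R *\<^sub>v y)"
      using S(1) R(1) by (simp add: T_step[OF i] assoc_mult_mat_vec[of _ d "rdim X (Some (j, Suc i))" _ "rdim X (Some (j, i))"])
    then have "?R *\<^sub>v x = ?R *\<^sub>v y"
      by (rule inj_onD[OF S(2)]) (use R(1) xy in \<open>auto intro: mult_mat_vec_carrier\<close>)
    then show "x = y" using inj_onD[OF R(2)] xy by blast
  qed
  moreover have "T j i \<in> carrier_mat d (rdim X (Some (j, i)))" using S(1) R(1) by (simp add: T_step[OF i])
  ultimately show ?case by blast
qed

lemma V_eq: "j < length ms \<Longrightarrow> 1 \<le> i \<Longrightarrow> i \<le> ms ! j \<Longrightarrow> V j i = mimg (T j i)"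
  using T_carrier_inj[of j i] by (auto simp: subsp_def mimg_def T_def)

lemma V_csub: "j < length ms \<Longrightarrow> 1 \<le> i \<Longrightarrow> i \<le> ms ! j \<Longrightarrow> csub d (V j i)"
  using T_carrier_inj[of j i] csub_mimg by (auto simp: V_eq)

lemma V_step: "j < length ms \<Longrightarrow> 1 \<le> i \<Longrightarrow> Suc i \<le> ms ! j \<Longrightarrow> V j i \<subseteq> V j (Suc i)"
proof
  fix x assume j: "j < length ms" and i: "1 \<le> i" "Suc i \<le> ms ! j" and "x \<in> V j i"
  let ?R = "rmap X (Some (j, i), Some (j, Suc i))"
  have Tc: "T j i \<in> carrier_mat d (rdim X (Some (j, i)))" "T j (Suc i) \<in> carrier_mat d (rdim X (Some (j, Suc i)))"
    using T_carrier_inj j i by auto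
  have R: "?R \<in> carrier_mat (rdim X (Some (j, Suc i))) (rdim X (Some (j, i)))"
    using arc_carrier[OF chain_arc[OF j i]] by simp
  obtain c where c: "c \<in> carrier_vec (rdim X (Some (j, i)))" "x = T j i *\<^sub>v c"
    using \<open>x \<in> V j i\<close> V_eq[of j i] mimg_iff[OF Tc(1)] j i by auto
  then have "x = T j (Suc i) *\<^sub>v (?R *\<^sub>v c)"
    using T_step[OF i] assoc_mult_mat_vec[OF Tc(2) R c(1)] by simp
  then show "x \<in> V j (Suc i)"
    using mimgI[OF Tc(2), of "?R *\<^sub>v c"] R c V_eq[of j "Suc i"] j i by (auto intro: mult_mat_vec_carrier)
qed

text \<open>Strictness embeds every space into the top one, so a zero top space would make
  \<open>X\<close> zero.\<close>

lemma dim_pos: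
  assumes "indecomposable_rep Q X"
  shows "d > 0"
proof (rule ccontr)
  assume "\<not> d > 0"
  then have d0: "d = 0" by simp
  have "rdim X v = 0" if vQ: "v \<in> verts Q" for v
  proof (cases v)
    case None then show ?thesis using d0 by simp
  next
    case (Some x)
    then obtain j i where v: "v = Some (j, i)" "j < length ms" "1 \<le> i" "i \<le> ms ! j"
      using vQ by (cases x) (auto simp: verts_Q prim_elems_def)
    let ?m = "rdim X (Some (j, i))"
    have T: "T j i \<in> carrier_mat 0 ?m" "inj_on (\<lambda>x. T j i *\<^sub>v x) (carrier_vec ?m)"
      using T_carrier_inj[OF v(2-4)] d0 by auto
    show ?thesis
    proof (rule ccontr)
      assume "rdim X v \<noteq> 0"
      then have "0 < ?m" using v by simp
      then obtain x where x: "x \<in> carrier_vec ?m" "x \<noteq> 0\<^sub>v ?m" "T j i *\<^sub>v x = 0\<^sub>v 0"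
        using wide_matrix_kernel[OF T(1)] by auto
      then have "T j i *\<^sub>v x = T j i *\<^sub>v 0\<^sub>v ?m" using mult_mat_vec_zero[OF T(1)] by simp
      then show False using inj_onD[OF T(2)] x by auto
    qed
  qed
  then have "zero_rep Q X" by (simp add: zero_rep_def)
  then show False using assms by (simp add: indecomposable_rep_def)
qed

text \<open>Endomorphisms of the configuration of subspaces; by strictness they are the top
  components of endomorphisms of \<open>X\<close>.\<close>

definition stabilizes :: "complex mat \<Rightarrow> bool" where
  "stabilizes A \<longleftrightarrow> A \<in> carrier_mat d d \<and>
    (\<forall>j<length ms. \<forall>i\<in>{1..ms ! j}. \<forall>x\<in>V j i. A *\<^sub>v x \<in> V j i)"

text \<open>\<open>A\<close> restricts to every subspace, and the restriction in coordinates is the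
  component at that vertex. Commutation with a chain arrow is checked after composing with the
  injective map to the top space.\<close>

lemma stabilizer_lift:
  assumes "stabilizes A"
  shows "\<exists>F. rep_hom Q X X F \<and> F None = A"
proof -
  have Ac: "A \<in> carrier_mat d d" and AV: "\<And>j i x. j < length ms \<Longrightarrow> 1 \<le> i \<Longrightarrow> i \<le> ms ! j \<Longrightarrow> x \<in> V j i \<Longrightarrow> A *\<^sub>v x \<in> V j i"
    using assms by (auto simp: stabilizes_def)
  have "\<exists>B. (j < length ms \<and> 1 \<le> i \<and> i \<le> ms ! j) \<longrightarrow>
      B \<in> carrier_mat (rdim X (Some (j, i))) (rdim X (Some (j, i))) \<and> A * T j i = T j i * B" for j i
  proof (cases "j < length ms \<and> 1 \<le> i \<and> i \<le> ms ! j")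
    case True
    let ?m = "rdim X (Some (j, i))"
    have Tc: "T j i \<in> carrier_mat d ?m" using T_carrier_inj True by auto
    have "\<exists>B\<in>carrier_mat ?m ?m. A * T j i = T j i * B"
    proof (rule factor_through[of _ d])
      fix k assume "k < ?m"
      then have "col (A * T j i) k = A *\<^sub>v col (T j i) k" "col (T j i) k \<in> V j i"
        using col_mult2[OF Ac Tc] col_in_mimg[OF Tc] V_eq True by auto
      then show "col (A * T j i) k \<in> mimg (T j i)" using AV V_eq True by auto
    qed (use Ac Tc in auto)
    then show ?thesis by blast
  qed auto
  then obtain B where B: "\<And>j i. j < length ms \<Longrightarrow> 1 \<le> i \<Longrightarrow> i \<le> ms ! j \<Longrightarrow>
      B j i \<in> carrier_mat (rdim X (Some (j, i))) (rdim X (Some (j, i))) \<and> A * T j i = T j i * B j i"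
    by metis
  define F where "F v = (case v of None \<Rightarrow> A | Some (j, i) \<Rightarrow> B j i)" for v
  have "rep_hom Q X X F" unfolding rep_hom_def
  proof (intro conjI ballI)
    fix v assume "v \<in> verts Q"
    then show "F v \<in> carrier_mat (rdim X v) (rdim X v)"
      using Ac B by (auto simp: F_def verts_Q prim_elems_def)
  next
    fix a assume "a \<in> arcs Q"
    then show "F (head Q a) * rmap X a = rmap X a * F (tail Q a)"
    proof (cases rule: arc_cases)
      case (2 j)
      then show ?thesis using B[of j "ms ! j"] T_top[of j] by (simp add: F_def)
    next
      case (1 j i)
      let ?m = "rdim X (Some (j, i))" and ?m' = "rdim X (Some (j, Suc i))"
      let ?R = "rmap X (Some (j, i), Some (j, Suc i))"
      have R: "?R \<in> carrier_mat ?m' ?m" using arc_carrier[OF chain_arc[OF 1(1-3)]] by simp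
      have T': "T j (Suc i) \<in> carrier_mat d ?m'" "inj_on (\<lambda>x. T j (Suc i) *\<^sub>v x) (carrier_vec ?m')"
        using T_carrier_inj[of j "Suc i"] 1 by auto
      have b: "B j i \<in> carrier_mat ?m ?m" "A * T j i = T j i * B j i"
        and b': "B j (Suc i) \<in> carrier_mat ?m' ?m'" "A * T j (Suc i) = T j (Suc i) * B j (Suc i)"
        using B[of j i] B[of j "Suc i"] 1 by auto
      note st = T_step[OF 1(2,3)]
      have "T j (Suc i) * (B j (Suc i) * ?R) = A * T j (Suc i) * ?R"
        unfolding b'(2) by (rule assoc_mult_mat[symmetric, OF T'(1) b'(1) R])
      also have "\<dots> = A * T j i" unfolding st by (rule assoc_mult_mat[OF Ac T'(1) R])
      also have "\<dots> = T j (Suc i) * ?R * B j i" by (subst b(2), subst st, rule refl)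
      also have "\<dots> = T j (Suc i) * (?R * B j i)" by (rule assoc_mult_mat[OF T'(1) R b(1)])
      finally have "B j (Suc i) * ?R = ?R * B j i"
        using inj_mult_cancel[OF T', of "B j (Suc i) * ?R" ?m "?R * B j i"] b(1) b'(1) R by auto
      then show ?thesis by (simp add: F_def 1)
    qed
  qed
  then show ?thesis by (intro exI[of _ F]) (simp add: F_def)
qed

text \<open>Put \<open>c j\<close> on the last arrow of branch \<open>j\<close> and 0 on all other
  arrows. Descending the chain, the solution of the commutator equation satisfies (\<phi> - c) T = T
  \<phi> at each element, so the difference preserves the flag. This is the form in which the
  vanishing of Ext enters the dimension counts.\<close>

lemma rigid_stabilizers:
  assumes rigid: "rigid_rep Q X" and c: "\<And>j. j < length ms \<Longrightarrow> c j \<in> carrier_mat d d"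
  shows "\<exists>\<phi>\<in>carrier_mat d d. \<forall>j<length ms. \<forall>i\<in>{1..ms ! j}. \<forall>x\<in>V j i. (\<phi> - c j) *\<^sub>v x \<in> V j i"
proof -
  interpret Qd: fin_digraph Q by (rule fin_digraph_star_quiver)
  define C where "C a = (case a of (Some (j, i), None) \<Rightarrow> c j * rmap X a
    | _ \<Rightarrow> 0\<^sub>m (rdim X (snd a)) (rdim X (fst a)))" for a :: "star_vertex \<times> star_vertex"
  have "C a \<in> carrier_mat (rdim X (head Q a)) (rdim X (tail Q a))" if "a \<in> arcs Q" for a
    using that
  proof (cases rule: arc_cases)
    case (2 j)
    then have "C a = c j * rmap X a" by (simp add: C_def)
    then show ?thesis using c[OF 2(1)] arc_carrier[OF that] 2 by auto
  qed (auto simp: C_def)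
  from rigid_rep_surjective[OF Qd.wf_digraph_axioms rep rigid this]
  obtain \<phi> where \<phi>c: "\<And>v. v \<in> verts Q \<Longrightarrow> \<phi> v \<in> carrier_mat (rdim X v) (rdim X v)"
    and \<phi>: "\<And>a. a \<in> arcs Q \<Longrightarrow> \<phi> (snd a) * rmap X a - rmap X a * \<phi> (fst a) = C a" by auto
  have \<phi>0: "\<phi> None \<in> carrier_mat d d" using \<phi>c by auto
  have key: "(\<phi> None - c j) * T j i = T j i * \<phi> (Some (j, i))" if j: "j < length ms" and i: "1 \<le> i" "i \<le> ms ! j" for j i
    using i(2,1)
  proof (induction i rule: inc_induct)
    case base
    let ?a = "(Some (j, ms ! j), None :: star_vertex)"
    have a: "?a \<in> arcs Q" using top_arc[OF j base] .
    have R: "rmap X ?a \<in> carrier_mat d (rdim X (Some (j, ms ! j)))" using arc_carrier[OF a] by simp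
    have \<phi>m: "\<phi> (Some (j, ms ! j)) \<in> carrier_mat (rdim X (Some (j, ms ! j))) (rdim X (Some (j, ms ! j)))"
      using \<phi>c j base by auto
    have "\<phi> None * rmap X ?a - rmap X ?a * \<phi> (Some (j, ms ! j)) = c j * rmap X ?a"
      using \<phi>[OF a] by (simp add: C_def)
    note eq = arg_cong[OF this, of "\<lambda>A. A $$ _"]
    have "(\<phi> None - c j) * rmap X ?a = \<phi> None * rmap X ?a - c j * rmap X ?a"
      by (rule minus_mult_distrib_mat[OF \<phi>0 c[OF j] R])
    also have "\<dots> = rmap X ?a * \<phi> (Some (j, ms ! j))"
    proof (rule eq_matI)
      fix r s assume "r < dim_row (rmap X ?a * \<phi> (Some (j, ms ! j)))" "s < dim_col (rmap X ?a * \<phi> (Some (j, ms ! j)))"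
      then have "r < d" "s < rdim X (Some (j, ms ! j))" using R \<phi>m by auto
      then show "(\<phi> None * rmap X ?a - c j * rmap X ?a) $$ (r, s) = (rmap X ?a * \<phi> (Some (j, ms ! j))) $$ (r, s)"
        using eq[of "(r, s)"] R \<phi>m \<phi>0 c[OF j] by (simp del: index_mult_mat(1) add: algebra_simps)
    qed (use R \<phi>m \<phi>0 c[OF j] in auto)
    finally show ?case by (simp add: T_top)
  next
    case (step i)
    let ?m = "rdim X (Some (j, i))" and ?m' = "rdim X (Some (j, Suc i))"
    let ?a = "(Some (j, i), Some (j, Suc i))"
    have i: "1 \<le> i" "Suc i \<le> ms ! j" using step by auto
    note a = chain_arc[OF j i]
    have R: "rmap X ?a \<in> carrier_mat ?m' ?m" using arc_carrier[OF a] by simp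
    have T': "T j (Suc i) \<in> carrier_mat d ?m'" using T_carrier_inj[of j "Suc i"] i j by auto
    have \<phi>i: "\<phi> (Some (j, i)) \<in> carrier_mat ?m ?m" "\<phi> (Some (j, Suc i)) \<in> carrier_mat ?m' ?m'"
      using \<phi>c j i by auto
    have "\<phi> (Some (j, Suc i)) * rmap X ?a - rmap X ?a * \<phi> (Some (j, i)) = 0\<^sub>m ?m' ?m"
      using \<phi>[OF a] by (simp add: C_def)
    note eq = arg_cong[OF this, of "\<lambda>A. A $$ _"]
    have comm: "\<phi> (Some (j, Suc i)) * rmap X ?a = rmap X ?a * \<phi> (Some (j, i))"
    proof (rule eq_matI)
      fix r s assume "r < dim_row (rmap X ?a * \<phi> (Some (j, i)))" "s < dim_col (rmap X ?a * \<phi> (Some (j, i)))"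
      then have "r < ?m'" "s < ?m" using R \<phi>i by auto
      then show "(\<phi> (Some (j, Suc i)) * rmap X ?a) $$ (r, s) = (rmap X ?a * \<phi> (Some (j, i))) $$ (r, s)"
        using eq[of "(r, s)"] R \<phi>i by (simp del: index_mult_mat(1))
    qed (use R \<phi>i in auto)
    have "(\<phi> None - c j) * T j i = (\<phi> None - c j) * T j (Suc i) * rmap X ?a"
      unfolding T_step[OF i] by (rule assoc_mult_mat[symmetric, OF minus_carrier_mat[OF c[OF j]] T' R])
    also have "\<dots> = T j (Suc i) * \<phi> (Some (j, Suc i)) * rmap X ?a" using step i by simp
    also have "\<dots> = T j (Suc i) * (rmap X ?a * \<phi> (Some (j, i)))"
      unfolding comm[symmetric] by (rule assoc_mult_mat[OF T' \<phi>i(2) R])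
    also have "\<dots> = T j i * \<phi> (Some (j, i))"
      unfolding T_step[OF i] by (rule assoc_mult_mat[symmetric, OF T' R \<phi>i(1)])
    finally show ?case .
  qed
  have "(\<phi> None - c j) *\<^sub>v x \<in> V j i" if j: "j < length ms" and i: "i \<in> {1..ms ! j}" and x: "x \<in> V j i" for j i x
  proof -
    let ?m = "rdim X (Some (j, i))"
    have Tc: "T j i \<in> carrier_mat d ?m" using T_carrier_inj[of j i] i j by auto
    have \<phi>i: "\<phi> (Some (j, i)) \<in> carrier_mat ?m ?m" using \<phi>c j i by auto
    obtain y where y: "y \<in> carrier_vec ?m" "x = T j i *\<^sub>v y" using x V_eq[of j i] mimg_iff[OF Tc] i j by auto
    have "(\<phi> None - c j) *\<^sub>v x = (\<phi> None - c j) * T j i *\<^sub>v y"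
      unfolding y(2) by (rule assoc_mult_mat_vec[symmetric, OF minus_carrier_mat[OF c[OF j]] Tc y(1)])
    also have "\<dots> = T j i *\<^sub>v (\<phi> (Some (j, i)) *\<^sub>v y)"
      using key[OF j] i assoc_mult_mat_vec[OF Tc \<phi>i y(1)] by auto
    finally show ?thesis using mimgI[OF Tc, of "\<phi> (Some (j, i)) *\<^sub>v y"] mult_mat_vec_carrier[OF \<phi>i y(1)] V_eq[of j i] i j by auto
  qed
  then show ?thesis using \<phi>0 by blast
qed

text \<open>A kernel vector in the top space makes the lifted endomorphism non-invertible there, and
  then its top component vanishes by the trace argument.\<close>

lemma singular_stabilizer_eq_0:
  assumes ind: "indecomposable_rep Q X" and rigid: "rigid_rep Q X" and A: "stabilizes A"
    and x: "x \<in> carrier_vec d" "x \<noteq> 0\<^sub>v d" "A *\<^sub>v x = 0\<^sub>v d"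
  shows "A = 0\<^sub>m d d"
proof -
  have Ac: "A \<in> carrier_mat d d" using A by (simp add: stabilizes_def)
  obtain F where F: "rep_hom Q X X F" "F None = A" using stabilizer_lift[OF A] by blast
  have "F None * L \<noteq> 1\<^sub>m d" if L: "L \<in> carrier_mat d d" for L
  proof
    assume "F None * L = 1\<^sub>m d"
    then have "L * A = 1\<^sub>m d" using mat_mult_left_right_inverse[OF Ac L] F by simp
    then have "x = L *\<^sub>v (A *\<^sub>v x)" using assoc_mult_mat_vec[OF L Ac x(1)] x(1) by simp
    then show False using x mult_mat_vec_zero[OF L] by simp
  qed
  from rigid_indecomposable_endomorphism[OF fin_digraph_star_quiver rep ind rigid F(1) _ this] F(2)
  show ?thesis by simp
qed

text \<open>Over the complex numbers \<open>A\<close> has an eigenvalue \<open>c\<close>; the matrix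
  \<open>A - c\<close> still preserves the subspaces and is singular, hence zero.\<close>

lemma stabilizer_scalar:
  assumes ind: "indecomposable_rep Q X" and rigid: "rigid_rep Q X" and A: "stabilizes A"
  shows "\<exists>c. A = c \<cdot>\<^sub>m 1\<^sub>m d"
proof -
  have Ac: "A \<in> carrier_mat d d" using A by (simp add: stabilizes_def)
  obtain c where "eigenvalue A c"
    using spectrum_non_empty[OF Ac dim_pos[OF ind]] by (auto simp: spectrum_def)
  then obtain x where x: "x \<in> carrier_vec d" "x \<noteq> 0\<^sub>v d" "A *\<^sub>v x = c \<cdot>\<^sub>v x"
    using Ac by (auto simp: eigenvalue_def eigenvector_def)
  define B where "B = A - c \<cdot>\<^sub>m 1\<^sub>m d"
  have Bx: "B *\<^sub>v y = A *\<^sub>v y - c \<cdot>\<^sub>v y" if "y \<in> carrier_vec d" for y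
  proof -
    have "(c \<cdot>\<^sub>m 1\<^sub>m d) *\<^sub>v y = c \<cdot>\<^sub>v y" using that by (intro eq_vecI) auto
    then show ?thesis unfolding B_def using Ac that by (subst minus_mult_distrib_mat_vec[of _ d d]) auto
  qed
  have "stabilizes B"
    unfolding stabilizes_def
  proof (intro conjI allI impI ballI)
    show "B \<in> carrier_mat d d" using Ac by (auto simp: B_def intro: minus_carrier_mat)
    fix j i y assume "j < length ms" "i \<in> {1..ms ! j}" "y \<in> V j i"
    then show "B *\<^sub>v y \<in> V j i"
      using Bx[of y] csub_minus[OF V_csub, of j i] csubD(4,5)[OF V_csub, of j i] A by (auto simp: stabilizes_def)
  qed
  moreover have "B *\<^sub>v x = 0\<^sub>v d" using Bx[OF x(1)] x by simp
  ultimately have B0: "B = 0\<^sub>m d d" using singular_stabilizer_eq_0[OF ind rigid] x by blast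
  have "A = c \<cdot>\<^sub>m 1\<^sub>m d"
  proof (rule eq_matI)
    fix r s assume "r < dim_row (c \<cdot>\<^sub>m 1\<^sub>m d)" "s < dim_col (c \<cdot>\<^sub>m 1\<^sub>m d)"
    then have rs: "r < d" "s < d" by auto
    have "B $$ (r, s) = 0" using B0 rs by simp
    then show "A $$ (r, s) = (c \<cdot>\<^sub>m 1\<^sub>m d) $$ (r, s)" using rs Ac by (simp add: B_def)
  qed (use Ac in auto)
  then show ?thesis by blast
qed

end

section \<open>Counting dimensions: the Euler form and stability\<close>

lemma onb_inverse:
  assumes H: "H \<in> carrier_mat d d" and N: "onb H d d N (carrier_vec d)"
  shows "N \<in> carrier_mat d d" "adj N * H \<in> carrier_mat d d" "adj N * H * N = 1\<^sub>m d" "N * (adj N * H) = 1\<^sub>m d"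
proof -
  show N1: "N \<in> carrier_mat d d" using N by (simp add: onb_def)
  show N2: "adj N * H \<in> carrier_mat d d" "adj N * H * N = 1\<^sub>m d" using onb_left_inverse[OF N H] by auto
  show "N * (adj N * H) = 1\<^sub>m d" by (rule mat_mult_left_right_inverse[OF N2(1) N1 N2(2)])
qed

definition first_cols :: "nat \<Rightarrow> complex mat \<Rightarrow> complex mat" where
  "first_cols k N = mat (dim_row N) k (\<lambda>(i, j). N $$ (i, j))"

lemma first_cols_carrier [simp]: "N \<in> carrier_mat m n \<Longrightarrow> first_cols k N \<in> carrier_mat m k"
  by (simp add: first_cols_def)

lemma col_first_cols: "N \<in> carrier_mat m n \<Longrightarrow> k \<le> n \<Longrightarrow> j < k \<Longrightarrow> col (first_cols k N) j = col N j"
  by (intro eq_vecI) (auto simp: first_cols_def)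

lemma mult_vec_coords:
  assumes N: "N \<in> carrier_mat m n" and k: "k \<le> n" and c: "c \<in> coords n k"
  shows "N *\<^sub>v c = first_cols k N *\<^sub>v vec k (\<lambda>a. c $ a)"
proof (rule eq_vecI)
  fix i assume "i < dim_vec (first_cols k N *\<^sub>v vec k (\<lambda>a. c $ a))"
  then have i: "i < m" using N by (simp add: first_cols_def)
  have "(N *\<^sub>v c) $ i = (\<Sum>j<n. N $$ (i, j) * c $ j)"
    using c by (intro mult_mat_vec_sum[OF N _ i]) (auto simp: coords_def)
  also have "\<dots> = (\<Sum>j<k. N $$ (i, j) * c $ j)"
    using k c by (intro sum.mono_neutral_right) (auto simp: coords_def)
  also have "\<dots> = (first_cols k N *\<^sub>v vec k (\<lambda>a. c $ a)) $ i"
    using mult_mat_vec_sum[of "first_cols k N" m k "vec k (\<lambda>a. c $ a)" i] N i by (simp add: first_cols_def)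
  finally show "(N *\<^sub>v c) $ i = \<dots>" .
qed (use N in \<open>simp add: first_cols_def\<close>)

lemma image_coords:
  assumes N: "N \<in> carrier_mat m n" and k: "k \<le> n"
  shows "(\<lambda>c. N *\<^sub>v c) ` coords n k = mimg (first_cols k N)"
proof (intro equalityI subsetI)
  have F: "first_cols k N \<in> carrier_mat m k" using N by simp
  fix y assume "y \<in> (\<lambda>c. N *\<^sub>v c) ` coords n k"
  then obtain c where "c \<in> coords n k" "y = N *\<^sub>v c" by blast
  then show "y \<in> mimg (first_cols k N)" using mult_vec_coords[OF N k] mimgI[OF F] by auto
next
  have F: "first_cols k N \<in> carrier_mat m k" using N by simp
  fix y assume "y \<in> mimg (first_cols k N)"
  then obtain a where a: "a \<in> carrier_vec k" "y = first_cols k N *\<^sub>v a" using mimg_iff[OF F] by auto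
  define c where "c = vec n (\<lambda>i. if i < k then a $ i else 0)"
  have c: "c \<in> coords n k" by (auto simp: c_def coords_def)
  have "vec k (\<lambda>i. c $ i) = a" using a k by (intro eq_vecI) (auto simp: c_def)
  then have "y = N *\<^sub>v c" using mult_vec_coords[OF N k c] a by simp
  then show "y \<in> (\<lambda>c. N *\<^sub>v c) ` coords n k" using c by blast
qed

lemma onb_first_cols:
  assumes H: "H \<in> carrier_mat d d" and N: "onb H d n N S" and k: "k \<le> n"
  shows "onb H d k (first_cols k N) ((\<lambda>c. N *\<^sub>v c) ` coords n k)"
proof -
  have Nc: "N \<in> carrier_mat d n" and NN: "adj N * (H * N) = 1\<^sub>m n" using N by (auto simp: onb_def)
  have F: "first_cols k N \<in> carrier_mat d k" using Nc by simp
  have "adj (first_cols k N) * (H * first_cols k N) = 1\<^sub>m k"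
  proof (rule eq_matI)
    fix i j assume "i < dim_row (1\<^sub>m k)" "j < dim_col (1\<^sub>m k)"
    then have ij: "i < k" "j < k" by auto
    have "(adj (first_cols k N) * (H * first_cols k N)) $$ (i, j) = (adj N * (H * N)) $$ (i, j)"
      using index_adj_form[OF F H F ij] index_adj_form[OF Nc H Nc, of i j] ij k
      by (simp add: col_first_cols[OF Nc k] del: index_mult_mat)
    then show "(adj (first_cols k N) * (H * first_cols k N)) $$ (i, j) = 1\<^sub>m k $$ (i, j)" using NN ij k by simp
  qed (use F in auto)
  then show ?thesis using F image_coords[OF Nc k] by (simp add: onb_def)
qed

lemma cdim_mono:
  assumes "csub d S" "csub d S'" "S \<subseteq> S'"
  shows "cdim d S \<le> cdim d S'"
proof -
  obtain k N k' N' where "onb (1\<^sub>m d) d k N S" "onb (1\<^sub>m d) d k' N' S'"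
    using onb_exists[OF posdef_one assms(1)] onb_exists[OF posdef_one assms(2)] by blast
  then show ?thesis using cdim_eq[of "1\<^sub>m d"] onb_dim_mono[of "1\<^sub>m d"] assms(3) by (metis one_carrier_mat)
qed

lemma cdim_le: "csub d S \<Longrightarrow> cdim d S \<le> d"
  using onb_exists[OF posdef_one, of d S] cdim_eq[of "1\<^sub>m d" d] onb_dim_le[of "1\<^sub>m d" d] by auto

lemma adapted_onb:
  assumes H: "posdef d H" and S: "\<And>i. i \<in> {1..m} \<Longrightarrow> csub d (S i)"
    and mono: "\<And>i. 1 \<le> i \<Longrightarrow> Suc i \<le> m \<Longrightarrow> S i \<subseteq> S (Suc i)"
  shows "\<exists>N. onb H d d N (carrier_vec d) \<and> (\<forall>i\<in>{1..m}. S i = (\<lambda>c. N *\<^sub>v c) ` coords d (cdim d (S i)))"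
proof -
  \<comment> \<open>The flag is completed by 0 at the bottom and by the whole space at the top, so
    that the adapted basis becomes a basis of the whole space.\<close>
  define S' where "S' i = (if i = 0 then {0\<^sub>v d} else if i \<le> m then S i else carrier_vec d)" for i
  have "csub d (S' i)" for i using S by (auto simp: S'_def)
  moreover have "S' i \<subseteq> S' (Suc i)" for i
    using S[of 1] S[of i] mono[of i] by (auto simp: S'_def dest: csubD)
  ultimately obtain k N x where N: "onb H d k N (S' (Suc m))"
    and x: "\<forall>i\<le>Suc m. x i \<le> k \<and> S' i = (\<lambda>c. N *\<^sub>v c) ` coords k (x i)"
    using adapted_onb_aux[OF H, of "Suc m" S'] by blast
  have Hc: "H \<in> carrier_mat d d" using H by (simp add: posdef_def)
  have N': "onb H d k N (carrier_vec d)" using N by (simp add: S'_def)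
  then have k: "k = d" by (rule onb_carrier_dim[OF Hc])
  have "S i = (\<lambda>c. N *\<^sub>v c) ` coords d (cdim d (S i))" if i: "i \<in> {1..m}" for i
  proof -
    have "S' i = S i" using i by (simp add: S'_def)
    then have "x i \<le> d" "S i = (\<lambda>c. N *\<^sub>v c) ` coords d (x i)" using x[rule_format, of i] i k by simp_all
    moreover from this have "cdim d (S i) = x i" using cdim_eq[OF Hc onb_first_cols[OF Hc N', of "x i"]] k by simp
    ultimately show ?thesis by simp
  qed
  then show ?thesis using N' k by blast
qed

text \<open>Positions that must vanish for a \<open>u\<close> by \<open>d\<close> matrix, written in
  adapted bases, to map the flag with dimensions \<open>x\<close> into the flag with dimensions
  \<open>y\<close>. Their number is the number of linear conditions imposed by one branch.\<close>

definition lower_entries :: "nat \<Rightarrow> (nat \<Rightarrow> nat) \<Rightarrow> (nat \<Rightarrow> nat) \<Rightarrow> nat \<Rightarrow> nat \<Rightarrow> (nat \<times> nat) set" where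
  "lower_entries m x y u d = {(r, c). r < u \<and> c < d \<and> (\<exists>i\<in>{1..m}. c < x i \<and> y i \<le> r)}"

lemma finite_lower_entries [simp]: "finite (lower_entries m x y u d)"
  by (rule finite_subset[of _ "{..<u} \<times> {..<d}"]) (auto simp: lower_entries_def)

text \<open>A column \<open>c\<close> with \<open>x (i - 1) \<le> c < x i\<close> is constrained
  from row \<open>y i\<close> on: among all \<open>i\<close> with \<open>c < x i\<close> the
  smallest gives the strongest condition, because \<open>y\<close> grows. Hence the blocks of
  columns contribute separately.\<close>

lemma card_lower_entries:
  fixes x y :: "nat \<Rightarrow> nat"
  assumes "x 0 = 0" "\<And>i. i < m \<Longrightarrow> x i \<le> x (Suc i)" "\<And>i. 1 \<le> i \<Longrightarrow> i < m \<Longrightarrow> y i \<le> y (Suc i)"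
    and "\<And>i. i \<in> {1..m} \<Longrightarrow> x i \<le> d \<and> y i \<le> u"
  shows "int (card (lower_entries m x y u d)) = (\<Sum>i=1..m. (int (x i) - int (x (i - 1))) * (int u - int (y i)))"
  using assms
proof (induction m)
  case 0
  have "lower_entries 0 x y u d = {}" by (auto simp: lower_entries_def)
  then show ?case by simp
next
  case (Suc m)
  have mx: "x i \<le> x m" if "i \<le> m" for i
    using that by (induction rule: dec_induct) (use Suc.prems(2) in \<open>auto intro: order_trans\<close>)
  have my: "y i \<le> y (Suc m)" if "1 \<le> i" "i \<le> Suc m" for i
    using that(2,1)
  proof (induction rule: inc_induct)
    case (step n) then show ?case using Suc.prems(3)[of n] by auto
  qed simp
  have "lower_entries (Suc m) x y u d = lower_entries m x y u d \<union> {y (Suc m)..<u} \<times> {x m..<x (Suc m)}"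
  proof (intro equalityI subsetI)
    fix p assume "p \<in> lower_entries (Suc m) x y u d"
    then obtain r c i where p: "p = (r, c)" "r < u" "c < d" "1 \<le> i" "i \<le> Suc m" "c < x i" "y i \<le> r"
      by (auto simp: lower_entries_def)
    show "p \<in> lower_entries m x y u d \<union> {y (Suc m)..<u} \<times> {x m..<x (Suc m)}"
    proof (cases "i \<le> m")
      case True then show ?thesis using p by (auto simp: lower_entries_def)
    next
      case False
      then have i: "i = Suc m" using p by simp
      show ?thesis
      proof (cases "c < x m")
        case True
        then have "m \<ge> 1" using Suc.prems(1) by (cases m) auto
        moreover have "y m \<le> r" using my[of m] \<open>m \<ge> 1\<close> p i by auto
        ultimately show ?thesis using p True by (auto simp: lower_entries_def)
      qed (use p i in auto)
    qed
  next
    fix p assume "p \<in> lower_entries m x y u d \<union> {y (Suc m)..<u} \<times> {x m..<x (Suc m)}"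
    then show "p \<in> lower_entries (Suc m) x y u d"
      using Suc.prems(4)[of "Suc m"] by (fastforce simp: lower_entries_def)
  qed
  moreover have "lower_entries m x y u d \<inter> {y (Suc m)..<u} \<times> {x m..<x (Suc m)} = {}"
    using mx by (fastforce simp: lower_entries_def)
  ultimately have "int (card (lower_entries (Suc m) x y u d)) =
      int (card (lower_entries m x y u d)) + (int (x (Suc m)) - int (x m)) * (int u - int (y (Suc m)))"
    using Suc.prems(2)[of m] Suc.prems(4)[of "Suc m"]
    by (simp add: card_Un_disjoint card_cartesian_product of_nat_diff)
  moreover have "int (card (lower_entries m x y u d)) = (\<Sum>i=1..m. (int (x i) - int (x (i - 1))) * (int u - int (y i)))"
    by (rule Suc.IH) (use Suc.prems in auto)
  ultimately show ?case by simp
qed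

text \<open>Summation by parts: the contribution of a branch to the antisymmetrised Euler form is
  linear in \<open>y\<close>, with coefficients \<open>x (Suc i) - x (i - 1)\<close>. These are the
  canonical weights; when \<open>x (Suc m) = d\<close>, the boundary term with \<open>y m\<close>
  drops out.\<close>

lemma euler_form_difference:
  fixes x y :: "nat \<Rightarrow> int"
  assumes "x 0 = 0" "y 0 = 0"
  shows "(\<Sum>i=1..m. (x i - x (i - 1)) * (u - y i)) - (\<Sum>i=1..m. (y i - y (i - 1)) * (d - x i)) =
    x m * u - y m * (d - x (Suc m)) - (\<Sum>i=1..m. y i * (x (Suc i) - x (i - 1)))"
proof (induction m)
  case (Suc m) then show ?case by (simp add: algebra_simps)
qed (use assms in simp)

text \<open>In the bases \<open>B\<close> and \<open>C\<close> the map becomes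
  \<open>Ci * (\<Phi> * B)\<close>; sending the first \<open>x\<close> coordinates into the first
  \<open>y\<close> means that its lower left block is zero.\<close>

lemma maps_coords_iff:
  fixes \<Phi> :: "complex mat"
  assumes \<Phi>: "\<Phi> \<in> carrier_mat u d" and B: "B \<in> carrier_mat d d" and C: "C \<in> carrier_mat u u" "Ci \<in> carrier_mat u u"
    and inv: "C * Ci = 1\<^sub>m u" "Ci * C = 1\<^sub>m u" and x: "x \<le> d"
  shows "(\<forall>v\<in>(\<lambda>c. B *\<^sub>v c) ` coords d x. \<Phi> *\<^sub>v v \<in> (\<lambda>c. C *\<^sub>v c) ` coords u y) \<longleftrightarrow>
    (\<forall>r<u. \<forall>c<x. y \<le> r \<longrightarrow> (Ci * (\<Phi> * B)) $$ (r, c) = 0)"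
proof -
  define M where "M = Ci * (\<Phi> * B)"
  have M: "M \<in> carrier_mat u d" using \<Phi> B C by (auto simp: M_def)
  have CM: "\<Phi> *\<^sub>v (B *\<^sub>v a) = C *\<^sub>v (M *\<^sub>v a)" if a: "a \<in> carrier_vec d" for a
  proof -
    have "C *\<^sub>v (M *\<^sub>v a) = (C * M) *\<^sub>v a" using C M a by simp
    also have "C * M = \<Phi> * B" 
      using assoc_mult_mat[of C u u Ci u "\<Phi> * B" d] inv(1) C \<Phi> B by (simp add: M_def)
    also have "\<Phi> * B *\<^sub>v a = \<Phi> *\<^sub>v (B *\<^sub>v a)" using \<Phi> B a by simp
    finally show ?thesis by simp
  qed
  have iff: "\<Phi> *\<^sub>v (B *\<^sub>v a) \<in> (\<lambda>c. C *\<^sub>v c) ` coords u y \<longleftrightarrow> M *\<^sub>v a \<in> coords u y" if a: "a \<in> carrier_vec d" for a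
  proof
    assume "\<Phi> *\<^sub>v (B *\<^sub>v a) \<in> (\<lambda>c. C *\<^sub>v c) ` coords u y"
    then obtain c where c: "c \<in> coords u y" "C *\<^sub>v (M *\<^sub>v a) = C *\<^sub>v c" using CM[OF a] by auto
    have inj: "Ci *\<^sub>v (C *\<^sub>v z) = z" if "z \<in> carrier_vec u" for z
      using that C inv by (simp flip: assoc_mult_mat_vec[of _ u u _ u])
    have "M *\<^sub>v a = c" using inj[of "M *\<^sub>v a"] inj[of c] c mult_mat_vec_carrier[OF M a] by (auto simp: coords_def)
    then show "M *\<^sub>v a \<in> coords u y" using c by simp
  qed (simp add: CM[OF a])
  have "(\<forall>v\<in>(\<lambda>c. B *\<^sub>v c) ` coords d x. \<Phi> *\<^sub>v v \<in> (\<lambda>c. C *\<^sub>v c) ` coords u y) \<longleftrightarrow>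
      (\<forall>a\<in>coords d x. M *\<^sub>v a \<in> coords u y)"
    using iff by (auto simp: coords_def)
  also have "\<dots> \<longleftrightarrow> (\<forall>r<u. \<forall>c<x. y \<le> r \<longrightarrow> M $$ (r, c) = 0)"
  proof (intro iffI allI impI ballI)
    fix r c assume h: "\<forall>a\<in>coords d x. M *\<^sub>v a \<in> coords u y" and rc: "r < u" "c < x" "y \<le> r"
    have "unit_vec d c \<in> coords d x" using rc by (auto simp: coords_def)
    then have "M *\<^sub>v unit_vec d c \<in> coords u y" using h by blast
    then have "col M c $ r = 0" using mult_unit_vec_col[OF M, of c] rc x by (auto simp: coords_def)
    then show "M $$ (r, c) = 0" using rc x M by simp
  next
    fix a assume h: "\<forall>r<u. \<forall>c<x. y \<le> r \<longrightarrow> M $$ (r, c) = 0" and a: "a \<in> coords d x"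
    then have ac: "a \<in> carrier_vec d" by (simp add: coords_def)
    have "(M *\<^sub>v a) $ r = 0" if r: "r < u" "y \<le> r" for r
      unfolding mult_mat_vec_sum[OF M ac r(1)]
    proof (intro sum.neutral ballI)
      fix c assume "c \<in> {..<d}"
      then show "M $$ (r, c) * a $ c = 0" using h a r by (cases "c < x") (auto simp: coords_def)
    qed
    then show "M *\<^sub>v a \<in> coords u y" using mult_mat_vec_carrier[OF M ac] by (auto simp: coords_def)
  qed
  finally show ?thesis by (simp add: M_def)
qed

text \<open>Displays an entry of the transformed matrix as an explicit linear functional of the
  entries \<open>z\<close>, which turns vanishing conditions into a linear system.\<close>

lemma index_conjugated_mat:
  fixes z :: "nat \<times> nat \<Rightarrow> complex"
  assumes "C \<in> carrier_mat u u" "B \<in> carrier_mat d d" "r < u" "c < d"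
  shows "(C * (mat u d z * B)) $$ (r, c) = (\<Sum>pq\<in>{..<u} \<times> {..<d}. C $$ (r, fst pq) * B $$ (snd pq, c) * z pq)"
proof -
  have "(C * (mat u d z * B)) $$ (r, c) = (\<Sum>p<u. C $$ (r, p) * (\<Sum>q<d. z (p, q) * B $$ (q, c)))"
  proof -
    have "(mat u d z * B) $$ (p, c) = (\<Sum>q<d. z (p, q) * B $$ (q, c))" if "p < u" for p
      using index_mult_mat_sum[of "mat u d z" u d B d p c] assms that by simp
    moreover have "(C * (mat u d z * B)) $$ (r, c) = (\<Sum>p<u. C $$ (r, p) * (mat u d z * B) $$ (p, c))"
      by (rule index_mult_mat_sum[of _ u u _ d]) (use assms in auto)
    ultimately show ?thesis by simp
  qed
  also have "\<dots> = (\<Sum>p<u. \<Sum>q<d. C $$ (r, p) * B $$ (q, c) * z (p, q))"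
    by (simp add: sum_distrib_left mult_ac)
  also have "\<dots> = (\<Sum>pq\<in>{..<u} \<times> {..<d}. C $$ (r, fst pq) * B $$ (snd pq, c) * z pq)"
    by (simp add: sum.cartesian_product split_def)
  finally show ?thesis .
qed

section \<open>Dimension vectors, the Euler form inequalities and stability\<close>

locale rigid_star_rep = strict_star_rep +
  assumes ind: "indecomposable_rep Q X" and rigid: "rigid_rep Q X"
begin

lemma V_adapted:
  assumes j: "j < length ms" and H: "posdef d H"
  shows "\<exists>N. onb H d d N (carrier_vec d) \<and> (\<forall>i\<in>{1..ms ! j}. V j i = (\<lambda>c. N *\<^sub>v c) ` coords d (cdim d (V j i)))"
  by (rule adapted_onb[OF H]) (use V_csub[OF j] V_step[OF j] in auto)

text \<open>The dimension vector along branch \<open>j\<close>, completed by 0 before the chain and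
  by \<open>d\<close> after it, so that differences of neighbours make sense at both ends.\<close>

definition xd :: "nat \<Rightarrow> nat \<Rightarrow> nat" where
  "xd j i = (if i = 0 then 0 else if i \<le> ms ! j then cdim d (V j i) else d)"

text \<open>The flag induced on the span of the columns of \<open>E\<close>, expressed in the
  coordinates given by these columns.\<close>

definition preV :: "complex mat \<Rightarrow> nat \<Rightarrow> nat \<Rightarrow> complex vec set" where
  "preV E j i = {a \<in> carrier_vec (dim_col E). E *\<^sub>v a \<in> V j i}"

definition yd :: "complex mat \<Rightarrow> nat \<Rightarrow> nat \<Rightarrow> nat" where
  "yd E j i = (if i = 0 then 0 else cdim (dim_col E) (preV E j i))"

lemma xd_eq: "i \<in> {1..ms ! j} \<Longrightarrow> xd j i = cdim d (V j i)"
  by (auto simp: xd_def)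

lemma xd_0 [simp]: "xd j 0 = 0" and xd_top [simp]: "xd j (Suc (ms ! j)) = d" and yd_0 [simp]: "yd E j 0 = 0"
  by (auto simp: xd_def yd_def)

lemma xd_le: "j < length ms \<Longrightarrow> xd j i \<le> d"
  using cdim_le[OF V_csub] by (auto simp: xd_def)

lemma xd_mono: "j < length ms \<Longrightarrow> xd j i \<le> xd j (Suc i)"
  using cdim_mono[OF V_csub V_csub V_step, of j i] cdim_le[OF V_csub, of j i] by (auto simp: xd_def)

context
  fixes E u
  assumes E: "E \<in> carrier_mat d u" and EE: "adj E * E = 1\<^sub>m u"
begin

lemma dimE [simp]: "dim_col E = u"
  using E by simp

lemma preV_csub: "j < length ms \<Longrightarrow> i \<in> {1..ms ! j} \<Longrightarrow> csub u (preV E j i)"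
  using csubD[OF V_csub, of j i] E
  by (auto simp: csub_def preV_def mult_add_distrib_mat_vec[OF E] mult_mat_vec[OF E] mult_mat_vec_zero[OF E])

lemma preV_step: "j < length ms \<Longrightarrow> 1 \<le> i \<Longrightarrow> Suc i \<le> ms ! j \<Longrightarrow> preV E j i \<subseteq> preV E j (Suc i)"
  using V_step[of j i] by (auto simp: preV_def)

lemma preV_adapted:
  assumes j: "j < length ms"
  shows "\<exists>N. onb (1\<^sub>m u) u u N (carrier_vec u) \<and> (\<forall>i\<in>{1..ms ! j}. preV E j i = (\<lambda>c. N *\<^sub>v c) ` coords u (yd E j i))"
  using adapted_onb[OF posdef_one, of "ms ! j" u "preV E j"] preV_csub[OF j] preV_step[OF j]
  by (auto simp: yd_def)

lemma yd_le: "j < length ms \<Longrightarrow> i \<in> {1..ms ! j} \<Longrightarrow> yd E j i \<le> u"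
  using cdim_le[OF preV_csub] by (auto simp: yd_def)

lemma yd_mono: "j < length ms \<Longrightarrow> Suc i \<le> ms ! j \<Longrightarrow> yd E j i \<le> yd E j (Suc i)"
  using cdim_mono[OF preV_csub preV_csub preV_step, of j i] by (auto simp: yd_def)

text \<open>\<open>E\<close> is an isometry onto its image, so it carries an orthonormal basis of
  the preimage to one of the intersection.\<close>

lemma yd_eq:
  assumes "j < length ms" "i \<in> {1..ms ! j}"
  shows "yd E j i = cdim d (V j i \<inter> mimg E)"
proof -
  obtain k N where N: "onb (1\<^sub>m u) u k N (preV E j i)" using onb_exists[OF posdef_one preV_csub[OF assms]] by blast
  then have Nc: "N \<in> carrier_mat u k" and NN: "adj N * N = 1\<^sub>m k" and NV: "mimg N = preV E j i"
    by (auto simp: onb_def)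
  have EN: "E * N \<in> carrier_mat d k" using E Nc by simp
  have "onb (1\<^sub>m d) d k (E * N) (V j i \<inter> mimg E)"
    unfolding onb_def
  proof (intro conjI)
    have "adj (E * N) * (1\<^sub>m d * (E * N)) = adj N * (adj E * E * N)"
      using E Nc adj_mult[OF E Nc] by (simp add: mult_assoc_dim)
    then show "adj (E * N) * (1\<^sub>m d * (E * N)) = 1\<^sub>m k" using EE Nc NN by simp
    show "mimg (E * N) = V j i \<inter> mimg E"
    proof (intro equalityI subsetI)
      fix y assume "y \<in> mimg (E * N)"
      then obtain c where c: "c \<in> carrier_vec k" "y = E * N *\<^sub>v c" using mimg_iff[OF EN] by auto
      have "N *\<^sub>v c \<in> preV E j i" using mimgI[OF Nc c(1)] NV by simp
      then show "y \<in> V j i \<inter> mimg E"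
        using c assoc_mult_mat_vec[OF E Nc c(1)] mimgI[OF E] by (auto simp: preV_def)
    next
      fix y assume y: "y \<in> V j i \<inter> mimg E"
      then obtain a where a: "a \<in> carrier_vec u" "y = E *\<^sub>v a" using mimg_iff[OF E] by auto
      then have "a \<in> mimg N" using y NV by (auto simp: preV_def)
      then obtain c where "c \<in> carrier_vec k" "a = N *\<^sub>v c" using mimg_iff[OF Nc] by auto
      then show "y \<in> mimg (E * N)" using a mimgI[OF EN] assoc_mult_mat_vec[OF E Nc] by auto
    qed
  qed (use EN in auto)
  then have "cdim d (V j i \<inter> mimg E) = k" by (intro cdim_eq[of "1\<^sub>m d"]) auto
  moreover have "yd E j i = k" using cdim_eq[OF _ N] assms by (auto simp: yd_def)
  ultimately show ?thesis by simp
qed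

text \<open>A subspace \<open>U\<close> with basis \<open>E\<close> has a nonzero map to \<open>X\<close> and \<open>Ext(U, X) = 0\<close>.\<close>

lemma euler_form_sub_pos:
  assumes u: "0 < u"
  shows "(\<Sum>j<length ms. card (lower_entries (ms ! j) (yd E j) (xd j) d u)) < d * u"
proof -
  let ?n = "length ms"
  have "\<exists>N. j < ?n \<longrightarrow> onb (1\<^sub>m d) d d N (carrier_vec d) \<and> (\<forall>i\<in>{1..ms ! j}. V j i = (\<lambda>c. N *\<^sub>v c) ` coords d (cdim d (V j i)))" for j
    using V_adapted[OF _ posdef_one] by blast
  then obtain B where B: "\<And>j. j < ?n \<Longrightarrow> onb (1\<^sub>m d) d d (B j) (carrier_vec d)"
    and BV: "\<And>j i. j < ?n \<Longrightarrow> i \<in> {1..ms ! j} \<Longrightarrow> V j i = (\<lambda>c. B j *\<^sub>v c) ` coords d (xd j i)"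
    by (metis xd_eq)
  have "\<exists>N. j < ?n \<longrightarrow> onb (1\<^sub>m u) u u N (carrier_vec u) \<and> (\<forall>i\<in>{1..ms ! j}. preV E j i = (\<lambda>c. N *\<^sub>v c) ` coords u (yd E j i))" for j
    using preV_adapted by blast
  then obtain C where C: "\<And>j. j < ?n \<Longrightarrow> onb (1\<^sub>m u) u u (C j) (carrier_vec u)"
    and CV: "\<And>j i. j < ?n \<Longrightarrow> i \<in> {1..ms ! j} \<Longrightarrow> preV E j i = (\<lambda>c. C j *\<^sub>v c) ` coords u (yd E j i)"
    by metis
  note Bi = onb_inverse[OF one_carrier_mat B] and Ci = onb_inverse[OF one_carrier_mat C]
  define Bv where "Bv j = adj (B j) * 1\<^sub>m d" for j
  define Cv where "Cv j = adj (C j) * 1\<^sub>m u" for j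
  note Bi = Bi[folded Bv_def] and Ci = Ci[folded Cv_def]
  let ?L = "\<lambda>j. lower_entries (ms ! j) (yd E j) (xd j) d u"
  define J where "J = Sigma {..<?n} ?L"
  have fJ: "finite J" by (auto simp: J_def)
  define K where "K jrc pq = Bv (fst jrc) $$ (fst (snd jrc), fst pq) * C (fst jrc) $$ (snd pq, snd (snd jrc))"
    for jrc :: "nat \<times> nat \<times> nat" and pq :: "nat \<times> nat"
  have Ksum: "(\<Sum>pq\<in>{..<d} \<times> {..<u}. K (j, r, c) pq * z pq) = (Bv j * (mat d u z * C j)) $$ (r, c)"
    if "j < ?n" "r < d" "c < u" for j r c z
    using index_conjugated_mat[OF Bi(2)[OF that(1)] Ci(1)[OF that(1)] that(2,3), of z] by (simp add: K_def)
  \<comment> \<open>Since \<open>u\<close> is positive, \<open>E\<close> has a first column; its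
    norm is 1, so some entry is nonzero. The entry certifies below that the kernel vector
    \<open>E\<close> is not zero.\<close>
  obtain p where p: "p < d" "E $$ (p, 0) \<noteq> 0"
  proof (rule ccontr)
    assume "\<not> thesis"
    then have "E $$ (p, 0) = 0" if "p < d" for p using \<open>\<And>p. p < d \<Longrightarrow> E $$ (p, 0) \<noteq> 0 \<Longrightarrow> thesis\<close> that by blast
    then have "(adj E * E) $$ (0, 0) = 0"
      using index_mult_mat_sum[of "adj E" u d E u 0 0] E u by simp
    then show False using EE u by simp
  qed
  have "card J < card ({..<d} \<times> {..<u})"
  proof (rule surjective_system_card_less[where K = K])
    fix b :: "nat \<times> nat \<times> nat \<Rightarrow> complex"
    \<comment> \<open>The prescribed right-hand side \<open>b\<close>, read as one matrix per branch
      in the adapted bases and moved back to the standard ones.\<close>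
    define c where "c j = B j * (mat d u (\<lambda>rc. b (j, rc)) * Cv j)" for j
    have cc: "c j \<in> carrier_mat d u" if "j < ?n" for j
      using Bi(1)[OF that] Ci(2)[OF that] by (auto simp: c_def)
    \<comment> \<open>\<open>c j * adj E\<close> extends \<open>c j\<close> from the subspace to the
      whole space because \<open>adj E * E = 1\<close>. In this way the vanishing of Ext(X, X)
      passes to Ext(U, X).\<close>
    have "\<exists>\<phi>\<in>carrier_mat d d. \<forall>j<?n. \<forall>i\<in>{1..ms ! j}. \<forall>x\<in>V j i. (\<phi> - c j * adj E) *\<^sub>v x \<in> V j i"
    proof (rule rigid_stabilizers[OF rigid])
      fix j assume "j < ?n"
      then show "c j * adj E \<in> carrier_mat d d" using cc[of j] E by auto
    qed
    then obtain \<phi> where \<phi>: "\<phi> \<in> carrier_mat d d"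
      and \<phi>V0: "\<forall>j<?n. \<forall>i\<in>{1..ms ! j}. \<forall>x\<in>V j i. (\<phi> - c j * adj E) *\<^sub>v x \<in> V j i"
      by (elim bexE)
    have \<phi>V: "(\<phi> - c j * adj E) *\<^sub>v x \<in> V j i" if "j < ?n" "i \<in> {1..ms ! j}" "x \<in> V j i" for j i x
      by (rule \<phi>V0[rule_format, OF that])
    define z where "z pq = (\<phi> * E) $$ pq" for pq
    have z: "mat d u z = \<phi> * E" using \<phi> E by (intro eq_matI) (auto simp: z_def)
    have "(\<Sum>pq\<in>{..<d} \<times> {..<u}. K jrc pq * z pq) = b jrc" if "jrc \<in> J" for jrc
    proof -
      obtain j r s where jrs: "jrc = (j, r, s)" by (cases jrc)
      with that have j: "j < ?n" and rs: "(r, s) \<in> ?L j" by (auto simp: J_def)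
      then obtain i where i: "r < d" "s < u" "i \<in> {1..ms ! j}" "s < yd E j i" "xd j i \<le> r"
        by (auto simp: lower_entries_def)
      note cj = cc[OF j]
      have D: "\<phi> * E - c j \<in> carrier_mat d u" using cj \<phi> E by (intro minus_carrier_mat)
      have "(\<phi> * E - c j) *\<^sub>v a \<in> V j i" if a: "a \<in> preV E j i" for a
      proof -
        have ac: "a \<in> carrier_vec u" "E *\<^sub>v a \<in> V j i" using a by (auto simp: preV_def)
        have "(\<phi> - c j * adj E) * E = \<phi> * E - c j"
          using \<phi> E cj EE by (simp add: minus_mult_distrib_dim mult_assoc_dim)
        moreover have "\<phi> - c j * adj E \<in> carrier_mat d d" using cj E by (intro minus_carrier_mat) auto
        ultimately have "(\<phi> * E - c j) *\<^sub>v a = (\<phi> - c j * adj E) *\<^sub>v (E *\<^sub>v a)"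
          using assoc_mult_mat_vec[OF _ E ac(1)] by metis
        then show ?thesis using \<phi>V[OF j i(3) ac(2)] by simp
      qed
      then have "\<forall>v\<in>(\<lambda>c. C j *\<^sub>v c) ` coords u (yd E j i). (\<phi> * E - c j) *\<^sub>v v \<in> (\<lambda>c. B j *\<^sub>v c) ` coords d (xd j i)"
        using CV[OF j i(3)] BV[OF j i(3)] by simp
      then have "(Bv j * ((\<phi> * E - c j) * C j)) $$ (r, s) = 0"
        using maps_coords_iff[OF D Ci(1)[OF j] Bi(1,2)[OF j] Bi(4,3)[OF j] yd_le[OF j i(3)]] i by blast
      also have "Bv j * ((\<phi> * E - c j) * C j) = Bv j * (\<phi> * E * C j) - Bv j * (c j * C j)"
        using Bi(2)[OF j] Ci(1)[OF j] cj \<phi> E by (simp add: minus_mult_distrib_dim mult_minus_distrib_dim)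
      also have "Bv j * (c j * C j) = (Bv j * B j) * (mat d u (\<lambda>rc. b (j, rc)) * (Cv j * C j))"
        using Bi(1,2)[OF j] Ci(1,2)[OF j] by (simp add: c_def mult_assoc_dim)
      also have "\<dots> = mat d u (\<lambda>rc. b (j, rc))" unfolding Bi(3)[OF j] Ci(3)[OF j] by simp
      finally have "(Bv j * (\<phi> * E * C j)) $$ (r, s) = b (j, r, s)"
        using i Bi(2)[OF j] Ci(1)[OF j] \<phi> E by (simp del: index_mult_mat(1))
      then show ?thesis using Ksum[OF j i(1,2), of z] z by (simp add: jrs)
    qed
    then show "\<exists>x. \<forall>jrc\<in>J. (\<Sum>pq\<in>{..<d} \<times> {..<u}. K jrc pq * x pq) = b jrc" by blast
  next
    \<comment> \<open>The inclusion \<open>E\<close> is itself a homomorphism, hence a nonzero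
      solution of the homogeneous system; this makes the count strict.\<close>
    have "mat d u (\<lambda>pq. E $$ pq) = E" using E by (intro eq_matI) auto
    have "(\<Sum>pq\<in>{..<d} \<times> {..<u}. K jrc pq * E $$ pq) = 0" if "jrc \<in> J" for jrc
    proof -
      obtain j r s where jrs: "jrc = (j, r, s)" by (cases jrc)
      with that have j: "j < ?n" and rs: "(r, s) \<in> ?L j" by (auto simp: J_def)
      then obtain i where i: "r < d" "s < u" "i \<in> {1..ms ! j}" "s < yd E j i" "xd j i \<le> r"
        by (auto simp: lower_entries_def)
      have "\<forall>v\<in>(\<lambda>c. C j *\<^sub>v c) ` coords u (yd E j i). E *\<^sub>v v \<in> (\<lambda>c. B j *\<^sub>v c) ` coords d (xd j i)"
        using CV[OF j i(3), symmetric] BV[OF j i(3), symmetric] by (auto simp: preV_def)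
      then have "(Bv j * (E * C j)) $$ (r, s) = 0"
        using maps_coords_iff[OF E Ci(1)[OF j] Bi(1,2)[OF j] Bi(4,3)[OF j] yd_le[OF j i(3)]] i by blast
      then show ?thesis using Ksum[OF j i(1,2), of "\<lambda>pq. E $$ pq"] \<open>mat d u _ = E\<close> by (simp add: jrs)
    qed
    then show "\<forall>jrc\<in>J. (\<Sum>pq\<in>{..<d} \<times> {..<u}. K jrc pq * E $$ pq) = 0" by blast
    show "(p, 0) \<in> {..<d} \<times> {..<u}" using p u by simp
    show "E $$ (p, 0) \<noteq> 0" by fact
  qed (use fJ in auto)
  then show ?thesis by (simp add: J_def)
qed

text \<open>The entries of \<Phi> are \<open>d * u\<close> unknowns. Preserving the flags costs one
  equation per lower entry, and \<open>R\<close> lists further entries required to vanish. If only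
  \<Phi> = 0 remains, there are at least as many equations as unknowns. \<open>R\<close> will be
  empty for a proper subspace and a single position for the whole space.\<close>

lemma hom_to_sub_count:
  assumes R: "R \<subseteq> {..<u} \<times> {..<d}"
    and inj: "\<And>\<Phi>. \<Phi> \<in> carrier_mat u d \<Longrightarrow> stabilizes (E * \<Phi>) \<Longrightarrow> \<forall>pq\<in>R. \<Phi> $$ pq = 0 \<Longrightarrow> \<Phi> = 0\<^sub>m u d"
  shows "d * u \<le> (\<Sum>j<length ms. card (lower_entries (ms ! j) (xd j) (yd E j) u d)) + card R"
proof -
  let ?n = "length ms"
  have "\<exists>N. j < ?n \<longrightarrow> onb (1\<^sub>m d) d d N (carrier_vec d) \<and> (\<forall>i\<in>{1..ms ! j}. V j i = (\<lambda>c. N *\<^sub>v c) ` coords d (cdim d (V j i)))" for j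
    using V_adapted[OF _ posdef_one] by blast
  then obtain B where B: "\<And>j. j < ?n \<Longrightarrow> onb (1\<^sub>m d) d d (B j) (carrier_vec d)"
    and BV: "\<And>j i. j < ?n \<Longrightarrow> i \<in> {1..ms ! j} \<Longrightarrow> V j i = (\<lambda>c. B j *\<^sub>v c) ` coords d (xd j i)"
    by (metis xd_eq)
  have "\<exists>N. j < ?n \<longrightarrow> onb (1\<^sub>m u) u u N (carrier_vec u) \<and> (\<forall>i\<in>{1..ms ! j}. preV E j i = (\<lambda>c. N *\<^sub>v c) ` coords u (yd E j i))" for j
    using preV_adapted by blast
  then obtain C where C: "\<And>j. j < ?n \<Longrightarrow> onb (1\<^sub>m u) u u (C j) (carrier_vec u)"
    and CV: "\<And>j i. j < ?n \<Longrightarrow> i \<in> {1..ms ! j} \<Longrightarrow> preV E j i = (\<lambda>c. C j *\<^sub>v c) ` coords u (yd E j i)"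
    by metis
  note Bi = onb_inverse[OF one_carrier_mat B] and Ci = onb_inverse[OF one_carrier_mat C]
  define Cv where "Cv j = adj (C j) * 1\<^sub>m u" for j
  note Ci = Ci[folded Cv_def]
  let ?L = "\<lambda>j. lower_entries (ms ! j) (xd j) (yd E j) u d"
  define J where "J = Sigma {..<?n} ?L"
  have fJ: "finite J" by (auto simp: J_def)
  have fR: "finite R" by (rule finite_subset[OF R]) simp
  define K where "K jrc pq = Cv (fst jrc) $$ (fst (snd jrc), fst pq) * B (fst jrc) $$ (snd pq, snd (snd jrc))"
    for jrc :: "nat \<times> nat \<times> nat" and pq :: "nat \<times> nat"
  have Ksum: "(\<Sum>pq\<in>{..<u} \<times> {..<d}. K (j, r, c) pq * z pq) = (Cv j * (mat u d z * B j)) $$ (r, c)"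
    if "j < ?n" "r < u" "c < d" for j r c z
    using index_conjugated_mat[OF Ci(2)[OF that(1)] Bi(1)[OF that(1)] that(2,3), of z] by (simp add: K_def)
  have "card ({..<u} \<times> {..<d}) \<le> card (J <+> R)"
  proof (rule injective_system_card_le[where K = "\<lambda>l pq. case l of Inl jrc \<Rightarrow> K jrc pq | Inr rs \<Rightarrow> (if pq = rs then 1 else 0)"])
    fix z assume h0: "\<forall>l\<in>J <+> R. (\<Sum>pq\<in>{..<u} \<times> {..<d}.
      (case l of Inl jrc \<Rightarrow> K jrc pq | Inr rs \<Rightarrow> (if pq = rs then 1 else 0)) * z pq) = 0"
    have h: "(\<Sum>pq\<in>{..<u} \<times> {..<d}. K jrc pq * z pq) = 0" if "jrc \<in> J" for jrc
      using h0[rule_format, OF InlI[OF that]] by simp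
    have zR: "z rs = 0" if rs: "rs \<in> R" for rs
    proof -
      have "(\<Sum>pq\<in>{..<u} \<times> {..<d}. (if pq = rs then 1 else 0) * z pq) = 0"
        using h0[rule_format, OF InrI[OF rs]] by simp
      moreover have "(\<Sum>pq\<in>{..<u} \<times> {..<d}. (if pq = rs then 1 else 0) * z pq) =
          (\<Sum>pq\<in>{..<u} \<times> {..<d}. if pq = rs then z pq else 0)" by (rule sum.cong) auto
      ultimately show ?thesis using rs R by (auto simp: sum.delta split: if_splits)
    qed
    define \<Phi> where "\<Phi> = mat u d z"
    have \<Phi>: "\<Phi> \<in> carrier_mat u d" by (simp add: \<Phi>_def)
    have "stabilizes (E * \<Phi>)"
      unfolding stabilizes_def
    proof (intro conjI allI impI ballI)
      fix j i x assume j: "j < ?n" and i: "i \<in> {1..ms ! j}" and x: "x \<in> V j i"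
      have "(Cv j * (\<Phi> * B j)) $$ (r, c) = 0" if "r < u" "c < xd j i" "yd E j i \<le> r" for r c
      proof -
        have "c < d" using that xd_le[OF j, of i] by simp
        moreover have "(j, r, c) \<in> J" using that i j \<open>c < d\<close> by (auto simp: J_def lower_entries_def)
        ultimately show ?thesis using h[of "(j, r, c)"] Ksum[OF j that(1), of c z] by (simp add: \<Phi>_def)
      qed
      then have "\<forall>v\<in>(\<lambda>c. B j *\<^sub>v c) ` coords d (xd j i). \<Phi> *\<^sub>v v \<in> (\<lambda>c. C j *\<^sub>v c) ` coords u (yd E j i)"
        using maps_coords_iff[OF \<Phi> Bi(1)[OF j] Ci(1,2)[OF j] Ci(4,3)[OF j] xd_le[OF j]] by blast
      then have "\<Phi> *\<^sub>v x \<in> preV E j i" using x BV[OF j i] CV[OF j i] by blast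
      moreover have "x \<in> carrier_vec d" using csubD(5)[OF V_csub x] i j by auto
      ultimately show "E * \<Phi> *\<^sub>v x \<in> V j i"
        using assoc_mult_mat_vec[OF E \<Phi>, of x] by (simp add: preV_def)
    qed (use E \<Phi> in auto)
    moreover have "\<forall>pq\<in>R. \<Phi> $$ pq = 0" using zR R by (auto simp: \<Phi>_def)
    ultimately have "\<Phi> = 0\<^sub>m u d" by (intro inj[OF \<Phi>])
    then have "\<Phi> $$ pq = 0" if "pq \<in> {..<u} \<times> {..<d}" for pq using that by auto
    then show "\<forall>pq\<in>{..<u} \<times> {..<d}. z pq = 0" by (auto simp: \<Phi>_def)
  qed (use fJ fR in auto)
  then show ?thesis using fJ fR by (simp add: J_def mult.commute card_Plus)
qed

text \<open>\<open>X\<close> is a brick, so it has no nonzero map to a proper subspace.\<close>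

lemma euler_form_to_sub:
  assumes u: "u < d"
  shows "d * u \<le> (\<Sum>j<length ms. card (lower_entries (ms ! j) (xd j) (yd E j) u d))"
proof -
  have "\<Phi> = 0\<^sub>m u d" if \<Phi>: "\<Phi> \<in> carrier_mat u d" and st: "stabilizes (E * \<Phi>)" for \<Phi>
  proof -
    obtain x where x: "x \<in> carrier_vec d" "x \<noteq> 0\<^sub>v d" "\<Phi> *\<^sub>v x = 0\<^sub>v u"
      using wide_matrix_kernel[OF \<Phi> u] by blast
    have "E * \<Phi> *\<^sub>v x = 0\<^sub>v d" using assoc_mult_mat_vec[OF E \<Phi> x(1)] x(3) mult_mat_vec_zero[OF E] by simp
    then have "E * \<Phi> = 0\<^sub>m d d" using singular_stabilizer_eq_0[OF ind rigid st] x by blast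
    then have "adj E * (E * \<Phi>) = 0\<^sub>m u d" using E by simp
    then show "\<Phi> = 0\<^sub>m u d" using E \<Phi> EE by (simp flip: mult_assoc_dim)
  qed
  then show ?thesis using hom_to_sub_count[of "{}"] by simp
qed

text \<open>The two counts lie on opposite sides of \<open>d * u\<close>. Their difference is the
  antisymmetrised Euler form, which is linear in the dimensions \<open>yd E\<close>.\<close>

lemma stability_canonical:
  assumes u: "0 < u" "u < d"
  shows "(\<Sum>j<length ms. \<Sum>i=1..ms ! j. int (yd E j i) * (int (xd j (Suc i)) - int (xd j (i - 1)))) <
    (\<Sum>j<length ms. int (xd j (ms ! j)) * int u)"
proof -
  have diff: "int (card (lower_entries (ms ! j) (xd j) (yd E j) u d)) - int (card (lower_entries (ms ! j) (yd E j) (xd j) d u)) =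
      int (xd j (ms ! j)) * int u - (\<Sum>i=1..ms ! j. int (yd E j i) * (int (xd j (Suc i)) - int (xd j (i - 1))))"
    if j: "j < length ms" for j
  proof -
    have "int (card (lower_entries (ms ! j) (xd j) (yd E j) u d)) =
        (\<Sum>i=1..ms ! j. (int (xd j i) - int (xd j (i - 1))) * (int u - int (yd E j i)))"
      by (rule card_lower_entries) (use xd_mono[OF j] yd_mono[OF j] xd_le[OF j] yd_le[OF j] in auto)
    moreover have "int (card (lower_entries (ms ! j) (yd E j) (xd j) d u)) =
        (\<Sum>i=1..ms ! j. (int (yd E j i) - int (yd E j (i - 1))) * (int d - int (xd j i)))"
      by (rule card_lower_entries) (use xd_mono[OF j] yd_mono[OF j] xd_le[OF j] yd_le[OF j] in auto)
    ultimately show ?thesis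
      using euler_form_difference[where x = "\<lambda>i. int (xd j i)" and y = "\<lambda>i. int (yd E j i)" and u = "int u" and m = "ms ! j" and d = "int d"] by simp
  qed
  have "int (\<Sum>j<length ms. card (lower_entries (ms ! j) (yd E j) (xd j) d u)) <
      int (\<Sum>j<length ms. card (lower_entries (ms ! j) (xd j) (yd E j) u d))"
    using euler_form_sub_pos[OF u(1)] euler_form_to_sub[OF u(2)] by linarith
  then have "0 < (\<Sum>j<length ms. int (card (lower_entries (ms ! j) (xd j) (yd E j) u d)) -
      int (card (lower_entries (ms ! j) (yd E j) (xd j) d u)))"
    by (simp add: sum_subtractf)
  also have "\<dots> = (\<Sum>j<length ms. int (xd j (ms ! j)) * int u -
      (\<Sum>i=1..ms ! j. int (yd E j i) * (int (xd j (Suc i)) - int (xd j (i - 1)))))"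
    by (rule sum.cong) (use diff in auto)
  finally show ?thesis by (simp add: sum_subtractf)
qed

end

text \<open>The difference identity for two equal dimension vectors, where its left-hand side is
  zero. It becomes the trace condition for the canonical weight.\<close>

lemma canonical_weight_trace:
  assumes j: "j < length ms"
  shows "(\<Sum>i=1..ms ! j. int (xd j i) * (int (xd j (Suc i)) - int (xd j (i - 1)))) = int (xd j (ms ! j)) * int d"
  using euler_form_difference[where x = "\<lambda>i. int (xd j i)" and y = "\<lambda>i. int (xd j i)" and u = "int d" and m = "ms ! j" and d = "int d"] by simp

text \<open>The whole space serves as its own test subspace, with \<open>E = 1\<close>. The identity
  in the kernel bounds the number of flag conditions strictly below \<open>d * d\<close>. Conversely
  all endomorphisms are scalars, so one more condition, on the entry \<open>(0, 0)\<close>, kills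
  them; this gives the reverse bound.\<close>

lemma euler_form_self:
  "d * d = (\<Sum>j<length ms. card (lower_entries (ms ! j) (xd j) (xd j) d d)) + 1"
proof -
  have d: "0 < d" by (rule dim_pos[OF ind])
  have one: "1\<^sub>m d \<in> carrier_mat d d" "adj (1\<^sub>m d) * 1\<^sub>m d = 1\<^sub>m d" by auto
  have pre: "preV (1\<^sub>m d) j i = V j i" if "j < length ms" "i \<in> {1..ms ! j}" for j i
    using csubD(1)[OF V_csub, of j i] that by (auto simp: preV_def)
  have eq: "lower_entries (ms ! j) (yd (1\<^sub>m d) j) (xd j) d d = lower_entries (ms ! j) (xd j) (xd j) d d"
    "lower_entries (ms ! j) (xd j) (yd (1\<^sub>m d) j) d d = lower_entries (ms ! j) (xd j) (xd j) d d"
    if j: "j < length ms" for j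
    using pre[OF j] by (auto simp: lower_entries_def yd_def xd_def)
  have "(\<Sum>j<length ms. card (lower_entries (ms ! j) (xd j) (xd j) d d)) < d * d"
    using euler_form_sub_pos[OF one d] eq(1) by simp
  moreover have "d * d \<le> (\<Sum>j<length ms. card (lower_entries (ms ! j) (xd j) (yd (1\<^sub>m d) j) d d)) + card {(0::nat, 0::nat)}"
  proof (rule hom_to_sub_count[OF one])
    fix \<Phi> assume \<Phi>: "\<Phi> \<in> carrier_mat d d" and st: "stabilizes (1\<^sub>m d * \<Phi>)" and z: "\<forall>pq\<in>{(0, 0)}. \<Phi> $$ pq = 0"
    obtain c where c: "\<Phi> = c \<cdot>\<^sub>m 1\<^sub>m d" using stabilizer_scalar[OF ind rigid, of \<Phi>] st \<Phi> by auto
    with z d have "c = 0" by simp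
    then show "\<Phi> = 0\<^sub>m d d" using c by (intro eq_matI) auto
  qed (use d in auto)
  ultimately show ?thesis using eq(2) by simp
qed

end

section \<open>Rank-one perturbations of Hermitian forms\<close>

lemma mult_add_distrib_dim:
  fixes A :: "complex mat"
  shows "dim_col A = dim_row B \<Longrightarrow> dim_row C = dim_row B \<Longrightarrow> dim_col C = dim_col B \<Longrightarrow>
    A * (B + C) = A * B + A * C"
  by (rule mult_add_distrib_mat[of _ "dim_row A" "dim_row B" _ "dim_col B"]) auto

lemma add_mult_distrib_dim:
  fixes A :: "complex mat"
  shows "dim_col A = dim_row C \<Longrightarrow> dim_row B = dim_row A \<Longrightarrow> dim_col B = dim_col A \<Longrightarrow>
    (A + B) * C = A * C + B * C"
  by (rule add_mult_distrib_mat[of _ "dim_row A" "dim_col A" _ _ "dim_col C"]) auto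

lemma smult_mat_mult_vec:
  assumes A: "(A :: complex mat) \<in> carrier_mat m n" and x: "x \<in> carrier_vec n"
  shows "(c \<cdot>\<^sub>m A) *\<^sub>v x = c \<cdot>\<^sub>v (A *\<^sub>v x)"
proof (rule eq_vecI)
  fix i assume "i < dim_vec (c \<cdot>\<^sub>v (A *\<^sub>v x))"
  then have i: "i < m" using A by simp
  have "((c \<cdot>\<^sub>m A) *\<^sub>v x) $ i = (\<Sum>j<n. (c \<cdot>\<^sub>m A) $$ (i, j) * x $ j)"
    by (rule mult_mat_vec_sum[OF _ x i]) (use A in simp)
  also have "\<dots> = c * (A *\<^sub>v x) $ i"
    unfolding mult_mat_vec_sum[OF A x i] using A i by (simp add: sum_distrib_left mult_ac)
  finally show "((c \<cdot>\<^sub>m A) *\<^sub>v x) $ i = (c \<cdot>\<^sub>v (A *\<^sub>v x)) $ i" using A i by simp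
qed (use A in simp)

text \<open>Both sides are determinants of block triangular matrices, \<open>?U\<close> and
  \<open>?V\<close>, related by \<open>?L * ?U = ?V * ?L\<close> with
  \<open>det ?L = 1\<close>.\<close>

lemma det_one_plus_mult_comm:
  fixes B :: "complex mat"
  assumes B: "B \<in> carrier_mat k m" and R: "R \<in> carrier_mat m k"
  shows "det (1\<^sub>m k + B * R) = det (1\<^sub>m m + R * B)"
proof -
  let ?L = "four_block_mat (1\<^sub>m k) (0\<^sub>m k m) R (1\<^sub>m m)"
  let ?U = "four_block_mat (1\<^sub>m k + B * R) B (0\<^sub>m m k) (1\<^sub>m m)"
  let ?V = "four_block_mat (1\<^sub>m k) B (0\<^sub>m m k) (1\<^sub>m m + R * B)"
  have BR: "B * R \<in> carrier_mat k k" "R * B \<in> carrier_mat m m" using B R by auto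
  have c: "1\<^sub>m k + B * R \<in> carrier_mat k k" "1\<^sub>m m + R * B \<in> carrier_mat m m" using BR by auto
  have e: "R * (1\<^sub>m k + B * R) = R + R * B * R" "(1\<^sub>m m + R * B) * R = R + R * B * R"
    using B R BR by (simp_all add: mult_add_distrib_dim add_mult_distrib_dim mult_assoc_dim)
  have "?L * ?U = ?V * ?L"
    using B R BR c
    by (subst mult_four_block_mat[OF one_carrier_mat zero_carrier_mat R one_carrier_mat c(1) B zero_carrier_mat one_carrier_mat],
        subst mult_four_block_mat[OF one_carrier_mat B zero_carrier_mat c(2) one_carrier_mat zero_carrier_mat R one_carrier_mat])
       (auto simp: e comm_add_mat[of _ m m] intro!: cong_four_block_mat)
  then have "det (?L * ?U) = det (?V * ?L)" by simp
  moreover have LUV: "?L \<in> carrier_mat (k + m) (k + m)" "?U \<in> carrier_mat (k + m) (k + m)" "?V \<in> carrier_mat (k + m) (k + m)"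
    using B R c by auto
  moreover have "det ?L = 1" by (subst det_four_block_mat_upper_right_zero[of _ k _ m]) (use R in auto)
  moreover have "det ?U = det (1\<^sub>m k + B * R)"
    by (subst det_four_block_mat_lower_left_zero[of _ k _ m]) (use B c in auto)
  moreover have "det ?V = det (1\<^sub>m m + R * B)"
    by (subst det_four_block_mat_lower_left_zero[of _ k _ m]) (use B c in auto)
  ultimately show ?thesis by (simp add: det_mult[of _ "k + m"])
qed

definition rank_one :: "complex vec \<Rightarrow> complex mat" where
  "rank_one w = mat (dim_vec w) (dim_vec w) (\<lambda>(i, j). w $ i * cnj (w $ j))"

lemma rank_one_carrier [simp]: "w \<in> carrier_vec d \<Longrightarrow> rank_one w \<in> carrier_mat d d"
  by (auto simp: rank_one_def)

lemma dim_rank_one [simp]: "dim_row (rank_one w) = dim_vec w" "dim_col (rank_one w) = dim_vec w"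
  by (simp_all add: rank_one_def)

lemma index_rank_one [simp]: "i < dim_vec w \<Longrightarrow> j < dim_vec w \<Longrightarrow> rank_one w $$ (i, j) = w $ i * cnj (w $ j)"
  by (simp add: rank_one_def)

lemma adj_rank_one: "adj (rank_one w) = rank_one w"
  by (rule eq_matI) (auto simp: rank_one_def)

lemma rank_one_mult_vec:
  assumes "w \<in> carrier_vec d" "x \<in> carrier_vec d"
  shows "rank_one w *\<^sub>v x = (x \<bullet>c w) \<cdot>\<^sub>v w"
  using assms by (intro eq_vecI) (auto simp: rank_one_def scalar_prod_def sum_distrib_left sum_distrib_right mult_ac)

text \<open>A rank-one matrix is a column times a row, so the exchange identity reduces the
  determinant to size 1.\<close>

lemma det_one_plus_rank_one:
  assumes y: "y \<in> carrier_vec k"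
  shows "det (1\<^sub>m k + complex_of_real t \<cdot>\<^sub>m rank_one y) = complex_of_real (1 + t * norm_sq y)"
proof -
  define B where "B = mat k 1 (\<lambda>(i, j). complex_of_real t * y $ i)"
  define R where "R = mat 1 k (\<lambda>(i, j). cnj (y $ j))"
  have B: "B \<in> carrier_mat k 1" and R: "R \<in> carrier_mat 1 k" by (simp_all add: B_def R_def)
  have "complex_of_real t \<cdot>\<^sub>m rank_one y = B * R"
    using y by (intro eq_matI) (auto simp: B_def R_def rank_one_def scalar_prod_def)
  then have "det (1\<^sub>m k + complex_of_real t \<cdot>\<^sub>m rank_one y) = det (1\<^sub>m 1 + R * B)"
    using det_one_plus_mult_comm[OF B R] by simp
  also have "\<dots> = (1\<^sub>m 1 + R * B) $$ (0, 0)" by (rule det_single) (use B R in auto)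
  also have "\<dots> = 1 + (\<Sum>l<k. cnj (y $ l) * (complex_of_real t * y $ l))"
    using B R by (simp add: index_mult_mat_sum[OF R B] del: index_mult_mat(1)) (simp add: B_def R_def)
  also have "(\<Sum>l<k. cnj (y $ l) * (complex_of_real t * y $ l)) = complex_of_real t * (y \<bullet>c y)"
    using y by (simp add: cscalar_prod_sum sum_distrib_left mult_ac)
  finally show ?thesis by (simp add: cscalar_prod_self)
qed

lemma onb_rank_one_update:
  assumes H: "H \<in> carrier_mat d d" and N: "onb H d k N S" and w: "w \<in> carrier_vec d"
  shows "adj N * ((H + complex_of_real t \<cdot>\<^sub>m rank_one w) * N) = 1\<^sub>m k + complex_of_real t \<cdot>\<^sub>m rank_one (adj N *\<^sub>v w)"
proof (rule eq_matI)
  have Nc: "N \<in> carrier_mat d k" and NN: "adj N * (H * N) = 1\<^sub>m k" using N by (auto simp: onb_def)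
  let ?R = "complex_of_real t \<cdot>\<^sub>m rank_one w"
  have R: "?R \<in> carrier_mat d d" using w by simp
  have HR: "H + ?R \<in> carrier_mat d d" using R by simp
  have Nw: "adj N *\<^sub>v w \<in> carrier_vec k" using Nc w by (auto intro: mult_mat_vec_carrier)
  show "dim_row (adj N * ((H + ?R) * N)) = dim_row (1\<^sub>m k + complex_of_real t \<cdot>\<^sub>m rank_one (adj N *\<^sub>v w))"
    "dim_col (adj N * ((H + ?R) * N)) = dim_col (1\<^sub>m k + complex_of_real t \<cdot>\<^sub>m rank_one (adj N *\<^sub>v w))"
    using Nc rank_one_carrier[OF Nw] by auto
  fix i j assume "i < dim_row (1\<^sub>m k + complex_of_real t \<cdot>\<^sub>m rank_one (adj N *\<^sub>v w))"
    "j < dim_col (1\<^sub>m k + complex_of_real t \<cdot>\<^sub>m rank_one (adj N *\<^sub>v w))"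
  then have ij: "i < k" "j < k" using rank_one_carrier[OF Nw] by auto
  have ci: "col N i \<in> carrier_vec d" "col N j \<in> carrier_vec d" using Nc by auto
  have Hcj: "H *\<^sub>v col N j \<in> carrier_vec d" using H ci by (auto intro: mult_mat_vec_carrier)
  have Rx: "?R *\<^sub>v col N j = complex_of_real t \<cdot>\<^sub>v ((col N j \<bullet>c w) \<cdot>\<^sub>v w)"
  proof -
    have "?R *\<^sub>v col N j = complex_of_real t \<cdot>\<^sub>v (rank_one w *\<^sub>v col N j)"
      by (rule smult_mat_mult_vec[OF rank_one_carrier[OF w] ci(2)])
    then show ?thesis using rank_one_mult_vec[OF w ci(2)] by simp
  qed
  have "(adj N * ((H + ?R) * N)) $$ (i, j) = ((H + ?R) *\<^sub>v col N j) \<bullet>c col N i"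
    by (rule index_adj_form[OF Nc HR Nc ij])
  also have "(H + ?R) *\<^sub>v col N j = H *\<^sub>v col N j + ?R *\<^sub>v col N j"
    by (rule add_mult_distrib_mat_vec[OF H R ci(2)])
  also have "\<dots> \<bullet>c col N i = (H *\<^sub>v col N j) \<bullet>c col N i + (?R *\<^sub>v col N j) \<bullet>c col N i"
    by (rule cscalar_prod_add_left) (use Hcj R ci in \<open>auto intro: mult_mat_vec_carrier\<close>)
  also have "(H *\<^sub>v col N j) \<bullet>c col N i = (if i = j then 1 else 0)"
    using index_adj_form[OF Nc H Nc ij] NN ij by simp
  also have "(?R *\<^sub>v col N j) \<bullet>c col N i = complex_of_real t * ((col N j \<bullet>c w) * (w \<bullet>c col N i))"
    unfolding Rx using w ci by (simp add: cscalar_prod_smult_left[of _ d])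
  also have "col N j \<bullet>c w = cnj ((adj N *\<^sub>v w) $ j)"
    using index_adj_mult_vec[OF Nc w ij(2)] cscalar_prod_swap[OF w ci(2)] by simp
  also have "w \<bullet>c col N i = (adj N *\<^sub>v w) $ i" using index_adj_mult_vec[OF Nc w ij(1)] by simp
  finally have e: "(adj N * ((H + ?R) * N)) $$ (i, j) =
    (if i = j then 1 else 0) + complex_of_real t * (cnj ((adj N *\<^sub>v w) $ j) * (adj N *\<^sub>v w) $ i)" .
  have "(1\<^sub>m k + complex_of_real t \<cdot>\<^sub>m rank_one (adj N *\<^sub>v w)) $$ (i, j) =
    (if i = j then 1 else 0) + complex_of_real t * ((adj N *\<^sub>v w) $ i * cnj ((adj N *\<^sub>v w) $ j))"
    using ij carrier_vecD[OF Nw] by (simp del: index_mult_mat_vec dim_mult_mat_vec)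
  with e show "(adj N * ((H + ?R) * N)) $$ (i, j) = (1\<^sub>m k + complex_of_real t \<cdot>\<^sub>m rank_one (adj N *\<^sub>v w)) $$ (i, j)"
    by (simp add: mult_ac)
qed

text \<open>Write \<open>M = N * C\<close>. The change of frame contributes the factor
  \<open>det (adj C) * det C\<close> before and after the update, and in the orthonormal frame
  \<open>N\<close> the updated Gram matrix is the identity plus a rank-one matrix.\<close>

lemma gram_det_rank_one_update:
  assumes H: "H \<in> carrier_mat d d" and N: "onb H d k N S" and M: "M \<in> carrier_mat d k" "mimg M = S"
    and w: "w \<in> carrier_vec d"
  shows "det (adj M * ((H + complex_of_real t \<cdot>\<^sub>m rank_one w) * M)) =
    det (adj M * (H * M)) * complex_of_real (1 + t * norm_sq (adj N *\<^sub>v w))"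
proof -
  have Nc: "N \<in> carrier_mat d k" and NN: "adj N * (H * N) = 1\<^sub>m k" and NS: "mimg N = S" using N by (auto simp: onb_def)
  obtain C where C: "C \<in> carrier_mat k k" "M = N * C" using factor_through_mimg[OF M(1) Nc] M NS by blast
  let ?H = "H + complex_of_real t \<cdot>\<^sub>m rank_one w"
  have Hc: "?H \<in> carrier_mat d d" using w by simp
  have e: "adj M * (G * M) = adj C * (adj N * (G * N) * C)" if G: "G \<in> carrier_mat d d" for G
    unfolding C(2) adj_mult[OF Nc C(1)] using Nc C(1) G by (simp add: mult_assoc_dim)
  have Nw: "adj N *\<^sub>v w \<in> carrier_vec k" using Nc w by (auto intro: mult_mat_vec_carrier)
  let ?R = "1\<^sub>m k + complex_of_real t \<cdot>\<^sub>m rank_one (adj N *\<^sub>v w)"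
  have R: "?R \<in> carrier_mat k k" using Nw by simp
  have "det (adj M * (?H * M)) = det (adj C * (?R * C))" unfolding e[OF Hc] onb_rank_one_update[OF H N w] ..
  also have "\<dots> = det (adj C) * (det ?R * det C)"
    using det_mult[of "adj C" k "?R * C"] det_mult[OF R C(1)] C(1) R by auto
  also have "\<dots> = det (adj C) * det C * complex_of_real (1 + t * norm_sq (adj N *\<^sub>v w))"
    using det_one_plus_rank_one[OF Nw] by simp
  also have "det (adj C) * det C = det (adj M * (H * M))"
    unfolding e[OF H] NN using det_mult[of "adj C" k C] C(1) by simp
  finally show ?thesis .
qed

lemma gram_det_nonzero:
  assumes H: "H \<in> carrier_mat d d" and N: "onb H d k N S" and M: "onb (1\<^sub>m d) d k M S"
  shows "det (adj M * (H * M)) \<noteq> 0"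
proof -
  have Nc: "N \<in> carrier_mat d k" and NN: "adj N * (H * N) = 1\<^sub>m k" and NS: "mimg N = S" using N by (auto simp: onb_def)
  have Mc: "M \<in> carrier_mat d k" and MM: "adj M * M = 1\<^sub>m k" and MS: "mimg M = S" using M by (auto simp: onb_def)
  obtain C where C: "C \<in> carrier_mat k k" "M = N * C" using factor_through_mimg[OF Mc Nc] MS NS by blast
  have "(adj M * N) * C = 1\<^sub>m k" using MM C Mc Nc by (simp add: mult_assoc_dim)
  moreover have "adj M * N \<in> carrier_mat k k" using Mc Nc by auto
  ultimately have d1: "det C \<noteq> 0" using det_mult[of "adj M * N" k C] C by auto
  have "adj C * adj (adj M * N) = adj (adj M * N * C)" by (rule adj_mult[symmetric, OF _ C(1)]) (use Mc Nc in auto)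
  also have "\<dots> = 1\<^sub>m k" using \<open>(adj M * N) * C = 1\<^sub>m k\<close> by simp
  finally have "det (adj C) * det (adj (adj M * N)) = 1"
    using det_mult[of "adj C" k "adj (adj M * N)"] C \<open>adj M * N \<in> carrier_mat k k\<close> by simp
  then have d2: "det (adj C) \<noteq> 0" by auto
  have "adj M * (H * M) = adj C * (adj N * (H * N) * C)"
    unfolding C(2) adj_mult[OF Nc C(1)] using Nc C(1) H by (simp add: mult_assoc_dim)
  also have "\<dots> = adj C * C" unfolding NN using C by simp
  finally show ?thesis using det_mult[of "adj C" k C] C d1 d2 by simp
qed

text \<open>Both \<open>N * adj N * H\<close> and \<open>N' * adj N' * H\<close> fix every column in
  \<open>S\<close>, hence each other's basis; taking adjoints compares the two. So quantities read
  off \<open>N * adj N\<close> depend only on the form and the subspace.\<close>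

lemma onb_gram_unique:
  assumes H: "H \<in> carrier_mat d d" "adj H = H" and N: "onb H d k N S" and N': "onb H d k' N' S"
  shows "N * adj N = N' * adj N'"
proof -
  have proj: "N * (adj N * (H * M)) = M" if N: "onb H d k N S" and M: "M \<in> carrier_mat d l" "mimg M = S" for k N l M
  proof -
    have Nc: "N \<in> carrier_mat d k" and NN: "adj N * (H * N) = 1\<^sub>m k" and NS: "mimg N = S" using N by (auto simp: onb_def)
    obtain C where C: "C \<in> carrier_mat k l" "M = N * C" using factor_through_mimg[OF M(1) Nc] M NS by blast
    have "N * (adj N * (H * M)) = N * (adj N * (H * N) * C)" unfolding C(2) using Nc C(1) H by (simp add: mult_assoc_dim)
    then show ?thesis unfolding NN using C by simp
  qed
  have Nc: "N \<in> carrier_mat d k" "mimg N = S" and Nc': "N' \<in> carrier_mat d k'" "mimg N' = S"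
    using N N' by (auto simp: onb_def)
  have 1: "N' * adj N' = N * adj N * H * (N' * adj N')"
    using arg_cong[OF proj[OF N Nc'], of "\<lambda>A. A * adj N'"] Nc Nc' H by (simp add: mult_assoc_dim)
  have 2: "N * adj N = N' * adj N' * H * (N * adj N)"
    using arg_cong[OF proj[OF N' Nc], of "\<lambda>A. A * adj N"] Nc Nc' H by (simp add: mult_assoc_dim)
  have s: "adj (N * adj N) = N * adj N" "adj (N' * adj N') = N' * adj N'"
    using adj_mult[OF Nc(1), of "adj N" d] adj_mult[OF Nc'(1), of "adj N'" d] Nc(1) Nc'(1) by auto
  have c: "N * adj N \<in> carrier_mat d d" "N' * adj N' \<in> carrier_mat d d" using Nc Nc' by auto
  have "N * adj N = adj (N' * adj N' * H * (N * adj N))" using 2 s(1) by simp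
  also have "\<dots> = N * adj N * (H * (N' * adj N'))"
    using adj_mult[OF mult_carrier_mat[OF c(2) H(1)] c(1)] adj_mult[OF c(2) H(1)] s H(2) by simp
  also have "\<dots> = N' * adj N'" using 1 c H by (simp add: mult_assoc_dim)
  finally show ?thesis .
qed

lemma onb_norm_sq_unique:
  assumes H: "H \<in> carrier_mat d d" "adj H = H" and N: "onb H d k N S" and N': "onb H d k' N' S" and w: "w \<in> carrier_vec d"
  shows "norm_sq (adj N *\<^sub>v w) = norm_sq (adj N' *\<^sub>v w)"
proof -
  have e: "complex_of_real (norm_sq (adj N *\<^sub>v w)) = (N * adj N *\<^sub>v w) \<bullet>c w" if N: "N \<in> carrier_mat d k" for N k
  proof -
    have v: "adj N *\<^sub>v w \<in> carrier_vec k" using N w by (auto intro: mult_mat_vec_carrier)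
    have "(N * adj N *\<^sub>v w) \<bullet>c w = (N *\<^sub>v (adj N *\<^sub>v w)) \<bullet>c w"
      using assoc_mult_mat_vec[OF N adj_carrier[OF N] w] by simp
    also have "\<dots> = (adj N *\<^sub>v w) \<bullet>c (adj N *\<^sub>v w)" by (rule cscalar_prod_adj[OF N v w])
    finally show ?thesis by (simp add: cscalar_prod_self)
  qed
  have "complex_of_real (norm_sq (adj N *\<^sub>v w)) = complex_of_real (norm_sq (adj N' *\<^sub>v w))"
    using e[of N k] e[of N' k'] onb_gram_unique[OF H N N'] N N' by (simp add: onb_def)
  then show ?thesis by (simp only: of_real_eq_iff)
qed

text \<open>For a basis of the whole space, \<open>N * adj N\<close> is the inverse of
  \<open>H\<close>.\<close>

lemma onb_full_norm_sq:
  assumes H: "H \<in> carrier_mat d d" "adj H = H" and N: "onb H d d N (carrier_vec d)" and v: "v \<in> carrier_vec d"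
  shows "norm_sq (adj N *\<^sub>v (H *\<^sub>v v)) = Re ((H *\<^sub>v v) \<bullet>c v)"
proof -
  note i = onb_inverse[OF H(1) N]
  have Hv: "H *\<^sub>v v \<in> carrier_vec d" using H v by (auto intro: mult_mat_vec_carrier)
  have a: "adj N *\<^sub>v (H *\<^sub>v v) \<in> carrier_vec d" using i(1) Hv by (auto intro: mult_mat_vec_carrier)
  have "complex_of_real (norm_sq (adj N *\<^sub>v (H *\<^sub>v v))) = cnj ((N *\<^sub>v (adj N *\<^sub>v (H *\<^sub>v v))) \<bullet>c (H *\<^sub>v v))"
    using cscalar_prod_adj[OF i(1) a Hv] by (simp add: cscalar_prod_self)
  also have "N *\<^sub>v (adj N *\<^sub>v (H *\<^sub>v v)) = N * (adj N * H) *\<^sub>v v"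
    using assoc_mult_mat_vec[OF i(1) i(2) v] assoc_mult_mat_vec[OF adj_carrier[OF i(1)] H(1) v] by simp
  also have "\<dots> = v" using i(4) v by simp
  also have "cnj (v \<bullet>c (H *\<^sub>v v)) = (H *\<^sub>v v) \<bullet>c v" using cscalar_prod_swap[OF v Hv] by simp
  finally have "Re (complex_of_real (norm_sq (adj N *\<^sub>v (H *\<^sub>v v)))) = Re ((H *\<^sub>v v) \<bullet>c v)" by (rule arg_cong)
  then show ?thesis by simp
qed

text \<open>The conclusion concerns the derivative at 0 of the function bounded below. That function
  vanishes at 0, so a negative derivative would make it negative just to the right. It serves to
  extract the first variation along a rank-one direction.\<close>

lemma weighted_log_derivative:
  fixes \<chi> p :: "'i \<Rightarrow> real"
  assumes fin: "finite I" and \<epsilon>: "\<epsilon> > 0"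
    and ge: "\<And>t. 0 < t \<Longrightarrow> t < \<epsilon> \<Longrightarrow> (\<Sum>i\<in>I. \<chi> i * ln (1 + t * p i)) - c * ln (1 + t * q) \<ge> 0"
  shows "(\<Sum>i\<in>I. \<chi> i * p i) - c * q \<ge> 0"
proof (rule ccontr)
  assume neg: "\<not> ?thesis"
  define f where "f t = (\<Sum>i\<in>I. \<chi> i * ln (1 + t * p i)) - c * ln (1 + t * q)" for t
  have "(f has_real_derivative (\<Sum>i\<in>I. \<chi> i * (p i / (1 + 0 * p i))) - c * (q / (1 + 0 * q))) (at 0)"
    unfolding f_def by (intro derivative_eq_intros DERIV_sum) (auto simp: field_simps intro!: derivative_eq_intros)
  then have "(f has_real_derivative (\<Sum>i\<in>I. \<chi> i * p i) - c * q) (at 0)" by simp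
  from DERIV_neg_dec_right[OF this] neg obtain \<delta> where \<delta>: "\<delta> > 0" "\<And>h. 0 < h \<Longrightarrow> h < \<delta> \<Longrightarrow> f (0 + h) < f 0"
    by auto
  define h where "h = min \<delta> \<epsilon> / 2"
  have h: "0 < h" "h < \<delta>" "h < \<epsilon>" using \<delta>(1) \<epsilon> by (auto simp: h_def)
  have "f h < f 0" using \<delta>(2)[OF h(1,2)] by simp
  moreover have "f 0 = 0" by (simp add: f_def)
  ultimately show False using ge[OF h(1,3)] by (simp add: f_def)
qed

section \<open>Entrywise limits of matrices\<close>

text \<open>For one member after the other, a monotone subsequence is extracted for the real and
  then for the imaginary parts.\<close>

lemma finite_family_convergent_subsequence:
  fixes f :: "'i \<Rightarrow> nat \<Rightarrow> complex"
  assumes "finite I" and "\<And>i. i \<in> I \<Longrightarrow> Bseq (f i)"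
  shows "\<exists>s. strict_mono s \<and> (\<forall>i\<in>I. convergent (\<lambda>n. f i (s n)))"
  using assms
proof (induction I rule: finite_induct)
  case empty
  show ?case by (intro exI[of _ id]) (auto simp: strict_mono_def)
next
  case (insert i I)
  then obtain s where s: "strict_mono s" "\<forall>j\<in>I. convergent (\<lambda>n. f j (s n))" by auto
  have real: "\<exists>t. strict_mono t \<and> convergent (\<lambda>n. g (t n))" if "Bseq g" for g :: "nat \<Rightarrow> real"
  proof -
    obtain t where t: "strict_mono t" "monoseq (\<lambda>n. g (t n))" using seq_monosub[of g] by auto
    have "Bseq (\<lambda>n. g (t n))" using that by (rule Bseq_subseq)
    then show ?thesis using Bseq_monoseq_convergent[OF _ t(2)] t(1) by blast
  qed
  obtain K where K: "\<And>n. cmod (f i n) \<le> K" using insert.prems[of i] by (auto simp: Bseq_def)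
  have "Bseq (\<lambda>n. Re (f i (s n)))"
    by (rule BseqI'[of _ K]) (use K in \<open>auto intro: order_trans[OF abs_Re_le_cmod]\<close>)
  from real[OF this] obtain t where t: "strict_mono t" "convergent (\<lambda>n. Re (f i (s (t n))))" by blast
  have "Bseq (\<lambda>n. Im (f i (s (t n))))"
    by (rule BseqI'[of _ K]) (use K in \<open>auto intro: order_trans[OF abs_Im_le_cmod]\<close>)
  from real[OF this] obtain u where u: "strict_mono u" "convergent (\<lambda>n. Im (f i (s (t (u n)))))" by blast
  have "convergent (\<lambda>n. Re (f i (s (t (u n)))))" using convergent_subseq_convergent[OF t(2) u(1)] by (simp add: o_def)
  with u(2) obtain a b where "(\<lambda>n. Re (f i (s (t (u n))))) \<longlonglongrightarrow> a" "(\<lambda>n. Im (f i (s (t (u n))))) \<longlonglongrightarrow> b"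
    by (auto simp: convergent_def)
  from tendsto_Complex[OF this] have "convergent (\<lambda>n. f i (s (t (u n))))" by (auto intro: convergentI)
  moreover have "convergent (\<lambda>n. f j (s (t (u n))))" if "j \<in> I" for j
    using convergent_subseq_convergent[OF bspec[OF s(2) that], of "t \<circ> u"] strict_mono_o[OF t(1) u(1)]
    by (simp add: o_def)
  ultimately show ?case
    using strict_mono_o[OF s(1) strict_mono_o[OF t(1) u(1)]] by (intro exI[of _ "s \<circ> (t \<circ> u)"]) (auto simp: o_def)
qed

text \<open>Matrices of all sizes share one type, so convergence is entrywise with the size fixed in
  advance.\<close>

definition mat_lim :: "nat \<Rightarrow> nat \<Rightarrow> (nat \<Rightarrow> complex mat) \<Rightarrow> complex mat \<Rightarrow> bool" where
  "mat_lim m n A L \<longleftrightarrow> L \<in> carrier_mat m n \<and> (\<forall>r. A r \<in> carrier_mat m n) \<and>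
     (\<forall>i<m. \<forall>j<n. (\<lambda>r. A r $$ (i, j)) \<longlonglongrightarrow> L $$ (i, j))"

lemma mat_lim_const [simp]: "A \<in> carrier_mat m n \<Longrightarrow> mat_lim m n (\<lambda>_. A) A"
  by (simp add: mat_lim_def)

lemma mat_lim_mult:
  assumes A: "mat_lim m n A L" and B: "mat_lim n k B K"
  shows "mat_lim m k (\<lambda>r. A r * B r) (L * K)"
  unfolding mat_lim_def
proof (intro conjI allI impI)
  fix i j assume ij: "i < m" "j < k"
  have c: "A r \<in> carrier_mat m n" "B r \<in> carrier_mat n k" "L \<in> carrier_mat m n" "K \<in> carrier_mat n k" for r
    using A B by (auto simp: mat_lim_def)
  show "(\<lambda>r. (A r * B r) $$ (i, j)) \<longlonglongrightarrow> (L * K) $$ (i, j)"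
    unfolding index_mult_mat_sum[OF c(1,2) ij] index_mult_mat_sum[OF c(3,4) ij]
    by (intro tendsto_sum tendsto_mult) (use A B ij in \<open>auto simp: mat_lim_def\<close>)
qed (use A B in \<open>auto simp: mat_lim_def intro!: mult_carrier_mat\<close>)

lemma mat_lim_adj: "mat_lim m n A L \<Longrightarrow> mat_lim n m (\<lambda>r. adj (A r)) (adj L)"
  unfolding mat_lim_def
proof (elim conjE, intro conjI allI impI)
  fix i j assume c: "L \<in> carrier_mat m n" "\<forall>r. A r \<in> carrier_mat m n"
    and l: "\<forall>i<m. \<forall>j<n. (\<lambda>r. A r $$ (i, j)) \<longlonglongrightarrow> L $$ (i, j)" and ij: "i < n" "j < m"
  have d: "dim_row (A r) = m" "dim_col (A r) = n" for r using c(2) by auto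
  show "(\<lambda>r. adj (A r) $$ (i, j)) \<longlonglongrightarrow> adj L $$ (i, j)"
    using ij c(1) l d by (simp add: tendsto_cnj)
qed auto

lemma mat_lim_det: "mat_lim n n A L \<Longrightarrow> (\<lambda>r. det (A r)) \<longlonglongrightarrow> det L"
  unfolding mat_lim_def
proof (elim conjE)
  assume c: "L \<in> carrier_mat n n" "\<forall>r. A r \<in> carrier_mat n n"
    and l: "\<forall>i<n. \<forall>j<n. (\<lambda>r. A r $$ (i, j)) \<longlonglongrightarrow> L $$ (i, j)"
  have e: "det (A r) = (\<Sum>p\<in>{p. p permutes {0..<n}}. signof p * (\<Prod>i = 0..<n. A r $$ (i, p i)))" for r
    by (rule det_def') (use c in auto)
  show ?thesis unfolding e det_def'[OF c(1)]
    by (intro tendsto_sum tendsto_mult tendsto_prod tendsto_const)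
       (use l in \<open>auto simp: permutes_in_image\<close>)
qed

lemma mat_lim_unique: "mat_lim m n A L \<Longrightarrow> mat_lim m n A K \<Longrightarrow> L = K"
  unfolding mat_lim_def
proof (elim conjE, intro eq_matI)
  fix i j assume c: "K \<in> carrier_mat m n" and ij: "i < dim_row K" "j < dim_col K"
    and "\<forall>i<m. \<forall>j<n. (\<lambda>r. A r $$ (i, j)) \<longlonglongrightarrow> L $$ (i, j)"
    and "\<forall>i<m. \<forall>j<n. (\<lambda>r. A r $$ (i, j)) \<longlonglongrightarrow> K $$ (i, j)"
  then have "(\<lambda>r. A r $$ (i, j)) \<longlonglongrightarrow> L $$ (i, j)" "(\<lambda>r. A r $$ (i, j)) \<longlonglongrightarrow> K $$ (i, j)" by auto
  then show "L $$ (i, j) = K $$ (i, j)" by (rule LIMSEQ_unique)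
qed auto

lemma bounded_mats_convergent_subsequence:
  fixes A :: "nat \<Rightarrow> complex mat"
  assumes A: "\<And>r. A r \<in> carrier_mat m n" and bd: "\<And>r i j. i < m \<Longrightarrow> j < n \<Longrightarrow> cmod (A r $$ (i, j)) \<le> K"
  shows "\<exists>s L. strict_mono s \<and> mat_lim m n (\<lambda>r. A (s r)) L"
proof -
  have "\<exists>s. strict_mono s \<and> (\<forall>ij\<in>{..<m} \<times> {..<n}. convergent (\<lambda>r. A (s r) $$ ij))"
    by (rule finite_family_convergent_subsequence[where f = "\<lambda>ij r. A r $$ ij"])
       (use bd in \<open>auto intro!: BseqI'[of _ K]\<close>)
  then obtain s where s: "strict_mono s" "\<And>i j. i < m \<Longrightarrow> j < n \<Longrightarrow> convergent (\<lambda>r. A (s r) $$ (i, j))" by auto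
  define L where "L = mat m n (\<lambda>ij. lim (\<lambda>r. A (s r) $$ ij))"
  have "mat_lim m n (\<lambda>r. A (s r)) L"
    using s(2) A by (auto simp: mat_lim_def L_def convergent_LIMSEQ_iff)
  with s(1) show ?thesis by blast
qed

section \<open>Spectral decomposition\<close>

definition eigenbasis :: "nat \<Rightarrow> complex mat \<Rightarrow> complex mat \<Rightarrow> (nat \<Rightarrow> real) \<Rightarrow> bool" where
  "eigenbasis d H U ev \<longleftrightarrow> onb (1\<^sub>m d) d d U (carrier_vec d) \<and>
     (\<forall>k<d. H *\<^sub>v col U k = complex_of_real (ev k) \<cdot>\<^sub>v col U k)"

lemma cdim_left_invertible:
  assumes A: "A \<in> carrier_mat d k" and L: "L \<in> carrier_mat k d" "L * A = 1\<^sub>m k"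
  shows "cdim d (mimg A) = k"
proof -
  obtain l N where N: "onb (1\<^sub>m d) d l N (mimg A)" using onb_exists[OF posdef_one csub_mimg[OF A]] by blast
  then have Nc: "N \<in> carrier_mat d l" "mimg N = mimg A" by (auto simp: onb_def)
  have "l \<le> k" using left_invertible_dim_mono[OF Nc(1) onb_left_inverse[OF N one_carrier_mat] A] Nc by simp
  moreover have "k \<le> l" using left_invertible_dim_mono[OF A L Nc(1)] Nc by simp
  ultimately show ?thesis using cdim_eq[OF one_carrier_mat N] by simp
qed

lemma onb_one_unitary:
  assumes "onb (1\<^sub>m d) d d U (carrier_vec d)"
  shows "U \<in> carrier_mat d d" "adj U * U = 1\<^sub>m d" "U * adj U = 1\<^sub>m d"
  using onb_inverse[OF one_carrier_mat assms] by auto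

text \<open>A Schur form gives an invertible \<open>P\<close> whose first \<open>i\<close> columns
  span an invariant subspace, for every \<open>i\<close>. An orthonormal basis adapted to this
  complete flag makes \<open>H\<close> upper triangular, and Hermitian symmetry then makes it real
  diagonal.\<close>

lemma hermitian_eigenbasis:
  assumes H: "H \<in> carrier_mat d d" "adj H = H"
  shows "\<exists>U ev. eigenbasis d H U ev"
proof -
  obtain as where "char_poly H = (\<Prod>a\<leftarrow>as. [:- a, 1:])" using char_poly_factorized[OF H(1)] by blast
  from schur_decomposition_exists[OF H(1) this] obtain B where B: "B \<in> carrier_mat d d" "upper_triangular B" "similar_mat H B"
    by blast
  then obtain P Qm where "similar_mat_wit H B P Qm" by (auto simp: similar_mat_def)
  note PQ = similar_mat_witD2[OF H(1) this]
  have HP: "H * P = P * B" using PQ by (simp add: mult_assoc_dim)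
  define S where "S i = (\<lambda>c. P *\<^sub>v c) ` coords d i" for i
  have S_img: "S i = mimg (first_cols i P)" if "i \<le> d" for i
    unfolding S_def by (rule image_coords[OF PQ(6) that])
  have S_csub: "csub d (S i)" if "i \<le> d" for i
    unfolding S_img[OF that] by (rule csub_mimg[OF first_cols_carrier[OF PQ(6)]])
  have S_mono: "S i \<subseteq> S (Suc i)" for i by (auto simp: S_def coords_def)
  have S_dim: "cdim d (S i) = i" if i: "i \<le> d" for i
    unfolding S_img[OF i]
  proof (rule cdim_left_invertible)
    let ?L = "mat i d (\<lambda>(a, b). Qm $$ (a, b))"
    show "?L * first_cols i P = 1\<^sub>m i"
    proof (rule eq_matI)
      fix a b assume "a < dim_row (1\<^sub>m i)" "b < dim_col (1\<^sub>m i)"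
      then have ab: "a < i" "b < i" by auto
      have "(?L * first_cols i P) $$ (a, b) = (\<Sum>l<d. Qm $$ (a, l) * P $$ (l, b))"
        using ab PQ by (subst index_mult_mat_sum[of _ i d _ i]) (auto simp: first_cols_def)
      also have "\<dots> = (Qm * P) $$ (a, b)" using ab i PQ by (subst index_mult_mat_sum[of _ d d _ d]) auto
      finally show "(?L * first_cols i P) $$ (a, b) = 1\<^sub>m i $$ (a, b)" using PQ(2) ab i by simp
    qed (auto simp: first_cols_def)
  qed (use PQ in auto)
  obtain N where N: "onb (1\<^sub>m d) d d N (carrier_vec d)"
    and NS: "\<And>i. i \<in> {1..d} \<Longrightarrow> S i = (\<lambda>c. N *\<^sub>v c) ` coords d i"
    using adapted_onb[OF posdef_one, of d d S] S_csub S_mono S_dim by auto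
  note Nu = onb_one_unitary[OF N]
  have HS: "H *\<^sub>v v \<in> S i" if v: "v \<in> S i" for i v
  proof -
    obtain c where c: "c \<in> coords d i" "v = P *\<^sub>v c" using v by (auto simp: S_def)
    have cc: "c \<in> carrier_vec d" using c by (simp add: coords_def)
    have "H *\<^sub>v v = P *\<^sub>v (B *\<^sub>v c)"
      using assoc_mult_mat_vec[OF H(1) PQ(6) cc] assoc_mult_mat_vec[OF PQ(6) B(1) cc] c(2) HP by simp
    moreover have "B *\<^sub>v c \<in> coords d i"
      unfolding coords_def
    proof (safe)
      show "B *\<^sub>v c \<in> carrier_vec d" using B(1) cc by (auto intro: mult_mat_vec_carrier)
      fix a assume a: "a < d" "i \<le> a"
      show "(B *\<^sub>v c) $ a = 0" unfolding mult_mat_vec_sum[OF B(1) cc a(1)]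
      proof (intro sum.neutral ballI)
        fix j assume "j \<in> {..<d}"
        then show "B $$ (a, j) * c $ j = 0"
          using upper_triangularD[OF B(2), of j a] c(1) a B(1) by (cases "j < i") (auto simp: coords_def)
      qed
    qed
    ultimately show ?thesis by (auto simp: S_def)
  qed
  define D where "D = adj N * (H * N)"
  have D: "D \<in> carrier_mat d d" using Nu H by (auto simp: D_def)
  have D_lower: "D $$ (r, c) = 0" if rc: "c < r" "r < d" for r c
  proof -
    have i: "Suc c \<in> {1..d}" using rc by auto
    have "\<forall>v\<in>(\<lambda>c. N *\<^sub>v c) ` coords d (Suc c). H *\<^sub>v v \<in> (\<lambda>c. N *\<^sub>v c) ` coords d (Suc c)"
      using HS[of _ "Suc c"] unfolding NS[OF i] by blast
    then show ?thesis unfolding D_def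
      using maps_coords_iff[OF H(1) Nu(1) Nu(1) adj_carrier[OF Nu(1)] Nu(3,2), of "Suc c" "Suc c"] rc by simp
  qed
  have adjD: "adj D = D"
    unfolding D_def using adj_mult[OF adj_carrier[OF Nu(1)] mult_carrier_mat[OF H(1) Nu(1)]] adj_mult[OF H(1) Nu(1)] Nu(1) H
    by (simp add: mult_assoc_dim)
  have Dsym: "D $$ (r, c) = cnj (D $$ (c, r))" if "r < d" "c < d" for r c
    using arg_cong[OF adjD, of "\<lambda>A. A $$ (r, c)"] that D by simp
  have D_diag: "D $$ (r, c) = (if r = c then complex_of_real (Re (D $$ (c, c))) else 0)" if rc: "r < d" "c < d" for r c
  proof -
    consider "c < r" | "r < c" | "r = c" by linarith
    then show ?thesis
    proof cases
      case 3
      then have "D $$ (c, c) = cnj (D $$ (c, c))" using Dsym[of c c] rc by simp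
      then show ?thesis using 3 by (simp add: complex_eq_iff)
    qed (use rc D_lower Dsym[of r c] in auto)
  qed
  define ev where "ev c = Re (D $$ (c, c))" for c
  have HN: "H * N = N * D"
    unfolding D_def using Nu H assoc_mult_mat[of N d d "adj N" d "H * N" d] by simp
  have "H *\<^sub>v col N k = complex_of_real (ev k) \<cdot>\<^sub>v col N k" if k: "k < d" for k
  proof -
    have "H *\<^sub>v col N k = col (N * D) k" using col_mult2[OF H(1) Nu(1) k] HN by simp
    also have "\<dots> = N *\<^sub>v col D k" by (rule col_mult2[OF Nu(1) D k])
    also have "col D k = complex_of_real (ev k) \<cdot>\<^sub>v unit_vec d k"
      using D D_diag[folded ev_def] k by (intro eq_vecI) auto
    also have "N *\<^sub>v \<dots> = complex_of_real (ev k) \<cdot>\<^sub>v col N k"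
      using mult_mat_vec[OF Nu(1), of "unit_vec d k"] mult_unit_vec_col[OF Nu(1) k] by simp
    finally show ?thesis .
  qed
  then show ?thesis using N unfolding eigenbasis_def
    by (intro exI[of _ N] exI[of _ ev]) simp
qed

lemma eigenbasisD:
  assumes "eigenbasis d H U ev"
  shows "onb (1\<^sub>m d) d d U (carrier_vec d)" "U \<in> carrier_mat d d" "adj U * U = 1\<^sub>m d" "U * adj U = 1\<^sub>m d"
    "k < d \<Longrightarrow> H *\<^sub>v col U k = complex_of_real (ev k) \<cdot>\<^sub>v col U k"
  using assms onb_one_unitary[of d U] by (auto simp: eigenbasis_def)

lemma norm_sq_unitary_coords:
  assumes U: "U \<in> carrier_mat d d" "U * adj U = 1\<^sub>m d" and x: "x \<in> carrier_vec d"
  shows "norm_sq x = (\<Sum>k<d. (cmod ((adj U *\<^sub>v x) $ k))\<^sup>2)"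
proof -
  have "norm_sq (adj U *\<^sub>v x) = norm_sq x"
    by (rule norm_sq_isometry[of _ d d]) (use U x in auto)
  then show ?thesis using U by (simp add: norm_sq_def)
qed

lemma eigenbasis_form:
  assumes H: "H \<in> carrier_mat d d" "adj H = H" and U: "eigenbasis d H U ev" and x: "x \<in> carrier_vec d"
  shows "Re ((H *\<^sub>v x) \<bullet>c x) = (\<Sum>k<d. ev k * (cmod ((adj U *\<^sub>v x) $ k))\<^sup>2)"
proof -
  note u = eigenbasisD[OF U]
  have Hx: "H *\<^sub>v x \<in> carrier_vec d" and Ux: "adj U *\<^sub>v x \<in> carrier_vec d" and UHx: "adj U *\<^sub>v (H *\<^sub>v x) \<in> carrier_vec d"
    using H u(2) x by (auto intro!: mult_mat_vec_carrier)
  have c: "(adj U *\<^sub>v (H *\<^sub>v x)) $ k = complex_of_real (ev k) * (adj U *\<^sub>v x) $ k" if k: "k < d" for k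
  proof -
    have ck: "col U k \<in> carrier_vec d" using u(2) by auto
    have "(adj U *\<^sub>v (H *\<^sub>v x)) $ k = (H *\<^sub>v x) \<bullet>c col U k" by (rule index_adj_mult_vec[OF u(2) Hx k])
    also have "\<dots> = x \<bullet>c (H *\<^sub>v col U k)" using cscalar_prod_adj[OF H(1) x ck] H(2) by simp
    also have "\<dots> = complex_of_real (ev k) * (x \<bullet>c col U k)"
      unfolding u(5)[OF k] using cscalar_prod_smult_right[OF ck x] by simp
    also have "x \<bullet>c col U k = (adj U *\<^sub>v x) $ k" by (rule index_adj_mult_vec[OF u(2) x k, symmetric])
    finally show ?thesis .
  qed
  have "x = U *\<^sub>v (adj U *\<^sub>v x)" using assoc_mult_mat_vec[OF u(2) adj_carrier[OF u(2)] x] u(4) x by simp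
  then have "(H *\<^sub>v x) \<bullet>c x = (H *\<^sub>v x) \<bullet>c (U *\<^sub>v (adj U *\<^sub>v x))" by simp
  also have "\<dots> = (adj U *\<^sub>v (H *\<^sub>v x)) \<bullet>c (adj U *\<^sub>v x)"
    using cscalar_prod_adj[OF adj_carrier[OF u(2)] Hx Ux] by simp
  also have "\<dots> = (\<Sum>k<d. complex_of_real (ev k * (cmod ((adj U *\<^sub>v x) $ k))\<^sup>2))"
    unfolding cscalar_prod_sum[OF UHx Ux]
    by (rule sum.cong) (auto simp: c complex_norm_square[symmetric] mult.assoc simp del: index_mult_mat_vec)
  finally show ?thesis by simp
qed

lemma isometry_entry_le_1:
  assumes N: "N \<in> carrier_mat d k" "adj N * N = 1\<^sub>m k" and ij: "i < d" "j < k"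
  shows "cmod (N $$ (i, j)) \<le> 1"
proof -
  have "norm_sq (N *\<^sub>v unit_vec k j) = norm_sq (unit_vec k j)" by (rule norm_sq_isometry[OF N]) simp
  also have "norm_sq (unit_vec k j) = 1"
    using ij by (simp add: norm_sq_def unit_vec_def if_distrib[of cmod] if_distrib[of "\<lambda>x. x\<^sup>2"] cong: if_cong)
  finally have "(\<Sum>l<d. (cmod (N $$ (l, j)))\<^sup>2) = 1"
    using N ij by (simp add: mult_unit_vec_col[OF N(1)] norm_sq_def)
  moreover have "(cmod (N $$ (i, j)))\<^sup>2 \<le> (\<Sum>l<d. (cmod (N $$ (l, j)))\<^sup>2)"
    by (rule member_le_sum) (use ij in auto)
  ultimately show ?thesis by (simp add: power_le_one_iff abs_square_le_1)
qed

text \<open>The interval from \<open>a\<close> to \<open>b\<close> in the order of Hermitian forms.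
  For positive \<open>a\<close>, entries are bounded and limits stay inside, so such an interval is
  compact.\<close>

definition form_bounds :: "nat \<Rightarrow> real \<Rightarrow> real \<Rightarrow> complex mat \<Rightarrow> bool" where
  "form_bounds d a b H \<longleftrightarrow> H \<in> carrier_mat d d \<and> adj H = H \<and>
     (\<forall>x\<in>carrier_vec d. a * norm_sq x \<le> Re ((H *\<^sub>v x) \<bullet>c x) \<and> Re ((H *\<^sub>v x) \<bullet>c x) \<le> b * norm_sq x)"

lemma form_bounds_posdef: "form_bounds d a b H \<Longrightarrow> 0 < a \<Longrightarrow> posdef d H"
  unfolding posdef_def form_bounds_def
  by (metis (no_types, lifting) less_le_trans mult_pos_pos norm_sq_pos)

lemma norm_sq_col_unitary:
  assumes U: "U \<in> carrier_mat d d" "adj U * U = 1\<^sub>m d" and k: "k < d"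
  shows "norm_sq (col U k) = 1"
proof -
  have "(adj U *\<^sub>v col U k) $ k = complex_of_real (norm_sq (col U k))"
    using index_adj_mult_vec[OF U(1), of "col U k" k] k U by (simp add: cscalar_prod_self)
  moreover have "(adj U *\<^sub>v col U k) = col (1\<^sub>m d) k" using col_mult2[of "adj U" d d U d k] U k by simp
  ultimately show ?thesis using k by (metis index_col index_one_mat(1,2,3) of_real_eq_1_iff)
qed

lemma eigenvalue_form:
  assumes H: "H \<in> carrier_mat d d" and U: "eigenbasis d H U ev" and k: "k < d"
  shows "(H *\<^sub>v col U k) \<bullet>c col U k = complex_of_real (ev k)"
  using eigenbasisD[OF U] k norm_sq_col_unitary[of U d k]
  by (simp add: cscalar_prod_smult_left[of _ d] cscalar_prod_self)

lemma eigenvalue_bounds: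
  assumes b: "form_bounds d a b H" and U: "eigenbasis d H U ev" and k: "k < d"
  shows "a \<le> ev k" "ev k \<le> b"
proof -
  have H: "H \<in> carrier_mat d d" using b by (simp add: form_bounds_def)
  have ck: "col U k \<in> carrier_vec d" using eigenbasisD(2)[OF U] by auto
  have "a * norm_sq (col U k) \<le> Re ((H *\<^sub>v col U k) \<bullet>c col U k) \<and> Re ((H *\<^sub>v col U k) \<bullet>c col U k) \<le> b * norm_sq (col U k)"
    using b ck unfolding form_bounds_def by blast
  then show "a \<le> ev k" "ev k \<le> b"
    unfolding eigenvalue_form[OF H U k] norm_sq_col_unitary[OF eigenbasisD(2,3)[OF U] k] by auto
qed

text \<open>Expand \<open>H\<close> in an orthonormal eigenbasis: the eigenvalues lie between 0 and
  \<open>b\<close>, and entries of a unitary matrix have modulus at most 1.\<close>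

lemma form_bounds_entry:
  assumes b: "form_bounds d a b H" and a: "0 < a" and ij: "i < d" "j < d"
  shows "cmod (H $$ (i, j)) \<le> real d * b"
proof -
  have H: "H \<in> carrier_mat d d" "adj H = H" using b by (auto simp: form_bounds_def)
  obtain U ev where U: "eigenbasis d H U ev" using hermitian_eigenbasis[OF H] by blast
  note u = eigenbasisD[OF U]
  have HU: "H * U \<in> carrier_mat d d" using H u by simp
  have "H = H * U * adj U" using H u(2) u(4) by (simp add: mult_assoc_dim)
  then have "H $$ (i, j) = (H * U * adj U) $$ (i, j)" by simp
  also have "\<dots> = (\<Sum>k<d. (H * U) $$ (i, k) * adj U $$ (k, j))"
    by (rule index_mult_mat_sum[OF HU adj_carrier[OF u(2)] ij])
  also have "\<dots> = (\<Sum>k<d. complex_of_real (ev k) * U $$ (i, k) * cnj (U $$ (j, k)))"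
  proof (rule sum.cong)
    fix k assume "k \<in> {..<d}"
    then have k: "k < d" by simp
    have "(H * U) $$ (i, k) = col (H * U) k $ i" by (rule index_col[symmetric]) (use HU ij k in auto)
    also have "col (H * U) k = complex_of_real (ev k) \<cdot>\<^sub>v col U k" using col_mult2[OF H(1) u(2) k] u(5)[OF k] by simp
    finally show "(H * U) $$ (i, k) * adj U $$ (k, j) = complex_of_real (ev k) * U $$ (i, k) * cnj (U $$ (j, k))"
      using u(2) ij k by simp
  qed simp
  also have "cmod \<dots> \<le> (\<Sum>k<d. b)"
  proof (rule order_trans[OF norm_sum], rule sum_mono)
    fix k assume "k \<in> {..<d}"
    then have k: "k < d" by simp
    have e: "0 \<le> ev k" "ev k \<le> b" using eigenvalue_bounds[OF b U k] a by auto
    have "cmod (complex_of_real (ev k) * U $$ (i, k) * cnj (U $$ (j, k))) = ev k * (cmod (U $$ (i, k)) * cmod (U $$ (j, k)))"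
      using e by (simp add: norm_mult)
    also have "\<dots> \<le> ev k * (1 * 1)"
      by (intro mult_left_mono mult_mono isometry_entry_le_1[OF u(2,3)]) (use ij k e in auto)
    finally show "cmod (complex_of_real (ev k) * U $$ (i, k) * cnj (U $$ (j, k))) \<le> b" using e by simp
  qed
  finally show ?thesis by simp
qed

lemma cauchy_schwarz_vec:
  assumes x: "x \<in> carrier_vec d" and y: "y \<in> carrier_vec d"
  shows "(cmod (x \<bullet>c y))\<^sup>2 \<le> norm_sq x * norm_sq y"
proof -
  have "cmod (x \<bullet>c y) \<le> (\<Sum>i<d. \<bar>cmod (x $ i)\<bar> * \<bar>cmod (y $ i)\<bar>)"
    unfolding cscalar_prod_sum[OF x y] by (rule order_trans[OF norm_sum]) (simp add: norm_mult)
  also have "\<dots> \<le> L2_set (\<lambda>i. cmod (x $ i)) {..<d} * L2_set (\<lambda>i. cmod (y $ i)) {..<d}"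
    by (rule L2_set_mult_ineq)
  finally have "(cmod (x \<bullet>c y))\<^sup>2 \<le> (L2_set (\<lambda>i. cmod (x $ i)) {..<d} * L2_set (\<lambda>i. cmod (y $ i)) {..<d})\<^sup>2"
    by (rule power_mono) simp
  then show ?thesis using x y by (simp add: L2_set_def norm_sq_def power_mult_distrib sum_nonneg)
qed

lemma rank_one_form:
  assumes H: "H \<in> carrier_mat d d" and w: "w \<in> carrier_vec d" and x: "x \<in> carrier_vec d"
  shows "Re (((H + complex_of_real t \<cdot>\<^sub>m rank_one w) *\<^sub>v x) \<bullet>c x) = Re ((H *\<^sub>v x) \<bullet>c x) + t * (cmod (x \<bullet>c w))\<^sup>2"
proof -
  let ?R = "complex_of_real t \<cdot>\<^sub>m rank_one w"
  have R: "?R \<in> carrier_mat d d" using w by simp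
  have Rx: "?R *\<^sub>v x = complex_of_real t \<cdot>\<^sub>v ((x \<bullet>c w) \<cdot>\<^sub>v w)"
    using smult_mat_mult_vec[OF rank_one_carrier[OF w] x] rank_one_mult_vec[OF w x] by simp
  have "((H + ?R) *\<^sub>v x) \<bullet>c x = (H *\<^sub>v x) \<bullet>c x + (?R *\<^sub>v x) \<bullet>c x"
    unfolding add_mult_distrib_mat_vec[OF H R x]
    by (rule cscalar_prod_add_left) (use H R x in \<open>auto intro: mult_mat_vec_carrier\<close>)
  also have "(?R *\<^sub>v x) \<bullet>c x = complex_of_real t * ((x \<bullet>c w) * (w \<bullet>c x))"
    unfolding Rx using w x by (simp add: cscalar_prod_smult_left[of _ d])
  also have "(x \<bullet>c w) * (w \<bullet>c x) = complex_of_real ((cmod (x \<bullet>c w))\<^sup>2)"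
    unfolding cscalar_prod_swap[OF x w] by (simp add: complex_norm_square[symmetric])
  finally show ?thesis by simp
qed

lemma hermitian_rank_one_update:
  assumes H: "H \<in> carrier_mat d d" "adj H = H" and w: "w \<in> carrier_vec d"
  shows "H + complex_of_real t \<cdot>\<^sub>m rank_one w \<in> carrier_mat d d"
    "adj (H + complex_of_real t \<cdot>\<^sub>m rank_one w) = H + complex_of_real t \<cdot>\<^sub>m rank_one w"
  using H w adj_add[of H d d "complex_of_real t \<cdot>\<^sub>m rank_one w"] by (auto simp: adj_smult adj_rank_one)

lemma form_bounds_scale:
  assumes b: "form_bounds d a b H" and c: "0 < c"
  shows "form_bounds d (c * a) (c * b) (complex_of_real c \<cdot>\<^sub>m H)"
  unfolding form_bounds_def
proof (intro conjI ballI)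
  have H: "H \<in> carrier_mat d d" "adj H = H" using b by (auto simp: form_bounds_def)
  show "complex_of_real c \<cdot>\<^sub>m H \<in> carrier_mat d d" "adj (complex_of_real c \<cdot>\<^sub>m H) = complex_of_real c \<cdot>\<^sub>m H"
    using H by (auto simp: adj_smult)
  fix x :: "complex vec" assume x: "x \<in> carrier_vec d"
  have Hx: "H *\<^sub>v x \<in> carrier_vec d" using H x by (auto intro: mult_mat_vec_carrier)
  have e: "Re (((complex_of_real c \<cdot>\<^sub>m H) *\<^sub>v x) \<bullet>c x) = c * Re ((H *\<^sub>v x) \<bullet>c x)"
    unfolding smult_mat_mult_vec[OF H(1) x] cscalar_prod_smult_left[OF Hx x] by simp
  have "a * norm_sq x \<le> Re ((H *\<^sub>v x) \<bullet>c x)" "Re ((H *\<^sub>v x) \<bullet>c x) \<le> b * norm_sq x"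
    using b x by (auto simp: form_bounds_def)
  then show "c * a * norm_sq x \<le> Re (((complex_of_real c \<cdot>\<^sub>m H) *\<^sub>v x) \<bullet>c x)"
    "Re (((complex_of_real c \<cdot>\<^sub>m H) *\<^sub>v x) \<bullet>c x) \<le> c * b * norm_sq x"
    unfolding e using c mult_left_mono[of _ _ c] by (simp_all add: mult.assoc)
qed

lemma tendsto_norm_sq_mult_vec:
  assumes A: "mat_lim d d A L" and x: "x \<in> carrier_vec d"
  shows "(\<lambda>r. Re ((A r *\<^sub>v x) \<bullet>c x)) \<longlonglongrightarrow> Re ((L *\<^sub>v x) \<bullet>c x)"
proof -
  have c: "A r \<in> carrier_mat d d" "L \<in> carrier_mat d d" for r using A by (auto simp: mat_lim_def)
  have e: "(B *\<^sub>v x) \<bullet>c x = (\<Sum>i<d. (\<Sum>j<d. B $$ (i, j) * x $ j) * cnj (x $ i))" if B: "B \<in> carrier_mat d d" for B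
    using B x by (subst cscalar_prod_sum[of _ d]) (auto intro!: sum.cong simp: mult_mat_vec_sum[OF B x] mult_mat_vec_carrier simp del: index_mult_mat_vec)
  show ?thesis unfolding e[OF c(1)] e[OF c(2)]
    by (intro tendsto_Re tendsto_sum tendsto_mult tendsto_const) (use A in \<open>auto simp: mat_lim_def\<close>)
qed

lemma form_bounds_limit:
  assumes A: "mat_lim d d A L" and b: "\<And>r. form_bounds d a b (A r)"
  shows "form_bounds d a b L"
  unfolding form_bounds_def
proof (intro conjI ballI)
  show "L \<in> carrier_mat d d" using A by (simp add: mat_lim_def)
  have "mat_lim d d A (adj L)" using mat_lim_adj[OF A] b by (simp add: form_bounds_def)
  then show "adj L = L" by (rule mat_lim_unique[OF _ A])
  fix x :: "complex vec" assume x: "x \<in> carrier_vec d"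
  note t = tendsto_norm_sq_mult_vec[OF A x]
  show "a * norm_sq x \<le> Re ((L *\<^sub>v x) \<bullet>c x)"
    by (rule LIMSEQ_le_const[OF t]) (use b x in \<open>auto simp: form_bounds_def\<close>)
  show "Re ((L *\<^sub>v x) \<bullet>c x) \<le> b * norm_sq x"
    by (rule LIMSEQ_le_const2[OF t]) (use b x in \<open>auto simp: form_bounds_def\<close>)
qed

section \<open>Stable configurations carry a balanced Hermitian form\<close>

lemma mimg_subset_csub:
  assumes S: "csub d S" and A: "A \<in> carrier_mat d n" and c: "\<And>j. j < n \<Longrightarrow> col A j \<in> S"
  shows "mimg A \<subseteq> S"
proof -
  obtain k N where N: "onb (1\<^sub>m d) d k N S" using onb_exists[OF posdef_one S] by blast
  then have Nc: "N \<in> carrier_mat d k" "mimg N = S" by (auto simp: onb_def)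
  obtain C where C: "C \<in> carrier_mat k n" "A = N * C"
    using factor_through[OF A Nc(1)] c Nc(2) by blast
  show ?thesis
  proof
    fix y assume "y \<in> mimg A"
    then obtain a where a: "a \<in> carrier_vec n" "y = A *\<^sub>v a" using mimg_iff[OF A] by auto
    then have "y = N *\<^sub>v (C *\<^sub>v a)" using C assoc_mult_mat_vec[OF Nc(1) C(1) a(1)] by simp
    then show "y \<in> S" using mimgI[OF Nc(1), of "C *\<^sub>v a"] Nc(2) mult_mat_vec_carrier[OF C(1) a(1)] by simp
  qed
qed

text \<open>In an orthonormal basis adapted to \<open>W\<close> inside \<open>V\<close>, the vectors
  of \<open>V\<close> beyond those of \<open>W\<close> span the complement.\<close>

lemma orthogonal_complement_in:
  assumes V: "csub d V" and W: "csub d W" "W \<subseteq> V"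
  shows "\<exists>Z M. csub d Z \<and> Z \<subseteq> V \<and> onb (1\<^sub>m d) d (cdim d V - cdim d W) M Z \<and> Z \<inter> W = {0\<^sub>v d}"
proof -
  let ?S = "\<lambda>i::nat. if i = 1 then W else V"
  have "\<exists>N. onb (1\<^sub>m d) d d N (carrier_vec d) \<and> (\<forall>i\<in>{1..2}. ?S i = (\<lambda>c. N *\<^sub>v c) ` coords d (cdim d (?S i)))"
    by (rule adapted_onb[OF posdef_one]) (use V W in \<open>auto split: if_splits\<close>)
  then obtain N where N: "onb (1\<^sub>m d) d d N (carrier_vec d)"
    and NS: "\<forall>i\<in>{1..2}. ?S i = (\<lambda>c. N *\<^sub>v c) ` coords d (cdim d (?S i))"
    by blast
  note u = onb_one_unitary[OF N]
  let ?y = "cdim d W" and ?x = "cdim d V"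
  have NW: "W = (\<lambda>c. N *\<^sub>v c) ` coords d ?y" and NV: "V = (\<lambda>c. N *\<^sub>v c) ` coords d ?x"
    using bspec[OF NS, of 1] bspec[OF NS, of 2] by simp_all
  have yx: "?y \<le> ?x" "?x \<le> d" using cdim_mono[OF W(1) V W(2)] cdim_le[OF V] by auto
  define M where "M = mat d (?x - ?y) (\<lambda>(i, j). N $$ (i, ?y + j))"
  have M: "M \<in> carrier_mat d (?x - ?y)" by (simp add: M_def)
  have colM: "col M j = col N (?y + j)" if "j < ?x - ?y" for j
    using that u(1) yx by (intro eq_vecI) (auto simp: M_def)
  have "adj M * (1\<^sub>m d * M) = 1\<^sub>m (?x - ?y)"
  proof (rule eq_matI)
    fix i j assume "i < dim_row (1\<^sub>m (?x - ?y))" "j < dim_col (1\<^sub>m (?x - ?y))"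
    then have ij: "i < ?x - ?y" "j < ?x - ?y" by auto
    have "(adj M * (1\<^sub>m d * M)) $$ (i, j) = (adj N * (1\<^sub>m d * N)) $$ (?y + i, ?y + j)"
      using index_adj_form[OF M one_carrier_mat M ij] index_adj_form[OF u(1) one_carrier_mat u(1), of "?y + i" "?y + j"]
        ij yx colM by simp
    also have "\<dots> = 1\<^sub>m d $$ (?y + i, ?y + j)" using u by simp
    finally show "(adj M * (1\<^sub>m d * M)) $$ (i, j) = 1\<^sub>m (?x - ?y) $$ (i, j)" using ij yx by simp
  qed (use M in auto)
  then have onbM: "onb (1\<^sub>m d) d (?x - ?y) M (mimg M)" using M by (simp add: onb_def)
  have MV: "mimg M \<subseteq> V"
  proof (rule mimg_subset_csub[OF V M])
    fix j assume j: "j < ?x - ?y"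
    have "unit_vec d (?y + j) \<in> coords d ?x" using j by (auto simp: coords_def)
    moreover have "N *\<^sub>v unit_vec d (?y + j) = col M j" using colM[OF j] mult_unit_vec_col[OF u(1)] j yx by simp
    ultimately show "col M j \<in> V" using NV by (metis imageI)
  qed
  have "mimg M \<inter> W = {0\<^sub>v d}"
  proof (intro equalityI subsetI)
    fix v assume v: "v \<in> mimg M \<inter> W"
    obtain a where a: "a \<in> carrier_vec (?x - ?y)" "v = M *\<^sub>v a" using v mimg_iff[OF M] by auto
    obtain c where c: "c \<in> coords d ?y" "v = N *\<^sub>v c" using v NW by auto
    define e where "e = vec d (\<lambda>i. if ?y \<le> i \<and> i < ?x then a $ (i - ?y) else 0)"
    have e: "e \<in> carrier_vec d" by (simp add: e_def)
    have cc: "c \<in> carrier_vec d" using c by (simp add: coords_def)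
    have "v = N *\<^sub>v e"
    proof (rule eq_vecI)
      fix i assume "i < dim_vec (N *\<^sub>v e)"
      then have i: "i < d" using u by simp
      have "(N *\<^sub>v e) $ i = (\<Sum>l<d. N $$ (i, l) * e $ l)" by (rule mult_mat_vec_sum[OF u(1) e i])
      also have "\<dots> = (\<Sum>l\<in>{?y..<?x}. N $$ (i, l) * e $ l)"
        by (rule sum.mono_neutral_right) (use yx in \<open>auto simp: e_def\<close>)
      also have "\<dots> = (\<Sum>j<?x - ?y. M $$ (i, j) * a $ j)"
        by (rule sum.reindex_bij_witness[where i = "\<lambda>j. ?y + j" and j = "\<lambda>l. l - ?y"])
           (use i yx in \<open>auto simp: M_def e_def\<close>)
      also have "\<dots> = v $ i" unfolding a(2) by (rule mult_mat_vec_sum[OF M a(1) i, symmetric])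
      finally show "v $ i = (N *\<^sub>v e) $ i" by simp
    qed (use a M u in simp)
    moreover have "adj N *\<^sub>v (N *\<^sub>v z) = z" if "z \<in> carrier_vec d" for z
      using assoc_mult_mat_vec[OF adj_carrier[OF u(1)] u(1) that] u(2) that by simp
    ultimately have ec: "e = c" using c(2) e cc by metis
    have "a = 0\<^sub>v (?x - ?y)"
    proof (rule eq_vecI)
      fix j assume "j < dim_vec (0\<^sub>v (?x - ?y))"
      then have j: "j < ?x - ?y" by simp
      have "e $ (?y + j) = a $ j" using j yx by (simp add: e_def)
      moreover have "c $ (?y + j) = 0" using c(1) j yx by (simp add: coords_def)
      ultimately show "a $ j = 0\<^sub>v (?x - ?y) $ j" using ec j by simp
    qed (use a in simp)
    then show "v \<in> {0\<^sub>v d}" using a mult_mat_vec_zero[OF M] by simp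
  qed (use csubD(2)[OF csub_mimg[OF M]] csubD(2)[OF W(1)] in auto)
  then show ?thesis using csub_mimg[OF M] MV onbM by blast
qed

lemma mat_lim_filterlim:
  assumes A: "mat_lim m n A L" and s: "filterlim s at_top sequentially"
  shows "mat_lim m n (\<lambda>r. A (s r)) L"
  unfolding mat_lim_def
proof (intro conjI allI impI)
  fix i j assume ij: "i < m" "j < n"
  then have "(\<lambda>r. A r $$ (i, j)) \<longlonglongrightarrow> L $$ (i, j)" using A by (simp add: mat_lim_def)
  then show "(\<lambda>r. A (s r) $$ (i, j)) \<longlonglongrightarrow> L $$ (i, j)" using s by (rule filterlim_compose)
qed (use A in \<open>auto simp: mat_lim_def\<close>)

text \<open>Compactness of the unit sphere of \<open>Z\<close>: otherwise unit vectors of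
  \<open>Z\<close>, at indices tending to infinity, have components outside \<open>A\<close> tending
  to 0, and a limit of them is a unit vector contradicting \<open>trans\<close>.\<close>

lemma transversal_subspace_gap:
  fixes U :: "nat \<Rightarrow> complex mat"
  assumes lim: "mat_lim d d U L" and Z: "onb (1\<^sub>m d) d z M Z"
    and trans: "\<And>x. x \<in> Z \<Longrightarrow> (\<And>k. k < d \<Longrightarrow> k \<notin> A \<Longrightarrow> (adj L *\<^sub>v x) $ k = 0) \<Longrightarrow> x = 0\<^sub>v d"
  shows "\<exists>c>0. \<exists>r0. \<forall>r\<ge>r0. \<forall>x\<in>Z. c * norm_sq x \<le> (\<Sum>k\<in>{..<d} - A. (cmod ((adj (U r) *\<^sub>v x) $ k))\<^sup>2)"
proof (rule ccontr)
  assume neg: "\<not> ?thesis"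
  have Mc: "M \<in> carrier_mat d z" and MM: "adj M * M = 1\<^sub>m z" and MZ: "mimg M = Z" using Z by (auto simp: onb_def)
  have Uc: "U r \<in> carrier_mat d d" for r using lim by (simp add: mat_lim_def)
  have Lc: "L \<in> carrier_mat d d" using lim by (simp add: mat_lim_def)
  let ?g = "\<lambda>r x. \<Sum>k\<in>{..<d} - A. (cmod ((adj (U r) *\<^sub>v x) $ k))\<^sup>2"
  have "\<exists>r a. n \<le> r \<and> a \<in> carrier_vec z \<and> norm_sq a = 1 \<and> ?g r (M *\<^sub>v a) < 1 / real (Suc n)" for n :: nat
  proof -
    have "\<not> (\<forall>r\<ge>n. \<forall>x\<in>Z. 1 / real (Suc n) * norm_sq x \<le> ?g r x)"
    proof
      assume "\<forall>r\<ge>n. \<forall>x\<in>Z. 1 / real (Suc n) * norm_sq x \<le> ?g r x"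
      then have "\<exists>c>0. \<exists>r0. \<forall>r\<ge>r0. \<forall>x\<in>Z. c * norm_sq x \<le> ?g r x"
        by (intro exI[of _ "1 / real (Suc n)"] conjI exI[of _ n]) auto
      with neg show False by blast
    qed
    then obtain r x where rx: "n \<le> r" "x \<in> Z" "?g r x < 1 / real (Suc n) * norm_sq x" by (auto simp: not_le)
    obtain b where b: "b \<in> carrier_vec z" "x = M *\<^sub>v b" using rx(2) MZ mimg_iff[OF Mc] by auto
    have nb: "norm_sq x = norm_sq b" unfolding b(2) by (rule norm_sq_isometry[OF Mc MM b(1)])
    have "0 \<le> ?g r x" by (simp add: sum_nonneg)
    then have "norm_sq b \<noteq> 0" using rx(3) nb by auto
    then have pos: "0 < norm_sq b" using norm_sq_nonneg[of b] by linarith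
    define s where "s = complex_of_real (1 / sqrt (norm_sq b))"
    have s2: "(cmod s)\<^sup>2 = 1 / norm_sq b" using pos by (simp add: s_def norm_divide power_divide)
    define a where "a = s \<cdot>\<^sub>v b"
    have a: "a \<in> carrier_vec z" using b by (simp add: a_def)
    have "norm_sq a = 1" using pos by (simp add: a_def norm_sq_smult s2)
    moreover have "?g r (M *\<^sub>v a) = (cmod s)\<^sup>2 * ?g r x"
    proof -
      have "M *\<^sub>v a = s \<cdot>\<^sub>v x" unfolding a_def b(2) by (rule mult_mat_vec[OF Mc b(1)])
      moreover have "adj (U r) *\<^sub>v (s \<cdot>\<^sub>v x) = s \<cdot>\<^sub>v (adj (U r) *\<^sub>v x)"
        by (rule mult_mat_vec[of _ d d]) (use Uc b Mc in \<open>auto intro: mult_mat_vec_carrier\<close>)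
      ultimately show ?thesis
        using Uc[of r] by (simp add: norm_mult power_mult_distrib sum_distrib_left del: index_mult_mat_vec)
    qed
    moreover have "(cmod s)\<^sup>2 * ?g r x < 1 / real (Suc n)"
    proof -
      have "(cmod s)\<^sup>2 * ?g r x < (cmod s)\<^sup>2 * (1 / real (Suc n) * norm_sq x)"
        by (rule mult_strict_left_mono[OF rx(3)]) (use pos s2 in simp)
      then show ?thesis using pos nb by (simp add: s2)
    qed
    ultimately show ?thesis using rx(1) a by (intro exI[of _ r] exI[of _ a]) simp
  qed
  then obtain r a where ra: "\<And>n. n \<le> r n" "\<And>n. a n \<in> carrier_vec z" "\<And>n. norm_sq (a n) = 1"
    "\<And>n. ?g (r n) (M *\<^sub>v a n) < 1 / real (Suc n)" by metis
  \<comment> \<open>The coefficient vectors as one-column matrices, so that limits of matrix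
    products apply to them.\<close>
  define B where "B n = mat z 1 (\<lambda>(i, j). a n $ i)" for n
  have Bc: "B n \<in> carrier_mat z 1" for n by (simp add: B_def)
  have colB: "col (B n) 0 = a n" for n using ra(2)[of n] by (intro eq_vecI) (auto simp: B_def)
  have Bbd: "cmod (B n $$ (i, j)) \<le> 1" if "i < z" "j < 1" for n i j
  proof -
    have "(cmod (a n $ i))\<^sup>2 \<le> (\<Sum>l<dim_vec (a n). (cmod (a n $ l))\<^sup>2)"
      by (rule member_le_sum) (use that ra(2)[of n] in auto)
    then have "(cmod (a n $ i))\<^sup>2 \<le> 1" using ra(3)[of n] by (simp add: norm_sq_def)
    then show ?thesis using that by (simp add: B_def abs_square_le_1)
  qed
  have "\<exists>t K. strict_mono t \<and> mat_lim z 1 (\<lambda>n. B (t n)) K"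
    by (rule bounded_mats_convergent_subsequence[OF Bc Bbd])
  then obtain t K where t: "strict_mono t" and K: "mat_lim z 1 (\<lambda>n. B (t n)) K"
    by blast
  have Kc: "K \<in> carrier_mat z 1" using K by (simp add: mat_lim_def)
  define x where "x = M *\<^sub>v col K 0"
  have kc: "col K 0 \<in> carrier_vec z" using Kc by auto
  have xZ: "x \<in> Z" unfolding x_def MZ[symmetric] by (rule mimgI[OF Mc kc])
  have ft: "filterlim (\<lambda>n. r (t n)) at_top sequentially"
  proof (rule filterlim_at_top_mono[OF filterlim_ident], rule always_eventually, rule allI)
    fix n show "n \<le> r (t n)" using ra(1)[of "t n"] seq_suble[OF t, of n] by simp
  qed
  have l1: "mat_lim d 1 (\<lambda>n. adj (U (r (t n))) * (M * B (t n))) (adj L * (M * K))"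
    by (intro mat_lim_mult[OF mat_lim_adj[OF mat_lim_filterlim[OF lim ft]]] mat_lim_mult[OF mat_lim_const[OF Mc] K])
  have ent: "(adj W * (M * C)) $$ (k, 0) = (adj W *\<^sub>v (M *\<^sub>v col C 0)) $ k"
    if "W \<in> carrier_mat d d" "C \<in> carrier_mat z 1" "k < d" for W C k
    using that Mc col_mult2[OF Mc that(2), of 0] by (subst index_mult_mat(1)) auto
  have "(adj L *\<^sub>v x) $ k = 0" if k: "k < d" "k \<notin> A" for k
  proof -
    have "(\<lambda>n. (adj (U (r (t n))) * (M * B (t n))) $$ (k, 0)) \<longlonglongrightarrow> (adj L * (M * K)) $$ (k, 0)"
      using l1 k by (simp add: mat_lim_def del: index_mult_mat)
    then have "(\<lambda>n. (adj (U (r (t n))) *\<^sub>v (M *\<^sub>v a (t n))) $ k) \<longlonglongrightarrow> (adj L *\<^sub>v x) $ k"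
      by (simp only: ent[OF Uc Bc k(1)] ent[OF Lc Kc k(1)] colB x_def)
    then have lim2: "(\<lambda>n. (cmod ((adj (U (r (t n))) *\<^sub>v (M *\<^sub>v a (t n))) $ k))\<^sup>2) \<longlonglongrightarrow> (cmod ((adj L *\<^sub>v x) $ k))\<^sup>2"
      by (intro tendsto_power tendsto_norm)
    have lim0: "(\<lambda>n. 1 / real (Suc (t n))) \<longlonglongrightarrow> 0"
      using LIMSEQ_subseq_LIMSEQ[OF lim_1_over_n t, THEN LIMSEQ_Suc] LIMSEQ_subseq_LIMSEQ[OF LIMSEQ_Suc[OF lim_1_over_n] t]
      by (simp add: o_def)
    have le: "(cmod ((adj (U (r (t n))) *\<^sub>v (M *\<^sub>v a (t n))) $ k))\<^sup>2 \<le> 1 / real (Suc (t n))" for n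
    proof -
      have "(cmod ((adj (U (r (t n))) *\<^sub>v (M *\<^sub>v a (t n))) $ k))\<^sup>2 \<le> ?g (r (t n)) (M *\<^sub>v a (t n))"
        by (rule member_le_sum) (use k in auto)
      then show ?thesis using ra(4)[of "t n"] by linarith
    qed
    have "(cmod ((adj L *\<^sub>v x) $ k))\<^sup>2 \<le> 0" by (rule LIMSEQ_le[OF lim2 lim0]) (use le in auto)
    then show ?thesis by simp
  qed
  then have "x = 0\<^sub>v d" using trans[OF xZ] by blast
  then have "norm_sq (col K 0) = 0" using norm_sq_isometry[OF Mc MM kc] by (simp add: x_def norm_sq_def)
  moreover have "(\<lambda>n. norm_sq (a (t n))) \<longlonglongrightarrow> norm_sq (col K 0)"
  proof -
    have e: "norm_sq (a n) = (\<Sum>i<z. (cmod (B n $$ (i, 0)))\<^sup>2)" for n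
      using ra(2)[of n] by (simp add: norm_sq_def B_def)
    have e': "norm_sq (col K 0) = (\<Sum>i<z. (cmod (K $$ (i, 0)))\<^sup>2)" using Kc by (simp add: norm_sq_def)
    show ?thesis unfolding e e' by (intro tendsto_sum tendsto_power tendsto_norm) (use K in \<open>auto simp: mat_lim_def\<close>)
  qed
  ultimately show False using ra(3) LIMSEQ_unique[OF tendsto_const, of 1 "norm_sq (col K 0)"] by simp
qed

text \<open>The left side does not depend on the orthonormal basis of \<open>V\<close>, so take one
  whose first vectors span \<open>Z\<close>. The squared coordinates of each basis vector, weighted
  by the eigenvalues, sum to 1, so it contributes at most 1. For a vector in \<open>Z\<close> the
  part outside \<open>A\<close> is at least \<open>T * R * c\<close> times its squared norm; the
  norm is therefore small, and the part in \<open>A\<close> is at most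
  \<open>1 / (R * c)\<close>.\<close>

lemma spectral_weight_bound:
  assumes H: "posdef d H" and U: "eigenbasis d H U ev" and V: "csub d V" and Z: "csub d Z" "Z \<subseteq> V"
    and N: "onb H d k N V" and A: "A \<subseteq> {..<d}" and c: "0 < c" "0 < R" "0 < T"
    and low: "\<And>k. k \<in> A \<Longrightarrow> 0 < ev k \<and> ev k \<le> T" and high: "\<And>k. k < d \<Longrightarrow> k \<notin> A \<Longrightarrow> T * R \<le> ev k"
    and gap: "\<And>x. x \<in> Z \<Longrightarrow> c * norm_sq x \<le> (\<Sum>k\<in>{..<d} - A. (cmod ((adj U *\<^sub>v x) $ k))\<^sup>2)"
  shows "(\<Sum>k\<in>A. ev k * norm_sq (adj N *\<^sub>v col U k)) \<le> real (cdim d V - cdim d Z) + real (cdim d Z) / (R * c)"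
proof -
  note Hc = posdefD(1,2)[OF H] and u = eigenbasisD[OF U]
  obtain z N1 where N1: "onb H d z N1 Z" using onb_exists[OF H Z(1)] by blast
  obtain x N' where N': "onb H d x N' V" "z \<le> x" and ext: "\<forall>i<d. \<forall>j<z. N' $$ (i, j) = N1 $$ (i, j)"
    using extend_onb[OF H V N1 Z(2)] by blast
  have zx: "z = cdim d Z" "x = cdim d V" using cdim_eq[OF Hc(1) N1] cdim_eq[OF Hc(1) N'(1)] by auto
  have N'c: "N' \<in> carrier_mat d x" and N'N': "adj N' * (H * N') = 1\<^sub>m x" using N'(1) by (auto simp: onb_def)
  have N1c: "N1 \<in> carrier_mat d z" and N1Z: "mimg N1 = Z" using N1 by (auto simp: onb_def)
  have colc: "col N' l \<in> carrier_vec d" for l using N'c by auto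
  define w where "w k l = (cmod ((adj U *\<^sub>v col N' l) $ k))\<^sup>2" for k l
  have w0: "0 \<le> w k l" for k l by (simp add: w_def)
  have ev0: "0 \<le> ev k" if "k < d" for k
  proof (cases "k \<in> A")
    case True then show ?thesis using low[of k] by simp
  next
    case False
    have "0 \<le> T * R" using c by simp
    also have "\<dots> \<le> ev k" using high[OF that False] .
    finally show ?thesis .
  qed
  have form: "(\<Sum>k<d. ev k * w k l) = 1" if l: "l < x" for l
  proof -
    have "(\<Sum>k<d. ev k * w k l) = Re ((H *\<^sub>v col N' l) \<bullet>c col N' l)"
      unfolding w_def by (rule eigenbasis_form[OF Hc U colc, symmetric])
    also have "(H *\<^sub>v col N' l) \<bullet>c col N' l = 1" using index_adj_form[OF N'c Hc(1) N'c l l] N'N' l by simp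
    finally show ?thesis by simp
  qed
  have split: "(\<Sum>k<d. f k) = (\<Sum>k\<in>A. f k) + (\<Sum>k\<in>{..<d} - A. f k)" for f :: "nat \<Rightarrow> real"
    using sum.subset_diff[OF A, of f] by simp
  have offA: "0 \<le> (\<Sum>k\<in>{..<d} - A. ev k * w k l)" for l
    by (intro sum_nonneg mult_nonneg_nonneg) (use ev0 w0 in auto)
  have onA: "0 \<le> (\<Sum>k\<in>A. ev k * w k l)" for l
    by (intro sum_nonneg mult_nonneg_nonneg) (use low w0 in \<open>auto intro: less_imp_le\<close>)
  have leA: "(\<Sum>k\<in>A. ev k * w k l) \<le> 1" if "l < x" for l
    using form[OF that] split[of "\<lambda>k. ev k * w k l"] offA[of l] by linarith
  have leZ: "(\<Sum>k\<in>A. ev k * w k l) \<le> 1 / (R * c)" if l: "l < z" for l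
  proof -
    have lx: "l < x" using l N'(2) by simp
    have "col N' l = col N1 l" using ext l N'c N1c lx by (intro eq_vecI) auto
    then have lZ: "col N' l \<in> Z" using col_in_mimg[OF N1c l] N1Z by simp
    have "(\<Sum>k\<in>A. ev k * w k l) \<le> (\<Sum>k\<in>A. T * w k l)"
      by (rule sum_mono, rule mult_right_mono) (use low w0 in auto)
    also have "\<dots> \<le> (\<Sum>k<d. T * w k l)"
      by (rule sum_mono2) (use A c w0 in auto)
    also have "\<dots> = T * norm_sq (col N' l)"
      unfolding norm_sq_unitary_coords[OF u(2,4) colc] by (simp add: w_def sum_distrib_left)
    finally have 1: "(\<Sum>k\<in>A. ev k * w k l) \<le> T * norm_sq (col N' l)" .
    have "T * R * (c * norm_sq (col N' l)) \<le> T * R * (\<Sum>k\<in>{..<d} - A. w k l)"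
      unfolding w_def by (rule mult_left_mono[OF gap[OF lZ]]) (use c in simp)
    also have "\<dots> \<le> (\<Sum>k\<in>{..<d} - A. ev k * w k l)"
      unfolding sum_distrib_left by (rule sum_mono, rule mult_right_mono) (use high w0 in auto)
    also have "\<dots> \<le> 1"
      using form[OF lx] split[of "\<lambda>k. ev k * w k l"] onA[of l] by linarith
    finally have "T * norm_sq (col N' l) \<le> 1 / (R * c)" using c by (simp add: field_simps)
    with 1 show ?thesis by linarith
  qed
  have "(\<Sum>k\<in>A. ev k * norm_sq (adj N *\<^sub>v col U k)) = (\<Sum>k\<in>A. \<Sum>l<x. ev k * w k l)"
  proof (rule sum.cong)
    fix k assume "k \<in> A"
    then have k: "k < d" using A by auto
    have ck: "col U k \<in> carrier_vec d" using u(2) by auto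
    have "norm_sq (adj N *\<^sub>v col U k) = norm_sq (adj N' *\<^sub>v col U k)"
      by (rule onb_norm_sq_unique[OF Hc N N'(1) ck])
    also have "\<dots> = (\<Sum>l<x. (cmod ((adj N' *\<^sub>v col U k) $ l))\<^sup>2)" using N'c by (simp add: norm_sq_def)
    also have "\<dots> = (\<Sum>l<x. w k l)"
    proof (rule sum.cong)
      fix l assume "l \<in> {..<x}"
      then have l: "l < x" by simp
      have "(adj N' *\<^sub>v col U k) $ l = cnj ((adj U *\<^sub>v col N' l) $ k)"
        unfolding index_adj_mult_vec[OF N'c ck l] index_adj_mult_vec[OF u(2) colc k]
        by (rule cscalar_prod_swap[OF colc ck])
      then show "(cmod ((adj N' *\<^sub>v col U k) $ l))\<^sup>2 = w k l" by (simp add: w_def del: index_mult_mat_vec)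
    qed simp
    finally show "ev k * norm_sq (adj N *\<^sub>v col U k) = (\<Sum>l<x. ev k * w k l)" by (simp add: sum_distrib_left)
  qed simp
  also have "\<dots> = (\<Sum>l<x. \<Sum>k\<in>A. ev k * w k l)" by (rule sum.swap)
  also have "\<dots> = (\<Sum>l<z. \<Sum>k\<in>A. ev k * w k l) + (\<Sum>l\<in>{z..<x}. \<Sum>k\<in>A. ev k * w k l)"
    using sum.atLeastLessThan_concat[of 0 z x "\<lambda>l. \<Sum>k\<in>A. ev k * w k l"] N'(2) by (simp add: atLeast0LessThan)
  also have "\<dots> \<le> (\<Sum>l<z. 1 / (R * c)) + (\<Sum>l\<in>{z..<x}. 1)"
    by (intro add_mono sum_mono) (use leA leZ in auto)
  finally show ?thesis using zx by simp
qed

text \<open>Slope stability for a weighted configuration of subspaces. Test subspaces enter through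
  orthonormal bases \<open>E\<close>, so that their dimension is the number of columns.\<close>

locale stable_config =
  fixes d :: nat and I :: "'i set" and V :: "'i \<Rightarrow> complex vec set" and \<chi> :: "'i \<Rightarrow> real" and \<chi>0 :: real
  assumes d_pos: "0 < d" and fin: "finite I" and V: "\<And>i. i \<in> I \<Longrightarrow> csub d (V i)"
    and \<chi>_pos: "\<And>i. i \<in> I \<Longrightarrow> 0 < \<chi> i"
    and trace: "(\<Sum>i\<in>I. \<chi> i * real (cdim d (V i))) = \<chi>0 * real d"
    and stable: "\<And>k E. 0 < k \<Longrightarrow> k < d \<Longrightarrow> E \<in> carrier_mat d k \<Longrightarrow> adj E * E = 1\<^sub>m k \<Longrightarrow>
      (\<Sum>i\<in>I. \<chi> i * real (cdim d (V i \<inter> mimg E))) < \<chi>0 * real k"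
begin

text \<open>If every ratio failed, there would be counterexamples with ratios tending to infinity.
  Along a subsequence their eigenbases converge, and the limits of the eigenvectors indexed by
  \<open>A\<close> span a proper nonzero subspace \<open>mimg E\<close>. Complements of
  \<open>V i \<inter> mimg E\<close> in \<open>V i\<close> contribute 0 in the limit, which leaves a
  weighted sum of the dimensions of these intersections of at least
  \<open>\<chi>0 * real (card A)\<close>, against stability.\<close>

lemma spectral_gap_fixed:
  assumes A: "A \<subseteq> {..<d}" "A \<noteq> {}" "A \<noteq> {..<d}"
  shows "\<exists>R>1. \<forall>H U ev T N. posdef d H \<and> eigenbasis d H U ev \<and> 0 < T \<and>
      (\<forall>k\<in>A. 0 < ev k \<and> ev k \<le> T) \<and> (\<forall>k<d. k \<notin> A \<longrightarrow> T * R \<le> ev k) \<and>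
      (\<forall>i\<in>I. onb H d (cdim d (V i)) (N i) (V i)) \<longrightarrow>
      (\<Sum>i\<in>I. \<chi> i * (\<Sum>k\<in>A. ev k * norm_sq (adj (N i) *\<^sub>v col U k))) < \<chi>0 * real (card A)"
proof (rule ccontr)
  let ?P = "\<lambda>R H U ev T N. posdef d H \<and> eigenbasis d H U ev \<and> 0 < T \<and>
      (\<forall>k\<in>A. 0 < ev k \<and> ev k \<le> T) \<and> (\<forall>k<d. k \<notin> A \<longrightarrow> T * R \<le> ev k) \<and>
      (\<forall>i\<in>I. onb H d (cdim d (V i)) (N i) (V i))"
  let ?S = "\<lambda>U ev N. \<Sum>i\<in>I. \<chi> i * (\<Sum>k\<in>A. ev k * norm_sq (adj (N i) *\<^sub>v col U k))"
  assume neg: "\<not> (\<exists>R>1. \<forall>H U ev T N. ?P R H U ev T N \<longrightarrow> ?S U ev N < \<chi>0 * real (card A))"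
  have "\<exists>H U ev T N. ?P (real n + 2) H U ev T N \<and> \<chi>0 * real (card A) \<le> ?S U ev N" for n :: nat
  proof -
    have "1 < real n + 2" by simp
    with neg have "\<not> (\<forall>H U ev T N. ?P (real n + 2) H U ev T N \<longrightarrow> ?S U ev N < \<chi>0 * real (card A))" by blast
    then show ?thesis unfolding not_less[symmetric] by blast
  qed
  then have "\<forall>n. \<exists>H U ev T N. ?P (real n + 2) H U ev T N \<and> \<chi>0 * real (card A) \<le> ?S U ev N" by (rule allI)
  from choice[OF this] obtain H where "\<forall>n. \<exists>U ev T N. ?P (real n + 2) (H n) U ev T N \<and> \<chi>0 * real (card A) \<le> ?S U ev N" ..
  from choice[OF this] obtain U where "\<forall>n. \<exists>ev T N. ?P (real n + 2) (H n) (U n) ev T N \<and> \<chi>0 * real (card A) \<le> ?S (U n) ev N" ..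
  from choice[OF this] obtain ev where "\<forall>n. \<exists>T N. ?P (real n + 2) (H n) (U n) (ev n) T N \<and> \<chi>0 * real (card A) \<le> ?S (U n) (ev n) N" ..
  from choice[OF this] obtain T where "\<forall>n. \<exists>N. ?P (real n + 2) (H n) (U n) (ev n) (T n) N \<and> \<chi>0 * real (card A) \<le> ?S (U n) (ev n) N" ..
  from choice[OF this] obtain N where PS: "\<forall>n. ?P (real n + 2) (H n) (U n) (ev n) (T n) (N n) \<and> \<chi>0 * real (card A) \<le> ?S (U n) (ev n) (N n)" ..
  have P: "?P (real n + 2) (H n) (U n) (ev n) (T n) (N n)" for n using spec[OF PS, of n] by (rule conjunct1)
  have S: "\<chi>0 * real (card A) \<le> ?S (U n) (ev n) (N n)" for n using spec[OF PS, of n] by (rule conjunct2)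
  have Uc: "U n \<in> carrier_mat d d" and UU: "adj (U n) * U n = 1\<^sub>m d" for n
    using eigenbasisD(2,3)[of d "H n" "U n" "ev n"] P[of n] by auto
  have "\<exists>s L. strict_mono s \<and> mat_lim d d (\<lambda>n. U (s n)) L"
    by (rule bounded_mats_convergent_subsequence[OF Uc, where K = 1])
      (rule isometry_entry_le_1[OF Uc UU])
  then obtain s L where s: "strict_mono s" and L: "mat_lim d d (\<lambda>n. U (s n)) L" by blast
  have Lc: "L \<in> carrier_mat d d" using L by (simp add: mat_lim_def)
  have "mat_lim d d (\<lambda>n. adj (U (s n)) * U (s n)) (adj L * L)" by (rule mat_lim_mult[OF mat_lim_adj[OF L] L])
  then have "mat_lim d d (\<lambda>n. 1\<^sub>m d) (adj L * L)" by (simp add: UU)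
  then have LL: "adj L * L = 1\<^sub>m d" by (rule mat_lim_unique) simp
  have LL': "L * adj L = 1\<^sub>m d" by (rule mat_mult_left_right_inverse[OF _ Lc LL]) (use Lc in auto)
  define m where "m = card A"
  have finA: "finite A" using A(1) finite_subset by blast
  obtain f where f: "bij_betw f {..<m} A"
    using ex_bij_betw_nat_finite[OF finA] by (auto simp: m_def atLeast0LessThan)
  have fA: "f j \<in> A" "f j < d" if "j < m" for j
    using f that A(1) by (auto simp: bij_betw_def)
  have m: "0 < m" "m < d"
    using A finA psubset_card_mono[of "{..<d}" A] by (auto simp: m_def card_gt_0_iff)
  \<comment> \<open>Columns of the limit indexed by \<open>A\<close>: the candidate for a
    destabilising subspace.\<close>
  define E where "E = mat d m (\<lambda>(i, j). L $$ (i, f j))"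
  have E: "E \<in> carrier_mat d m" by (simp add: E_def)
  have colE: "col E j = col L (f j)" if "j < m" for j
    using that fA[OF that] Lc by (intro eq_vecI) (auto simp: E_def)
  have EE: "adj E * E = 1\<^sub>m m"
  proof (rule eq_matI)
    fix i j assume "i < dim_row (1\<^sub>m m)" "j < dim_col (1\<^sub>m m)"
    then have ij: "i < m" "j < m" by auto
    have "(adj E * E) $$ (i, j) = (\<Sum>l<d. cnj (L $$ (l, f i)) * L $$ (l, f j))"
      using ij by (subst index_mult_mat_sum[of _ m d _ m]) (auto simp: E_def)
    also have "\<dots> = (adj L * L) $$ (f i, f j)"
      using fA ij Lc by (subst index_mult_mat_sum[of _ d d _ d]) auto
    also have "\<dots> = 1\<^sub>m m $$ (i, j)"
      unfolding LL using fA[OF ij(1)] fA[OF ij(2)] ij f by (auto simp: bij_betw_def dest: inj_onD)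
    finally show "(adj E * E) $$ (i, j) = 1\<^sub>m m $$ (i, j)" .
  qed (use E in auto)
  have inE: "x \<in> mimg E" if x: "x \<in> carrier_vec d" and z: "\<And>k. k < d \<Longrightarrow> k \<notin> A \<Longrightarrow> (adj L *\<^sub>v x) $ k = 0" for x
  proof -
    define a where "a = vec m (\<lambda>j. (adj L *\<^sub>v x) $ (f j))"
    have a: "a \<in> carrier_vec m" by (simp add: a_def)
    have Lx: "adj L *\<^sub>v x \<in> carrier_vec d" using Lc x by (auto intro: mult_mat_vec_carrier)
    have "x = E *\<^sub>v a"
    proof (rule eq_vecI)
      fix i assume "i < dim_vec (E *\<^sub>v a)"
      then have i: "i < d" using E by simp
      have "x = L *\<^sub>v (adj L *\<^sub>v x)" using assoc_mult_mat_vec[OF Lc adj_carrier[OF Lc] x] LL' x by simp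
      then have "x $ i = (L *\<^sub>v (adj L *\<^sub>v x)) $ i" by simp
      also have "\<dots> = (\<Sum>k<d. L $$ (i, k) * (adj L *\<^sub>v x) $ k)" by (rule mult_mat_vec_sum[OF Lc Lx i])
      also have "\<dots> = (\<Sum>k\<in>A. L $$ (i, k) * (adj L *\<^sub>v x) $ k)"
        by (rule sum.mono_neutral_right) (use A(1) z in auto)
      also have "\<dots> = (\<Sum>j<m. L $$ (i, f j) * (adj L *\<^sub>v x) $ (f j))"
        by (rule sum.reindex_bij_betw[OF f, symmetric])
      also have "\<dots> = (E *\<^sub>v a) $ i"
        unfolding mult_mat_vec_sum[OF E a i] using i by (simp add: E_def a_def)
      finally show "x $ i = (E *\<^sub>v a) $ i" .
    qed (use x E in simp)
    then show ?thesis using mimgI[OF E a] by simp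
  qed
  note Ec = csub_mimg[OF E]
  let ?y = "\<lambda>i. cdim d (V i \<inter> mimg E)"
  \<comment> \<open>For each \<open>i\<close> a complement of \<open>V i \<inter> mimg E\<close> in
    \<open>V i\<close>, with its gap constant \<open>c\<close> and the index \<open>r0\<close> from
    which the gap estimate holds.\<close>
  have "\<exists>Z c r0. i \<in> I \<longrightarrow> csub d Z \<and> Z \<subseteq> V i \<and> cdim d Z = cdim d (V i) - ?y i \<and> 0 < c \<and>
      (\<forall>r\<ge>r0. \<forall>x\<in>Z. c * norm_sq x \<le> (\<Sum>k\<in>{..<d} - A. (cmod ((adj (U (s r)) *\<^sub>v x) $ k))\<^sup>2))" for i
  proof (cases "i \<in> I")
    case True
    have W: "csub d (V i \<inter> mimg E)" by (rule csub_Int[OF V[OF True] Ec])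
    obtain Z M where Z: "csub d Z" "Z \<subseteq> V i" and M: "onb (1\<^sub>m d) d (cdim d (V i) - ?y i) M Z"
      and ZW: "Z \<inter> (V i \<inter> mimg E) = {0\<^sub>v d}"
      using orthogonal_complement_in[OF V[OF True] W Int_lower1] by blast
    have "x = 0\<^sub>v d" if "x \<in> Z" "\<And>k. k < d \<Longrightarrow> k \<notin> A \<Longrightarrow> (adj L *\<^sub>v x) $ k = 0" for x
      using inE[OF csubD(5)[OF Z(1) that(1)] that(2)] that(1) Z(2) ZW by blast
    from transversal_subspace_gap[OF L M this]
    obtain c r0 where "0 < c" "\<forall>r\<ge>r0. \<forall>x\<in>Z. c * norm_sq x \<le> (\<Sum>k\<in>{..<d} - A. (cmod ((adj (U (s r)) *\<^sub>v x) $ k))\<^sup>2)"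
      by blast
    then show ?thesis using Z cdim_eq[OF one_carrier_mat M] by blast
  qed auto
  then have "\<forall>i. \<exists>Z c r0. i \<in> I \<longrightarrow> csub d Z \<and> Z \<subseteq> V i \<and> cdim d Z = cdim d (V i) - ?y i \<and> 0 < c \<and>
      (\<forall>r\<ge>r0. \<forall>x\<in>Z. c * norm_sq x \<le> (\<Sum>k\<in>{..<d} - A. (cmod ((adj (U (s r)) *\<^sub>v x) $ k))\<^sup>2))" by (rule allI)
  from choice[OF this] obtain Z where "\<forall>i. \<exists>c r0. i \<in> I \<longrightarrow> csub d (Z i) \<and> (Z i) \<subseteq> V i \<and> cdim d (Z i) = cdim d (V i) - ?y i \<and> 0 < c \<and>
      (\<forall>r\<ge>r0. \<forall>x\<in>(Z i). c * norm_sq x \<le> (\<Sum>k\<in>{..<d} - A. (cmod ((adj (U (s r)) *\<^sub>v x) $ k))\<^sup>2))" ..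
  from choice[OF this] obtain c where "\<forall>i. \<exists>r0. i \<in> I \<longrightarrow> csub d (Z i) \<and> (Z i) \<subseteq> V i \<and> cdim d (Z i) = cdim d (V i) - ?y i \<and> 0 < c i \<and>
      (\<forall>r\<ge>r0. \<forall>x\<in>(Z i). c i * norm_sq x \<le> (\<Sum>k\<in>{..<d} - A. (cmod ((adj (U (s r)) *\<^sub>v x) $ k))\<^sup>2))" ..
  from choice[OF this] obtain r0 where Zcr: "\<forall>i. i \<in> I \<longrightarrow> csub d (Z i) \<and> (Z i) \<subseteq> V i \<and> cdim d (Z i) = cdim d (V i) - ?y i \<and> 0 < c i \<and>
      (\<forall>r\<ge>r0 i. \<forall>x\<in>(Z i). c i * norm_sq x \<le> (\<Sum>k\<in>{..<d} - A. (cmod ((adj (U (s r)) *\<^sub>v x) $ k))\<^sup>2))" ..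
  have Z: "csub d (Z i)" "Z i \<subseteq> V i" "cdim d (Z i) = cdim d (V i) - ?y i" and c: "0 < c i" if "i \<in> I" for i
    using mp[OF spec[OF Zcr, of i] that] by simp_all
  have gap: "c i * norm_sq x \<le> (\<Sum>k\<in>{..<d} - A. (cmod ((adj (U (s r)) *\<^sub>v x) $ k))\<^sup>2)"
    if "i \<in> I" "r0 i \<le> r" "x \<in> Z i" for i r x
    using mp[OF spec[OF Zcr, of i] that(1)] that(2,3) by (elim conjE) (drule spec, drule mp, assumption, drule bspec, assumption)
  define rm where "rm = (\<Sum>i\<in>I. r0 i)"
  have rm: "r0 i \<le> rm" if "i \<in> I" for i
    unfolding rm_def by (rule member_le_sum) (use that fin in auto)
  have bound: "\<chi>0 * real m \<le> (\<Sum>i\<in>I. \<chi> i * (real (?y i) + real (cdim d (Z i)) / c i * (1 / (real (s r) + 2))))"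
    if r: "rm \<le> r" for r
  proof -
    have "\<chi>0 * real m \<le> ?S (U (s r)) (ev (s r)) (N (s r))" using S[of "s r"] by (simp add: m_def)
    also have "\<dots> \<le> (\<Sum>i\<in>I. \<chi> i * (real (?y i) + real (cdim d (Z i)) / c i * (1 / (real (s r) + 2))))"
    proof (rule sum_mono, rule mult_left_mono)
      fix i assume i: "i \<in> I"
      note Pn = P[of "s r"]
      have 1: "(\<Sum>k\<in>A. ev (s r) k * norm_sq (adj (N (s r) i) *\<^sub>v col (U (s r)) k)) \<le>
          real (cdim d (V i) - cdim d (Z i)) + real (cdim d (Z i)) / ((real (s r) + 2) * c i)"
      proof (rule spectral_weight_bound[where T = "T (s r)" and H = "H (s r)" and k = "cdim d (V i)"])
        show "c i * norm_sq x \<le> (\<Sum>k\<in>{..<d} - A. (cmod ((adj (U (s r)) *\<^sub>v x) $ k))\<^sup>2)" if "x \<in> Z i" for x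
          by (rule gap[OF i _ that]) (use rm[OF i] r in simp)
      qed (use Pn i V[OF i] Z(1,2)[OF i] A(1) c[OF i] in auto)
      have "?y i \<le> cdim d (V i)" by (rule cdim_mono[OF csub_Int[OF V[OF i] Ec] V[OF i]]) simp
      then have e1: "real (cdim d (V i) - cdim d (Z i)) = real (?y i)" using Z(3)[OF i] by simp
      have e2: "real (cdim d (Z i)) / ((real (s r) + 2) * c i) = real (cdim d (Z i)) / c i * (1 / (real (s r) + 2))"
        by (simp add: mult.commute[of _ "c i"])
      show "(\<Sum>k\<in>A. ev (s r) k * norm_sq (adj (N (s r) i) *\<^sub>v col (U (s r)) k)) \<le>
          real (?y i) + real (cdim d (Z i)) / c i * (1 / (real (s r) + 2))" using 1 unfolding e1 e2 .
      show "0 \<le> \<chi> i" using \<chi>_pos[OF i] by simp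
    qed
    finally show ?thesis .
  qed
  have lim0: "(\<lambda>r. 1 / (real (s r) + 2)) \<longlonglongrightarrow> 0"
  proof -
    have "(\<lambda>n. 1 / (real n + 2)) \<longlonglongrightarrow> 0"
      using LIMSEQ_ignore_initial_segment[OF lim_1_over_n[where 'a = real], of 2] by (simp add: add.commute)
    from LIMSEQ_subseq_LIMSEQ[OF this s] show ?thesis by (simp add: o_def)
  qed
  have "(\<lambda>r. \<Sum>i\<in>I. \<chi> i * (real (?y i) + real (cdim d (Z i)) / c i * (1 / (real (s r) + 2))))
      \<longlonglongrightarrow> (\<Sum>i\<in>I. \<chi> i * (real (?y i) + real (cdim d (Z i)) / c i * 0))"
    by (intro tendsto_sum tendsto_mult tendsto_add tendsto_const lim0)
  then have "\<chi>0 * real m \<le> (\<Sum>i\<in>I. \<chi> i * (real (?y i) + real (cdim d (Z i)) / c i * 0))"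
    by (rule LIMSEQ_le_const) (use bound in auto)
  then show False using stable[OF m E EE] by simp
qed

text \<open>There are finitely many index sets \<open>A\<close>, and a ratio may be enlarged. The
  sum dominates every single ratio, and the summand 2 keeps \<open>R\<close> above 1 even when no
  proper nonempty \<open>A\<close> exists.\<close>

lemma spectral_gap:
  "\<exists>R>1. \<forall>A H U ev T N. A \<subseteq> {..<d} \<and> A \<noteq> {} \<and> A \<noteq> {..<d} \<and> posdef d H \<and> eigenbasis d H U ev \<and> 0 < T \<and>
      (\<forall>k\<in>A. 0 < ev k \<and> ev k \<le> T) \<and> (\<forall>k<d. k \<notin> A \<longrightarrow> T * R \<le> ev k) \<and>
      (\<forall>i\<in>I. onb H d (cdim d (V i)) (N i) (V i)) \<longrightarrow>
      (\<Sum>i\<in>I. \<chi> i * (\<Sum>k\<in>A. ev k * norm_sq (adj (N i) *\<^sub>v col U k))) < \<chi>0 * real (card A)"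
proof -
  define P where "P A R \<longleftrightarrow> (\<forall>H U ev T N. posdef d H \<and> eigenbasis d H U ev \<and> 0 < T \<and>
      (\<forall>k\<in>A. 0 < ev k \<and> ev k \<le> T) \<and> (\<forall>k<d. k \<notin> A \<longrightarrow> T * R \<le> ev k) \<and>
      (\<forall>i\<in>I. onb H d (cdim d (V i)) (N i) (V i)) \<longrightarrow>
      (\<Sum>i\<in>I. \<chi> i * (\<Sum>k\<in>A. ev k * norm_sq (adj (N i) *\<^sub>v col U k))) < \<chi>0 * real (card A))" for A R
  define \<A> where "\<A> = Pow {..<d} - {{}, {..<d}}"
  have "\<exists>R. A \<in> \<A> \<longrightarrow> 1 < R \<and> P A R" for A
    using spectral_gap_fixed[of A] unfolding P_def \<A>_def by auto
  then obtain r where r: "\<And>A. A \<in> \<A> \<Longrightarrow> 1 < r A \<and> P A (r A)" by metis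
  define R where "R = 2 + (\<Sum>A\<in>\<A>. r A)"
  have fA: "finite \<A>" by (simp add: \<A>_def)
  have r_nonneg: "0 \<le> r A" if "A \<in> \<A>" for A using r[OF that] by auto
  have rR: "r A \<le> R" if "A \<in> \<A>" for A
  proof -
    have "r A \<le> (\<Sum>A\<in>\<A>. r A)" by (rule member_le_sum) (use that fA r_nonneg in auto)
    then show ?thesis by (simp add: R_def)
  qed
  have "0 \<le> (\<Sum>A\<in>\<A>. r A)" by (rule sum_nonneg) (use r_nonneg in auto)
  then have R1: "1 < R" by (simp add: R_def)
  have PR: "P A R" if A: "A \<in> \<A>" for A
    unfolding P_def
  proof (intro allI impI, elim conjE)
    fix H U ev T N
    assume *: "posdef d H" "eigenbasis d H U ev" "0 < T" "\<forall>k\<in>A. 0 < ev k \<and> ev k \<le> T"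
      "\<forall>k<d. k \<notin> A \<longrightarrow> T * R \<le> ev k" "\<forall>i\<in>I. onb H d (cdim d (V i)) (N i) (V i)"
    have "T * r A \<le> ev k" if "k < d" "k \<notin> A" for k
    proof -
      have "T * r A \<le> T * R" using rR[OF A] *(3) by simp
      also have "\<dots> \<le> ev k" using *(5) that by blast
      finally show ?thesis .
    qed
    then show "(\<Sum>i\<in>I. \<chi> i * (\<Sum>k\<in>A. ev k * norm_sq (adj (N i) *\<^sub>v col U k))) < \<chi>0 * real (card A)"
      using r[OF A] * unfolding P_def by blast
  qed
  show ?thesis
  proof (intro exI[of _ R] conjI R1 allI impI)
    fix A H U ev T N
    assume *: "A \<subseteq> {..<d} \<and> A \<noteq> {} \<and> A \<noteq> {..<d} \<and> posdef d H \<and> eigenbasis d H U ev \<and> 0 < T \<and>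
      (\<forall>k\<in>A. 0 < ev k \<and> ev k \<le> T) \<and> (\<forall>k<d. k \<notin> A \<longrightarrow> T * R \<le> ev k) \<and>
      (\<forall>i\<in>I. onb H d (cdim d (V i)) (N i) (V i))"
    then have "A \<in> \<A>" by (simp add: \<A>_def)
    note PAR = PR[OF this, unfolded P_def, THEN spec, THEN spec, THEN spec, THEN spec, THEN spec, THEN mp]
    show "(\<Sum>i\<in>I. \<chi> i * (\<Sum>k\<in>A. ev k * norm_sq (adj (N i) *\<^sub>v col U k))) < \<chi>0 * real (card A)"
      by (rule PAR[OF *[THEN conjunct2, THEN conjunct2, THEN conjunct2]])
  qed
qed

text \<open>A basis of \<open>V i\<close> chosen once and independently of \<open>H\<close>, so that
  the Gram determinants are polynomials in the entries of \<open>H\<close> and vary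
  continuously.\<close>

definition M :: "'i \<Rightarrow> complex mat" where
  "M i = (SOME N. onb (1\<^sub>m d) d (cdim d (V i)) N (V i))"

lemma M_onb: "i \<in> I \<Longrightarrow> onb (1\<^sub>m d) d (cdim d (V i)) (M i) (V i)"
proof -
  assume i: "i \<in> I"
  obtain k N where N: "onb (1\<^sub>m d) d k N (V i)" using onb_exists[OF posdef_one V[OF i]] by blast
  then have "onb (1\<^sub>m d) d (cdim d (V i)) N (V i)" using cdim_eq[OF one_carrier_mat N] by simp
  then show ?thesis unfolding M_def by (rule someI)
qed

lemma M_carrier: "i \<in> I \<Longrightarrow> M i \<in> carrier_mat d (cdim d (V i))"
  using M_onb by (simp add: onb_def)

definition gram :: "complex mat \<Rightarrow> 'i \<Rightarrow> complex mat" where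
  "gram H i = adj (M i) * (H * M i)"

text \<open>The Kempf-Ness functional of the configuration on the cone of Hermitian inner products.\<close>

definition kn :: "complex mat \<Rightarrow> real" where
  "kn H = (\<Sum>i\<in>I. \<chi> i * ln (cmod (det (gram H i)))) - \<chi>0 * ln (cmod (det H))"

lemma onb_V_exists:
  assumes "posdef d H"
  shows "\<exists>N. \<forall>i\<in>I. onb H d (cdim d (V i)) (N i) (V i)"
proof -
  have "\<exists>N. i \<in> I \<longrightarrow> onb H d (cdim d (V i)) N (V i)" for i
  proof (cases "i \<in> I")
    case True
    obtain k N where N: "onb H d k N (V i)" using onb_exists[OF assms V[OF True]] by blast
    then show ?thesis using cdim_eq[OF posdefD(1)[OF assms] N] by auto
  qed simp
  then show ?thesis by metis
qed

lemma gram_det_nz: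
  assumes H: "posdef d H" and i: "i \<in> I"
  shows "det (gram H i) \<noteq> 0"
proof -
  obtain N where "onb H d (cdim d (V i)) N (V i)" using onb_V_exists[OF H] i by blast
  from gram_det_nonzero[OF posdefD(1)[OF H] this M_onb[OF i]] show ?thesis by (simp add: gram_def)
qed

lemma onb_full_exists:
  assumes H: "posdef d H"
  shows "\<exists>N0. onb H d d N0 (carrier_vec d)"
proof -
  obtain k N where N: "onb H d k N (carrier_vec d)" using onb_exists[OF H csub_carrier] by blast
  then show ?thesis using onb_carrier_dim[OF posdefD(1)[OF H] N] by auto
qed

lemma onb_one_carrier: "onb (1\<^sub>m d) d d (1\<^sub>m d) (carrier_vec d)"
  by (force simp: onb_def mimg_def)

lemma det_nz:
  assumes H: "posdef d H"
  shows "det H \<noteq> 0"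
proof -
  obtain N0 where "onb H d d N0 (carrier_vec d)" using onb_full_exists[OF H] by blast
  from gram_det_nonzero[OF posdefD(1)[OF H] this onb_one_carrier] posdefD(1)[OF H] show ?thesis by simp
qed

lemma kn_rank_one_update:
  assumes H: "posdef d H" and N: "\<forall>i\<in>I. onb H d (cdim d (V i)) (N i) (V i)" and N0: "onb H d d N0 (carrier_vec d)"
    and w: "w \<in> carrier_vec d"
    and pos: "\<And>i. i \<in> I \<Longrightarrow> 0 < 1 + t * norm_sq (adj (N i) *\<^sub>v w)" "0 < 1 + t * norm_sq (adj N0 *\<^sub>v w)"
  shows "kn (H + complex_of_real t \<cdot>\<^sub>m rank_one w) = kn H +
    ((\<Sum>i\<in>I. \<chi> i * ln (1 + t * norm_sq (adj (N i) *\<^sub>v w))) - \<chi>0 * ln (1 + t * norm_sq (adj N0 *\<^sub>v w)))"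
proof -
  note Hc = posdefD(1)[OF H]
  let ?H = "H + complex_of_real t \<cdot>\<^sub>m rank_one w"
  have Hc': "?H \<in> carrier_mat d d" using w by simp
  have 1: "ln (cmod (det (gram ?H i))) = ln (cmod (det (gram H i))) + ln (1 + t * norm_sq (adj (N i) *\<^sub>v w))" if i: "i \<in> I" for i
  proof -
    have "det (gram ?H i) = det (gram H i) * complex_of_real (1 + t * norm_sq (adj (N i) *\<^sub>v w))"
      unfolding gram_def
      by (rule gram_det_rank_one_update[OF Hc _ M_carrier[OF i] _ w, of _ "V i"]) (use N i M_onb[OF i] in \<open>auto simp: onb_def\<close>)
    then have "cmod (det (gram ?H i)) = cmod (det (gram H i)) * (1 + t * norm_sq (adj (N i) *\<^sub>v w))"
      using pos(1)[OF i] by (simp only: norm_mult norm_of_real abs_of_pos)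
    then show ?thesis using gram_det_nz[OF H i] pos(1)[OF i] by (simp add: ln_mult)
  qed
  have "mimg (1\<^sub>m d) = carrier_vec d" using onb_one_carrier by (simp add: onb_def)
  from gram_det_rank_one_update[OF Hc N0 one_carrier_mat this w, of t]
  have "det (adj (1\<^sub>m d) * (?H * 1\<^sub>m d)) = det (adj (1\<^sub>m d) * (H * 1\<^sub>m d)) * complex_of_real (1 + t * norm_sq (adj N0 *\<^sub>v w))" .
  moreover have "adj (1\<^sub>m d) * (G * 1\<^sub>m d) = G" if "G \<in> carrier_mat d d" for G
    using that by simp
  ultimately have "det ?H = det H * complex_of_real (1 + t * norm_sq (adj N0 *\<^sub>v w))"
    by (simp only: Hc Hc')
  then have "cmod (det ?H) = cmod (det H) * (1 + t * norm_sq (adj N0 *\<^sub>v w))"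
    using pos(2) by (simp only: norm_mult norm_of_real abs_of_pos)
  then have 2: "ln (cmod (det ?H)) = ln (cmod (det H)) + ln (1 + t * norm_sq (adj N0 *\<^sub>v w))"
    using det_nz[OF H] pos(2) by (simp add: ln_mult)
  show ?thesis unfolding kn_def 2 using 1 by (simp add: algebra_simps sum.distrib)
qed

text \<open>Scaling multiplies the determinants by powers of \<open>c\<close>, and the exponents
  cancel by the condition \<open>trace\<close>. Hence only ratios of eigenvalues matter in the
  search for a minimum.\<close>

lemma kn_scale:
  assumes H: "posdef d H" and c: "0 < c"
  shows "kn (complex_of_real c \<cdot>\<^sub>m H) = kn H"
proof -
  note Hc = posdefD(1)[OF H]
  have 1: "ln (cmod (det (gram (complex_of_real c \<cdot>\<^sub>m H) i))) = ln (cmod (det (gram H i))) + real (cdim d (V i)) * ln c"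
    if i: "i \<in> I" for i
  proof -
    have "gram (complex_of_real c \<cdot>\<^sub>m H) i = complex_of_real c \<cdot>\<^sub>m gram H i"
      using mult_smult_assoc_mat[OF Hc M_carrier[OF i]]
        mult_smult_distrib[OF adj_carrier[OF M_carrier[OF i]] mult_carrier_mat[OF Hc M_carrier[OF i]]]
      by (simp add: gram_def)
    moreover have "gram H i \<in> carrier_mat (cdim d (V i)) (cdim d (V i))" using M_carrier[OF i] by (auto simp: gram_def)
    ultimately have "cmod (det (gram (complex_of_real c \<cdot>\<^sub>m H) i)) = c ^ cdim d (V i) * cmod (det (gram H i))"
      using c by (simp add: det_smult norm_mult norm_power)
    then show ?thesis using gram_det_nz[OF H i] c by (simp add: ln_mult ln_realpow)
  qed
  have 2: "ln (cmod (det (complex_of_real c \<cdot>\<^sub>m H))) = ln (cmod (det H)) + real d * ln c"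
    using det_nz[OF H] c Hc by (simp add: det_smult norm_mult norm_power ln_mult ln_realpow)
  have "(\<Sum>i\<in>I. \<chi> i * (real (cdim d (V i)) * ln c)) = \<chi>0 * real d * ln c"
    unfolding trace[symmetric] by (simp add: sum_distrib_right mult.assoc)
  then show ?thesis unfolding kn_def 2 using 1 by (simp add: algebra_simps sum.distrib)
qed

lemma kn_continuous:
  fixes H :: "nat \<Rightarrow> complex mat"
  assumes lim: "mat_lim d d H L" and L: "posdef d L"
  shows "(\<lambda>r. kn (H r)) \<longlonglongrightarrow> kn L"
  unfolding kn_def
proof (intro tendsto_diff tendsto_sum tendsto_mult tendsto_const tendsto_ln tendsto_norm)
  show "(\<lambda>r. det (H r)) \<longlonglongrightarrow> det L" by (rule mat_lim_det[OF lim])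
  show "cmod (det L) \<noteq> 0" using det_nz[OF L] by simp
  fix i assume i: "i \<in> I"
  show "cmod (det (gram L i)) \<noteq> 0" using gram_det_nz[OF L i] by simp
  show "(\<lambda>r. det (gram (H r) i)) \<longlonglongrightarrow> det (gram L i)"
    unfolding gram_def
    by (rule mat_lim_det[OF mat_lim_mult[OF mat_lim_const[OF adj_carrier[OF M_carrier[OF i]]]
          mat_lim_mult[OF lim mat_lim_const[OF M_carrier[OF i]]]]])
qed

lemma kn_compact:
  fixes H :: "nat \<Rightarrow> complex mat"
  assumes H: "\<And>r. form_bounds d 1 n (H r)"
  shows "\<exists>s L. strict_mono s \<and> form_bounds d 1 n L \<and> (\<lambda>r. kn (H (s r))) \<longlonglongrightarrow> kn L"
proof -
  have Hc: "H r \<in> carrier_mat d d" for r using H[of r] by (simp add: form_bounds_def)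
  have "\<exists>s L. strict_mono s \<and> mat_lim d d (\<lambda>r. H (s r)) L"
    by (rule bounded_mats_convergent_subsequence[OF Hc, where K = "real d * n"]) (rule form_bounds_entry[OF H], auto)
  then obtain s L where s: "strict_mono s" and L: "mat_lim d d (\<lambda>r. H (s r)) L" by blast
  have fb: "form_bounds d 1 n L" by (rule form_bounds_limit[OF L H])
  then have "posdef d L" by (rule form_bounds_posdef) simp
  from s fb kn_continuous[OF L this] show ?thesis by blast
qed

text \<open>The admissible forms are compact and \<open>kn\<close> is continuous on them, so both
  boundedness below and attainment follow by extracting subsequences.\<close>

lemma kn_minimiser:
  assumes n: "1 \<le> n"
  shows "\<exists>L. form_bounds d 1 n L \<and> (\<forall>H. form_bounds d 1 n H \<longrightarrow> kn L \<le> kn H)"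
proof -
  define S where "S = kn ` {H. form_bounds d 1 n H}"
  have "form_bounds d 1 n (1\<^sub>m d)"
    unfolding form_bounds_def
  proof (intro conjI ballI)
    fix x :: "complex vec" assume "x \<in> carrier_vec d"
    then show "1 * norm_sq x \<le> Re ((1\<^sub>m d *\<^sub>v x) \<bullet>c x)" "Re ((1\<^sub>m d *\<^sub>v x) \<bullet>c x) \<le> n * norm_sq x"
      using mult_right_mono[OF n norm_sq_nonneg[of x]] by (simp_all add: cscalar_prod_self)
  qed auto
  then have ne: "S \<noteq> {}" by (auto simp: S_def)
  have bdd: "bdd_below S"
  proof (rule ccontr)
    assume nb: "\<not> bdd_below S"
    have "\<exists>H. form_bounds d 1 n H \<and> kn H < - real r" for r :: nat
    proof -
      have "\<not> (\<forall>y\<in>S. - real r \<le> y)" using nb unfolding bdd_below_def by blast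
      then obtain y where "y \<in> S" "y < - real r" by (auto simp: not_le)
      then show ?thesis by (auto simp: S_def)
    qed
    then obtain H where H: "\<And>r. form_bounds d 1 n (H r)" "\<And>r. kn (H r) < - real r" by metis
    obtain s L where s: "strict_mono s" and lim: "(\<lambda>r. kn (H (s r))) \<longlonglongrightarrow> kn L" using kn_compact[of n H, OF H(1)] by blast
    from lim have "Bseq (\<lambda>r. kn (H (s r)))" by (intro convergent_imp_Bseq convergentI)
    then obtain K where K: "\<And>r. \<bar>kn (H (s r))\<bar> \<le> K" by (auto simp: Bseq_def)
    obtain r :: nat where "K < real r" using reals_Archimedean2 by blast
    also have "real r \<le> real (s r)" using seq_suble[OF s] by simp
    finally show False using H(2)[of "s r"] K[of r] by linarith
  qed
  have "\<exists>H. form_bounds d 1 n H \<and> kn H < Inf S + 1 / real (Suc r)" for r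
  proof -
    have "Inf S < Inf S + 1 / real (Suc r)" by simp
    then obtain y where "y \<in> S" "y < Inf S + 1 / real (Suc r)" using cInf_lessD[OF ne] by blast
    then show ?thesis by (auto simp: S_def)
  qed
  then obtain H where H: "\<And>r. form_bounds d 1 n (H r)" "\<And>r. kn (H r) < Inf S + 1 / real (Suc r)" by metis
  obtain s L where s: "strict_mono s" and L: "form_bounds d 1 n L" and lim: "(\<lambda>r. kn (H (s r))) \<longlonglongrightarrow> kn L"
    using kn_compact[of n H, OF H(1)] by blast
  have "(\<lambda>r. Inf S + 1 / real (Suc r)) \<longlonglongrightarrow> Inf S + 0"
    by (intro tendsto_add tendsto_const LIMSEQ_Suc lim_1_over_n)
  from LIMSEQ_subseq_LIMSEQ[OF this s] have lim': "(\<lambda>r. Inf S + 1 / real (Suc (s r))) \<longlonglongrightarrow> Inf S" by (simp add: o_def)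
  have "kn L \<le> Inf S" by (rule LIMSEQ_le[OF lim lim']) (use H(2) in \<open>auto intro: less_imp_le\<close>)
  moreover have "Inf S \<le> kn H" if "form_bounds d 1 n H" for H
    by (rule cInf_lower[OF _ bdd]) (use that in \<open>auto simp: S_def\<close>)
  ultimately show ?thesis using L by (intro exI[of _ L]) (auto intro: order_trans)
qed

end

text \<open>Pigeonhole: otherwise each of the \<open>d\<close> disjoint intervals from
  \<open>a * R ^ i\<close> (excluded) to \<open>a * R ^ Suc i\<close> (included) contains a value of
  \<open>ev\<close>. Since \<open>ev k0 = a\<close> lies in none of them, only \<open>d - 1\<close>
  indices are available.\<close>

lemma geometric_gap:
  fixes ev :: "nat \<Rightarrow> real"
  assumes k0: "k0 < d" and a: "0 < a" "ev k0 = a" and R: "1 < R"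
  shows "\<exists>i<d. \<forall>k<d. a * R ^ i < ev k \<longrightarrow> a * R ^ Suc i < ev k"
proof (rule ccontr)
  assume neg: "\<not> ?thesis"
  have ex: "\<exists>k. k < d \<and> a * R ^ i < ev k \<and> ev k \<le> a * R ^ Suc i" if "i < d" for i
    using that neg unfolding not_less[symmetric] by blast
  define g where "g i = (SOME k. k < d \<and> a * R ^ i < ev k \<and> ev k \<le> a * R ^ Suc i)" for i
  have g: "g i < d \<and> a * R ^ i < ev (g i) \<and> ev (g i) \<le> a * R ^ Suc i" if "i < d" for i
    unfolding g_def by (rule someI_ex[OF ex[OF that]])
  have less: "ev (g i) < ev (g j)" if "i < j" "j < d" for i j
  proof -
    have "R ^ Suc i \<le> R ^ j" using that R by (intro power_increasing) auto
    then have "a * R ^ Suc i \<le> a * R ^ j" using a(1) by (intro mult_left_mono) auto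
    then show ?thesis using g[of i] g[of j] that by fastforce
  qed
  have "inj_on g {..<d}"
  proof (rule inj_onI)
    fix i j assume "i \<in> {..<d}" "j \<in> {..<d}" "g i = g j"
    then show "i = j" using less[of i j] less[of j i] by (cases i j rule: linorder_cases) auto
  qed
  moreover have "g ` {..<d} \<subseteq> {..<d} - {k0}"
  proof
    fix k assume "k \<in> g ` {..<d}"
    then obtain i where i: "i < d" "k = g i" by auto
    have "1 \<le> R ^ i" using R by simp
    then have "a \<le> a * R ^ i" using a(1) by simp
    then have "ev k0 < ev k" using conjunct1[OF conjunct2[OF g[OF i(1)]]] i(2) a(2) by simp
    then show "k \<in> {..<d} - {k0}" using g[OF i(1)] i(2) by auto
  qed
  ultimately have "card {..<d} \<le> card ({..<d} - {k0})" by (intro card_inj_on_le) auto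
  then show False using k0 by simp
qed

context stable_config
begin

text \<open>The minimiser over forms between 1 and \<open>n\<close> is critical. Its eigenvalue
  spread is below \<open>R ^ d\<close>: otherwise there is a gap above a group \<open>A\<close> of
  small eigenvalues; raising any of them is admissible and so cannot decrease \<open>kn\<close>,
  while the sum of these variations over \<open>A\<close> contradicts \<open>spectral_gap\<close>.
  With the spread bounded, small rank-one changes of either sign are admissible after scaling, and
  the first variation vanishes.\<close>

lemma balanced_form:
  "\<exists>H. posdef d H \<and> (\<forall>N w. (\<forall>i\<in>I. onb H d (cdim d (V i)) (N i) (V i)) \<and> w \<in> carrier_vec d \<longrightarrow>
    (\<Sum>i\<in>I. \<chi> i * norm_sq (adj (N i) *\<^sub>v (H *\<^sub>v w))) = \<chi>0 * Re ((H *\<^sub>v w) \<bullet>c w))"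
proof -
  obtain R where R: "1 < R" and gap: "\<forall>A H U ev T N. A \<subseteq> {..<d} \<and> A \<noteq> {} \<and> A \<noteq> {..<d} \<and> posdef d H \<and> eigenbasis d H U ev \<and> 0 < T \<and>
      (\<forall>k\<in>A. 0 < ev k \<and> ev k \<le> T) \<and> (\<forall>k<d. k \<notin> A \<longrightarrow> T * R \<le> ev k) \<and>
      (\<forall>i\<in>I. onb H d (cdim d (V i)) (N i) (V i)) \<longrightarrow>
      (\<Sum>i\<in>I. \<chi> i * (\<Sum>k\<in>A. ev k * norm_sq (adj (N i) *\<^sub>v col U k))) < \<chi>0 * real (card A)"
    using spectral_gap by (elim exE conjE)
  note gap' = gap[THEN spec, THEN spec, THEN spec, THEN spec, THEN spec, THEN spec, THEN mp]
  \<comment> \<open>\<open>R ^ d\<close> is the bound on the eigenvalue spread proved below; the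
    factor 2 is room for perturbations.\<close>
  define n where "n = 2 * R ^ d"
  have Rd: "1 \<le> R ^ d" using R by simp
  then have n1: "1 \<le> n" by (simp add: n_def)
  obtain H where Hb: "form_bounds d 1 n H" and min: "\<And>H'. form_bounds d 1 n H' \<Longrightarrow> kn H \<le> kn H'"
    using kn_minimiser[OF n1] by blast
  have H: "posdef d H" by (rule form_bounds_posdef[OF Hb]) simp
  note Hc = posdefD(1,2)[OF H]
  \<comment> \<open>By scale invariance \<open>H\<close> also competes with every form whose bounds
    have ratio at most \<open>n\<close>.\<close>
  have min': "kn H \<le> kn H'" if b: "form_bounds d a b H'" and a: "0 < a" "b \<le> n * a" for a b H'
  proof -
    have "form_bounds d (1 / a * a) (1 / a * b) (complex_of_real (1 / a) \<cdot>\<^sub>m H')"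
      by (rule form_bounds_scale[OF b]) (use a in simp)
    moreover have "1 / a * b \<le> n" "1 / a * a = 1" using a by (simp_all add: field_simps)
    moreover have "norm_sq x * (1 / a * b) \<le> norm_sq x * n" for x
      by (rule mult_left_mono) (use calculation in auto)
    ultimately have "form_bounds d 1 n (complex_of_real (1 / a) \<cdot>\<^sub>m H')"
      unfolding form_bounds_def by (metis (no_types, lifting) mult.commute order_trans)
    then have "kn H \<le> kn (complex_of_real (1 / a) \<cdot>\<^sub>m H')" by (rule min)
    also have "\<dots> = kn H'" by (rule kn_scale[OF form_bounds_posdef[OF b a(1)]]) (use a in simp)
    finally show ?thesis .
  qed
  obtain U ev where U: "eigenbasis d H U ev" using hermitian_eigenbasis[OF Hc] by blast
  note u = eigenbasisD[OF U]
  have ev1: "1 \<le> ev k" if "k < d" for k using eigenvalue_bounds[OF Hb U that] by simp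
  obtain N where N: "\<forall>i\<in>I. onb H d (cdim d (V i)) (N i) (V i)" using onb_V_exists[OF H] by blast
  obtain N0 where N0: "onb H d d N0 (carrier_vec d)" using onb_full_exists[OF H] by blast
  define p where "p w i = norm_sq (adj (N i) *\<^sub>v w)" for w i
  define q where "q w = norm_sq (adj N0 *\<^sub>v w)" for w
  have pq0: "0 \<le> p w i" "0 \<le> q w" for w i by (auto simp: p_def q_def)
  have update: "kn (H + complex_of_real t \<cdot>\<^sub>m rank_one w) = kn H + ((\<Sum>i\<in>I. \<chi> i * ln (1 + t * p w i)) - \<chi>0 * ln (1 + t * q w))"
    if "w \<in> carrier_vec d" "\<And>i. i \<in> I \<Longrightarrow> 0 < 1 + t * p w i" "0 < 1 + t * q w" for t w
    using kn_rank_one_update[OF H N N0 that(1), of t] that(2,3) unfolding p_def q_def by blast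
  have fin_ev: "finite (ev ` {..<d})" "ev ` {..<d} \<noteq> {}" using d_pos by auto
  define lo where "lo = Min (ev ` {..<d})"
  define hi where "hi = Max (ev ` {..<d})"
  obtain k0 where k0: "k0 < d" "ev k0 = lo" using Min_in[OF fin_ev] unfolding lo_def by auto
  obtain k1 where k1: "k1 < d" "ev k1 = hi" using Max_in[OF fin_ev] unfolding hi_def by auto
  have lohi: "lo \<le> ev k" "ev k \<le> hi" if "k < d" for k
    using that fin_ev by (auto simp: lo_def hi_def)
  have lo: "1 \<le> lo" using ev1[OF k0(1)] k0(2) by simp
  have form: "Re ((H *\<^sub>v x) \<bullet>c x) = (\<Sum>k<d. ev k * (cmod ((adj U *\<^sub>v x) $ k))\<^sup>2)" if "x \<in> carrier_vec d" for x
    by (rule eigenbasis_form[OF Hc U that])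
  have ns: "norm_sq x = (\<Sum>k<d. (cmod ((adj U *\<^sub>v x) $ k))\<^sup>2)" if "x \<in> carrier_vec d" for x
    by (rule norm_sq_unitary_coords[OF u(2,4) that])
  have bounds: "lo * norm_sq x \<le> Re ((H *\<^sub>v x) \<bullet>c x)" "Re ((H *\<^sub>v x) \<bullet>c x) \<le> hi * norm_sq x"
    if x: "x \<in> carrier_vec d" for x
    unfolding form[OF x] ns[OF x] sum_distrib_left by (rule sum_mono, rule mult_right_mono; use lohi in simp)+
  have hi: "hi < R ^ d * lo"
  proof (rule ccontr)
    assume "\<not> hi < R ^ d * lo"
    then have hi: "lo * R ^ d \<le> hi" by (simp add: mult.commute)
    \<comment> \<open>A jump in the spectrum: no eigenvalue lies above \<open>lo * R ^ i\<close> and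
      at most \<open>lo * R ^ Suc i\<close>.\<close>
    obtain i where i: "i < d" and gapi: "\<And>k. k < d \<Longrightarrow> lo * R ^ i < ev k \<Longrightarrow> lo * R ^ Suc i < ev k"
      using geometric_gap[of k0 d lo ev R] k0 R lo by auto
    define T where "T = lo * R ^ i"
    have T: "0 < T" using lo R by (simp add: T_def)
    define A where "A = {k. k < d \<and> ev k \<le> T}"
    have "1 \<le> R ^ i" using R by simp
    then have "lo \<le> T" using lo by (simp add: T_def)
    then have k0A: "k0 \<in> A" using k0 by (simp add: A_def)
    have "R ^ i < R ^ d" using i R by (simp add: power_strict_increasing)
    then have "lo * R ^ i < lo * R ^ d" using lo by (intro mult_strict_left_mono) auto
    then have Thi: "T < hi" using hi by (simp add: T_def)
    have k1A: "k1 \<notin> A" using Thi k1 by (simp add: A_def)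
    have "A \<subseteq> {..<d} \<and> A \<noteq> {} \<and> A \<noteq> {..<d} \<and> posdef d H \<and> eigenbasis d H U ev \<and> 0 < T \<and>
      (\<forall>k\<in>A. 0 < ev k \<and> ev k \<le> T) \<and> (\<forall>k<d. k \<notin> A \<longrightarrow> T * R \<le> ev k) \<and>
      (\<forall>i\<in>I. onb H d (cdim d (V i)) (N i) (V i))"
    proof (intro conjI ballI allI impI)
      show "A \<noteq> {}" "A \<noteq> {..<d}" using k0A k1A k1 by auto
      fix k assume "k < d" "k \<notin> A"
      then show "T * R \<le> ev k" using gapi[of k] by (auto simp: A_def T_def mult_ac not_le)
    next
      fix k assume "k \<in> A"
      then show "0 < ev k" using ev1[of k] by (auto simp: A_def)
    qed (use H U T N in \<open>auto simp: A_def\<close>)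
    then have less: "(\<Sum>i\<in>I. \<chi> i * (\<Sum>k\<in>A. ev k * norm_sq (adj (N i) *\<^sub>v col U k))) < \<chi>0 * real (card A)"
      by (rule gap')
    \<comment> \<open>Raising the eigenvalue \<open>ev k\<close> by less than \<open>hi - T\<close>
      keeps the form below \<open>hi\<close>, so the perturbed form is admissible and the one-sided
      derivative is nonnegative.\<close>
    have "\<chi>0 \<le> (\<Sum>i\<in>I. \<chi> i * (ev k * p (col U k) i))" if kA: "k \<in> A" for k
    proof -
      have k: "k < d" "ev k \<le> T" using kA by (auto simp: A_def)
      let ?w = "col U k"
      have w: "?w \<in> carrier_vec d" using u(2) by auto
      have "(\<Sum>i\<in>I. \<chi> i * p ?w i) - \<chi>0 * q ?w \<ge> 0"
      proof (rule weighted_log_derivative[OF fin, of "hi - T"])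
        show "0 < hi - T" using Thi by simp
        fix t assume t: "0 < t" "t < hi - T"
        have H': "H + complex_of_real t \<cdot>\<^sub>m rank_one ?w \<in> carrier_mat d d"
          "adj (H + complex_of_real t \<cdot>\<^sub>m rank_one ?w) = H + complex_of_real t \<cdot>\<^sub>m rank_one ?w"
          using hermitian_rank_one_update[OF Hc w] by auto
        have "form_bounds d 1 n (H + complex_of_real t \<cdot>\<^sub>m rank_one ?w)"
          unfolding form_bounds_def
        proof (intro conjI H' ballI)
          fix x :: "complex vec" assume x: "x \<in> carrier_vec d"
          have e: "Re (((H + complex_of_real t \<cdot>\<^sub>m rank_one ?w) *\<^sub>v x) \<bullet>c x) = Re ((H *\<^sub>v x) \<bullet>c x) + t * (cmod (x \<bullet>c ?w))\<^sup>2"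
            by (rule rank_one_form[OF Hc(1) w x])
          have "1 * norm_sq x \<le> Re ((H *\<^sub>v x) \<bullet>c x)" using Hb x by (simp add: form_bounds_def)
          moreover have "0 \<le> t * (cmod (x \<bullet>c ?w))\<^sup>2" using t by simp
          ultimately show "1 * norm_sq x \<le> Re (((H + complex_of_real t \<cdot>\<^sub>m rank_one ?w) *\<^sub>v x) \<bullet>c x)"
            unfolding e by linarith
          have xk: "x \<bullet>c ?w = (adj U *\<^sub>v x) $ k" by (rule index_adj_mult_vec[OF u(2) x k(1), symmetric])
          have "Re (((H + complex_of_real t \<cdot>\<^sub>m rank_one ?w) *\<^sub>v x) \<bullet>c x) =
              (\<Sum>l<d. (ev l + (if l = k then t else 0)) * (cmod ((adj U *\<^sub>v x) $ l))\<^sup>2)"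
            unfolding e form[OF x] xk using k(1)
            by (simp add: distrib_right sum.distrib if_distrib[of "\<lambda>z. z * _"] cong: if_cong del: index_mult_mat_vec)
          also have "\<dots> \<le> (\<Sum>l<d. hi * (cmod ((adj U *\<^sub>v x) $ l))\<^sup>2)"
            by (rule sum_mono, rule mult_right_mono) (use lohi(2) k(2) t in auto)
          also have "\<dots> = hi * norm_sq x" unfolding ns[OF x] sum_distrib_left ..
          also have "\<dots> \<le> n * norm_sq x"
            using eigenvalue_bounds(2)[OF Hb U k1(1)] k1(2) by (intro mult_right_mono) auto
          finally show "Re (((H + complex_of_real t \<cdot>\<^sub>m rank_one ?w) *\<^sub>v x) \<bullet>c x) \<le> n * norm_sq x" .
        qed
        from min[OF this] update[OF w, of t] t pq0[of ?w]
        show "0 \<le> (\<Sum>i\<in>I. \<chi> i * ln (1 + t * p ?w i)) - \<chi>0 * ln (1 + t * q ?w)"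
          by (simp add: add_pos_nonneg)
      qed
      \<comment> \<open>\<open>q\<close> is the quadratic form of the inverse of \<open>H\<close>,
        and \<open>?w\<close> is a unit eigenvector for \<open>ev k\<close>.\<close>
      moreover have "q ?w = 1 / ev k"
      proof -
        let ?v = "complex_of_real (1 / ev k) \<cdot>\<^sub>v ?w"
        have e: "ev k \<noteq> 0" using ev1[OF k(1)] by auto
        have Hv: "H *\<^sub>v ?v = ?w"
          unfolding mult_mat_vec[OF Hc(1) w] u(5)[OF k(1)] using e by (simp add: smult_smult_assoc)
        have "q ?w = Re (?w \<bullet>c ?v)" using onb_full_norm_sq[OF Hc N0, of ?v] w Hv by (simp add: q_def)
        also have "\<dots> = 1 / ev k"
          unfolding cscalar_prod_smult_right[OF w w] cscalar_prod_self norm_sq_col_unitary[OF u(2,3) k(1)] by simp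
        finally show ?thesis .
      qed
      ultimately have "\<chi>0 / ev k \<le> (\<Sum>i\<in>I. \<chi> i * p ?w i)" by simp
      then have "\<chi>0 \<le> ev k * (\<Sum>i\<in>I. \<chi> i * p ?w i)" using ev1[OF k(1)] by (simp add: field_simps)
      then show ?thesis by (simp add: sum_distrib_left mult_ac)
    qed
    then have "(\<Sum>k\<in>A. \<chi>0) \<le> (\<Sum>k\<in>A. \<Sum>i\<in>I. \<chi> i * (ev k * p (col U k) i))" by (rule sum_mono)
    also have "\<dots> = (\<Sum>i\<in>I. \<chi> i * (\<Sum>k\<in>A. ev k * norm_sq (adj (N i) *\<^sub>v col U k)))"
      unfolding p_def by (subst sum.swap) (simp add: sum_distrib_left)
    finally show False using less by (simp add: mult.commute[of \<chi>0])
  qed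
  have balanced: "(\<Sum>i\<in>I. \<chi> i * p w i) = \<chi>0 * q w" if w: "w \<in> carrier_vec d" for w
  proof -
    \<comment> \<open>\<open>B\<close> bounds \<open>norm_sq w\<close>, \<open>q w\<close> and every
      \<open>p w i\<close>. When the modulus of \<open>t\<close> times \<open>B\<close> is below
      1/4, all arguments of the logarithms stay positive, and the form changes by at most a quarter
      of \<open>norm_sq\<close>.\<close>
    define B where "B = 1 + norm_sq w + q w + (\<Sum>i\<in>I. p w i)"
    have sum0: "0 \<le> (\<Sum>i\<in>I. p w i)" by (rule sum_nonneg) (use pq0 in auto)
    have B: "0 < B" "norm_sq w \<le> B" "q w \<le> B"
      using sum0 norm_sq_nonneg[of w] pq0(2)[of w] unfolding B_def by linarith+
    have Bp: "p w i \<le> B" if "i \<in> I" for i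
    proof -
      have "p w i \<le> (\<Sum>i\<in>I. p w i)" by (rule member_le_sum) (use that fin pq0 in auto)
      then show ?thesis using norm_sq_nonneg[of w] pq0(2)[of w] unfolding B_def by linarith
    qed
    have ge: "0 \<le> (\<Sum>i\<in>I. \<chi> i * ln (1 + t * p w i)) - \<chi>0 * ln (1 + t * q w)" if t: "\<bar>t\<bar> * B < 1 / 4" for t
    proof -
      have small: "\<bar>t * z\<bar> < 1 / 4" if "0 \<le> z" "z \<le> B" for z
      proof -
        have "\<bar>t * z\<bar> \<le> \<bar>t\<bar> * B" using that by (simp add: abs_mult mult_left_mono)
        then show ?thesis using t by linarith
      qed
      have pos: "0 < 1 + t * z" if "0 \<le> z" "z \<le> B" for z using small[OF that] by linarith
      have "form_bounds d (lo - 1 / 4) (hi + 1 / 4) (H + complex_of_real t \<cdot>\<^sub>m rank_one w)"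
        unfolding form_bounds_def
      proof (intro conjI hermitian_rank_one_update[OF Hc w] ballI)
        fix x :: "complex vec" assume x: "x \<in> carrier_vec d"
        have e: "Re (((H + complex_of_real t \<cdot>\<^sub>m rank_one w) *\<^sub>v x) \<bullet>c x) = Re ((H *\<^sub>v x) \<bullet>c x) + t * (cmod (x \<bullet>c w))\<^sup>2"
          by (rule rank_one_form[OF Hc(1) w x])
        have "\<bar>t * (cmod (x \<bullet>c w))\<^sup>2\<bar> \<le> \<bar>t\<bar> * (norm_sq x * norm_sq w)"
          using mult_left_mono[OF cauchy_schwarz_vec[OF x w], of "\<bar>t\<bar>"] by (simp add: abs_mult)
        also have "\<dots> = \<bar>t * norm_sq w\<bar> * norm_sq x" by (simp add: abs_mult)
        also have "\<dots> \<le> 1 / 4 * norm_sq x"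
          by (rule mult_right_mono) (use small[of "norm_sq w"] B(2) in auto)
        finally have "\<bar>t * (cmod (x \<bullet>c w))\<^sup>2\<bar> \<le> 1 / 4 * norm_sq x" .
        then show "(lo - 1 / 4) * norm_sq x \<le> Re (((H + complex_of_real t \<cdot>\<^sub>m rank_one w) *\<^sub>v x) \<bullet>c x)"
          "Re (((H + complex_of_real t \<cdot>\<^sub>m rank_one w) *\<^sub>v x) \<bullet>c x) \<le> (hi + 1 / 4) * norm_sq x"
          unfolding e left_diff_distrib distrib_right using bounds[OF x] by linarith+
      qed
      moreover have "0 < lo - 1 / 4" using lo by simp
      \<comment> \<open>The difference of the two sides exceeds
        \<open>R ^ d * (lo - 1 / 2) - 1 / 4\<close>, which is positive because \<open>R ^ d\<close>
        and \<open>lo\<close> are at least 1.\<close>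
      moreover have "hi + 1 / 4 \<le> n * (lo - 1 / 4)"
      proof -
        have "n * (lo - 1 / 4) - (R ^ d * lo + 1 / 4) = R ^ d * (lo - 1 / 2) - 1 / 4"
          by (simp add: n_def algebra_simps)
        moreover have "1 * (1 / 2) \<le> R ^ d * (lo - 1 / 2)" by (rule mult_mono) (use Rd lo in auto)
        ultimately show ?thesis using hi by linarith
      qed
      ultimately have "kn H \<le> kn (H + complex_of_real t \<cdot>\<^sub>m rank_one w)" by (rule min')
      then show ?thesis using update[OF w, of t] pos pq0 Bp B(3) by simp
    qed
    have \<epsilon>: "0 < 1 / (4 * B)" using B(1) by simp
    have tB: "\<bar>t\<bar> * B < 1 / 4" if "0 < t" "t < 1 / (4 * B)" for t :: real
      using that B(1) by (simp add: field_simps)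
    have "(\<Sum>i\<in>I. \<chi> i * p w i) - \<chi>0 * q w \<ge> 0"
      by (rule weighted_log_derivative[OF fin \<epsilon>]) (rule ge[OF tB])
    \<comment> \<open>Negative \<open>t\<close>, written as positive \<open>t\<close> with
      \<open>- p\<close> and \<open>- q\<close>, gives the reverse inequality.\<close>
    moreover have "(\<Sum>i\<in>I. \<chi> i * - p w i) - \<chi>0 * - q w \<ge> 0"
    proof (rule weighted_log_derivative[OF fin \<epsilon>])
      fix t :: real assume t: "0 < t" "t < 1 / (4 * B)"
      have "\<bar>- t\<bar> * B < 1 / 4" using tB[OF t] by simp
      from ge[OF this] show "0 \<le> (\<Sum>i\<in>I. \<chi> i * ln (1 + t * - p w i)) - \<chi>0 * ln (1 + t * - q w)" by simp
    qed
    ultimately show ?thesis by (simp add: sum_negf)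
  qed
  show ?thesis
  proof (intro exI[of _ H] conjI H allI impI, elim conjE)
    fix N' and w :: "complex vec" assume N': "\<forall>i\<in>I. onb H d (cdim d (V i)) (N' i) (V i)" and w: "w \<in> carrier_vec d"
    have Hw: "H *\<^sub>v w \<in> carrier_vec d" using Hc(1) w by (auto intro: mult_mat_vec_carrier)
    \<comment> \<open>The balance is applied at \<open>H *\<^sub>v w\<close>; the choice of
      orthonormal bases does not affect the norms.\<close>
    have "(\<Sum>i\<in>I. \<chi> i * norm_sq (adj (N' i) *\<^sub>v (H *\<^sub>v w))) = (\<Sum>i\<in>I. \<chi> i * p (H *\<^sub>v w) i)"
      unfolding p_def
    proof (rule sum.cong)
      fix i assume i: "i \<in> I"
      have "norm_sq (adj (N' i) *\<^sub>v (H *\<^sub>v w)) = norm_sq (adj (N i) *\<^sub>v (H *\<^sub>v w))"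
        by (rule onb_norm_sq_unique[OF Hc _ _ Hw]) (use N N' i in blast)+
      then show "\<chi> i * norm_sq (adj (N' i) *\<^sub>v (H *\<^sub>v w)) = \<chi> i * norm_sq (adj (N i) *\<^sub>v (H *\<^sub>v w))" by simp
    qed simp
    also have "\<dots> = \<chi>0 * q (H *\<^sub>v w)" by (rule balanced[OF Hw])
    also have "q (H *\<^sub>v w) = Re ((H *\<^sub>v w) \<bullet>c w)" unfolding q_def by (rule onb_full_norm_sq[OF Hc N0 w])
    finally show "(\<Sum>i\<in>I. \<chi> i * norm_sq (adj (N' i) *\<^sub>v (H *\<^sub>v w))) = \<chi>0 * Re ((H *\<^sub>v w) \<bullet>c w)" .
  qed
qed

end

section \<open>Centralizers of Hermitian matrices\<close>

text \<open>Stated for any module with matrix addition, because it is applied both to all square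
  matrices and to a centralizer with its restricted carrier.\<close>

lemma finsum_mat:
  fixes M :: "(complex, complex mat) module"
  assumes M: "abelian_monoid M" and add: "add M = (+)" and zero: "zero M = 0\<^sub>m d d"
    and sub: "carrier M \<subseteq> carrier_mat d d" and I: "finite I" and f: "f \<in> I \<rightarrow> carrier M"
  shows "finsum M f I \<in> carrier M"
    and "r < d \<Longrightarrow> c < d \<Longrightarrow> finsum M f I $$ (r, c) = (\<Sum>i\<in>I. f i $$ (r, c))"
proof -
  interpret abelian_monoid M by (rule M)
  show "finsum M f I \<in> carrier M" using f by (rule finsum_closed)
  show "finsum M f I $$ (r, c) = (\<Sum>i\<in>I. f i $$ (r, c))" if rc: "r < d" "c < d"
    using I f
  proof (induction I rule: finite_induct)
    case empty then show ?case using rc by (simp add: zero)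
  next
    case (insert i I)
    then have i: "f i \<in> carrier M" and fI: "f \<in> I \<rightarrow> carrier M" by auto
    have "finsum M f (insert i I) = f i + finsum M f I"
      using finsum_insert[OF insert.hyps fI i] by (simp add: add)
    moreover have "finsum M f I \<in> carrier_mat d d" using finsum_closed[OF fI] sub by blast
    ultimately show ?case using insert.IH[OF fI] insert.hyps rc by simp
  qed
qed

lemma mat_sum:
  assumes "finite I" and "\<And>i. i \<in> I \<Longrightarrow> f i \<in> carrier_mat d d"
  shows "mat_sum d f I \<in> carrier_mat d d"
    and "r < d \<Longrightarrow> c < d \<Longrightarrow> mat_sum d f I $$ (r, c) = (\<Sum>i\<in>I. f i $$ (r, c))"
proof -
  have M: "abelian_monoid (module_mat TYPE(complex) d d)"
    using abelian_group_mat by (rule abelian_group.axioms(1))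
  note s = finsum_mat[OF M, of d, unfolded module_mat_simps, OF refl refl subset_refl assms(1)]
  have f: "f \<in> I \<rightarrow> carrier_mat d d" using assms(2) by blast
  show "mat_sum d f I \<in> carrier_mat d d" by (rule s(1)[OF f])
  show "r < d \<Longrightarrow> c < d \<Longrightarrow> mat_sum d f I $$ (r, c) = (\<Sum>i\<in>I. f i $$ (r, c))" by (rule s(2)[OF f])
qed

section \<open>Unitarily diagonalised matrices and their commutants\<close>

definition unitary_mat :: "nat \<Rightarrow> complex mat \<Rightarrow> bool" where
  "unitary_mat d W \<longleftrightarrow> W \<in> carrier_mat d d \<and> adj W * W = 1\<^sub>m d \<and> W * adj W = 1\<^sub>m d"

definition spectral_mat :: "nat \<Rightarrow> complex mat \<Rightarrow> (nat \<Rightarrow> real) \<Rightarrow> complex mat" where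
  "spectral_mat d W \<alpha> = W * (mat d d (\<lambda>(r, c). if r = c then complex_of_real (\<alpha> r) else 0) * adj W)"

lemma conjugate_conjugate:
  fixes A B C :: "complex mat"
  assumes "A \<in> carrier_mat d d" "B \<in> carrier_mat d d" "A' \<in> carrier_mat d d" "B' \<in> carrier_mat d d"
    "A' * A = 1\<^sub>m d" "B * B' = 1\<^sub>m d" and C: "C \<in> carrier_mat d d"
  shows "A' * ((A * (C * B)) * B') = C"
proof -
  have "A' * ((A * (C * B)) * B') = (A' * A) * (C * (B * B'))"
    using assms(1-4) C by (simp add: mult_assoc_dim)
  then show ?thesis using assms by simp
qed

context
  fixes d W and \<alpha> :: "nat \<Rightarrow> real"
  assumes W: "unitary_mat d W"
begin

private abbreviation (input) "D \<equiv> mat d d (\<lambda>(r, c). if r = c then complex_of_real (\<alpha> r) else 0)"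

lemma W_facts: "W \<in> carrier_mat d d" "adj W \<in> carrier_mat d d" "adj W * W = 1\<^sub>m d" "W * adj W = 1\<^sub>m d"
  using W by (auto simp: unitary_mat_def)

lemma spectral_mat_carrier: "spectral_mat d W \<alpha> \<in> carrier_mat d d"
  using W_facts by (auto simp: spectral_mat_def intro!: mult_carrier_mat)

lemma index_spectral_mat:
  assumes "r < d" "c < d"
  shows "spectral_mat d W \<alpha> $$ (r, c) = (\<Sum>a<d. complex_of_real (\<alpha> a) * (W $$ (r, a) * cnj (W $$ (c, a))))"
proof -
  have "spectral_mat d W \<alpha> $$ (r, c) = (\<Sum>pq\<in>{..<d} \<times> {..<d}. W $$ (r, fst pq) * adj W $$ (snd pq, c) *
      (case pq of (r, c) \<Rightarrow> if r = c then complex_of_real (\<alpha> r) else 0))"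
    unfolding spectral_mat_def by (rule index_conjugated_mat) (use W_facts assms in auto)
  also have "\<dots> = (\<Sum>p<d. \<Sum>q<d. W $$ (r, p) * adj W $$ (q, c) * (if p = q then complex_of_real (\<alpha> p) else 0))"
    by (simp add: sum.cartesian_product case_prod_beta)
  also have "\<dots> = (\<Sum>p<d. W $$ (r, p) * adj W $$ (p, c) * complex_of_real (\<alpha> p))"
    by (intro sum.cong refl) (simp add: sum.delta' if_distrib[where f = "\<lambda>x. _ * x"] cong: if_cong)
  also have "\<dots> = (\<Sum>a<d. complex_of_real (\<alpha> a) * (W $$ (r, a) * cnj (W $$ (c, a))))"
    using W_facts(1) assms by (intro sum.cong refl) simp
  finally show ?thesis .
qed

lemma spectral_mat_adj: "adj (spectral_mat d W \<alpha>) = spectral_mat d W \<alpha>"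
proof (rule eq_matI)
  fix r c assume "r < dim_row (spectral_mat d W \<alpha>)" "c < dim_col (spectral_mat d W \<alpha>)"
  then have rc: "r < d" "c < d" using spectral_mat_carrier by auto
  have "adj (spectral_mat d W \<alpha>) $$ (r, c) = cnj (spectral_mat d W \<alpha> $$ (c, r))"
    by (rule index_adj) (use rc spectral_mat_carrier in auto)
  also have "\<dots> = spectral_mat d W \<alpha> $$ (r, c)"
    unfolding index_spectral_mat[OF rc] index_spectral_mat[OF rc(2,1)] by (simp add: mult.commute)
  finally show "adj (spectral_mat d W \<alpha>) $$ (r, c) = spectral_mat d W \<alpha> $$ (r, c)" .
qed (use spectral_mat_carrier in auto)

lemma index_diag_mult:
  assumes "C \<in> carrier_mat d d" "r < d" "c < d"
  shows "(D * C) $$ (r, c) = complex_of_real (\<alpha> r) * C $$ (r, c)" "(C * D) $$ (r, c) = complex_of_real (\<alpha> c) * C $$ (r, c)"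
proof -
  have "(D * C) $$ (r, c) = (\<Sum>a<d. D $$ (r, a) * C $$ (a, c))"
    by (rule index_mult_mat_sum[of _ d d _ d]) (use assms in auto)
  also have "\<dots> = (\<Sum>a<d. if a = r then complex_of_real (\<alpha> r) * C $$ (r, c) else 0)"
    by (rule sum.cong) (use assms in auto)
  also have "\<dots> = complex_of_real (\<alpha> r) * C $$ (r, c)" using assms by simp
  finally show "(D * C) $$ (r, c) = complex_of_real (\<alpha> r) * C $$ (r, c)" .
  have "(C * D) $$ (r, c) = (\<Sum>a<d. C $$ (r, a) * D $$ (a, c))"
    by (rule index_mult_mat_sum[of _ d d _ d]) (use assms in auto)
  also have "\<dots> = (\<Sum>a<d. if a = c then complex_of_real (\<alpha> c) * C $$ (r, c) else 0)"
    by (rule sum.cong) (use assms in auto)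
  also have "\<dots> = complex_of_real (\<alpha> c) * C $$ (r, c)" using assms by simp
  finally show "(C * D) $$ (r, c) = complex_of_real (\<alpha> c) * C $$ (r, c)" .
qed

lemma spectrum_spectral_mat: "spectrum (spectral_mat d W \<alpha>) \<subseteq> (\<lambda>r. complex_of_real (\<alpha> r)) ` {..<d}"
proof
  fix k assume "k \<in> spectrum (spectral_mat d W \<alpha>)"
  then obtain v where v: "v \<in> carrier_vec d" "v \<noteq> 0\<^sub>v d" "spectral_mat d W \<alpha> *\<^sub>v v = k \<cdot>\<^sub>v v"
    using spectral_mat_carrier by (auto simp: spectrum_def eigenvalue_def eigenvector_def)
  define u where "u = adj W *\<^sub>v v"
  have u: "u \<in> carrier_vec d" using W_facts v by (auto simp: u_def intro: mult_mat_vec_carrier)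
  have Wu: "W *\<^sub>v u = v" unfolding u_def using W_facts v by (simp flip: assoc_mult_mat_vec[of _ d d _ d])
  have "u \<noteq> 0\<^sub>v d" using Wu v(2) mult_mat_vec_zero[OF W_facts(1)] by auto
  then obtain a where a: "a < d" "u $ a \<noteq> 0" using u by (auto simp: vec_eq_iff)
  have "k \<cdot>\<^sub>v u = adj W *\<^sub>v (spectral_mat d W \<alpha> *\<^sub>v v)" unfolding v(3) u_def by (rule mult_mat_vec[OF W_facts(2) v(1), symmetric])
  also have "\<dots> = (adj W * spectral_mat d W \<alpha>) *\<^sub>v v"
    by (rule assoc_mult_mat_vec[OF W_facts(2) spectral_mat_carrier v(1), symmetric])
  also have "adj W * spectral_mat d W \<alpha> = (adj W * W) * (D * adj W)"
    unfolding spectral_mat_def by (rule mult_assoc_dim[symmetric]) (use W_facts in auto)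
  also have "\<dots> = D * adj W" using W_facts by simp
  also have "\<dots> *\<^sub>v v = D *\<^sub>v u" unfolding u_def by (rule assoc_mult_mat_vec[of _ d d _ d]) (use W_facts v in auto)
  finally have "k * u $ a = (D *\<^sub>v u) $ a" using u a(1) by (metis index_smult_vec(1) carrier_vecD)
  also have "\<dots> = (\<Sum>b<d. D $$ (a, b) * u $ b)" by (rule mult_mat_vec_sum[of _ d d]) (use u a in auto)
  also have "\<dots> = (\<Sum>b<d. if b = a then complex_of_real (\<alpha> a) * u $ a else 0)" by (rule sum.cong) (use a in auto)
  finally have "k = complex_of_real (\<alpha> a)" using a by simp
  then show "k \<in> (\<lambda>r. complex_of_real (\<alpha> r)) ` {..<d}" using a by blast
qed

text \<open>Conjugation by \<open>W\<close> reduces the claim to a diagonal matrix. There the two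
  products multiply the entry of \<open>C\<close> at \<open>(r, c)\<close> by the eigenvalues at
  \<open>r\<close> and at \<open>c\<close>.\<close>

lemma centralizer_spectral_mat:
  "centralizer_mat d (spectral_mat d W \<alpha>) =
    {W * (C * adj W) | C. C \<in> carrier_mat d d \<and> (\<forall>r<d. \<forall>c<d. \<alpha> r \<noteq> \<alpha> c \<longrightarrow> C $$ (r, c) = 0)}" (is "?L = ?R")
proof -
  let ?A = "spectral_mat d W \<alpha>"
  have conj: "W * (C * adj W) \<in> ?L \<longleftrightarrow> (\<forall>r<d. \<forall>c<d. \<alpha> r \<noteq> \<alpha> c \<longrightarrow> C $$ (r, c) = 0)" if C: "C \<in> carrier_mat d d" for C
  proof -
    have prod: "(W * (E * adj W)) * (W * (F * adj W)) = W * ((E * F) * adj W)"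
      if EF: "E \<in> carrier_mat d d" "F \<in> carrier_mat d d" for E F
    proof -
      have "(W * (E * adj W)) * (W * (F * adj W)) = W * (E * ((adj W * W) * (F * adj W)))"
        using W_facts(1,2) EF by (simp add: mult_assoc_dim)
      also have "(adj W * W) * (F * adj W) = F * adj W" using W_facts EF by simp
      finally show ?thesis using W_facts(1,2) EF by (simp add: mult_assoc_dim)
    qed
    have Dc: "D \<in> carrier_mat d d" by simp
    have "W * (C * adj W) \<in> ?L \<longleftrightarrow> W * ((D * C) * adj W) = W * ((C * D) * adj W)"
      unfolding centralizer_mat_def using prod[OF Dc C] prod[OF C Dc] W_facts C by (auto simp: spectral_mat_def)
    also have "\<dots> \<longleftrightarrow> D * C = C * D"
    proof
      assume e: "W * ((D * C) * adj W) = W * ((C * D) * adj W)"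
      note cc = conjugate_conjugate[OF W_facts(1,2,2,1,3,3)]
      show "D * C = C * D" using cc[of "D * C"] cc[of "C * D"] C Dc unfolding e by simp
    qed simp
    also have "\<dots> \<longleftrightarrow> (\<forall>r<d. \<forall>c<d. \<alpha> r \<noteq> \<alpha> c \<longrightarrow> C $$ (r, c) = 0)"
    proof
      assume e: "D * C = C * D"
      show "\<forall>r<d. \<forall>c<d. \<alpha> r \<noteq> \<alpha> c \<longrightarrow> C $$ (r, c) = 0"
      proof (intro allI impI)
        fix r c assume rc: "r < d" "c < d" and ne: "\<alpha> r \<noteq> \<alpha> c"
        have "complex_of_real (\<alpha> r) * C $$ (r, c) = complex_of_real (\<alpha> c) * C $$ (r, c)"
          by (simp only: index_diag_mult[OF C rc, symmetric] e)
        then show "C $$ (r, c) = 0" using ne by simp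
      qed
    next
      assume z: "\<forall>r<d. \<forall>c<d. \<alpha> r \<noteq> \<alpha> c \<longrightarrow> C $$ (r, c) = 0"
      show "D * C = C * D"
      proof (rule eq_matI)
        fix r c assume "r < dim_row (C * D)" "c < dim_col (C * D)"
        then have rc: "r < d" "c < d" using C by auto
        show "(D * C) $$ (r, c) = (C * D) $$ (r, c)"
          unfolding index_diag_mult[OF C rc] using z rc by auto
      qed (use C in auto)
    qed
    finally show ?thesis .
  qed
  show ?thesis
  proof (intro equalityI subsetI)
    fix B assume B: "B \<in> ?L"
    then have Bc: "B \<in> carrier_mat d d" by (simp add: centralizer_mat_def)
    define C where "C = adj W * (B * W)"
    have C: "C \<in> carrier_mat d d" using W_facts Bc by (auto simp: C_def intro!: mult_carrier_mat)
    have "W * (C * adj W) = B" unfolding C_def by (rule conjugate_conjugate[OF W_facts(2,1,1,2,4,4) Bc])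
    then show "B \<in> ?R" using conj[OF C] B C by auto
  next
    fix B assume "B \<in> ?R"
    then show "B \<in> ?L" using conj by blast
  qed
qed

text \<open>The conjugated matrix units at positions with equal eigenvalues form a basis, and the
  coordinates are entries in the eigenbasis. Existence and uniqueness of linear combinations connect
  this to the abstract dimension.\<close>

lemma dim_centralizer_spectral_mat:
  "dim_centralizer d (spectral_mat d W \<alpha>) = card {(r, c). r < d \<and> c < d \<and> \<alpha> r = \<alpha> c}"
proof -
  define Z where "Z = centralizer_mat d (spectral_mat d W \<alpha>)"
  define K where "K = {(r, c). r < d \<and> c < d \<and> \<alpha> r = \<alpha> c}"
  define M where "M = (module_mat TYPE(complex) d d)\<lparr>carrier := Z\<rparr>"
  have Zc: "Z \<subseteq> carrier_mat d d" by (auto simp: Z_def centralizer_mat_def)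
  have A: "spectral_mat d W \<alpha> \<in> carrier_mat d d" by (rule spectral_mat_carrier)
  have "submodule class_ring Z (module_mat TYPE(complex) d d)"
  proof (unfold submodule_def, unfold module_mat_simps class_ring_simps, intro conjI allI impI)
    show "module class_ring (module_mat TYPE(complex) d d)" using matrix_vs by (rule vectorspace.axioms(1))
    show "Z \<subseteq> carrier_mat d d" by (rule Zc)
    show "v + w \<in> Z" if "v \<in> Z" "w \<in> Z" for v w
      using that A by (auto simp: Z_def centralizer_mat_def mult_add_distrib_mat[of _ d d _ d] add_mult_distrib_mat[of _ d d _ _ d])
    show "0\<^sub>m d d \<in> Z" using A by (auto simp: Z_def centralizer_mat_def)
    show "k \<cdot>\<^sub>m v \<in> Z" if "v \<in> Z" for k v
      using that A by (auto simp: Z_def centralizer_mat_def mult_smult_distrib[of _ d d _ d] mult_smult_assoc_mat[of _ d d _ d])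
  qed
  then have "subspace class_ring Z (module_mat TYPE(complex) d d)" using matrix_vs by (simp add: subspace_def)
  then have "vectorspace class_ring (module_mat TYPE(complex) d d\<lparr>carrier := Z\<rparr>)"
    by (rule vectorspace.subspace_is_vs[OF matrix_vs])
  then interpret M: vectorspace class_ring M by (simp add: M_def)
  have Msimps: "carrier M = Z" "add M = (+)" "zero M = 0\<^sub>m d d" "module.smult M = (\<cdot>\<^sub>m)"
    by (simp_all add: M_def module_mat_simps)
  define E where "E p = W * (mat d d (\<lambda>q. if q = p then 1 else 0) * adj W)" for p :: "nat \<times> nat"
  have fK: "finite K" by (rule finite_subset[of _ "{..<d} \<times> {..<d}"]) (auto simp: K_def)
  have unit: "adj W * (E p * W) = mat d d (\<lambda>q. if q = p then 1 else 0)" for p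
    unfolding E_def by (rule conjugate_conjugate[OF W_facts(1,2,2,1,3,3)]) simp
  have inj: "inj_on E K"
  proof (rule inj_onI)
    fix p q assume pq: "p \<in> K" "q \<in> K" "E p = E q"
    have "mat d d (\<lambda>r. if r = p then 1 else 0 :: complex) = mat d d (\<lambda>r. if r = q then 1 else 0)"
      using unit[of p] unit[of q] pq(3) by simp
    then have "mat d d (\<lambda>r. if r = p then 1 else 0 :: complex) $$ p = mat d d (\<lambda>r. if r = q then 1 else 0) $$ p" by simp
    then show "p = q" using pq(1) by (auto simp: K_def split: if_splits)
  qed
  have EZ: "E p \<in> Z" if "p \<in> K" for p
    unfolding Z_def centralizer_spectral_mat E_def using that by (auto simp: K_def intro!: exI[of _ "mat d d (\<lambda>q. if q = p then 1 else 0)"])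
  have lin: "M.lincomb a (E ` K) = W * (mat d d (\<lambda>p. if p \<in> K then a (E p) else 0) * adj W)" for a
  proof -
    have f: "(\<lambda>v. a v \<odot>\<^bsub>M\<^esub> v) \<in> E ` K \<rightarrow> carrier M"
      using EZ M.smult_closed by (auto simp: Msimps class_ring_simps)
    have "M.lincomb a (E ` K) = finsum M (\<lambda>v. a v \<odot>\<^bsub>M\<^esub> v) (E ` K)" by (rule M.lincomb_def)
    note s = finsum_mat[OF M.abelian_monoid_axioms Msimps(2,3) Zc[folded Msimps(1)] finite_imageI[OF fK] f, folded this]
    show ?thesis
    proof (rule eq_matI)
      fix r c assume "r < dim_row (W * (mat d d (\<lambda>p. if p \<in> K then a (E p) else 0) * adj W))"
        "c < dim_col (W * (mat d d (\<lambda>p. if p \<in> K then a (E p) else 0) * adj W))"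
      then have rc: "r < d" "c < d" using W_facts by auto
      have e: "E p $$ (r, c) = W $$ (r, fst p) * adj W $$ (snd p, c)" if "p \<in> K" for p
      proof -
        have "E p $$ (r, c) = (\<Sum>q\<in>{..<d} \<times> {..<d}. W $$ (r, fst q) * adj W $$ (snd q, c) * (if q = p then 1 else 0))"
          unfolding E_def by (rule index_conjugated_mat) (use W_facts rc in auto)
        also have "\<dots> = (\<Sum>q\<in>{..<d} \<times> {..<d}. if q = p then W $$ (r, fst p) * adj W $$ (snd p, c) else 0)"
          by (rule sum.cong) auto
        finally show ?thesis using that by (auto simp: K_def)
      qed
      have "M.lincomb a (E ` K) $$ (r, c) = (\<Sum>v\<in>E ` K. (a v \<odot>\<^bsub>M\<^esub> v) $$ (r, c))" by (rule s(2)[OF rc])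
      also have "\<dots> = (\<Sum>p\<in>K. (a (E p) \<odot>\<^bsub>M\<^esub> E p) $$ (r, c))" by (simp add: sum.reindex[OF inj])
      also have "\<dots> = (\<Sum>p\<in>K. W $$ (r, fst p) * adj W $$ (snd p, c) * a (E p))"
      proof (rule sum.cong)
        fix p assume p: "p \<in> K"
        have "E p \<in> carrier_mat d d" using EZ[OF p] Zc by blast
        then show "(a (E p) \<odot>\<^bsub>M\<^esub> E p) $$ (r, c) = W $$ (r, fst p) * adj W $$ (snd p, c) * a (E p)"
          using rc e[OF p] by (simp add: Msimps)
      qed simp
      also have "\<dots> = (\<Sum>p\<in>{..<d} \<times> {..<d}. W $$ (r, fst p) * adj W $$ (snd p, c) * (if p \<in> K then a (E p) else 0))"
        by (rule sum.mono_neutral_cong_left) (auto simp: K_def)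
      also have "\<dots> = (W * (mat d d (\<lambda>p. if p \<in> K then a (E p) else 0) * adj W)) $$ (r, c)"
        by (rule index_conjugated_mat[symmetric]) (use W_facts rc in auto)
      finally show "M.lincomb a (E ` K) $$ (r, c) = (W * (mat d d (\<lambda>p. if p \<in> K then a (E p) else 0) * adj W)) $$ (r, c)" .
    next
      have "M.lincomb a (E ` K) \<in> carrier_mat d d" using s(1) Zc unfolding Msimps by (rule subsetD[rotated])
      then show "dim_row (M.lincomb a (E ` K)) = dim_row (W * (mat d d (\<lambda>p. if p \<in> K then a (E p) else 0) * adj W))"
        "dim_col (M.lincomb a (E ` K)) = dim_col (W * (mat d d (\<lambda>p. if p \<in> K then a (E p) else 0) * adj W))"
        using carrier_matD[OF W_facts(1)] by (simp_all only: carrier_matD index_mult_mat dim_adj)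
    qed
  qed
  have "M.basis (E ` K)"
  proof (subst M.basis_criterion[OF finite_imageI[OF fK]])
    show "E ` K \<subseteq> carrier M" using EZ by (auto simp: Msimps)
    show "\<forall>v. v \<in> carrier M \<longrightarrow> (\<exists>!a. a \<in> E ` K \<rightarrow>\<^sub>E carrier class_ring \<and> M.lincomb a (E ` K) = v)"
    proof (intro allI impI)
      fix v assume "v \<in> carrier M"
      then obtain C where C: "v = W * (C * adj W)" "C \<in> carrier_mat d d" "\<forall>r<d. \<forall>c<d. \<alpha> r \<noteq> \<alpha> c \<longrightarrow> C $$ (r, c) = 0"
        unfolding Msimps Z_def centralizer_spectral_mat by blast
      define a where "a = (\<lambda>v\<in>E ` K. C $$ the_inv_into K E v)"
      have aE: "a (E p) = C $$ p" if "p \<in> K" for p using that by (simp add: a_def the_inv_into_f_f[OF inj])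
      have "mat d d (\<lambda>p. if p \<in> K then a (E p) else 0) = C"
        using C aE by (intro eq_matI) (auto simp: K_def)
      then have la: "M.lincomb a (E ` K) = v" using C(1) lin by simp
      show "\<exists>!a. a \<in> E ` K \<rightarrow>\<^sub>E carrier class_ring \<and> M.lincomb a (E ` K) = v"
      proof (rule ex1I[of _ a])
        show "a \<in> E ` K \<rightarrow>\<^sub>E carrier class_ring \<and> M.lincomb a (E ` K) = v" using la by (simp add: a_def class_ring_simps)
      next
        fix b assume b: "b \<in> E ` K \<rightarrow>\<^sub>E carrier class_ring \<and> M.lincomb b (E ` K) = v"
        let ?B = "mat d d (\<lambda>p. if p \<in> K then b (E p) else 0)"
        have e: "W * (?B * adj W) = W * (C * adj W)" using b lin C(1) by simp
        have "?B = adj W * ((W * (?B * adj W)) * W)"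
          by (rule conjugate_conjugate[OF W_facts(1,2,2,1,3,3), symmetric]) simp
        also have "\<dots> = C" unfolding e by (rule conjugate_conjugate[OF W_facts(1,2,2,1,3,3) C(2)])
        finally have BC: "?B = C" .
        have bE: "b (E p) = C $$ p" if "p \<in> K" for p
        proof -
          have "?B $$ p = b (E p)" using that by (cases p) (auto simp: K_def)
          then show ?thesis using BC by simp
        qed
        have "b v = a v" if v: "v \<in> E ` K" for v
        proof -
          obtain p where "p \<in> K" "v = E p" using v by blast
          then show ?thesis using aE bE by simp
        qed
        moreover have "a \<in> extensional (E ` K)" "b \<in> extensional (E ` K)" using b by (auto simp: a_def PiE_def)
        ultimately show "b = a" by (intro extensionalityI[of b "E ` K" a])
      qed
    qed
  qed
  then have "M.dim = card (E ` K)" by (rule M.dim_basis[OF finite_imageI[OF fK]])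
  then show ?thesis unfolding dim_centralizer_def using card_image[OF inj] by (simp add: M_def Z_def K_def)
qed

end

text \<open>\<alpha> is a nonincreasing step function with steps at the \<open>x i\<close>, and
  positivity of \<chi> makes every step a genuine drop. Hence the positions with unequal levels are
  the lower entries and their transposes, two disjoint sets of equal size.\<close>

lemma card_equal_levels:
  fixes \<chi> :: "nat \<Rightarrow> real"
  assumes pos: "\<And>i. i \<in> {1..m} \<Longrightarrow> 0 < \<chi> i" and \<alpha>: "\<And>r. \<alpha> r = (\<Sum>i\<in>{1..m}. if r < x i then \<chi> i else 0)"
  shows "card {(r, c). r < d \<and> c < d \<and> \<alpha> r = \<alpha> c} + 2 * card (lower_entries m x x d d) = d * d"
proof -
  define L where "L = lower_entries m x x d d"
  define K where "K = {(r, c). r < d \<and> c < d \<and> \<alpha> r = \<alpha> c}"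
  have level: "\<alpha> r = \<alpha> c \<longleftrightarrow> (c, r) \<notin> L" if rc: "r \<le> c" "c < d" for r c
  proof -
    have "\<alpha> r - \<alpha> c = (\<Sum>i\<in>{1..m}. if r < x i \<and> x i \<le> c then \<chi> i else 0)"
      unfolding \<alpha> sum_subtractf[symmetric] by (rule sum.cong) (use rc in auto)
    also have "\<dots> = 0 \<longleftrightarrow> (\<forall>i\<in>{1..m}. \<not> (r < x i \<and> x i \<le> c))"
      by (subst sum_nonneg_eq_0_iff) (use pos in \<open>force intro: less_imp_le\<close>)+
    also have "\<dots> \<longleftrightarrow> (c, r) \<notin> L" using rc by (auto simp: L_def lower_entries_def)
    finally show ?thesis by simp
  qed
  have low: "c < r" if "(r, c) \<in> L" for r c using that by (auto simp: L_def lower_entries_def)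
  have sub: "L \<subseteq> {..<d} \<times> {..<d}" by (auto simp: L_def lower_entries_def)
  have "{..<d} \<times> {..<d} = K \<union> (L \<union> prod.swap ` L)"
  proof (intro equalityI subsetI)
    fix p assume p: "p \<in> {..<d} \<times> {..<d}"
    obtain r c where rc: "p = (r, c)" "r < d" "c < d" using p by auto
    show "p \<in> K \<union> (L \<union> prod.swap ` L)"
    proof (cases "r \<le> c")
      case True
      then show ?thesis using level[of r c] rc by (force simp: K_def)
    next
      case False
      then show ?thesis using level[of c r] rc by (auto simp: K_def)
    qed
  qed (use sub in \<open>auto simp: K_def\<close>)
  moreover have "K \<inter> (L \<union> prod.swap ` L) = {}"
  proof -
    have "(r, c) \<notin> L \<and> (c, r) \<notin> L" if "(r, c) \<in> K" for r c
      using that level[of r c] level[of c r] low[of r c] low[of c r] by (fastforce simp: K_def)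
    then show ?thesis by auto
  qed
  moreover have "L \<inter> prod.swap ` L = {}" by (auto dest!: low)
  moreover have "finite L" "finite K"
    by (rule finite_subset[of _ "{..<d} \<times> {..<d}"], use sub in \<open>auto simp: K_def\<close>)+
  ultimately have "card ({..<d} \<times> {..<d}) = card K + (card L + card (prod.swap ` L))"
    by (simp add: card_Un_disjoint)
  then show ?thesis by (simp add: card_image K_def L_def)
qed

section \<open>Unitarizations\<close>

lemma inner_product_onD:
  assumes "inner_product_on d h"
  shows "u \<in> carrier_vec d \<Longrightarrow> v \<in> carrier_vec d \<Longrightarrow> w \<in> carrier_vec d \<Longrightarrow> h (u + v) w = h u w + h v w"
    "u \<in> carrier_vec d \<Longrightarrow> v \<in> carrier_vec d \<Longrightarrow> h (c \<cdot>\<^sub>v u) v = c * h u v"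
    "u \<in> carrier_vec d \<Longrightarrow> v \<in> carrier_vec d \<Longrightarrow> h v u = cnj (h u v)"
    "u \<in> carrier_vec d \<Longrightarrow> u \<noteq> 0\<^sub>v d \<Longrightarrow> Re (h u u) > 0"
  using assms unfolding inner_product_on_def by blast+

text \<open>Induction on the number \<open>k\<close> of coordinates that may be nonzero, splitting
  off the last one.\<close>

lemma inner_product_on_expand:
  assumes h: "inner_product_on d h" and v: "v \<in> carrier_vec d"
  shows "k \<le> d \<Longrightarrow> u \<in> coords d k \<Longrightarrow> h u v = (\<Sum>b<k. u $ b * h (unit_vec d b) v)"
proof (induction k arbitrary: u)
  case 0
  then have "u = 0 \<cdot>\<^sub>v 0\<^sub>v d" by (intro eq_vecI) (auto simp: coords_def)
  then show ?case using inner_product_onD(2)[OF h zero_carrier_vec v, of 0] by simp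
next
  case (Suc k)
  have uc: "u \<in> carrier_vec d" and z: "\<And>a. a < d \<Longrightarrow> Suc k \<le> a \<Longrightarrow> u $ a = 0" using Suc.prems by (auto simp: coords_def)
  define u' where "u' = vec d (\<lambda>a. if a < k then u $ a else 0)"
  have u': "u' \<in> coords d k" "u' \<in> carrier_vec d" by (auto simp: u'_def coords_def)
  have "u = u' + u $ k \<cdot>\<^sub>v unit_vec d k"
  proof (rule eq_vecI)
    fix a assume "a < dim_vec (u' + u $ k \<cdot>\<^sub>v unit_vec d k)"
    then have "a < d" by (simp add: u'_def)
    then show "u $ a = (u' + u $ k \<cdot>\<^sub>v unit_vec d k) $ a"
      using z[of a] Suc.prems(1) by (cases "a < k"; cases "a = k") (auto simp: u'_def)
  qed (use uc in auto)
  then have "h u v = h u' v + u $ k * h (unit_vec d k) v"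
    using inner_product_onD(1)[OF h u'(2) _ v, of "u $ k \<cdot>\<^sub>v unit_vec d k"] inner_product_onD(2)[OF h _ v, of "unit_vec d k" "u $ k"]
    by simp
  also have "h u' v = (\<Sum>b<k. u' $ b * h (unit_vec d b) v)" by (rule Suc.IH) (use Suc.prems u' in auto)
  also have "\<dots> = (\<Sum>b<k. u $ b * h (unit_vec d b) v)" by (rule sum.cong) (use Suc.prems in \<open>auto simp: u'_def\<close>)
  finally show ?case by simp
qed

text \<open>Both arguments are expanded in unit vectors. The entry at \<open>(a, b)\<close> takes
  the unit vectors in the order \<open>b\<close>, \<open>a\<close> because \<open>h\<close> is
  linear in its first argument.\<close>

lemma inner_product_on_matrix:
  assumes h: "inner_product_on d h"
  shows "\<exists>H. posdef d H \<and> (\<forall>u\<in>carrier_vec d. \<forall>v\<in>carrier_vec d. h u v = (H *\<^sub>v u) \<bullet>c v)"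
proof -
  have exp: "h u v = (\<Sum>b<d. u $ b * h (unit_vec d b) v)" if "u \<in> carrier_vec d" "v \<in> carrier_vec d" for u v
    by (rule inner_product_on_expand[OF h that(2)]) (use that in \<open>auto simp: coords_def\<close>)
  define H where "H = mat d d (\<lambda>(a, b). h (unit_vec d b) (unit_vec d a))"
  have H: "H \<in> carrier_mat d d" by (simp add: H_def)
  have form: "h u v = (H *\<^sub>v u) \<bullet>c v" if u: "u \<in> carrier_vec d" and v: "v \<in> carrier_vec d" for u v
  proof -
    have "h u v = cnj (h v u)" using inner_product_onD(3)[OF h v u] .
    also have "\<dots> = (\<Sum>a<d. cnj (v $ a) * h u (unit_vec d a))"
      unfolding exp[OF v u] using inner_product_onD(3)[OF h _ u] by (simp flip: inner_product_onD(3)[OF h])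
    also have "\<dots> = (\<Sum>a<d. (H *\<^sub>v u) $ a * cnj (v $ a))"
    proof (rule sum.cong)
      fix a assume a: "a \<in> {..<d}"
      have "h u (unit_vec d a) = (H *\<^sub>v u) $ a"
        using a exp[OF u, of "unit_vec d a"] mult_mat_vec_sum[OF H u, of a] by (simp add: H_def mult.commute)
      then show "cnj (v $ a) * h u (unit_vec d a) = (H *\<^sub>v u) $ a * cnj (v $ a)" by simp
    qed simp
    also have "\<dots> = (H *\<^sub>v u) \<bullet>c v"
      by (rule cscalar_prod_sum[symmetric, of _ d]) (use mult_mat_vec_carrier[OF H u] v in auto)
    finally show ?thesis .
  qed
  have "adj H = H"
  proof (rule eq_matI)
    fix a b assume "a < dim_row H" "b < dim_col H"
    then have ab: "a < d" "b < d" by (simp_all add: H_def)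
    have "cnj (h (unit_vec d a) (unit_vec d b)) = h (unit_vec d b) (unit_vec d a)"
      by (rule inner_product_onD(3)[OF h, symmetric]) auto
    then show "adj H $$ (a, b) = H $$ (a, b)" using ab by (simp add: H_def)
  qed (use H in auto)
  then have "posdef d H" unfolding posdef_def using H form inner_product_onD(4)[OF h] by auto
  then show ?thesis using form by blast
qed

lemma inner_product_on_posdef:
  assumes H: "posdef d H"
  shows "inner_product_on d (\<lambda>u v. (H *\<^sub>v u) \<bullet>c v)"
  unfolding inner_product_on_def
proof (intro conjI ballI allI impI)
  fix u v w :: "complex vec" and c :: complex
  assume u: "u \<in> carrier_vec d"
  have Hu: "H *\<^sub>v u \<in> carrier_vec d" using posdefD(1)[OF H] u by (rule mult_mat_vec_carrier)
  show "Re ((H *\<^sub>v u) \<bullet>c u) > 0" if "u \<noteq> 0\<^sub>v d" by (rule posdefD(3)[OF H u that])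
  assume v: "v \<in> carrier_vec d"
  have Hv: "H *\<^sub>v v \<in> carrier_vec d" using posdefD(1)[OF H] v by (rule mult_mat_vec_carrier)
  show "(H *\<^sub>v (c \<cdot>\<^sub>v u)) \<bullet>c v = c * ((H *\<^sub>v u) \<bullet>c v)"
    unfolding mult_mat_vec[OF posdefD(1)[OF H] u] by (rule cscalar_prod_smult_left[OF Hu v])
  show "(H *\<^sub>v v) \<bullet>c u = cnj ((H *\<^sub>v u) \<bullet>c v)"
    by (rule hermitian_form_swap[OF posdefD(1,2)[OF H] u v])
  assume w: "w \<in> carrier_vec d"
  show "(H *\<^sub>v (u + v)) \<bullet>c w = (H *\<^sub>v u) \<bullet>c w + (H *\<^sub>v v) \<bullet>c w"
    unfolding mult_add_distrib_mat_vec[OF posdefD(1)[OF H] u v] by (rule cscalar_prod_add_left[OF Hu Hv w])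
qed

text \<open>\<open>adj N * H\<close> computes coordinates along \<open>N\<close>. The residual has
  zero coordinates, so it is orthogonal to everything spanned by the columns of
  \<open>N\<close>.\<close>

lemma orth_proj_onto_onb:
  assumes H: "posdef d H" and N: "onb H d k N S"
  shows "orth_proj_onto d (\<lambda>u v. (H *\<^sub>v u) \<bullet>c v) S (N * (adj N * H))"
  unfolding orth_proj_onto_def
proof (intro conjI ballI)
  note Hc = posdefD(1,2)[OF H]
  have Nc: "N \<in> carrier_mat d k" and NS: "mimg N = S" using N by (auto simp: onb_def)
  note inv = onb_left_inverse[OF N Hc(1)]
  show P: "N * (adj N * H) \<in> carrier_mat d d" using Nc inv by (auto intro!: mult_carrier_mat)
  fix x :: "complex vec" assume x: "x \<in> carrier_vec d"
  define c where "c = (adj N * H) *\<^sub>v x"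
  have c: "c \<in> carrier_vec k" using inv x by (auto simp: c_def intro: mult_mat_vec_carrier)
  have Px: "N * (adj N * H) *\<^sub>v x = N *\<^sub>v c" unfolding c_def by (rule assoc_mult_mat_vec[OF Nc inv(1) x])
  show "N * (adj N * H) *\<^sub>v x \<in> S" unfolding Px using mimgI[OF Nc c] NS by simp
  fix w :: "complex vec" assume "w \<in> S"
  then obtain b where b: "b \<in> carrier_vec k" "w = N *\<^sub>v b" using NS mimg_iff[OF Nc] by auto
  have z: "x - N *\<^sub>v c \<in> carrier_vec d" using x Nc c by (auto intro: mult_mat_vec_carrier)
  have "adj N *\<^sub>v (H *\<^sub>v (x - N *\<^sub>v c)) = (adj N * H) *\<^sub>v (x - N *\<^sub>v c)"
    using assoc_mult_mat_vec[of "adj N" k d H d] Nc Hc z by simp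
  also have "\<dots> = c - (adj N * H) *\<^sub>v (N *\<^sub>v c)"
    unfolding c_def by (rule mult_minus_distrib_mat_vec[OF inv(1) x]) (use Nc c c_def in \<open>auto intro: mult_mat_vec_carrier\<close>)
  also have "(adj N * H) *\<^sub>v (N *\<^sub>v c) = c"
    using assoc_mult_mat_vec[OF inv(1) Nc c] inv(2) c by simp
  finally have "adj N *\<^sub>v (H *\<^sub>v (x - N *\<^sub>v c)) = 0\<^sub>v k" using c by simp
  moreover have "(H *\<^sub>v (x - N *\<^sub>v c)) \<bullet>c (N *\<^sub>v b) = cnj ((N *\<^sub>v b) \<bullet>c (H *\<^sub>v (x - N *\<^sub>v c)))"
    by (rule cscalar_prod_swap[of _ d]) (use z Nc b Hc in \<open>auto intro: mult_mat_vec_carrier\<close>)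
  moreover have "(N *\<^sub>v b) \<bullet>c (H *\<^sub>v (x - N *\<^sub>v c)) = b \<bullet>c (adj N *\<^sub>v (H *\<^sub>v (x - N *\<^sub>v c)))"
    by (rule cscalar_prod_adj[OF Nc b(1)]) (use z Hc in \<open>auto intro: mult_mat_vec_carrier\<close>)
  ultimately show "(H *\<^sub>v (x - N * (adj N * H) *\<^sub>v x)) \<bullet>c w = 0"
    unfolding Px b(2) using b(1) by (simp add: cscalar_prod_sum[of _ k])
qed

lemma minus_add_minus_vec:
  fixes p p' :: "complex vec"
  assumes "p \<in> carrier_vec d" "p' \<in> carrier_vec d"
  shows "p = (p - p') + p'"
  using assms by (intro eq_vecI) auto

text \<open>The difference \<open>z\<close> of the two projections of \<open>x\<close> lies in
  \<open>S\<close> and is orthogonal to \<open>S\<close>, hence to itself. With uniqueness,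
  statements about an arbitrary unitarization can be proved using explicit projections.\<close>

lemma orth_proj_onto_unique:
  assumes h: "inner_product_on d h" and S: "csub d S" and P: "orth_proj_onto d h S P" and P': "orth_proj_onto d h S P'"
  shows "P = P'"
proof -
  have c: "P \<in> carrier_mat d d" "P' \<in> carrier_mat d d" using P P' by (auto simp: orth_proj_onto_def)
  have diff: "p - p' = (x - p') + (-1) \<cdot>\<^sub>v (x - p)"
    if "x \<in> carrier_vec d" "p \<in> carrier_vec d" "p' \<in> carrier_vec d" for x p p' :: "complex vec"
    using that by (intro eq_vecI) auto
  have "P *\<^sub>v x = P' *\<^sub>v x" if x: "x \<in> carrier_vec d" for x :: "complex vec"
  proof (rule ccontr)
    assume ne: "P *\<^sub>v x \<noteq> P' *\<^sub>v x"
    have PS: "P *\<^sub>v x \<in> S" "P' *\<^sub>v x \<in> S" and o: "\<And>w. w \<in> S \<Longrightarrow> h (x - P *\<^sub>v x) w = 0" "\<And>w. w \<in> S \<Longrightarrow> h (x - P' *\<^sub>v x) w = 0"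
      using P P' x by (auto simp: orth_proj_onto_def)
    have Pc: "P *\<^sub>v x \<in> carrier_vec d" "P' *\<^sub>v x \<in> carrier_vec d" using PS csubD(5)[OF S] by auto
    define z where "z = P *\<^sub>v x - P' *\<^sub>v x"
    have z: "z \<in> S" "z \<in> carrier_vec d" unfolding z_def using csub_minus[OF S] PS Pc by auto
    have zz: "z = (x - P' *\<^sub>v x) + (-1) \<cdot>\<^sub>v (x - P *\<^sub>v x)" unfolding z_def by (rule diff[OF x Pc])
    have "h z z = h (x - P' *\<^sub>v x) z + -1 * h (x - P *\<^sub>v x) z"
      using inner_product_onD(1)[OF h _ _ z(2), of "x - P' *\<^sub>v x" "(-1) \<cdot>\<^sub>v (x - P *\<^sub>v x)"]
        inner_product_onD(2)[OF h _ z(2), of "x - P *\<^sub>v x" "-1"] x Pc zz by simp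
    then have "h z z = 0" using o z(1) by simp
    moreover have "z \<noteq> 0\<^sub>v d"
    proof
      assume "z = 0\<^sub>v d"
      moreover have "P *\<^sub>v x = z + P' *\<^sub>v x" unfolding z_def by (rule minus_add_minus_vec[OF Pc])
      ultimately show False using ne Pc by simp
    qed
    ultimately show False using inner_product_onD(4)[OF h z(2)] by simp
  qed
  then have "col P j = col P' j" if "j < d" for j
    using mult_unit_vec_col[OF c(1) that] mult_unit_vec_col[OF c(2) that] by (metis unit_vec_carrier)
  then show ?thesis using c by (intro mat_col_eqI) auto
qed

text \<open>Polarization over the complex numbers: the coefficients \<open>c = 1\<close> and
  \<open>c = \<i>\<close> separate the two mixed terms of the form at
  \<open>u + c \<cdot>\<^sub>v v\<close>.\<close>

lemma hermitian_quadratic_form_zero: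
  assumes A: "A \<in> carrier_mat d d" and z: "\<And>w :: complex vec. w \<in> carrier_vec d \<Longrightarrow> (A *\<^sub>v w) \<bullet>c w = 0"
  shows "A = 0\<^sub>m d d"
proof -
  have Aw: "A *\<^sub>v w \<in> carrier_vec d" if "w \<in> carrier_vec d" for w using A that by (rule mult_mat_vec_carrier)
  have pol: "cnj c * ((A *\<^sub>v u) \<bullet>c v) + c * ((A *\<^sub>v v) \<bullet>c u) = 0"
    if u: "u \<in> carrier_vec d" and v: "v \<in> carrier_vec d" for u v :: "complex vec" and c
  proof -
    have cv: "c \<cdot>\<^sub>v v \<in> carrier_vec d" using v by simp
    have e: "A *\<^sub>v (u + c \<cdot>\<^sub>v v) = A *\<^sub>v u + c \<cdot>\<^sub>v (A *\<^sub>v v)"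
      using mult_add_distrib_mat_vec[OF A u cv] mult_mat_vec[OF A v] by simp
    have cA: "c \<cdot>\<^sub>v (A *\<^sub>v v) \<in> carrier_vec d" "u + c \<cdot>\<^sub>v v \<in> carrier_vec d" using Aw[OF v] u v by auto
    have "(A *\<^sub>v u + c \<cdot>\<^sub>v (A *\<^sub>v v)) \<bullet>c (u + c \<cdot>\<^sub>v v) = 0" using z[OF cA(2)] e by simp
    then have "(A *\<^sub>v u) \<bullet>c u + cnj c * ((A *\<^sub>v u) \<bullet>c v) + (c * ((A *\<^sub>v v) \<bullet>c u) + c * (cnj c * ((A *\<^sub>v v) \<bullet>c v))) = 0"
      unfolding cscalar_prod_add_left[OF Aw[OF u] cA] cscalar_prod_add_right[OF u cv Aw[OF u]]
        cscalar_prod_add_right[OF u cv cA(1)] cscalar_prod_smult_right[OF v Aw[OF u]]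
        cscalar_prod_smult_left[OF Aw[OF v] u] cscalar_prod_smult_left[OF Aw[OF v] cv] cscalar_prod_smult_right[OF v Aw[OF v]] .
    then show ?thesis using z[OF u] z[OF v] by simp
  qed
  have zero: "(A *\<^sub>v u) \<bullet>c v = 0" if u: "u \<in> carrier_vec d" and v: "v \<in> carrier_vec d" for u v :: "complex vec"
  proof -
    have "(A *\<^sub>v v) \<bullet>c u = - ((A *\<^sub>v u) \<bullet>c v)" using pol[OF u v, of 1] by (simp add: add_eq_0_iff)
    then have "-2 * \<i> * ((A *\<^sub>v u) \<bullet>c v) = 0" using pol[OF u v, of \<i>] by (simp add: algebra_simps)
    then show ?thesis by simp
  qed
  show ?thesis
  proof (rule eq_matI)
    fix r c assume "r < dim_row (0\<^sub>m d d :: complex mat)" "c < dim_col (0\<^sub>m d d :: complex mat)"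
    then have rc: "r < d" "c < d" by auto
    have "(1\<^sub>m d * (A * 1\<^sub>m d)) $$ (r, c) = 0"
      using index_adj_form[OF one_carrier_mat A one_carrier_mat rc] zero[of "unit_vec d c" "unit_vec d r"] rc by simp
    then show "A $$ (r, c) = 0\<^sub>m d d $$ (r, c)" using A rc by simp
  qed (use A in auto)
qed

lemma conjugated_mat_sum:
  assumes "C \<in> carrier_mat d d" "B \<in> carrier_mat d d" and I: "finite I" "\<And>i. i \<in> I \<Longrightarrow> f i \<in> carrier_mat d d"
  shows "C * (mat_sum d f I * B) = mat_sum d (\<lambda>i. C * (f i * B)) I"
proof (rule eq_matI)
  have CfB: "C * (f i * B) \<in> carrier_mat d d" if "i \<in> I" for i using assms that by (auto intro!: mult_carrier_mat)
  have s1: "mat_sum d f I \<in> carrier_mat d d" by (rule mat_sum(1)) (use I in auto)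
  have s3: "mat_sum d (\<lambda>i. C * (f i * B)) I \<in> carrier_mat d d" by (rule mat_sum(1)) (use I CfB in auto)
  have "C * (mat_sum d f I * B) \<in> carrier_mat d d" using assms(1,2) s1 by (auto intro!: mult_carrier_mat)
  then show "dim_row (C * (mat_sum d f I * B)) = dim_row (mat_sum d (\<lambda>i. C * (f i * B)) I)"
    "dim_col (C * (mat_sum d f I * B)) = dim_col (mat_sum d (\<lambda>i. C * (f i * B)) I)" using s3 by auto
  fix r c assume "r < dim_row (mat_sum d (\<lambda>i. C * (f i * B)) I)" "c < dim_col (mat_sum d (\<lambda>i. C * (f i * B)) I)"
  then have rc: "r < d" "c < d" using s3 by auto
  have entry: "(C * (T * B)) $$ (r, c) = (\<Sum>pq\<in>{..<d} \<times> {..<d}. C $$ (r, fst pq) * B $$ (snd pq, c) * T $$ pq)"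
    if T: "T \<in> carrier_mat d d" for T
  proof -
    have "mat d d (\<lambda>pq. T $$ pq) = T" using T by (intro eq_matI) auto
    then show ?thesis using index_conjugated_mat[OF assms(1,2) rc, of "\<lambda>pq. T $$ pq"] by simp
  qed
  have "(C * (mat_sum d f I * B)) $$ (r, c) =
      (\<Sum>pq\<in>{..<d} \<times> {..<d}. C $$ (r, fst pq) * B $$ (snd pq, c) * (\<Sum>i\<in>I. f i $$ pq))"
    unfolding entry[OF s1] by (rule sum.cong) (use mat_sum(2)[OF I] in auto)
  also have "\<dots> = (\<Sum>i\<in>I. \<Sum>pq\<in>{..<d} \<times> {..<d}. C $$ (r, fst pq) * B $$ (snd pq, c) * f i $$ pq)"
    unfolding sum_distrib_left by (rule sum.swap)
  also have "\<dots> = (\<Sum>i\<in>I. (C * (f i * B)) $$ (r, c))" by (rule sum.cong) (use entry I(2) in auto)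
  also have "\<dots> = mat_sum d (\<lambda>i. C * (f i * B)) I $$ (r, c)" by (rule mat_sum(2)[symmetric]) (use I CfB rc in auto)
  finally show "(C * (mat_sum d f I * B)) $$ (r, c) = mat_sum d (\<lambda>i. C * (f i * B)) I $$ (r, c)" .
qed

text \<open>\<open>S\<close> has the basis vectors as columns and \<open>adj S * H\<close> is its
  inverse, so the matrix of \<open>T\<close> in the basis is the usual conjugate.\<close>

lemma matrix_in_basis_eq:
  assumes H: "posdef d H" and form: "\<forall>u\<in>carrier_vec d. \<forall>v\<in>carrier_vec d. h u v = (H *\<^sub>v u) \<bullet>c v"
    and bs: "orthonormal_basis d h bs"
  defines "S \<equiv> mat_of_cols d bs"
  shows "S \<in> carrier_mat d d" "adj S * (H * S) = 1\<^sub>m d"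
    "T \<in> carrier_mat d d \<Longrightarrow> matrix_in_basis h bs T = adj S * (H * (T * S))"
proof -
  have Hc: "H \<in> carrier_mat d d" by (rule posdefD(1)[OF H])
  have h: "u \<in> carrier_vec d \<Longrightarrow> v \<in> carrier_vec d \<Longrightarrow> h u v = (H *\<^sub>v u) \<bullet>c v" for u v using form by blast
  have len: "length bs = d" and bc: "\<And>i. i < d \<Longrightarrow> bs ! i \<in> carrier_vec d"
    and o: "\<And>a b. a < d \<Longrightarrow> b < d \<Longrightarrow> h (bs ! a) (bs ! b) = (if a = b then 1 else 0)"
    using bs by (auto simp: orthonormal_basis_def)
  show S: "S \<in> carrier_mat d d" using len by (auto simp: S_def)
  have colS: "col S i = bs ! i" if "i < d" for i using that len bc by (simp add: S_def)
  show "adj S * (H * S) = 1\<^sub>m d"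
  proof (rule eq_matI)
    fix a b assume "a < dim_row (1\<^sub>m d :: complex mat)" "b < dim_col (1\<^sub>m d :: complex mat)"
    then have ab: "a < d" "b < d" by auto
    show "(adj S * (H * S)) $$ (a, b) = 1\<^sub>m d $$ (a, b)"
      unfolding index_adj_form[OF S Hc S ab] using ab o[of b a] h[OF bc bc, of b a] colS by simp
  qed (use S Hc in auto)
  assume T: "T \<in> carrier_mat d d"
  have TS: "T * S \<in> carrier_mat d d" using T S by simp
  show "matrix_in_basis h bs T = adj S * (H * (T * S))"
  proof (rule eq_matI)
    fix a b assume "a < dim_row (adj S * (H * (T * S)))" "b < dim_col (adj S * (H * (T * S)))"
    then have ab: "a < d" "b < d" using S T by auto
    have "col (T * S) b = T *\<^sub>v bs ! b" using col_mult2[OF T S ab(2)] colS[OF ab(2)] by simp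
    then show "matrix_in_basis h bs T $$ (a, b) = (adj S * (H * (T * S))) $$ (a, b)"
      unfolding index_adj_form[OF S Hc TS ab]
      using ab len colS h[OF mult_mat_vec_carrier[OF T bc] bc, of b a] by (simp add: matrix_in_basis_def)
  qed (use S T len in \<open>auto simp: matrix_in_basis_def\<close>)
qed

text \<open>In the basis \<open>N\<close> the projection onto the span of the first \<open>x\<close>
  vectors is a diagonal matrix of ones and zeros. Conjugating with the change of basis
  \<open>W\<close> truncates the sum over \<open>a\<close> at \<open>x\<close>.\<close>

lemma conjugated_projection:
  assumes H: "posdef d H" and N: "onb H d d N (carrier_vec d)" and S: "S \<in> carrier_mat d d"
    and x: "x \<le> d" and rc: "r < d" "c < d"
  defines "W \<equiv> adj S * (H * N)" and "M \<equiv> first_cols x N"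
  shows "(adj S * (H * ((M * (adj M * H)) * S))) $$ (r, c) = (\<Sum>a<d. if a < x then W $$ (r, a) * cnj (W $$ (c, a)) else 0)"
proof -
  note Hc = posdefD(1,2)[OF H]
  have Nc: "N \<in> carrier_mat d d" using N by (simp add: onb_def)
  have M: "M \<in> carrier_mat d x" using Nc by (simp add: M_def)
  define Y where "Y = adj S * (H * M)"
  have Y: "Y \<in> carrier_mat d x" using S Hc M by (auto simp: Y_def intro!: mult_carrier_mat)
  have "adj Y = adj (H * M) * adj (adj S)" unfolding Y_def by (rule adj_mult[of _ d d _ x]) (use S Hc M in auto)
  also have "adj (H * M) = adj M * H" using adj_mult[OF Hc(1) M] Hc(2) by simp
  finally have adjY: "adj Y = adj M * H * S" by simp
  have "adj S * (H * ((M * (adj M * H)) * S)) = Y * adj Y"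
    unfolding adjY unfolding Y_def using S Hc(1) M by (simp add: mult_assoc_dim)
  moreover have "(Y * adj Y) $$ (r, c) = (\<Sum>a<x. Y $$ (r, a) * adj Y $$ (a, c))"
    by (rule index_mult_mat_sum[of _ d x _ d]) (use Y rc in auto)
  moreover have "\<dots> = (\<Sum>a<x. W $$ (r, a) * cnj (W $$ (c, a)))"
  proof (rule sum.cong)
    fix a assume a: "a \<in> {..<x}"
    have YW: "Y $$ (r', a) = W $$ (r', a)" if r': "r' < d" for r'
      unfolding Y_def W_def using index_adj_form[OF S Hc(1) M r', of a] index_adj_form[OF S Hc(1) Nc r', of a] a x
        col_first_cols[OF Nc x, of a] by (simp add: M_def del: index_mult_mat)
    show "Y $$ (r, a) * adj Y $$ (a, c) = W $$ (r, a) * cnj (W $$ (c, a))"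
      using YW[OF rc(1)] YW[OF rc(2)] Y a rc by simp
  qed simp
  moreover have "\<dots> = (\<Sum>a<d. if a < x then W $$ (r, a) * cnj (W $$ (c, a)) else 0)"
    by (rule sum.mono_neutral_cong_left) (use x in auto)
  ultimately show ?thesis by simp
qed

lemma unitary_basis_change:
  assumes H: "posdef d H" and N: "onb H d d N (carrier_vec d)" and S: "S \<in> carrier_mat d d" "adj S * (H * S) = 1\<^sub>m d"
  shows "unitary_mat d (adj S * (H * N))"
proof -
  note Hc = posdefD(1,2)[OF H]
  note inv = onb_inverse[OF Hc(1) N]
  have W: "adj S * (H * N) \<in> carrier_mat d d" using S Hc inv(1) by (auto intro!: mult_carrier_mat)
  have "adj (adj S * (H * N)) = adj (H * N) * adj (adj S)" by (rule adj_mult[of _ d d _ d]) (use S Hc inv in auto)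
  also have "adj (H * N) = adj N * H" using adj_mult[OF Hc(1) inv(1)] Hc(2) by simp
  finally have aW: "adj (adj S * (H * N)) = adj N * H * S" by simp
  have "adj S * (H * N) * (adj N * H * S) = adj S * (H * ((N * (adj N * H)) * S))"
    using S(1) Hc(1) inv(1) by (simp add: mult_assoc_dim)
  also have "\<dots> = 1\<^sub>m d" unfolding inv(4) using S by simp
  finally have 1: "adj S * (H * N) * adj (adj S * (H * N)) = 1\<^sub>m d" unfolding aW .
  then show ?thesis using mat_mult_left_right_inverse[OF W _ 1] W by (auto simp: unitary_mat_def)
qed

lemma mat_sum_cong:
  assumes "finite I" "\<And>i. i \<in> I \<Longrightarrow> f i \<in> carrier_mat d d" "\<And>i. i \<in> I \<Longrightarrow> f i = g i"
  shows "mat_sum d f I = mat_sum d g I"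
proof (rule eq_matI)
  have c: "mat_sum d f I \<in> carrier_mat d d" "mat_sum d g I \<in> carrier_mat d d"
    by (rule mat_sum(1); use assms in fastforce)+
  fix r c assume "r < dim_row (mat_sum d g I)" "c < dim_col (mat_sum d g I)"
  then have rc: "r < d" "c < d" using c by auto
  have "mat_sum d f I $$ (r, c) = (\<Sum>i\<in>I. f i $$ (r, c))" by (rule mat_sum(2)) (use assms rc in auto)
  also have "\<dots> = (\<Sum>i\<in>I. g i $$ (r, c))" using assms(3) by simp
  also have "\<dots> = mat_sum d g I $$ (r, c)" by (rule mat_sum(2)[symmetric]) (use assms rc in fastforce)+
  finally show "mat_sum d f I $$ (r, c) = mat_sum d g I $$ (r, c)" .
next
  have c: "mat_sum d f I \<in> carrier_mat d d" "mat_sum d g I \<in> carrier_mat d d"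
    by (rule mat_sum(1); use assms in fastforce)+
  then show "dim_row (mat_sum d f I) = dim_row (mat_sum d g I)" "dim_col (mat_sum d f I) = dim_col (mat_sum d g I)" by auto
qed

lemma form_mat_sum:
  assumes I: "finite I" "\<And>i. i \<in> I \<Longrightarrow> f i \<in> carrier_mat d d" and w: "w \<in> carrier_vec d" and u: "u \<in> carrier_vec d"
  shows "(mat_sum d f I *\<^sub>v w) \<bullet>c u = (\<Sum>i\<in>I. (f i *\<^sub>v w) \<bullet>c u)"
proof -
  have form: "(A *\<^sub>v w) \<bullet>c u = (\<Sum>p<d. \<Sum>q<d. A $$ (p, q) * (w $ q * cnj (u $ p)))" if A: "A \<in> carrier_mat d d" for A
  proof -
    have "(A *\<^sub>v w) \<bullet>c u = (\<Sum>p<d. (A *\<^sub>v w) $ p * cnj (u $ p))"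
      by (rule cscalar_prod_sum[OF mult_mat_vec_carrier[OF A w] u])
    also have "\<dots> = (\<Sum>p<d. \<Sum>q<d. A $$ (p, q) * (w $ q * cnj (u $ p)))"
      by (rule sum.cong) (use mult_mat_vec_sum[OF A w] in \<open>simp_all add: sum_distrib_right mult.assoc\<close>)
    finally show ?thesis .
  qed
  have S: "mat_sum d f I \<in> carrier_mat d d" by (rule mat_sum(1)) (use I in auto)
  have "(mat_sum d f I *\<^sub>v w) \<bullet>c u = (\<Sum>p<d. \<Sum>q<d. \<Sum>i\<in>I. f i $$ (p, q) * (w $ q * cnj (u $ p)))"
    unfolding form[OF S] by (intro sum.cong refl) (use mat_sum(2)[OF I] in \<open>simp add: sum_distrib_right\<close>)
  also have "\<dots> = (\<Sum>p<d. \<Sum>i\<in>I. \<Sum>q<d. f i $$ (p, q) * (w $ q * cnj (u $ p)))"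
    by (intro sum.cong refl sum.swap)
  also have "\<dots> = (\<Sum>i\<in>I. \<Sum>p<d. \<Sum>q<d. f i $$ (p, q) * (w $ q * cnj (u $ p)))" by (rule sum.swap)
  also have "\<dots> = (\<Sum>i\<in>I. (f i *\<^sub>v w) \<bullet>c u)" by (rule sum.cong) (use form I(2) in auto)
  finally show ?thesis .
qed

lemma prim_elems_Sigma: "prim_elems ms = (SIGMA j:{..<length ms}. {1..ms ! j})"
  by (auto simp: prim_elems_def)

lemma finite_prim_elems: "finite (prim_elems ms)"
  by (simp add: prim_elems_Sigma)

lemma sum_prim_elems: "(\<Sum>p\<in>prim_elems ms. f p) = (\<Sum>j<length ms. \<Sum>i=1..ms ! j. f (j, i))"
  unfolding prim_elems_Sigma by (simp add: sum.Sigma)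

section \<open>A positive stable weight and the rigidity index\<close>

context rigid_star_rep
begin

text \<open>The coefficients of the antisymmetrised Euler form. They are nonnegative on the branches
  because dimensions grow along a chain.\<close>

abbreviation canonical :: "nat \<Rightarrow> nat \<Rightarrow> int" where
  "canonical j i \<equiv> int (xd j (Suc i)) - int (xd j (i - 1))"

text \<open>
  The canonical weights are integral and may vanish. The strict integral stability inequality leaves
  room for the perturbation that makes a large multiple of them positive.
\<close>

definition weight :: "nat \<Rightarrow> nat \<Rightarrow> real" where
  "weight j i = real (1 + d * card (prim_elems ms)) * real_of_int (canonical j i) + 1"

text \<open>Forced by comparing traces in the balance equation: the projection onto
  \<open>V j i\<close> has trace \<open>xd j i\<close>, and the identity has trace
  \<open>d\<close>.\<close>

definition weight0 :: real where
  "weight0 = (\<Sum>(j, i)\<in>prim_elems ms. weight j i * real (xd j i)) / real d"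

lemma weight_pos: "j < length ms \<Longrightarrow> 0 < weight j i"
proof -
  assume j: "j < length ms"
  have "xd j (i - 1) \<le> xd j (Suc i)"
    using xd_mono[OF j, of "i - 1"] xd_mono[OF j, of i] by (cases i) auto
  then have "0 \<le> real_of_int (canonical j i)" by simp
  then have "0 \<le> real (1 + d * card (prim_elems ms)) * real_of_int (canonical j i)" by (intro mult_nonneg_nonneg) auto
  then show ?thesis unfolding weight_def by linarith
qed

lemma weight0_nonneg: "0 \<le> weight0"
  unfolding weight0_def
  by (intro divide_nonneg_nonneg sum_nonneg) (auto simp: prim_elems_def intro!: mult_nonneg_nonneg less_imp_le[OF weight_pos])

lemma stable_config_weight:
  "stable_config d (prim_elems ms) (\<lambda>(j, i). V j i) (\<lambda>(j, i). weight j i) weight0"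
proof
  show dpos: "0 < d" by (rule dim_pos[OF ind])
  show "finite (prim_elems ms)" by (rule finite_prim_elems)
  show "csub d (case p of (j, i) \<Rightarrow> V j i)" if "p \<in> prim_elems ms" for p
    using that V_csub by (auto simp: prim_elems_def)
  show "0 < (case p of (j, i) \<Rightarrow> weight j i)" if "p \<in> prim_elems ms" for p
    using that weight_pos by (auto simp: prim_elems_def)
  have "(\<Sum>p\<in>prim_elems ms. (case p of (j, i) \<Rightarrow> weight j i) * real (cdim d (case p of (j, i) \<Rightarrow> V j i))) =
      (\<Sum>(j, i)\<in>prim_elems ms. weight j i * real (xd j i))"
    by (rule sum.cong) (auto simp: prim_elems_def xd_eq)
  also have "\<dots> = weight0 * real d" using dpos by (simp add: weight0_def)
  finally show "(\<Sum>p\<in>prim_elems ms. (case p of (j, i) \<Rightarrow> weight j i) * real (cdim d (case p of (j, i) \<Rightarrow> V j i))) = weight0 * real d" .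
  fix u E assume u: "0 < u" "u < d" and E: "E \<in> carrier_mat d u" "adj E * E = 1\<^sub>m u"
  \<comment> \<open>The multiple exceeds \<open>d * card (prim_elems ms)\<close>, the largest
    possible effect of adding 1 to every weight. The integral inequality is strict by at least 1,
    hence by at least \<open>M\<close> after multiplication.\<close>
  define M where "M = real (1 + d * card (prim_elems ms))"
  define c0 where "c0 = (\<Sum>j<length ms. int (xd j (ms ! j)))"
  have M0: "0 < M" unfolding M_def of_nat_0_less_iff by simp
  have expand: "(\<Sum>(j, i)\<in>prim_elems ms. weight j i * real (z j i)) =
      M * real_of_int (\<Sum>j<length ms. \<Sum>i=1..ms ! j. int (z j i) * canonical j i) + (\<Sum>(j, i)\<in>prim_elems ms. real (z j i))"
    for z :: "nat \<Rightarrow> nat \<Rightarrow> nat"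
  proof -
    have "(\<Sum>(j, i)\<in>prim_elems ms. weight j i * real (z j i)) =
        (\<Sum>p\<in>prim_elems ms. M * (case p of (j, i) \<Rightarrow> real (z j i) * real_of_int (canonical j i)) + (case p of (j, i) \<Rightarrow> real (z j i)))"
      by (rule sum.cong) (auto simp: weight_def M_def algebra_simps)
    also have "\<dots> = M * (\<Sum>p\<in>prim_elems ms. case p of (j, i) \<Rightarrow> real (z j i) * real_of_int (canonical j i)) +
        (\<Sum>p\<in>prim_elems ms. case p of (j, i) \<Rightarrow> real (z j i))"
      by (simp add: sum.distrib sum_distrib_left)
    also have "(\<Sum>p\<in>prim_elems ms. case p of (j, i) \<Rightarrow> real (z j i) * real_of_int (canonical j i)) =
        real_of_int (\<Sum>j<length ms. \<Sum>i=1..ms ! j. int (z j i) * canonical j i)"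
      by (simp add: sum_prim_elems)
    finally show ?thesis .
  qed
  have "(\<Sum>j<length ms. \<Sum>i=1..ms ! j. int (xd j i) * canonical j i) = c0 * int d"
    unfolding c0_def sum_distrib_right by (rule sum.cong) (use canonical_weight_trace in auto)
  then have "weight0 * real d = M * real_of_int (c0 * int d) + (\<Sum>(j, i)\<in>prim_elems ms. real (xd j i))"
    using expand[of xd] dpos by (simp add: weight0_def)
  moreover have "0 \<le> (\<Sum>(j, i)\<in>prim_elems ms. real (xd j i))" by (intro sum_nonneg) auto
  ultimately have "(M * real_of_int c0) * real d \<le> weight0 * real d" by simp
  \<comment> \<open>Adding 1 to every weight can only raise \<open>weight0\<close>, so the bound by
    the unperturbed value survives.\<close>
  then have w0: "M * real_of_int c0 \<le> weight0" using dpos by (simp add: mult_le_cancel_right)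
  have "(\<Sum>p\<in>prim_elems ms. (case p of (j, i) \<Rightarrow> weight j i) * real (cdim d ((case p of (j, i) \<Rightarrow> V j i) \<inter> mimg E))) =
      (\<Sum>(j, i)\<in>prim_elems ms. weight j i * real (yd E j i))"
    by (rule sum.cong) (auto simp: prim_elems_def yd_eq[OF E])
  also have "\<dots> = M * real_of_int (\<Sum>j<length ms. \<Sum>i=1..ms ! j. int (yd E j i) * canonical j i) +
      (\<Sum>(j, i)\<in>prim_elems ms. real (yd E j i))" by (rule expand)
  also have "\<dots> \<le> M * real_of_int (c0 * int u - 1) + real (card (prim_elems ms)) * real d"
  proof (rule add_mono)
    have "(\<Sum>j<length ms. \<Sum>i=1..ms ! j. int (yd E j i) * canonical j i) \<le> c0 * int u - 1"
      using stability_canonical[OF E u] by (simp add: c0_def sum_distrib_right)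
    then show "M * real_of_int (\<Sum>j<length ms. \<Sum>i=1..ms ! j. int (yd E j i) * canonical j i) \<le> M * real_of_int (c0 * int u - 1)"
      using M0 by (intro mult_left_mono) (simp_all only: of_int_le_iff less_imp_le)
    show "(\<Sum>(j, i)\<in>prim_elems ms. real (yd E j i)) \<le> real (card (prim_elems ms)) * real d"
    proof (rule sum_bounded_above)
      fix p assume "p \<in> prim_elems ms"
      then show "(case p of (j, i) \<Rightarrow> real (yd E j i)) \<le> real d"
        using yd_le[OF E] u by (fastforce simp: prim_elems_def)
    qed
  qed
  \<comment> \<open>The two sides differ by exactly 1, the summand built into
    \<open>M\<close>.\<close>
  also have "\<dots> < M * real_of_int (c0 * int u)"
    by (simp add: M_def algebra_simps)
  also have "\<dots> = (M * real_of_int c0) * real u" by simp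
  also have "\<dots> \<le> weight0 * real u" using w0 by (rule mult_right_mono) simp
  finally show "(\<Sum>p\<in>prim_elems ms. (case p of (j, i) \<Rightarrow> weight j i) * real (cdim d ((case p of (j, i) \<Rightarrow> V j i) \<inter> mimg E))) < weight0 * real u" .
qed

text \<open>The projections \<open>N * (adj N * H)\<close> are taken for the balanced form
  \<open>H\<close>. Pairing their weighted sum \<open>T\<close> with \<open>H *\<^sub>v w\<close>
  turns the balance into the vanishing of the quadratic form of \<open>H * A\<close>, where
  \<open>A\<close> is \<open>T\<close> minus the scalar \<open>weight0\<close>. Polarization and the
  invertibility of \<open>H\<close> give \<open>A = 0\<close>.\<close>

lemma unitarizable_weight: "unitarizable ms X weight0 weight"
proof -
  interpret C: stable_config d "prim_elems ms" "\<lambda>(j, i). V j i" "\<lambda>(j, i). weight j i" weight0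
    by (rule stable_config_weight)
  obtain H where H: "posdef d H" and bal: "\<And>N w. (\<forall>p\<in>prim_elems ms. onb H d (cdim d (case p of (j, i) \<Rightarrow> V j i)) (N p) (case p of (j, i) \<Rightarrow> V j i)) \<Longrightarrow> w \<in> carrier_vec d \<Longrightarrow>
      (\<Sum>p\<in>prim_elems ms. (case p of (j, i) \<Rightarrow> weight j i) * norm_sq (adj (N p) *\<^sub>v (H *\<^sub>v w))) = weight0 * Re ((H *\<^sub>v w) \<bullet>c w)"
    using C.balanced_form by blast
  obtain N where N: "\<forall>p\<in>prim_elems ms. onb H d (cdim d (case p of (j, i) \<Rightarrow> V j i)) (N p) (case p of (j, i) \<Rightarrow> V j i)"
    using C.onb_V_exists[OF H] by blast
  note Hc = posdefD(1,2)[OF H]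
  define P where "P j i = N (j, i) * (adj (N (j, i)) * H)" for j i
  have onbN: "onb H d (cdim d (V j i)) (N (j, i)) (V j i)" if "j < length ms" "i \<in> {1..ms ! j}" for j i
    using that N by (auto simp: prim_elems_def)
  have orth: "orth_proj_onto d (\<lambda>u v. (H *\<^sub>v u) \<bullet>c v) (V j i) (P j i)" if "j < length ms" "i \<in> {1..ms ! j}" for j i
    unfolding P_def by (rule orth_proj_onto_onb[OF H onbN[OF that]])
  have Pc: "complex_of_real (weight j i) \<cdot>\<^sub>m P j i \<in> carrier_mat d d" if "j < length ms" "i \<in> {1..ms ! j}" for j i
    using orth[OF that] by (simp add: orth_proj_onto_def)
  have wc: "weighted_op ms d weight P j \<in> carrier_mat d d" if "j < length ms" for j
    unfolding weighted_op_def by (rule mat_sum(1)) (use Pc that in auto)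
  define T where "T = mat_sum d (weighted_op ms d weight P) {0..<length ms}"
  have Tc: "T \<in> carrier_mat d d" unfolding T_def by (rule mat_sum(1)) (use wc in auto)
  have Tform: "(T *\<^sub>v w) \<bullet>c (H *\<^sub>v w) = complex_of_real weight0 * ((H *\<^sub>v w) \<bullet>c w)" if w: "w \<in> carrier_vec d" for w
  proof -
    have Hw: "H *\<^sub>v w \<in> carrier_vec d" by (rule mult_mat_vec_carrier[OF Hc(1) w])
    have "(T *\<^sub>v w) \<bullet>c (H *\<^sub>v w) = (\<Sum>j\<in>{0..<length ms}. (weighted_op ms d weight P j *\<^sub>v w) \<bullet>c (H *\<^sub>v w))"
      unfolding T_def by (rule form_mat_sum) (use wc w Hw in auto)
    also have "\<dots> = (\<Sum>j\<in>{0..<length ms}. \<Sum>i=1..ms ! j. complex_of_real (weight j i * norm_sq (adj (N (j, i)) *\<^sub>v (H *\<^sub>v w))))"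
    proof (rule sum.cong)
      fix j assume "j \<in> {0..<length ms}"
      then have j: "j < length ms" by simp
      have "(weighted_op ms d weight P j *\<^sub>v w) \<bullet>c (H *\<^sub>v w) =
          (\<Sum>i=1..ms ! j. ((complex_of_real (weight j i) \<cdot>\<^sub>m P j i) *\<^sub>v w) \<bullet>c (H *\<^sub>v w))"
        unfolding weighted_op_def by (rule form_mat_sum) (use Pc j w Hw in auto)
      also have "\<dots> = (\<Sum>i=1..ms ! j. complex_of_real (weight j i * norm_sq (adj (N (j, i)) *\<^sub>v (H *\<^sub>v w))))"
      proof (rule sum.cong)
        fix i assume i: "i \<in> {1..ms ! j}"
        have Nc: "N (j, i) \<in> carrier_mat d (cdim d (V j i))" using onbN[OF j i] by (simp add: onb_def)
        have Pc': "P j i \<in> carrier_mat d d" using orth[OF j i] by (simp add: orth_proj_onto_def)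
        let ?b = "adj (N (j, i)) *\<^sub>v (H *\<^sub>v w)"
        have b: "?b \<in> carrier_vec (cdim d (V j i))" using Nc Hw by (auto intro: mult_mat_vec_carrier)
        have "P j i *\<^sub>v w = N (j, i) *\<^sub>v ((adj (N (j, i)) * H) *\<^sub>v w)"
          unfolding P_def by (rule assoc_mult_mat_vec[OF Nc _ w]) (use Nc Hc in auto)
        also have "(adj (N (j, i)) * H) *\<^sub>v w = ?b" by (rule assoc_mult_mat_vec[OF _ Hc(1) w]) (use Nc in auto)
        finally have "(P j i *\<^sub>v w) \<bullet>c (H *\<^sub>v w) = complex_of_real (norm_sq ?b)"
          using cscalar_prod_adj[OF Nc b Hw] cscalar_prod_self[of ?b] by simp
        moreover have "((complex_of_real (weight j i) \<cdot>\<^sub>m P j i) *\<^sub>v w) \<bullet>c (H *\<^sub>v w) =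
            complex_of_real (weight j i) * ((P j i *\<^sub>v w) \<bullet>c (H *\<^sub>v w))"
          unfolding smult_mat_mult_vec[OF Pc' w]
          by (rule cscalar_prod_smult_left[OF mult_mat_vec_carrier[OF Pc' w] Hw])
        ultimately show "((complex_of_real (weight j i) \<cdot>\<^sub>m P j i) *\<^sub>v w) \<bullet>c (H *\<^sub>v w) = complex_of_real (weight j i * norm_sq ?b)" by simp
      qed simp
      finally show "(weighted_op ms d weight P j *\<^sub>v w) \<bullet>c (H *\<^sub>v w) =
          (\<Sum>i=1..ms ! j. complex_of_real (weight j i * norm_sq (adj (N (j, i)) *\<^sub>v (H *\<^sub>v w))))" .
    qed simp
    also have "\<dots> = complex_of_real (\<Sum>p\<in>prim_elems ms. (case p of (j, i) \<Rightarrow> weight j i) * norm_sq (adj (N p) *\<^sub>v (H *\<^sub>v w)))"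
      by (simp add: sum_prim_elems atLeast0LessThan)
    also have "\<dots> = complex_of_real (weight0 * Re ((H *\<^sub>v w) \<bullet>c w))" using bal[OF N w] by (rule arg_cong)
    also have "\<dots> = complex_of_real weight0 * ((H *\<^sub>v w) \<bullet>c w)"
      using hermitian_form_real[OF Hc w] by simp
    finally show ?thesis .
  qed
  define A where "A = T - complex_of_real weight0 \<cdot>\<^sub>m 1\<^sub>m d"
  have Ac: "A \<in> carrier_mat d d" unfolding A_def by (rule minus_carrier_mat) simp
  have "H * A = 0\<^sub>m d d"
  proof (rule hermitian_quadratic_form_zero)
    show "H * A \<in> carrier_mat d d" using Hc Ac by simp
    fix w :: "complex vec" assume w: "w \<in> carrier_vec d"
    have Hw: "H *\<^sub>v w \<in> carrier_vec d" by (rule mult_mat_vec_carrier[OF Hc(1) w])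
    have Tw: "T *\<^sub>v w \<in> carrier_vec d" by (rule mult_mat_vec_carrier[OF Tc w])
    have "A *\<^sub>v w = T *\<^sub>v w - complex_of_real weight0 \<cdot>\<^sub>v w"
      unfolding A_def using minus_mult_distrib_mat_vec[OF Tc _ w, of "complex_of_real weight0 \<cdot>\<^sub>m 1\<^sub>m d"]
        smult_mat_mult_vec[OF one_carrier_mat w, of "complex_of_real weight0"] w by simp
    also have "\<dots> = T *\<^sub>v w + (- complex_of_real weight0) \<cdot>\<^sub>v w" using Tw w by (intro eq_vecI) auto
    finally have Aw: "A *\<^sub>v w = T *\<^sub>v w + (- complex_of_real weight0) \<cdot>\<^sub>v w" .
    have "(H * A *\<^sub>v w) \<bullet>c w = (H *\<^sub>v (A *\<^sub>v w)) \<bullet>c w" using assoc_mult_mat_vec[OF Hc(1) Ac w] by simp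
    also have "\<dots> = (A *\<^sub>v w) \<bullet>c (H *\<^sub>v w)"
      using cscalar_prod_adj[OF Hc(1) mult_mat_vec_carrier[OF Ac w] w] Hc(2) by simp
    also have "\<dots> = (T *\<^sub>v w) \<bullet>c (H *\<^sub>v w) + - complex_of_real weight0 * (w \<bullet>c (H *\<^sub>v w))"
      unfolding Aw using cscalar_prod_add_left[OF Tw _ Hw, of "(- complex_of_real weight0) \<cdot>\<^sub>v w"]
        cscalar_prod_smult_left[OF w Hw, of "- complex_of_real weight0"] w by simp
    also have "w \<bullet>c (H *\<^sub>v w) = (H *\<^sub>v w) \<bullet>c w" using cscalar_prod_adj[OF Hc(1) w w] Hc(2) by simp
    finally show "(H * A *\<^sub>v w) \<bullet>c w = 0" using Tform[OF w] by simp
  qed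
  moreover obtain K B where B: "onb H d K B (carrier_vec d)" using onb_exists[OF H csub_carrier] by blast
  ultimately have "A = 0\<^sub>m d d"
  proof -
    have "K = d" by (rule onb_carrier_dim[OF Hc(1) B])
    note inv = onb_inverse[OF Hc(1) B[unfolded this]]
    assume HA: "H * A = 0\<^sub>m d d"
    have "A = (B * (adj B * H)) * A" unfolding inv(4) using Ac by simp
    also have "\<dots> = B * (adj B * (H * A))" using inv(1) Hc(1) Ac by (simp add: mult_assoc_dim)
    also have "\<dots> = 0\<^sub>m d d" unfolding HA using inv(1) by simp
    finally show ?thesis .
  qed
  then have "T = complex_of_real weight0 \<cdot>\<^sub>m 1\<^sub>m d"
    using Tc unfolding A_def by (auto simp: mat_eq_iff)
  then have "unitarization ms X weight0 weight (\<lambda>u v. (H *\<^sub>v u) \<bullet>c v) P"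
    unfolding unitarization_def Let_def T_def using inner_product_on_posdef[OF H] orth by (auto simp: prim_elems_def)
  moreover have "is_weight ms weight0 weight"
    unfolding is_weight_def using weight0_nonneg weight_pos by (auto simp: prim_elems_def)
  ultimately show ?thesis unfolding unitarizable_def by blast
qed

text \<open>The eigenvalue of the \<open>j\<close>-th operator on the \<open>r\<close>-th vector of
  a basis adapted to the flag of branch \<open>j\<close>.\<close>

definition level :: "nat \<Rightarrow> nat \<Rightarrow> real" where
  "level j r = (\<Sum>i\<in>{1..ms ! j}. if r < xd j i then weight j i else 0)"

text \<open>If \<open>k\<close> is the first step of the flag that contains the \<open>r\<close>-th
  basis vector, exactly the steps from \<open>k\<close> on contribute, and their weights add up to
  \<open>omega\<close> at \<open>k\<close>. If there is no such step, the eigenvalue is 0.\<close>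

lemma level_omega:
  assumes j: "j < length ms"
  shows "level j r = 0 \<or> (\<exists>i\<in>{1..ms ! j}. level j r = omega ms weight j i)"
proof (cases "\<exists>i. i \<in> {1..ms ! j} \<and> r < xd j i")
  case True
  define k where "k = (LEAST i. i \<in> {1..ms ! j} \<and> r < xd j i)"
  have k: "k \<in> {1..ms ! j}" "r < xd j k" using LeastI_ex[OF True] by (auto simp: k_def)
  have "r < xd j i \<longleftrightarrow> k \<le> i" if i: "i \<in> {1..ms ! j}" for i
  proof
    show "r < xd j i \<Longrightarrow> k \<le> i" using i unfolding k_def by (intro Least_le) auto
    show "k \<le> i \<Longrightarrow> r < xd j i" using k(2) lift_Suc_mono_le[of "xd j", OF xd_mono[OF j]] by (meson order_less_le_trans)
  qed
  then have "level j r = (\<Sum>i\<in>{1..ms ! j}. if k \<le> i then weight j i else 0)"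
    unfolding level_def by (intro sum.cong) auto
  also have "\<dots> = omega ms weight j k"
    unfolding omega_def by (rule sum.mono_neutral_cong_right) (use k in auto)
  finally show ?thesis using k(1) by blast
next
  case False
  then have "level j r = 0" unfolding level_def by (intro sum.neutral) auto
  then show ?thesis ..
qed

context
  fixes h P bs
  assumes u: "unitarization ms X weight0 weight h P" and bs: "orthonormal_basis d h bs"
begin

lemma weighted_op_carrier:
  assumes j: "j < length ms"
  shows "i \<in> {1..ms ! j} \<Longrightarrow> P j i \<in> carrier_mat d d" "weighted_op ms d weight P j \<in> carrier_mat d d"
proof -
  show P: "P j i \<in> carrier_mat d d" if "i \<in> {1..ms ! j}" for i
    using u j that by (auto simp: unitarization_def Let_def prim_elems_def orth_proj_onto_def)
  show "weighted_op ms d weight P j \<in> carrier_mat d d"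
    unfolding weighted_op_def by (rule mat_sum(1)) (use P in auto)
qed

text \<open>The projections are determined by \<open>h\<close>, so they may be computed in an
  \<open>h\<close>-orthonormal basis adapted to the flag. There all projections of one branch are
  diagonal at once, and their weighted sum has the diagonal \<open>level j\<close>. The matrix
  \<open>W\<close> is the unitary change from this basis to \<open>bs\<close>.\<close>

lemma matrix_in_basis_weighted_op:
  assumes j: "j < length ms"
  shows "\<exists>W. unitary_mat d W \<and> matrix_in_basis h bs (weighted_op ms d weight P j) = spectral_mat d W (level j)"
proof -
  have ip: "inner_product_on d h" and orth: "\<And>i. i \<in> {1..ms ! j} \<Longrightarrow> orth_proj_onto d h (V j i) (P j i)"
    using u j by (auto simp: unitarization_def Let_def prim_elems_def)
  obtain H where H: "posdef d H" and h: "\<forall>u\<in>carrier_vec d. \<forall>v\<in>carrier_vec d. h u v = (H *\<^sub>v u) \<bullet>c v"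
    using inner_product_on_matrix[OF ip] by blast
  note Hc = posdefD(1,2)[OF H]
  obtain N where N: "onb H d d N (carrier_vec d)" and NV: "\<forall>i\<in>{1..ms ! j}. V j i = (\<lambda>c. N *\<^sub>v c) ` coords d (cdim d (V j i))"
    using V_adapted[OF j H] by blast
  define S where "S = mat_of_cols d bs"
  note S = matrix_in_basis_eq[OF H h bs, folded S_def]
  define W where "W = adj S * (H * N)"
  have W: "unitary_mat d W" unfolding W_def by (rule unitary_basis_change[OF H N S(1,2)])
  have P: "P j i = first_cols (xd j i) N * (adj (first_cols (xd j i) N) * H)" if i: "i \<in> {1..ms ! j}" for i
  proof (rule orth_proj_onto_unique[OF ip _ orth[OF i]])
    show Vc: "csub d (V j i)" using V_csub j i by simp
    have "onb H d (xd j i) (first_cols (xd j i) N) (V j i)"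
      using onb_first_cols[OF Hc(1) N xd_le[OF j]] NV i by (simp add: xd_eq[symmetric])
    from orth_proj_onto_onb[OF H this]
    show "orth_proj_onto d h (V j i) (first_cols (xd j i) N * (adj (first_cols (xd j i) N) * H))"
      unfolding orth_proj_onto_def
    proof (elim conjE, intro conjI ballI)
      fix x w :: "complex vec" assume *: "\<forall>x\<in>carrier_vec d. first_cols (xd j i) N * (adj (first_cols (xd j i) N) * H) *\<^sub>v x \<in> V j i \<and>
          (\<forall>w\<in>V j i. (H *\<^sub>v (x - first_cols (xd j i) N * (adj (first_cols (xd j i) N) * H) *\<^sub>v x)) \<bullet>c w = 0)"
        and x: "x \<in> carrier_vec d" and w: "w \<in> V j i"
      let ?y = "first_cols (xd j i) N * (adj (first_cols (xd j i) N) * H) *\<^sub>v x"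
      have "?y \<in> carrier_vec d" using * x csubD(5)[OF Vc] by blast
      then have "x - ?y \<in> carrier_vec d" by (rule minus_carrier_vec[OF x])
      then show "h (x - ?y) w = 0" using * x w h csubD(5)[OF Vc w] by metis
    qed blast+
  qed
  have SH: "adj S * H \<in> carrier_mat d d" using S(1) Hc by auto
  have opc: "weighted_op ms d weight P j \<in> carrier_mat d d" by (rule weighted_op_carrier(2)[OF j])
  have "matrix_in_basis h bs (weighted_op ms d weight P j) = (adj S * H) * (weighted_op ms d weight P j * S)"
    unfolding S(3)[OF opc] using S(1) Hc opc by (simp add: mult_assoc_dim)
  also have "\<dots> = mat_sum d (\<lambda>i. (adj S * H) * ((complex_of_real (weight j i) \<cdot>\<^sub>m P j i) * S)) {1..ms ! j}"
    unfolding weighted_op_def by (rule conjugated_mat_sum[OF SH S(1)]) (use weighted_op_carrier(1)[OF j] in auto)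
  also have "\<dots> = spectral_mat d W (level j)" (is "?M = _")
  proof (rule eq_matI)
    have fc: "(adj S * H) * ((complex_of_real (weight j i) \<cdot>\<^sub>m P j i) * S) \<in> carrier_mat d d" if "i \<in> {1..ms ! j}" for i
      by (rule mult_carrier_mat[OF SH mult_carrier_mat[OF smult_carrier_mat[OF weighted_op_carrier(1)[OF j that]] S(1)]])
    have Mc: "?M \<in> carrier_mat d d" by (rule mat_sum(1)) (use fc in auto)
    then show "dim_row ?M = dim_row (spectral_mat d W (level j))" "dim_col ?M = dim_col (spectral_mat d W (level j))"
      using spectral_mat_carrier[OF W, of "level j"] by auto
    fix r c assume "r < dim_row (spectral_mat d W (level j))" "c < dim_col (spectral_mat d W (level j))"
    then have rc: "r < d" "c < d" using spectral_mat_carrier[OF W, of "level j"] by auto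
    have "?M $$ (r, c) = (\<Sum>i\<in>{1..ms ! j}. ((adj S * H) * ((complex_of_real (weight j i) \<cdot>\<^sub>m P j i) * S)) $$ (r, c))"
      by (rule mat_sum(2)) (use fc rc in auto)
    also have "\<dots> = (\<Sum>i\<in>{1..ms ! j}. \<Sum>a<d. complex_of_real (if a < xd j i then weight j i else 0) * (W $$ (r, a) * cnj (W $$ (c, a))))"
    proof (rule sum.cong)
      fix i assume i: "i \<in> {1..ms ! j}"
      have Pc: "P j i \<in> carrier_mat d d" by (rule weighted_op_carrier(1)[OF j i])
      have Xc: "adj S * (H * (P j i * S)) \<in> carrier_mat d d" using Pc Hc S(1) by (auto intro!: mult_carrier_mat)
      have "(adj S * H) * ((complex_of_real (weight j i) \<cdot>\<^sub>m P j i) * S) = complex_of_real (weight j i) \<cdot>\<^sub>m ((adj S * H) * (P j i * S))"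
        unfolding mult_smult_assoc_mat[OF Pc S(1)] by (rule mult_smult_distrib[OF SH]) (use Pc S(1) in auto)
      also have "(adj S * H) * (P j i * S) = adj S * (H * (P j i * S))" using S(1) Hc(1) Pc by (simp add: mult_assoc_dim)
      finally have "((adj S * H) * ((complex_of_real (weight j i) \<cdot>\<^sub>m P j i) * S)) $$ (r, c) =
          complex_of_real (weight j i) * (adj S * (H * (P j i * S))) $$ (r, c)"
        using Xc rc by (simp del: index_mult_mat)
      also have "(adj S * (H * (P j i * S))) $$ (r, c) = (\<Sum>a<d. if a < xd j i then W $$ (r, a) * cnj (W $$ (c, a)) else 0)"
        unfolding P[OF i] W_def by (rule conjugated_projection[OF H N S(1) xd_le[OF j] rc])
      also have "complex_of_real (weight j i) * \<dots> =
          (\<Sum>a<d. complex_of_real (if a < xd j i then weight j i else 0) * (W $$ (r, a) * cnj (W $$ (c, a))))"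
        unfolding sum_distrib_left by (rule sum.cong) auto
      finally show "((adj S * H) * ((complex_of_real (weight j i) \<cdot>\<^sub>m P j i) * S)) $$ (r, c) =
          (\<Sum>a<d. complex_of_real (if a < xd j i then weight j i else 0) * (W $$ (r, a) * cnj (W $$ (c, a))))" .
    qed simp
    also have "\<dots> = (\<Sum>a<d. \<Sum>i\<in>{1..ms ! j}. complex_of_real (if a < xd j i then weight j i else 0) * (W $$ (r, a) * cnj (W $$ (c, a))))"
      by (rule sum.swap)
    also have "\<dots> = (\<Sum>a<d. complex_of_real (level j a) * (W $$ (r, a) * cnj (W $$ (c, a))))"
      unfolding level_def of_real_sum sum_distrib_right ..
    also have "\<dots> = spectral_mat d W (level j) $$ (r, c)" by (rule index_spectral_mat[OF W rc, symmetric])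
    finally show "?M $$ (r, c) = spectral_mat d W (level j) $$ (r, c)" .
  qed
  finally show ?thesis using W by blast
qed

text \<open>Self-adjointness and spectrum are read off the diagonal form; the relation for the sum
  is the balance equation conjugated by the matrix of basis vectors.\<close>

lemma star_algebra_rep_weight:
  "star_algebra_rep ms weight0 (omega ms weight) d (hermitian_collection ms X weight h P bs)"
proof -
  let ?A = "\<lambda>j. matrix_in_basis h bs (weighted_op ms d weight P j)"
  have nth: "hermitian_collection ms X weight h P bs ! j = ?A j" if "j < length ms" for j
    using that by (simp add: hermitian_collection_def)
  have A: "?A j \<in> carrier_mat d d \<and> mat_adjoint (?A j) = ?A j \<and>
      spectrum (?A j) \<subseteq> insert 0 ((\<lambda>i. complex_of_real (omega ms weight j i)) ` {1..ms ! j})" if j: "j < length ms" for j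
  proof -
    obtain W where W: "unitary_mat d W" "?A j = spectral_mat d W (level j)" using matrix_in_basis_weighted_op[OF j] by blast
    have "complex_of_real (level j r) \<in> insert 0 ((\<lambda>i. complex_of_real (omega ms weight j i)) ` {1..ms ! j})" for r
      using level_omega[OF j, of r] by auto
    then show ?thesis
      unfolding W(2) mat_adjoint_eq_adj using spectral_mat_carrier[OF W(1)] spectral_mat_adj[OF W(1)] spectrum_spectral_mat[OF W(1), of "level j"] by blast
  qed
  have ip: "inner_product_on d h" and tot: "mat_sum d (weighted_op ms d weight P) {0..<length ms} = complex_of_real weight0 \<cdot>\<^sub>m 1\<^sub>m d"
    using u by (auto simp: unitarization_def Let_def)
  obtain H where H: "posdef d H" and h: "\<forall>u\<in>carrier_vec d. \<forall>v\<in>carrier_vec d. h u v = (H *\<^sub>v u) \<bullet>c v"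
    using inner_product_on_matrix[OF ip] by blast
  note Hc = posdefD(1,2)[OF H]
  define S where "S = mat_of_cols d bs"
  note S = matrix_in_basis_eq[OF H h bs, folded S_def]
  have SH: "adj S * H \<in> carrier_mat d d" using S(1) Hc by auto
  have "mat_sum d (\<lambda>j. hermitian_collection ms X weight h P bs ! j) {0..<length ms} =
      mat_sum d (\<lambda>j. (adj S * H) * (weighted_op ms d weight P j * S)) {0..<length ms}"
  proof (rule mat_sum_cong)
    fix j assume "j \<in> {0..<length ms}"
    then have j: "j < length ms" by simp
    note opc = weighted_op_carrier(2)[OF j]
    show "hermitian_collection ms X weight h P bs ! j \<in> carrier_mat d d" using A[OF j] nth[OF j] by simp
    show "hermitian_collection ms X weight h P bs ! j = (adj S * H) * (weighted_op ms d weight P j * S)"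
      unfolding nth[OF j] S(3)[OF opc] using S(1) Hc opc by (simp add: mult_assoc_dim)
  qed simp
  also have "\<dots> = (adj S * H) * (mat_sum d (weighted_op ms d weight P) {0..<length ms} * S)"
    by (rule conjugated_mat_sum[OF SH S(1), symmetric]) (use weighted_op_carrier(2) in auto)
  also have "\<dots> = (adj S * H) * (complex_of_real weight0 \<cdot>\<^sub>m S)"
    unfolding tot using mult_smult_assoc_mat[OF one_carrier_mat S(1)] S(1) by simp
  also have "\<dots> = complex_of_real weight0 \<cdot>\<^sub>m (adj S * H * S)" by (rule mult_smult_distrib[OF SH S(1)])
  also have "adj S * H * S = 1\<^sub>m d" using S(1,2) Hc by (simp add: mult_assoc_dim)
  finally show ?thesis
    unfolding star_algebra_rep_def using A nth by (simp add: hermitian_collection_def)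
qed

text \<open>Each centralizer has dimension \<open>d * d - 2 * l j\<close>, and the identity that the
  Euler form of the dimension vector is 1 says that the \<open>l j\<close> sum to
  \<open>d * d - 1\<close>. The terms with the number of branches cancel, leaving
  \<open>2 * (d * d)\<close> minus \<open>2 * (d * d - 1)\<close>.\<close>

lemma rigid_collection_weight: "rigid_collection d (hermitian_collection ms X weight h P bs)"
proof -
  define l where "l j = card (lower_entries (ms ! j) (xd j) (xd j) d d)" for j
  have dim: "int (dim_centralizer d (matrix_in_basis h bs (weighted_op ms d weight P j))) = int (d * d) - 2 * int (l j)"
    if j: "j < length ms" for j
  proof -
    obtain W where W: "unitary_mat d W" "matrix_in_basis h bs (weighted_op ms d weight P j) = spectral_mat d W (level j)"
      using matrix_in_basis_weighted_op[OF j] by blast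
    have "card {(r, c). r < d \<and> c < d \<and> level j r = level j c} + 2 * l j = d * d"
      unfolding l_def by (rule card_equal_levels[where \<chi> = "weight j"]) (use weight_pos[OF j] level_def in auto)
    then have "int (card {(r, c). r < d \<and> c < d \<and> level j r = level j c} + 2 * l j) = int (d * d)"
      by (rule arg_cong)
    then show ?thesis unfolding W(2) dim_centralizer_spectral_mat[OF W(1)] of_nat_add by linarith
  qed
  have "(\<Sum>A\<leftarrow>hermitian_collection ms X weight h P bs. int (dim_centralizer d A)) =
      (\<Sum>j<length ms. int (dim_centralizer d (matrix_in_basis h bs (weighted_op ms d weight P j))))"
    by (simp add: hermitian_collection_def o_def interv_sum_list_conv_sum_set_nat atLeast0LessThan)
  also have "\<dots> = (\<Sum>j<length ms. int (d * d) - 2 * int (l j))" by (rule sum.cong) (use dim in auto)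
  also have "\<dots> = int (length ms) * int (d * d) - 2 * (\<Sum>j<length ms. int (l j))"
    by (simp add: sum_subtractf sum_distrib_left)
  also have "(\<Sum>j<length ms. int (l j)) = int (d * d) - 1"
    using euler_form_self by (simp add: l_def)
  finally show ?thesis
    unfolding rigid_collection_def rigidity_index_def
    by (simp add: hermitian_collection_def power2_eq_square algebra_simps)
qed

end

end

theorem theorem27:
  fixes ms :: "nat list" and X :: star_rep
  assumes "primitive_type ms"
    and "is_rep (star_quiver ms) X"
    and "strict_rep (star_quiver ms) X"
    and "indecomposable_rep (star_quiver ms) X"
    and "rigid_rep (star_quiver ms) X"
  shows "\<exists>\<chi>0 \<chi>. unitarizable ms X \<chi>0 \<chi> \<and>
    (\<forall>h P bs. unitarization ms X \<chi>0 \<chi> h P \<and> orthonormal_basis (rdim X None) h bs \<longrightarrow>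
       star_algebra_rep ms \<chi>0 (omega ms \<chi>) (rdim X None) (hermitian_collection ms X \<chi> h P bs) \<and>
       rigid_collection (rdim X None) (hermitian_collection ms X \<chi> h P bs))"
proof -
  interpret rigid_star_rep ms X by unfold_locales (fact assms(2-5))+
  show ?thesis
  proof (intro exI conjI allI impI; (elim conjE)?)
    show "unitarizable ms X weight0 weight" by (rule unitarizable_weight)
  qed (rule star_algebra_rep_weight rigid_collection_weight; assumption)+
qed

end
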